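(* \textsc{MSO$_2$ Reconfiguration} (MSOR$_2$) parameterized by $\mathrm{td}(G) + k + |\phi|$ is fixed-parameter tractable, where $G$ is the input graph, $\phi$ the input formula, and $k=|S|=|S'|$ the size of the input sets. Furthermore, for a yes-instance of MSOR$_2$, finding a shortest $\mathsf{TJ}(\phi)$-sequence from $S$ to $S'$ is fixed-parameter tractable with the same parameter.
   Context: A colored graph is a tuple $G=(V,E,\mathcal{C})$ with $V$ finite, $E$ a set of unordered pairs of vertices, and $\mathcal{C}=\langle C_1,\dots,C_c\rangle$ a tuple of subsets of $V$ (colors). MSO$_2$ formulas over colored graphs use vertex, vertex-set, edge and edge-set variables, atomic formulas $x=y$, $E(x,y)$, $C_i(x)$, membership in set variables, and edge–vertex incidence $I(e,x)$, closed under Boolean connectives and quantification; $|\phi|$ is formula length. For an MSO$_2$ formula $\phi(X)$ with one free vertex-set variable, a $\mathsf{TJ}(\phi)$-sequence from $S_0$ to $S_\ell$ (of length $\ell$) is a sequence $S_0,\dots,S_\ell$ of vertex subsets with $|S_{i-1}\setminus S_i|=|S_i\setminus S_{i-1}|=1$ for all $i\in[\ell]$ and $G\models\phi(S_i)$ for all $i$. MSOR$_2$: given such $\phi(X)$, a colored graph $G=(V,E,\mathcal{C})$ and $S,S'\subseteq V$ with $|S|=|S'|$, $G\models\phi(S)$, $G\models\phi(S')$, decide whether a $\mathsf{TJ}(\phi)$-sequence from $S$ to $S'$ exists. The treedepth $\mathrm{td}(G)$ is the minimum depth of a rooted forest $F$ on vertex set $V$ such that every edge of $G$ joins an ancestor–descendant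 pair in $F$, where depth is the maximum number of vertices on a root-to-leaf path. Fixed-parameter tractable with parameter $p$ means solvable in time $f(p)\cdot n^{O(1)}$ for computable $f$. *)

theory Defs
  imports Main
begin

section \<open>Machine model\<close>

text \<open>
  Programs transform finite binary trees; \<open>While\<close> keeps its whole state in one tree, as in the
  one-variable WHILE language of Jones. A program pays at least the size of its argument and
  at least the size of its result (lemma \<open>runs_size\<close>), so shared subtrees are paid for as if
  copied. With this cost measure the model and Turing machines simulate each other with
  polynomial overhead.
\<close>

datatype bt = Lf | Br bt bt

fun bt_size :: "bt \<Rightarrow> nat" where
  "bt_size Lf = 1"
| "bt_size (Br l r) = 1 + bt_size l + bt_size r"

fun bt_hd :: "bt \<Rightarrow> bt" where
  "bt_hd Lf = Lf"
| "bt_hd (Br l r) = l"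

fun bt_tl :: "bt \<Rightarrow> bt" where
  "bt_tl Lf = Lf"
| "bt_tl (Br l r) = r"

datatype prog =
    Ident
  | Empty
  | Hd
  | Tl
  | Join prog prog
  | Seq prog prog
  | Cond prog prog prog
  | While prog prog

text \<open>\<open>runs p x y t\<close>: program \<open>p\<close> on input \<open>x\<close> halts with output \<open>y\<close> after time \<open>t\<close>.
  In conditions, \<open>Lf\<close> counts as false and every other tree as true.\<close>

inductive runs :: "prog \<Rightarrow> bt \<Rightarrow> bt \<Rightarrow> nat \<Rightarrow> bool" where
  Ident: "runs Ident x x (1 + bt_size x)"
| Empty: "runs Empty x Lf (1 + bt_size x)"
| Hd: "runs Hd x (bt_hd x) (1 + bt_size x)"
| Tl: "runs Tl x (bt_tl x) (1 + bt_size x)"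
| Join: "runs p x y s \<Longrightarrow> runs q x z t \<Longrightarrow> runs (Join p q) x (Br y z) (1 + s + t)"
| Seq: "runs p x y s \<Longrightarrow> runs q y z t \<Longrightarrow> runs (Seq p q) x z (1 + s + t)"
| CondT: "runs b x c s \<Longrightarrow> c \<noteq> Lf \<Longrightarrow> runs p x y t \<Longrightarrow> runs (Cond b p q) x y (1 + s + t)"
| CondF: "runs b x Lf s \<Longrightarrow> runs q x y t \<Longrightarrow> runs (Cond b p q) x y (1 + s + t)"
| WhileT: "runs b x c s \<Longrightarrow> c \<noteq> Lf \<Longrightarrow> runs p x y t \<Longrightarrow> runs (While b p) y z u
    \<Longrightarrow> runs (While b p) x z (1 + s + t + u)"
| WhileF: "runs b x Lf s \<Longrightarrow> runs (While b p) x x (1 + s)"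

inductive_cases runs_IdentE: "runs Ident x y t"
inductive_cases runs_EmptyE: "runs Empty x y t"
inductive_cases runs_HdE: "runs Hd x y t"
inductive_cases runs_TlE: "runs Tl x y t"
inductive_cases runs_JoinE: "runs (Join p q) x y t"
inductive_cases runs_SeqE: "runs (Seq p q) x y t"
inductive_cases runs_CondE: "runs (Cond b p q) x y t"
inductive_cases runs_WhileE: "runs (While b p) x y t"

lemma runs_deterministic: "runs p x y t \<Longrightarrow> runs p x y' t' \<Longrightarrow> y' = y \<and> t' = t"
proof (induction arbitrary: y' t' rule: runs.induct)
  case (Ident x) then show ?case by (auto elim: runs_IdentE)
next
  case (Empty x) then show ?case by (auto elim: runs_EmptyE)
next
  case (Hd x) then show ?case by (auto elim: runs_HdE)
next
  case (Tl x) then show ?case by (auto elim: runs_TlE)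
next
  case (Join p x y s q z t)
  from Join.prems show ?case by (rule runs_JoinE) (auto dest!: Join.IH)
next
  case (Seq p x y s q z t)
  from Seq.prems show ?case by (rule runs_SeqE) (auto dest!: Seq.IH)
next
  case (CondT b x c s p y t q)
  from CondT.prems show ?case by (rule runs_CondE) (auto dest!: CondT.IH simp: CondT.hyps(2))
next
  case (CondF b x s q y t p)
  from CondF.prems show ?case by (rule runs_CondE) (auto dest!: CondF.IH)
next
  case (WhileT b x c s p y t z u)
  from WhileT.prems show ?case by (rule runs_WhileE) (auto dest!: WhileT.IH simp: WhileT.hyps(2))
next
  case (WhileF b x s p)
  from WhileF.prems show ?case by (rule runs_WhileE) (auto dest!: WhileF.IH)
qed

lemma runs_size: "runs p x y t \<Longrightarrow> bt_size x \<le> t \<and> bt_size y \<le> t"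
proof (induction rule: runs.induct)
  case (Hd x) then show ?case by (cases x) auto
next
  case (Tl x) then show ?case by (cases x) auto
qed auto

section \<open>Encodings and fixed-parameter tractability\<close>

fun bt_of_bool :: "bool \<Rightarrow> bt" where
  "bt_of_bool False = Lf"
| "bt_of_bool True = Br Lf Lf"

text \<open>Binary, least significant bit first.\<close>

fun bt_of_nat :: "nat \<Rightarrow> bt" where
  "bt_of_nat n = (if n = 0 then Lf else Br (bt_of_bool (odd n)) (bt_of_nat (n div 2)))"

declare bt_of_nat.simps [simp del]

definition bt_of_list :: "('a \<Rightarrow> bt) \<Rightarrow> 'a list \<Rightarrow> bt" where
  "bt_of_list enc xs = foldr (\<lambda>x. Br (enc x)) xs Lf"

definition computable :: "(nat \<Rightarrow> nat) \<Rightarrow> bool" where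
  "computable f \<longleftrightarrow> (\<exists>p. \<forall>n. \<exists>t. runs p (bt_of_nat n) (bt_of_nat (f n)) t)"

text \<open>
  A problem is given by the relation \<open>rep x I\<close> that the tree \<open>x\<close> is an input representing the
  instance \<open>I\<close>, by the parameter \<open>\<kappa> I\<close>, and by the relation \<open>ans I y\<close> that \<open>y\<close> is a correct
  output. An instance may have several representations (sets are listed in any order); the
  algorithm has to be correct and within the time bound on all of them.
\<close>

definition fpt_solvable ::
  "(bt \<Rightarrow> 'i \<Rightarrow> bool) \<Rightarrow> ('i \<Rightarrow> nat) \<Rightarrow> ('i \<Rightarrow> bt \<Rightarrow> bool) \<Rightarrow> bool" where
  "fpt_solvable rep \<kappa> ans \<longleftrightarrow>
    (\<exists>p f c. computable f \<and>
      (\<forall>x I. rep x I \<longrightarrow> (\<exists>y t. runs p x y t \<and> ans I y \<and> t \<le> f (\<kappa> I) * bt_size x ^ c)))"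

definition fpt_decidable ::
  "(bt \<Rightarrow> 'i \<Rightarrow> bool) \<Rightarrow> ('i \<Rightarrow> nat) \<Rightarrow> ('i \<Rightarrow> bool) \<Rightarrow> bool" where
  "fpt_decidable rep \<kappa> yes \<longleftrightarrow> fpt_solvable rep \<kappa> (\<lambda>I y. y = bt_of_bool (yes I))"

section \<open>Colored graphs and treedepth\<close>

record 'v cgraph =
  verts :: "'v set"
  edges :: "'v set set"
  colors :: "'v set list"

definition cgraph :: "'v cgraph \<Rightarrow> bool" where
  "cgraph G \<longleftrightarrow> finite (verts G) \<and> (\<forall>e \<in> edges G. e \<subseteq> verts G \<and> card e = 2) \<and>
    (\<forall>C \<in> set (colors G). C \<subseteq> verts G)"

text \<open>A rooted forest on \<open>V\<close> is given by its set \<open>F\<close> of (parent, child) pairs.\<close>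

definition rooted_forest :: "'v set \<Rightarrow> ('v \<times> 'v) set \<Rightarrow> bool" where
  "rooted_forest V F \<longleftrightarrow> F \<subseteq> V \<times> V \<and> acyclic F \<and> single_valued (F\<inverse>)"

definition root_to_leaf_path :: "'v set \<Rightarrow> ('v \<times> 'v) set \<Rightarrow> 'v list \<Rightarrow> bool" where
  "root_to_leaf_path V F xs \<longleftrightarrow> xs \<noteq> [] \<and> set xs \<subseteq> V \<and> hd xs \<notin> Range F \<and> last xs \<notin> Domain F \<and>
    successively (\<lambda>u v. (u, v) \<in> F) xs"

text \<open>The inserted \<open>0\<close> is the depth of the forest without vertices.\<close>

definition forest_depth :: "'v set \<Rightarrow> ('v \<times> 'v) set \<Rightarrow> nat" where
  "forest_depth V F = Max (insert 0 (length ` {xs. root_to_leaf_path V F xs}))"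

definition treedepth :: "'v cgraph \<Rightarrow> nat" where
  "treedepth G = (LEAST d. \<exists>F. rooted_forest (verts G) F \<and>
    (\<forall>u v. {u, v} \<in> edges G \<longrightarrow> (u, v) \<in> F\<^sup>+ \<or> (v, u) \<in> F\<^sup>+) \<and>
    forest_depth (verts G) F = d)"

section \<open>MSO2 over colored graphs\<close>

datatype sort = Vertex | VertexSet | Edge | EdgeSet

text \<open>
  Variables are numbers; each of the four sorts has its own name space. Arguments of atoms are,
  in this order: \<open>EqV x y\<close>, \<open>EqE e f\<close>, \<open>Adj x y\<close> for E(x,y), \<open>Col i x\<close> for x in the \<open>i\<close>-th
  color (counted from 0), \<open>MemV x X\<close>, \<open>MemE e Y\<close>, \<open>Inc e x\<close> for I(e,x).
\<close>

datatype mso2 =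
    EqV nat nat
  | EqE nat nat
  | Adj nat nat
  | Col nat nat
  | MemV nat nat
  | MemE nat nat
  | Inc nat nat
  | Neg mso2
  | Conj mso2 mso2
  | Disj mso2 mso2
  | Imp mso2 mso2
  | Iff mso2 mso2
  | Exists sort nat mso2
  | Forall sort nat mso2

text \<open>Number of symbols in prefix notation; a color predicate is one symbol.\<close>

fun mso2_length :: "mso2 \<Rightarrow> nat" where
  "mso2_length (EqV x y) = 3"
| "mso2_length (EqE e f) = 3"
| "mso2_length (Adj x y) = 3"
| "mso2_length (Col i x) = 2"
| "mso2_length (MemV x X) = 3"
| "mso2_length (MemE e Y) = 3"
| "mso2_length (Inc e x) = 3"
| "mso2_length (Neg \<phi>) = 1 + mso2_length \<phi>"
| "mso2_length (Conj \<phi> \<psi>) = 1 + mso2_length \<phi> + mso2_length \<psi>"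
| "mso2_length (Disj \<phi> \<psi>) = 1 + mso2_length \<phi> + mso2_length \<psi>"
| "mso2_length (Imp \<phi> \<psi>) = 1 + mso2_length \<phi> + mso2_length \<psi>"
| "mso2_length (Iff \<phi> \<psi>) = 1 + mso2_length \<phi> + mso2_length \<psi>"
| "mso2_length (Exists s x \<phi>) = 2 + mso2_length \<phi>"
| "mso2_length (Forall s x \<phi>) = 2 + mso2_length \<phi>"

fun free_vars :: "mso2 \<Rightarrow> (sort \<times> nat) set" where
  "free_vars (EqV x y) = {(Vertex, x), (Vertex, y)}"
| "free_vars (EqE e f) = {(Edge, e), (Edge, f)}"
| "free_vars (Adj x y) = {(Vertex, x), (Vertex, y)}"
| "free_vars (Col i x) = {(Vertex, x)}"
| "free_vars (MemV x X) = {(Vertex, x), (VertexSet, X)}"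
| "free_vars (MemE e Y) = {(Edge, e), (EdgeSet, Y)}"
| "free_vars (Inc e x) = {(Edge, e), (Vertex, x)}"
| "free_vars (Neg \<phi>) = free_vars \<phi>"
| "free_vars (Conj \<phi> \<psi>) = free_vars \<phi> \<union> free_vars \<psi>"
| "free_vars (Disj \<phi> \<psi>) = free_vars \<phi> \<union> free_vars \<psi>"
| "free_vars (Imp \<phi> \<psi>) = free_vars \<phi> \<union> free_vars \<psi>"
| "free_vars (Iff \<phi> \<psi>) = free_vars \<phi> \<union> free_vars \<psi>"
| "free_vars (Exists s x \<phi>) = free_vars \<phi> - {(s, x)}"
| "free_vars (Forall s x \<phi>) = free_vars \<phi> - {(s, x)}"

fun color_indices :: "mso2 \<Rightarrow> nat set" where
  "color_indices (Col i x) = {i}"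
| "color_indices (Neg \<phi>) = color_indices \<phi>"
| "color_indices (Conj \<phi> \<psi>) = color_indices \<phi> \<union> color_indices \<psi>"
| "color_indices (Disj \<phi> \<psi>) = color_indices \<phi> \<union> color_indices \<psi>"
| "color_indices (Imp \<phi> \<psi>) = color_indices \<phi> \<union> color_indices \<psi>"
| "color_indices (Iff \<phi> \<psi>) = color_indices \<phi> \<union> color_indices \<psi>"
| "color_indices (Exists s x \<phi>) = color_indices \<phi>"
| "color_indices (Forall s x \<phi>) = color_indices \<phi>"
| "color_indices _ = {}"

text \<open>The assignments \<open>a\<close>, \<open>A\<close>, \<open>b\<close>, \<open>B\<close> interpret the variables of sort \<open>Vertex\<close>, \<open>VertexSet\<close>,
  \<open>Edge\<close>, \<open>EdgeSet\<close>.\<close>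

fun sat :: "'v cgraph \<Rightarrow> (nat \<Rightarrow> 'v) \<Rightarrow> (nat \<Rightarrow> 'v set) \<Rightarrow> (nat \<Rightarrow> 'v set) \<Rightarrow> (nat \<Rightarrow> 'v set set)
    \<Rightarrow> mso2 \<Rightarrow> bool" where
  "sat G a A b B (EqV x y) \<longleftrightarrow> a x = a y"
| "sat G a A b B (EqE e f) \<longleftrightarrow> b e = b f"
| "sat G a A b B (Adj x y) \<longleftrightarrow> {a x, a y} \<in> edges G"
| "sat G a A b B (Col i x) \<longleftrightarrow> a x \<in> colors G ! i"
| "sat G a A b B (MemV x X) \<longleftrightarrow> a x \<in> A X"
| "sat G a A b B (MemE e Y) \<longleftrightarrow> b e \<in> B Y"
| "sat G a A b B (Inc e x) \<longleftrightarrow> a x \<in> b e"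
| "sat G a A b B (Neg \<phi>) \<longleftrightarrow> \<not> sat G a A b B \<phi>"
| "sat G a A b B (Conj \<phi> \<psi>) \<longleftrightarrow> sat G a A b B \<phi> \<and> sat G a A b B \<psi>"
| "sat G a A b B (Disj \<phi> \<psi>) \<longleftrightarrow> sat G a A b B \<phi> \<or> sat G a A b B \<psi>"
| "sat G a A b B (Imp \<phi> \<psi>) \<longleftrightarrow> (sat G a A b B \<phi> \<longrightarrow> sat G a A b B \<psi>)"
| "sat G a A b B (Iff \<phi> \<psi>) \<longleftrightarrow> (sat G a A b B \<phi> \<longleftrightarrow> sat G a A b B \<psi>)"
| "sat G a A b B (Exists Vertex x \<phi>) \<longleftrightarrow> (\<exists>v \<in> verts G. sat G (a(x := v)) A b B \<phi>)"
| "sat G a A b B (Exists VertexSet X \<phi>) \<longleftrightarrow> (\<exists>U. U \<subseteq> verts G \<and> sat G a (A(X := U)) b B \<phi>)"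
| "sat G a A b B (Exists Edge e \<phi>) \<longleftrightarrow> (\<exists>d \<in> edges G. sat G a A (b(e := d)) B \<phi>)"
| "sat G a A b B (Exists EdgeSet Y \<phi>) \<longleftrightarrow> (\<exists>D. D \<subseteq> edges G \<and> sat G a A b (B(Y := D)) \<phi>)"
| "sat G a A b B (Forall Vertex x \<phi>) \<longleftrightarrow> (\<forall>v \<in> verts G. sat G (a(x := v)) A b B \<phi>)"
| "sat G a A b B (Forall VertexSet X \<phi>) \<longleftrightarrow> (\<forall>U. U \<subseteq> verts G \<longrightarrow> sat G a (A(X := U)) b B \<phi>)"
| "sat G a A b B (Forall Edge e \<phi>) \<longleftrightarrow> (\<forall>d \<in> edges G. sat G a A (b(e := d)) B \<phi>)"
| "sat G a A b B (Forall EdgeSet Y \<phi>) \<longleftrightarrow> (\<forall>D. D \<subseteq> edges G \<longrightarrow> sat G a A b (B(Y := D)) \<phi>)"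

text \<open>The free variable \<open>X\<close> of a formula \<open>\<phi>(X)\<close> is the vertex-set variable \<open>0\<close>.\<close>

definition formula_of_set :: "'v cgraph \<Rightarrow> mso2 \<Rightarrow> bool" where
  "formula_of_set G \<phi> \<longleftrightarrow> free_vars \<phi> \<subseteq> {(VertexSet, 0)} \<and>
    color_indices \<phi> \<subseteq> {..<length (colors G)}"

definition models :: "'v cgraph \<Rightarrow> mso2 \<Rightarrow> 'v set \<Rightarrow> bool" where
  "models G \<phi> S \<longleftrightarrow> sat G (\<lambda>_. undefined) (\<lambda>_. S) (\<lambda>_. undefined) (\<lambda>_. undefined) \<phi>"

section \<open>MSO2 reconfiguration\<close>

text \<open>A sequence of length \<open>l\<close> is a list of \<open>l + 1\<close> sets.\<close>

definition tj_sequence :: "'v cgraph \<Rightarrow> mso2 \<Rightarrow> 'v set \<Rightarrow> 'v set \<Rightarrow> 'v set list \<Rightarrow> bool" where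
  "tj_sequence G \<phi> S S' Ss \<longleftrightarrow> Ss \<noteq> [] \<and> hd Ss = S \<and> last Ss = S' \<and>
    (\<forall>T \<in> set Ss. T \<subseteq> verts G \<and> models G \<phi> T) \<and>
    successively (\<lambda>T T'. card (T - T') = 1 \<and> card (T' - T) = 1) Ss"

definition shortest_tj_sequence ::
  "'v cgraph \<Rightarrow> mso2 \<Rightarrow> 'v set \<Rightarrow> 'v set \<Rightarrow> 'v set list \<Rightarrow> bool" where
  "shortest_tj_sequence G \<phi> S S' Ss \<longleftrightarrow> tj_sequence G \<phi> S S' Ss \<and>
    (\<forall>Ts. tj_sequence G \<phi> S S' Ts \<longrightarrow> length Ss \<le> length Ts)"

record msor2 =
  graph :: "nat cgraph"
  formula :: mso2
  source :: "nat set"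
  target :: "nat set"

definition msor2_instance :: "msor2 \<Rightarrow> bool" where
  "msor2_instance I \<longleftrightarrow> cgraph (graph I) \<and> formula_of_set (graph I) (formula I) \<and>
    source I \<subseteq> verts (graph I) \<and> target I \<subseteq> verts (graph I) \<and>
    card (source I) = card (target I) \<and>
    models (graph I) (formula I) (source I) \<and> models (graph I) (formula I) (target I)"

definition msor2_yes :: "msor2 \<Rightarrow> bool" where
  "msor2_yes I \<longleftrightarrow> (\<exists>Ss. tj_sequence (graph I) (formula I) (source I) (target I) Ss)"

definition msor2_param :: "msor2 \<Rightarrow> nat" where
  "msor2_param I = treedepth (graph I) + card (source I) + mso2_length (formula I)"

fun bt_of_sort :: "sort \<Rightarrow> bt" where
  "bt_of_sort Vertex = bt_of_nat 0"
| "bt_of_sort VertexSet = bt_of_nat 1"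
| "bt_of_sort Edge = bt_of_nat 2"
| "bt_of_sort EdgeSet = bt_of_nat 3"

fun bt_of_mso2 :: "mso2 \<Rightarrow> bt" where
  "bt_of_mso2 (EqV x y) = Br (bt_of_nat 0) (Br (bt_of_nat x) (bt_of_nat y))"
| "bt_of_mso2 (EqE e f) = Br (bt_of_nat 1) (Br (bt_of_nat e) (bt_of_nat f))"
| "bt_of_mso2 (Adj x y) = Br (bt_of_nat 2) (Br (bt_of_nat x) (bt_of_nat y))"
| "bt_of_mso2 (Col i x) = Br (bt_of_nat 3) (Br (bt_of_nat i) (bt_of_nat x))"
| "bt_of_mso2 (MemV x X) = Br (bt_of_nat 4) (Br (bt_of_nat x) (bt_of_nat X))"
| "bt_of_mso2 (MemE e Y) = Br (bt_of_nat 5) (Br (bt_of_nat e) (bt_of_nat Y))"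
| "bt_of_mso2 (Inc e x) = Br (bt_of_nat 6) (Br (bt_of_nat e) (bt_of_nat x))"
| "bt_of_mso2 (Neg \<phi>) = Br (bt_of_nat 7) (bt_of_mso2 \<phi>)"
| "bt_of_mso2 (Conj \<phi> \<psi>) = Br (bt_of_nat 8) (Br (bt_of_mso2 \<phi>) (bt_of_mso2 \<psi>))"
| "bt_of_mso2 (Disj \<phi> \<psi>) = Br (bt_of_nat 9) (Br (bt_of_mso2 \<phi>) (bt_of_mso2 \<psi>))"
| "bt_of_mso2 (Imp \<phi> \<psi>) = Br (bt_of_nat 10) (Br (bt_of_mso2 \<phi>) (bt_of_mso2 \<psi>))"
| "bt_of_mso2 (Iff \<phi> \<psi>) = Br (bt_of_nat 11) (Br (bt_of_mso2 \<phi>) (bt_of_mso2 \<psi>))"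
| "bt_of_mso2 (Exists s x \<phi>) = Br (bt_of_nat 12) (Br (bt_of_sort s) (Br (bt_of_nat x) (bt_of_mso2 \<phi>)))"
| "bt_of_mso2 (Forall s x \<phi>) = Br (bt_of_nat 13) (Br (bt_of_sort s) (Br (bt_of_nat x) (bt_of_mso2 \<phi>)))"

definition represents_set :: "bt \<Rightarrow> nat set \<Rightarrow> bool" where
  "represents_set x A \<longleftrightarrow> (\<exists>vs. distinct vs \<and> set vs = A \<and> x = bt_of_list bt_of_nat vs)"

definition represents_sets :: "bt \<Rightarrow> nat set list \<Rightarrow> bool" where
  "represents_sets x As \<longleftrightarrow> (\<exists>xs. list_all2 represents_set xs As \<and> x = bt_of_list id xs)"

text \<open>Every edge is listed once, with its two ends in either order.\<close>

definition represents_edges :: "bt \<Rightarrow> nat set set \<Rightarrow> bool" where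
  "represents_edges x E \<longleftrightarrow> (\<exists>es. distinct (map (\<lambda>(u, v). {u, v}) es) \<and>
    set (map (\<lambda>(u, v). {u, v}) es) = E \<and>
    x = bt_of_list (\<lambda>(u, v). Br (bt_of_nat u) (bt_of_nat v)) es)"

definition represents_cgraph :: "bt \<Rightarrow> nat cgraph \<Rightarrow> bool" where
  "represents_cgraph x G \<longleftrightarrow> (\<exists>v e c. represents_set v (verts G) \<and> represents_edges e (edges G) \<and>
    represents_sets c (colors G) \<and> x = Br v (Br e c))"

definition represents_msor2 :: "bt \<Rightarrow> msor2 \<Rightarrow> bool" where
  "represents_msor2 x I \<longleftrightarrow> msor2_instance I \<and>
    (\<exists>g s t. represents_cgraph g (graph I) \<and> represents_set s (source I) \<and>
      represents_set t (target I) \<and> x = Br g (Br (bt_of_mso2 (formula I)) (Br s t)))"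

end

theory Submission
  imports Defs
begin

text \<open>
  A path in a graph of treedepth d has fewer than 2^d vertices, so depth-first search yields forests
  of bounded depth. Label every vertex of such a forest with its adjacency to its ancestors, its colours and
  its membership in the two given sets. Two subtrees that hang below the same vertex and are equal as
  labelled ordered trees are interchanged by an automorphism of the graph. If there are more than 2^a of them,
  where a depends on the size of the subtree, the formula and k, then one of them can be deleted: by the
  pigeonhole principle no choice of k vertices and of values for the quantified variables tells the smaller graph
  from the larger one, and since a token set touches at most k of the copies, every token jumping sequence
  can be rerouted, step by step, around the deleted copy. Deleting during the search, when
  a vertex is left, keeps it polynomial and leaves a kernel of bounded size.

  After its vertices and the variables of the formula have been renumbered, the kernel itself is
  bounded in the parameter, so exhaustive search on it is fast enough. No
  running time has to be estimated for this search: a program which always halts has a computable time bound,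
  because it can be made to count its own steps.
\<close>

section \<open>Computability with and without polynomial time bounds\<close>

text \<open>The flag \<open>b\<close> lets one set of closure rules serve both the polynomial
  kernelization (\<open>True\<close>) and the merely computable search on the kernel
  (\<open>False\<close>). The type \<open>t\<close> of a subtree dictates how many copies must
  survive: \<open>bt_size t\<close> bounds the vertices of a copy and the edges that meet it, so a
  set variable cuts a copy in at most \<open>2 ^ bt_size t\<close> ways and a quantifier costs a
  factor \<open>2 ^ (bt_size t + 1)\<close>. A further factor \<open>2 ^ (k + 3)\<close> leaves room
  for the copies touched by tokens. Two obstacles shape the construction. The input sets must avoid
  the deleted copy: as membership in them belongs to the label, a set that meets one copy meets all
  of them, which is impossible with more than k copies. And neither the number of colours nor the
  names of vertices and variables are bounded in the parameter: labels record only the colours of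
  the formula, and names become positions in lists. The size of types is bounded by recursion on the
  height left below a vertex, because boundedly many types, each with boundedly many copies, remain
  there.\<close>

definition bnd :: "bool \<Rightarrow> (nat \<Rightarrow> nat) \<Rightarrow> bool" where
  "bnd b T \<longleftrightarrow> mono T \<and> (b \<longrightarrow> (\<exists>c. \<forall>n. T n \<le> (n + 2) ^ c))"

lemma bnd_mono: "bnd b T \<Longrightarrow> m \<le> n \<Longrightarrow> T m \<le> T n"
  by (auto simp: bnd_def mono_def)

text \<open>The base \<open>n + 2\<close> in \<open>bnd\<close> is at least 2 even for
  \<open>n = 0\<close>, so constants and sums are absorbed by a larger exponent.\<close>

lemma bnd_const: "bnd b (\<lambda>n. k)"
proof -
  have "k \<le> (n + 2) ^ k" for n :: nat
  proof -
    have "k < 2 ^ k" by (rule less_exp)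
    also have "\<dots> \<le> (n + 2) ^ k" by (rule power_mono) auto
    finally show ?thesis by simp
  qed
  then show ?thesis unfolding bnd_def mono_def by blast
qed

lemma bnd_id: "bnd b (\<lambda>n. n)"
  by (auto simp: bnd_def mono_def intro!: exI[of _ 1])

lemma bnd_add:
  assumes "bnd b T" "bnd b S" shows "bnd b (\<lambda>n. T n + S n)"
proof -
  have "\<exists>c. \<forall>n. T n + S n \<le> (n + 2) ^ c" if bT: b
  proof -
    obtain c d where c: "\<And>n. T n \<le> (n + 2) ^ c" and d: "\<And>n. S n \<le> (n + 2) ^ d"
      using assms bT by (auto simp: bnd_def)
    have "T n + S n \<le> (n + 2) ^ (c + d + 1)" for n
    proof -
      have "(n + 2) ^ c \<le> (n + 2) ^ (c + d)" "(n + 2) ^ d \<le> (n + 2) ^ (c + d)"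
        by (rule power_increasing; simp)+
      then have "T n + S n \<le> 2 * (n + 2) ^ (c + d)" using c[of n] d[of n] by linarith
      then show ?thesis by (simp add: algebra_simps)
    qed
    then show ?thesis by blast
  qed
  then show ?thesis using assms by (auto simp: bnd_def mono_def add_mono)
qed

lemma bnd_mult:
  assumes "bnd b T" "bnd b S" shows "bnd b (\<lambda>n. T n * S n)"
proof -
  have "\<exists>c. \<forall>n. T n * S n \<le> (n + 2) ^ c" if bT: b
  proof -
    obtain c d where c: "\<And>n. T n \<le> (n + 2) ^ c" and d: "\<And>n. S n \<le> (n + 2) ^ d"
      using assms bT by (auto simp: bnd_def)
    have "T n * S n \<le> (n + 2) ^ (c + d)" for n
      using mult_mono[OF c[of n] d[of n]] by (simp add: power_add)
    then show ?thesis by blast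
  qed
  then show ?thesis using assms by (auto simp: bnd_def mono_def mult_mono)
qed

lemma bnd_comp:
  assumes "bnd b T" "bnd b S" shows "bnd b (\<lambda>n. T (S n))"
proof -
  have "\<exists>c. \<forall>n. T (S n) \<le> (n + 2) ^ c" if bT: b
  proof -
    obtain c d where c: "\<And>n. T n \<le> (n + 2) ^ c" and d: "\<And>n. S n \<le> (n + 2) ^ d"
      using assms bT by (auto simp: bnd_def)
    have "T (S n) \<le> (n + 2) ^ ((d + 2) * c)" for n
    proof -
      have 1: "1 \<le> (n + 2) ^ d" by simp
      have "4 * (n + 2) ^ d \<le> (n + 2) ^ 2 * (n + 2) ^ d"
        by (rule mult_right_mono) (auto simp: power2_eq_square)
      also have "\<dots> = (n + 2) ^ (d + 2)" by (simp only: power_add mult.commute)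
      finally have "(n + 2) ^ d + 2 \<le> (n + 2) ^ (d + 2)" using 1 by linarith
      then have "S n + 2 \<le> (n + 2) ^ (d + 2)" using d[of n] by linarith
      then have "(S n + 2) ^ c \<le> ((n + 2) ^ (d + 2)) ^ c" by (rule power_mono) simp
      then show ?thesis using c[of "S n"] by (metis le_trans power_mult)
    qed
    then show ?thesis by blast
  qed
  then show ?thesis using assms by (auto simp: bnd_def mono_def)
qed

lemmas bnd_intros = bnd_const bnd_id bnd_add bnd_mult

lemma bnd_Suc: "bnd b T \<Longrightarrow> bnd b (\<lambda>n. Suc (T n))"
  using bnd_add[OF bnd_const[of b 1]] by simp

text \<open>\<open>tr b I X Y\<close>: a single program maps \<open>X i\<close> to \<open>Y i\<close> for every index \<open>i \<in> I\<close>; for \<open>b\<close> it does so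
  in polynomial time, otherwise in some time bounded in terms of the size of \<open>X i\<close>.\<close>

definition tr :: "bool \<Rightarrow> 'i set \<Rightarrow> ('i \<Rightarrow> bt) \<Rightarrow> ('i \<Rightarrow> bt) \<Rightarrow> bool" where
  "tr b I X Y \<longleftrightarrow> (\<exists>p T. bnd b T \<and>
     (\<forall>i\<in>I. \<exists>t. runs p (X i) (Y i) t \<and> t \<le> T (bt_size (X i))))"

lemma tr_id: "tr b I X X"
  unfolding tr_def
  by (rule exI[of _ Ident], rule exI[of _ "\<lambda>n. 1 + n"]) (auto intro: bnd_intros bnd_Suc runs.Ident)

text \<open>A run pays for its output, so the intermediate tree is no larger than the time of the
  first program, and the monotone bound of the second program applies to it.\<close>

lemma tr_trans:
  assumes "tr b I X Y" "tr b I Y Z" shows "tr b I X Z"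
proof -
  obtain p T where p: "bnd b T" "\<And>i. i \<in> I \<Longrightarrow> \<exists>t. runs p (X i) (Y i) t \<and> t \<le> T (bt_size (X i))"
    using assms(1) by (auto simp: tr_def)
  obtain q S where q: "bnd b S" "\<And>i. i \<in> I \<Longrightarrow> \<exists>t. runs q (Y i) (Z i) t \<and> t \<le> S (bt_size (Y i))"
    using assms(2) by (auto simp: tr_def)
  have "\<exists>t. runs (Seq p q) (X i) (Z i) t \<and> t \<le> 1 + T (bt_size (X i)) + S (T (bt_size (X i)))"
    if i: "i \<in> I" for i
  proof -
    obtain t s where t: "runs p (X i) (Y i) t" "t \<le> T (bt_size (X i))"
      and s: "runs q (Y i) (Z i) s" "s \<le> S (bt_size (Y i))"
      using p(2)[OF i] q(2)[OF i] by auto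
    have "bt_size (Y i) \<le> T (bt_size (X i))" using runs_size[OF t(1)] t(2) by simp
    then have "S (bt_size (Y i)) \<le> S (T (bt_size (X i)))" by (rule bnd_mono[OF q(1)])
    then show ?thesis using runs.Seq[OF t(1) s(1)] t(2) s(2) by (metis add_mono le_trans order_refl)
  qed
  moreover have "bnd b (\<lambda>n. 1 + T n + S (T n))"
    by (intro bnd_intros bnd_comp[OF q(1)] p)
  ultimately show ?thesis unfolding tr_def by blast
qed

lemma tr_unary:
  assumes "\<And>x. runs p x (F x) (1 + bt_size x)"
  shows "tr b I X (\<lambda>i. F (X i))"
  unfolding tr_def
  by (rule exI[of _ p], rule exI[of _ "\<lambda>n. 1 + n"]) (auto intro!: bnd_Suc bnd_id exI[of _ "1 + _"] assms)

lemma tr_Lf: "tr b I X (\<lambda>i. Lf)"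
  by (rule tr_unary[of Empty "\<lambda>x. Lf"]) (rule runs.Empty)

lemma tr_hd: "tr b I X Y \<Longrightarrow> tr b I X (\<lambda>i. bt_hd (Y i))"
  by (erule tr_trans) (rule tr_unary[of Hd], rule runs.Hd)

lemma tr_tl: "tr b I X Y \<Longrightarrow> tr b I X (\<lambda>i. bt_tl (Y i))"
  by (erule tr_trans) (rule tr_unary[of Tl], rule runs.Tl)

lemma tr_Br:
  assumes "tr b I X Y" "tr b I X Z" shows "tr b I X (\<lambda>i. Br (Y i) (Z i))"
proof -
  obtain p T where p: "bnd b T" "\<And>i. i \<in> I \<Longrightarrow> \<exists>t. runs p (X i) (Y i) t \<and> t \<le> T (bt_size (X i))"
    using assms(1) by (auto simp: tr_def)
  obtain q S where q: "bnd b S" "\<And>i. i \<in> I \<Longrightarrow> \<exists>t. runs q (X i) (Z i) t \<and> t \<le> S (bt_size (X i))"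
    using assms(2) by (auto simp: tr_def)
  have "\<exists>t. runs (Join p q) (X i) (Br (Y i) (Z i)) t \<and> t \<le> 1 + T (bt_size (X i)) + S (bt_size (X i))"
    if i: "i \<in> I" for i
    using p(2)[OF i] q(2)[OF i] by (metis add_mono order_refl runs.Join)
  moreover have "bnd b (\<lambda>n. 1 + T n + S n)" by (intro bnd_intros p q)
  ultimately show ?thesis unfolding tr_def by blast
qed

lemma tr_const: "tr b I X (\<lambda>i. c)"
  by (induction c) (auto intro: tr_Lf tr_Br)

text \<open>Here the index sets pay off: each branch has to be correct only on the indices that
  reach it.\<close>

lemma tr_cond:
  assumes "tr b I X C" "tr b {i\<in>I. C i \<noteq> Lf} X Y" "tr b {i\<in>I. C i = Lf} X Y"
  shows "tr b I X Y"
proof -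
  obtain p T where p: "bnd b T" "\<And>i. i \<in> I \<Longrightarrow> \<exists>t. runs p (X i) (C i) t \<and> t \<le> T (bt_size (X i))"
    using assms(1) by (auto simp: tr_def)
  obtain q S where q: "bnd b S"
    "\<And>i. i \<in> I \<Longrightarrow> C i \<noteq> Lf \<Longrightarrow> \<exists>t. runs q (X i) (Y i) t \<and> t \<le> S (bt_size (X i))"
    using assms(2) by (auto simp: tr_def)
  obtain r R where r: "bnd b R"
    "\<And>i. i \<in> I \<Longrightarrow> C i = Lf \<Longrightarrow> \<exists>t. runs r (X i) (Y i) t \<and> t \<le> R (bt_size (X i))"
    using assms(3) by (auto simp: tr_def)
  have "\<exists>t. runs (Cond p q r) (X i) (Y i) t
      \<and> t \<le> 1 + T (bt_size (X i)) + (S (bt_size (X i)) + R (bt_size (X i)))"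
    if i: "i \<in> I" for i
  proof (cases "C i = Lf")
    case True
    obtain s t where "runs p (X i) Lf s" "s \<le> T (bt_size (X i))" "runs r (X i) (Y i) t" "t \<le> R (bt_size (X i))"
      using p(2)[OF i] r(2)[OF i True] True by auto
    then show ?thesis using runs.CondF[of p "X i" s r "Y i" t q] by (intro exI[of _ "1 + s + t"]) auto
  next
    case False
    obtain s t where "runs p (X i) (C i) s" "s \<le> T (bt_size (X i))" "runs q (X i) (Y i) t" "t \<le> S (bt_size (X i))"
      using p(2)[OF i] q(2)[OF i False] by auto
    then show ?thesis using False runs.CondT[of p "X i" "C i" s q "Y i" t r] by (intro exI[of _ "1 + s + t"]) auto
  qed
  moreover have "bnd b (\<lambda>n. 1 + T n + (S n + R n))" by (intro bnd_intros p q r)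
  ultimately show ?thesis unfolding tr_def by blast
qed

lemma tr_subset: "tr b J X Y \<Longrightarrow> I \<subseteq> J \<Longrightarrow> tr b I X Y"
  unfolding tr_def by blast

lemma tr_reindex: "tr b J X Y \<Longrightarrow> (\<And>i. i \<in> I \<Longrightarrow> f i \<in> J) \<Longrightarrow> tr b I (\<lambda>i. X (f i)) (\<lambda>i. Y (f i))"
  unfolding tr_def by blast

lemma tr_cong: "tr b I X Y \<Longrightarrow> (\<And>i. i \<in> I \<Longrightarrow> X i = X' i) \<Longrightarrow> (\<And>i. i \<in> I \<Longrightarrow> Y i = Y' i) \<Longrightarrow> tr b I X' Y'"
  unfolding tr_def by metis

subsection \<open>Encoded types\<close>

text \<open>Besides giving injectivity of \<open>enc\<close>, \<open>dec\<close> extends a function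
  on encoded values to all trees; \<open>computable_time_bound\<close> runs it on every tree of a
  given size.\<close>

class enc =
  fixes enc :: "'a \<Rightarrow> bt" and dec :: "bt \<Rightarrow> 'a"
  assumes dec_enc: "dec (enc x) = x"

lemma enc_inject [simp]: "enc x = enc y \<longleftrightarrow> x = y"
  by (metis dec_enc)

fun bt_children :: "bt \<Rightarrow> bt list" where
  "bt_children Lf = []"
| "bt_children (Br l r) = l # bt_children r"

lemma bt_of_list_simps [simp]:
  "bt_of_list f [] = Lf" "bt_of_list f (x # xs) = Br (f x) (bt_of_list f xs)"
  by (auto simp: bt_of_list_def)

lemma bt_children_of_list: "bt_children (bt_of_list f xs) = map f xs"
  by (induction xs) auto

instantiation bt :: enc
begin
definition "enc_bt (x::bt) = x"
definition "dec_bt (x::bt) = x"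
instance by standard (auto simp: enc_bt_def dec_bt_def)
end

instantiation bool :: enc
begin
definition "enc_bool = bt_of_bool"
definition "dec_bool x \<longleftrightarrow> x \<noteq> Lf"
instance
proof
  fix x :: bool show "dec (enc x) = x" by (cases x) (auto simp: enc_bool_def dec_bool_def)
qed
end

instantiation prod :: (enc, enc) enc
begin
definition "enc_prod p = Br (enc (fst p)) (enc (snd p))"
definition "dec_prod x = (dec (bt_hd x), dec (bt_tl x))"
instance by standard (auto simp: enc_prod_def dec_prod_def dec_enc)
end

instantiation list :: (enc) enc
begin
definition "enc_list = bt_of_list enc"
definition "dec_list x = map dec (bt_children x)"
instance
proof
  fix x :: "'a list" show "dec (enc x) = x"
    by (induction x) (auto simp: enc_list_def dec_list_def dec_enc)
qed
end

text \<open>Numbers are encoded in unary here, unlike in \<open>bt_of_nat\<close>.\<close>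

instantiation nat :: enc
begin
definition "enc_nat n = bt_of_list (\<lambda>_. Lf) [0..<n]"
definition "dec_nat x = length (bt_children x)"
instance by standard (auto simp: enc_nat_def dec_nat_def bt_children_of_list)
end

lemma enc_bt [simp]: "enc (x::bt) = x" by (simp add: enc_bt_def)

lemma enc_True [simp]: "enc True = Br Lf Lf" and enc_False [simp]: "enc False = Lf"
  by (auto simp: enc_bool_def)

lemma enc_Pair [simp]: "enc (x, y) = Br (enc x) (enc y)" by (simp add: enc_prod_def)

lemma enc_Nil [simp]: "enc [] = Lf" and enc_Cons [simp]: "enc (x # xs) = Br (enc x) (enc xs)"
  by (auto simp: enc_list_def)

lemma enc_nat_replicate: "enc (n::nat) = enc (replicate n Lf)"
proof -
  have "bt_of_list (\<lambda>_. Lf) [m..<m + n] = enc (replicate n Lf)" for m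
    by (induction n arbitrary: m) (auto simp: upt_rec[of _ "Suc _"] upt_conv_Cons simp flip: add_Suc)
  from this[of 0] show ?thesis by (simp add: enc_nat_def)
qed

lemma enc_0 [simp]: "enc (0::nat) = Lf" and enc_Suc [simp]: "enc (Suc n) = Br Lf (enc n)"
  by (auto simp: enc_nat_replicate)

lemma enc_bool_eq_Lf [simp]: "enc (P::bool) = Lf \<longleftrightarrow> \<not> P"
  by (cases P) auto

lemma enc_list_eq_Lf [simp]: "enc (xs::'a::enc list) = Lf \<longleftrightarrow> xs = []"
  by (cases xs) auto

abbreviation sz :: "'a::enc \<Rightarrow> nat" where "sz x \<equiv> bt_size (enc x)"

lemma bt_size_pos [simp]: "0 < bt_size x" by (cases x) auto

lemma bt_size_neq_0 [simp]: "bt_size x \<noteq> 0" by (cases x) auto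

lemma sz_nat [simp]: "sz (n::nat) = 2 * n + 1"
  by (induction n) auto

lemma sz_bool: "sz (P::bool) \<le> 3"
  by (cases P) auto

lemma sz_list: "sz xs = Suc (\<Sum>x\<leftarrow>xs. Suc (sz x))"
  by (induction xs) auto

lemma length_le_sz: "length xs \<le> sz xs"
  by (induction xs) auto

lemma sz_append: "sz (xs @ ys) + 1 = sz xs + sz ys"
  by (induction xs) auto

lemma sz_drop: "sz (drop n xs) \<le> sz xs"
proof -
  have "sz (take n xs) + sz (drop n xs) = sz xs + 1"
    using sz_append[of "take n xs" "drop n xs"] by simp
  moreover have "0 < sz (take n xs)" by simp
  ultimately show ?thesis by linarith
qed

lemma sz_rev [simp]: "sz (rev xs) = sz xs"
  by (simp add: sz_list rev_map[symmetric] sum_list_rev)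

lemma sz_mem: "x \<in> set xs \<Longrightarrow> sz x < sz xs"
  by (induction xs) auto

lemma finite_bt_size: "finite {x. bt_size x \<le> n}"
proof (induction n)
  case 0
  have "{x. bt_size x \<le> 0} = {}" using bt_size_pos by (auto simp: not_le simp del: le_zero_eq)
  then show ?case by (simp only: finite.emptyI)
next
  case (Suc n)
  have "{x. bt_size x \<le> Suc n} \<subseteq> insert Lf ((\<lambda>(l, r). Br l r) ` ({x. bt_size x \<le> n} \<times> {x. bt_size x \<le> n}))"
  proof
    fix x assume "x \<in> {x. bt_size x \<le> Suc n}"
    then show "x \<in> insert Lf ((\<lambda>(l, r). Br l r) ` ({x. bt_size x \<le> n} \<times> {x. bt_size x \<le> n}))"
      by (cases x) (auto simp: image_iff)
  qed
  then show ?case by (rule finite_subset) (auto intro: Suc)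
qed

text \<open>Only finitely many values have size at most n, and the sum of \<open>h\<close> over them
  is monotone in n. So a bound without the polynomial requirement always exists.\<close>

lemma bnd_False_exists: "\<exists>B. bnd False B \<and> (\<forall>x::'a::enc. h x \<le> B (sz x))"
proof -
  have fin: "finite {x::'a. sz x \<le> n}" for n
  proof (rule finite_imageD[of enc])
    show "finite (enc ` {x::'a. sz x \<le> n})" by (rule finite_subset[OF _ finite_bt_size[of n]]) auto
    show "inj_on enc {x::'a. sz x \<le> n}" by (auto simp: inj_on_def)
  qed
  define B where "B n = (\<Sum>x\<in>{x::'a. sz x \<le> n}. h x)" for n
  have "mono B" unfolding B_def mono_def using fin by (auto intro!: sum_mono2)
  moreover have "h x \<le> B (sz x)" for x unfolding B_def by (rule member_le_sum) (auto intro: fin)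
  ultimately show ?thesis by (auto simp: bnd_def)
qed

section \<open>Computable functions on encoded values\<close>

definition cmp :: "bool \<Rightarrow> ('a::enc \<Rightarrow> 'b::enc) \<Rightarrow> bool" where
  "cmp b f \<longleftrightarrow> tr b UNIV enc (\<lambda>x. enc (f x))"

lemma cmp_tr: "cmp b f \<Longrightarrow> tr b I (\<lambda>i. enc (g i)) (\<lambda>i. enc (f (g i)))"
  unfolding cmp_def by (rule tr_reindex) auto

lemma cmp_size:
  assumes "cmp b f" shows "\<exists>B. bnd b B \<and> (\<forall>x. sz (f x) \<le> B (sz x))"
proof -
  obtain p T where T: "bnd b T" "\<And>x. \<exists>t. runs p (enc x) (enc (f x)) t \<and> t \<le> T (sz x)"
    using assms unfolding cmp_def tr_def by auto
  have "sz (f x) \<le> T (sz x)" for x using T(2)[of x] runs_size le_trans by blast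
  then show ?thesis using T by blast
qed

named_theorems cmp_intros

lemma cmp_id [cmp_intros]: "cmp b (\<lambda>x. x)"
  unfolding cmp_def by (rule tr_id)

lemma cmp_const [cmp_intros]: "cmp b (\<lambda>x. c)"
  unfolding cmp_def by (rule tr_const)

lemma cmp_comp: "cmp b g \<Longrightarrow> cmp b f \<Longrightarrow> cmp b (\<lambda>x. g (f x))"
  unfolding cmp_def[of b f] cmp_def[of b "\<lambda>x. g (f x)"] by (erule tr_trans[rotated, OF cmp_tr])

lemma cmp_Pair [cmp_intros]: "cmp b f \<Longrightarrow> cmp b g \<Longrightarrow> cmp b (\<lambda>x. (f x, g x))"
  unfolding cmp_def by (simp add: tr_Br)

lemma cmp_fst [cmp_intros]: "cmp b f \<Longrightarrow> cmp b (\<lambda>x. fst (f x))"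
  unfolding cmp_def by (drule tr_hd) (simp add: enc_prod_def)

lemma cmp_snd [cmp_intros]: "cmp b f \<Longrightarrow> cmp b (\<lambda>x. snd (f x))"
  unfolding cmp_def by (drule tr_tl) (simp add: enc_prod_def)

lemma cmp_Cons [cmp_intros]: "cmp b f \<Longrightarrow> cmp b g \<Longrightarrow> cmp b (\<lambda>x. f x # g x)"
  unfolding cmp_def by (simp add: tr_Br)

lemma cmp_Suc [cmp_intros]: "cmp b f \<Longrightarrow> cmp b (\<lambda>x. Suc (f x))"
  unfolding cmp_def by (simp add: tr_Br tr_Lf)

lemma cmp_Br [cmp_intros]: "cmp b f \<Longrightarrow> cmp b g \<Longrightarrow> cmp b (\<lambda>x. Br (f x) (g x))"
  unfolding cmp_def by (simp add: tr_Br)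

lemma cmp_bt_hd [cmp_intros]: "cmp b f \<Longrightarrow> cmp b (\<lambda>x. bt_hd (f x))"
  unfolding cmp_def by (simp add: tr_hd)

lemma cmp_bt_tl [cmp_intros]: "cmp b f \<Longrightarrow> cmp b (\<lambda>x. bt_tl (f x))"
  unfolding cmp_def by (simp add: tr_tl)

lemma cmp_enc [cmp_intros]: "cmp b f \<Longrightarrow> cmp b (\<lambda>x. enc (f x))"
  unfolding cmp_def by simp

lemma cmp_bt_children [cmp_intros]: "cmp b f \<Longrightarrow> cmp b (\<lambda>x. bt_children (f x))"
proof -
  have "enc (bt_children x) = x" for x by (induction x) auto
  then show "cmp b f \<Longrightarrow> cmp b (\<lambda>x. bt_children (f x))" unfolding cmp_def by simp
qed

lemma cmp_replicate_Lf: "cmp b f \<Longrightarrow> cmp b (\<lambda>x. replicate (f x) Lf)"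
  unfolding cmp_def by (simp add: enc_nat_replicate)

lemma cmp_if [cmp_intros]:
  assumes "cmp b P" "cmp b f" "cmp b g"
  shows "cmp b (\<lambda>x. if P x then f x else g x)"
  unfolding cmp_def
proof (rule tr_cond[OF assms(1)[unfolded cmp_def]])
  show "tr b {i \<in> UNIV. enc (P i) \<noteq> Lf} enc (\<lambda>x. enc (if P x then f x else g x))"
    by (rule tr_cong[OF cmp_tr[OF assms(2), of _ id]]) auto
  show "tr b {i \<in> UNIV. enc (P i) = Lf} enc (\<lambda>x. enc (if P x then f x else g x))"
    by (rule tr_cong[OF cmp_tr[OF assms(3), of _ id]]) auto
qed

lemma cmp_not [cmp_intros]: "cmp b P \<Longrightarrow> cmp b (\<lambda>x. \<not> P x)"
  using cmp_if[OF _ cmp_const[of b False] cmp_const[of b True], of P] by (simp add: if_bool_eq_conj)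

lemma cmp_conj [cmp_intros]: "cmp b P \<Longrightarrow> cmp b Q \<Longrightarrow> cmp b (\<lambda>x. P x \<and> Q x)"
  using cmp_if[OF _ _ cmp_const[of b False], of P Q] by (simp add: if_bool_eq_disj)

lemma cmp_disj [cmp_intros]: "cmp b P \<Longrightarrow> cmp b Q \<Longrightarrow> cmp b (\<lambda>x. P x \<or> Q x)"
  using cmp_if[OF _ cmp_const[of b True], of P Q] by (simp add: if_bool_eq_disj disj_commute cong: disj_cong)

text \<open>Functions of several arguments enter the rules as functions of one nested pair, because
  \<open>cmp\<close> speaks of unary functions.\<close>

lemma cmp_Let [cmp_intros]:
  assumes "cmp b f" "cmp b (\<lambda>p. h (fst p) (snd p))"
  shows "cmp b (\<lambda>x. let y = f x in h x y)"
  using cmp_comp[OF assms(2) cmp_Pair[OF cmp_id assms(1)]] by simp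

lemma cmp_case_list [cmp_intros]:
  assumes "cmp b f" "cmp b g" "cmp b (\<lambda>p. h (fst p) (fst (snd p)) (snd (snd p)))"
  shows "cmp b (\<lambda>x. case f x of [] \<Rightarrow> g x | y # ys \<Rightarrow> h x y ys)" (is "cmp b ?F")
  unfolding cmp_def
proof (rule tr_cond[OF assms(1)[unfolded cmp_def]])
  have "tr b {i \<in> UNIV. f i \<noteq> []} enc (\<lambda>x. Br (enc x) (Br (bt_hd (enc (f x))) (bt_tl (enc (f x)))))"
    using cmp_tr[OF assms(1), of _ id] by (intro tr_Br tr_hd tr_tl tr_id) auto
  then have "tr b {i \<in> UNIV. f i \<noteq> []} enc (\<lambda>x. enc (x, hd (f x), tl (f x)))"
    by (rule tr_cong) (auto simp: neq_Nil_conv)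
  from tr_trans[OF this cmp_tr[OF assms(3)]]
  show "tr b {i \<in> UNIV. enc (f i) \<noteq> Lf} enc (\<lambda>x. enc (?F x))"
    by (rule tr_cong[OF tr_subset]) (auto simp: neq_Nil_conv)
  show "tr b {i \<in> UNIV. enc (f i) = Lf} enc (\<lambda>x. enc (?F x))"
    by (rule tr_cong[OF cmp_tr[OF assms(2), of _ id]]) auto
qed

lemma cmp_isLf [cmp_intros]:
  assumes "cmp b f" shows "cmp b (\<lambda>x. f x = Lf)"
  unfolding cmp_def
proof (rule tr_cond[OF assms[unfolded cmp_def]])
  show "tr b {i \<in> UNIV. enc (f i) \<noteq> Lf} enc (\<lambda>x. enc (f x = Lf))"
    by (rule tr_cong[OF tr_const[of _ _ _ Lf]]) auto
  show "tr b {i \<in> UNIV. enc (f i) = Lf} enc (\<lambda>x. enc (f x = Lf))"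
    by (rule tr_cong[OF tr_const[of _ _ _ "Br Lf Lf"]]) auto
qed

lemma cmp_is_Nil: "cmp b f \<Longrightarrow> cmp b (\<lambda>x. f x = [])"
  using cmp_isLf[OF cmp_enc, of b f] by simp

subsection \<open>Loops\<close>

text \<open>The last hypothesis covers termination and space at once: as long as the test has
  succeeded, both the number of rounds and the current state are bounded in the size of
  \<open>x\<close>.\<close>

lemma cmp_while:
  fixes init :: "'x::enc \<Rightarrow> 's::enc"
  assumes c: "cmp b c" and g: "cmp b g" and init: "cmp b init"
    and F: "\<And>s. F s = (if c s then F (g s) else s)"
    and B: "bnd b B"
      "\<And>x n. (\<And>i. i < n \<Longrightarrow> c ((g ^^ i) (init x))) \<Longrightarrow> n \<le> B (sz x) \<and> sz ((g ^^ n) (init x)) \<le> B (sz x)"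
  shows "cmp b (\<lambda>x. F (init x))"
proof -
  obtain p S where p: "bnd b S" "\<And>x. \<exists>t. runs p (enc x) (enc (c x)) t \<and> t \<le> S (sz x)"
    using c unfolding cmp_def tr_def by auto
  obtain q R where q: "bnd b R" "\<And>x. \<exists>t. runs q (enc x) (enc (g x)) t \<and> t \<le> R (sz x)"
    using g unfolding cmp_def tr_def by auto
  have loop: "\<exists>t. runs (While p q) (enc s) (enc ((g ^^ m) s)) t \<and> t \<le> (m + 1) * (1 + S M + R M)"
    if "\<And>i. i < m \<Longrightarrow> c ((g ^^ i) s)" "\<not> c ((g ^^ m) s)" "\<And>i. i \<le> m \<Longrightarrow> sz ((g ^^ i) s) \<le> M" for m s M
    using that
  proof (induction m arbitrary: s)
    case 0
    obtain t where t: "runs p (enc s) (enc (c s)) t" "t \<le> S (sz s)" using p by blast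
    have "S (sz s) \<le> S M" using 0(3)[of 0] by (intro bnd_mono[OF p(1)]) simp
    then show ?case using 0 t runs.WhileF[of p "enc s" t q]
      by (intro exI[of _ "1 + t"]) (auto simp: enc_bool_def)
  next
    case (Suc m)
    obtain t where t: "runs p (enc s) (enc (c s)) t" "t \<le> S (sz s)" using p by blast
    obtain u where u: "runs q (enc s) (enc (g s)) u" "u \<le> R (sz s)" using q by blast
    have le: "S (sz s) \<le> S M" "R (sz s) \<le> R M"
      using Suc.prems(3)[of 0] by (auto intro!: bnd_mono[OF p(1)] bnd_mono[OF q(1)])
    have "\<exists>t. runs (While p q) (enc (g s)) (enc ((g ^^ m) (g s))) t \<and> t \<le> (m + 1) * (1 + S M + R M)"
    proof (rule Suc.IH)
      show "c ((g ^^ i) (g s))" if "i < m" for i using Suc.prems(1)[of "Suc i"] that by (simp add: funpow_swap1)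
      show "\<not> c ((g ^^ m) (g s))" using Suc.prems(2) by (simp add: funpow_swap1)
      show "sz ((g ^^ i) (g s)) \<le> M" if "i \<le> m" for i using Suc.prems(3)[of "Suc i"] that by (simp add: funpow_swap1)
    qed
    then obtain v where v: "runs (While p q) (enc (g s)) (enc ((g ^^ Suc m) s)) v" "v \<le> (m + 1) * (1 + S M + R M)"
      by (auto simp: funpow_swap1)
    have "enc (c s) \<noteq> Lf" using Suc.prems(1)[of 0] by simp
    from runs.WhileT[OF t(1) this u(1) v(1)]
    show ?case using t(2) u(2) v(2) le by (intro exI[of _ "1 + t + u + v"]) auto
  qed
  \<comment> \<open>\<open>x\<close> travels along with the initial state because \<open>B\<close>
    is stated in the size of \<open>x\<close>, while \<open>tr\<close> measures time in the size of
    what the program receives.\<close>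
  have "tr b UNIV (\<lambda>x. enc (x, init x)) (\<lambda>x. Br (enc (F (init x))) Lf)"
  proof -
    have "\<exists>t. runs (Join (Seq Tl (While p q)) Empty) (enc (x, init x)) (Br (enc (F (init x))) Lf) t
       \<and> t \<le> 100 * (bt_size (enc (x, init x)) + 1) + (B (bt_size (enc (x, init x))) + 1) * (1 + S (B (bt_size (enc (x, init x)))) + R (B (bt_size (enc (x, init x)))))" for x
    proof -
      let ?z = "bt_size (enc (x, init x))"
      \<comment> \<open>If the test never failed, the hypothesis with
        \<open>n = Suc (B (sz x))\<close> would bound \<open>n\<close> by
        \<open>B (sz x)\<close>.\<close>
      have "\<exists>n. \<not> c ((g ^^ n) (init x))"
        using B(2)[of "Suc (B (sz x))" x] not_less_eq_eq by blast
      then obtain m where m: "\<not> c ((g ^^ m) (init x))" "\<And>i. i < m \<Longrightarrow> c ((g ^^ i) (init x))"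
        using exists_least_iff[of "\<lambda>n. \<not> c ((g ^^ n) (init x))"] by blast
      have Fm: "F (init x) = (g ^^ i) (init x)" if "i = m" for i
      proof -
        have "F (init x) = F ((g ^^ i) (init x))" if "i \<le> m" for i
          using that by (induction i) (auto simp: F[of "(g ^^ _) _"] m(2))
        from this[of m] show ?thesis using F[of "(g ^^ m) (init x)"] m that by simp
      qed
      have BB: "B (sz x) \<le> B ?z" by (rule bnd_mono[OF B(1)]) simp
      have "m \<le> B ?z" using B(2)[of m x] m(2) BB by force
      have "\<exists>t. runs (While p q) (enc (init x)) (enc ((g ^^ m) (init x))) t \<and> t \<le> (m + 1) * (1 + S (B ?z) + R (B ?z))"
      proof (rule loop)
        show "sz ((g ^^ i) (init x)) \<le> B ?z" if "i \<le> m" for i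
          using B(2)[of i x] m(2) that BB by (meson le_trans less_le_trans)
      qed (use m in auto)
      then obtain t where t: "runs (While p q) (enc (init x)) (enc (F (init x))) t" "t \<le> (m + 1) * (1 + S (B ?z) + R (B ?z))"
        using Fm by auto
      have "runs (Seq Tl (While p q)) (enc (x, init x)) (enc (F (init x))) (1 + (1 + ?z) + t)"
        using runs.Seq[OF runs.Tl[of "enc (x, init x)"]] t by simp
      from runs.Join[OF this runs.Empty]
      have "runs (Join (Seq Tl (While p q)) Empty) (enc (x, init x)) (Br (enc (F (init x))) Lf) (1 + (1 + (1 + ?z) + t) + (1 + ?z))" .
      moreover have "t \<le> (B ?z + 1) * (1 + S (B ?z) + R (B ?z))"
        using t(2) \<open>m \<le> B ?z\<close> by (meson add_le_mono1 le_trans mult_le_mono1)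
      ultimately show ?thesis by (intro exI conjI) auto
    qed
    moreover have "bnd b (\<lambda>n. 100 * (n + 1) + (B n + 1) * (1 + S (B n) + R (B n)))"
      by (intro bnd_intros B bnd_comp[OF p(1)] bnd_comp[OF q(1)])
    ultimately show ?thesis unfolding tr_def by blast
  qed
  from tr_hd[OF this] have "tr b UNIV (\<lambda>x. enc (x, init x)) (\<lambda>x. enc (F (init x)))" by simp
  moreover have "tr b UNIV enc (\<lambda>x. enc (x, init x))"
    using cmp_Pair[OF cmp_id init] by (simp add: cmp_def)
  ultimately show ?thesis unfolding cmp_def by (rule tr_trans[rotated])
qed

text \<open>The loop state is the rest of the list, the context \<open>x\<close> and the
  accumulator. A size bound on the accumulator is asked for only in the polynomial case; otherwise
  \<open>bnd_False_exists\<close> supplies it.\<close>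

lemma cmp_foldl:
  fixes step :: "'x::enc \<Rightarrow> 's::enc \<Rightarrow> 'y::enc \<Rightarrow> 's"
  assumes xs: "cmp b xs" and a: "cmp b a"
    and step: "cmp b (\<lambda>p. step (fst p) (fst (snd p)) (snd (snd p)))"
    and size: "b \<Longrightarrow> \<exists>B. bnd b B \<and> (\<forall>x n. n \<le> length (xs x) \<longrightarrow> sz (foldl (step x) (a x) (take n (xs x))) \<le> B (sz x))"
  shows "cmp b (\<lambda>x. foldl (step x) (a x) (xs x))"
proof -
  have "\<exists>B. bnd b B \<and> (\<forall>x n. n \<le> length (xs x) \<longrightarrow> sz (foldl (step x) (a x) (take n (xs x))) \<le> B (sz x))"
  proof (cases b)
    case False
    obtain B where B: "bnd False B"
      "\<And>x. (\<Sum>n\<le>length (xs x). sz (foldl (step x) (a x) (take n (xs x)))) \<le> B (sz x)"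
      using bnd_False_exists[of "\<lambda>x. \<Sum>n\<le>length (xs x). sz (foldl (step x) (a x) (take n (xs x)))"] by blast
    have "sz (foldl (step x) (a x) (take n (xs x))) \<le> B (sz x)" if "n \<le> length (xs x)" for x n
      by (rule le_trans[OF _ B(2)], rule member_le_sum) (use that in auto)
    then show ?thesis using B(1) False by (intro exI[of _ B]) auto
  qed (use size in blast)
  then obtain B where B: "bnd b B"
    "\<And>x n. n \<le> length (xs x) \<Longrightarrow> sz (foldl (step x) (a x) (take n (xs x))) \<le> B (sz x)" by blast
  obtain L where L: "bnd b L" "\<And>x. sz (xs x) \<le> L (sz x)" using cmp_size[OF xs] by blast
  define c where "c = (\<lambda>s::'y list \<times> 'x \<times> 's. fst s \<noteq> [])"
  define g where "g = (\<lambda>s::'y list \<times> 'x \<times> 's. case fst s of [] \<Rightarrow> s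
     | y # ys \<Rightarrow> (ys, fst (snd s), step (fst (snd s)) (snd (snd s)) y))"
  define F where "F = (\<lambda>s::'y list \<times> 'x \<times> 's. ([]::'y list, fst (snd s), foldl (step (fst (snd s))) (snd (snd s)) (fst s)))"
  have g_Cons: "g (y # ys, x, s) = (ys, x, step x s y)" for y ys x s by (simp add: g_def)
  have iter: "(g ^^ n) (ys, x, s) = (drop n ys, x, foldl (step x) s (take n ys))" if "n \<le> length ys" for n ys x s
    using that
  proof (induction n arbitrary: ys s)
    case (Suc n) then show ?case by (cases ys) (simp_all add: funpow_Suc_right g_Cons del: funpow.simps(2))
  qed auto
  have "cmp b (\<lambda>x. F (xs x, x, a x))"
  proof (rule cmp_while[where F = F and init = "\<lambda>x. (xs x, x, a x)" and c = c and g = g and B = "\<lambda>n. L n + n + B n + 3"])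
    show "cmp b c" unfolding c_def by (intro cmp_not cmp_is_Nil cmp_intros)
    have "cmp b (\<lambda>p :: ('y list \<times> 'x \<times> 's) \<times> 'y \<times> 'y list. (\<lambda>p. step (fst p) (fst (snd p)) (snd (snd p)))
       (fst (snd (fst p)), snd (snd (fst p)), fst (snd p)))"
      by (rule cmp_comp[OF step]) (intro cmp_intros)
    then show "cmp b g" unfolding g_def by (intro cmp_intros) auto
    show "cmp b (\<lambda>x. (xs x, x, a x))" by (intro cmp_intros xs a)
    show "F s = (if c s then F (g s) else s)" for s
      by (cases s; cases "fst s") (auto simp: F_def c_def g_def)
    show "bnd b (\<lambda>n. L n + n + B n + 3)" by (intro bnd_intros L B)
    fix x n assume c: "\<And>i. i < n \<Longrightarrow> c ((g ^^ i) (xs x, x, a x))"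
    have n: "n \<le> length (xs x)"
    proof (rule ccontr)
      assume "\<not> n \<le> length (xs x)"
      with c[of "length (xs x)"] show False by (simp add: iter c_def)
    qed
    show "n \<le> L (sz x) + sz x + B (sz x) + 3 \<and> sz ((g ^^ n) (xs x, x, a x)) \<le> L (sz x) + sz x + B (sz x) + 3"
      using n L(2)[of x] B(2)[OF n] length_le_sz[of "xs x"] sz_drop[of n "xs x"] by (auto simp: iter)
  qed
  from cmp_snd[OF cmp_snd[OF this]] show ?thesis by (simp add: F_def)
qed

text \<open>The increment per step depends on \<open>x\<close> and \<open>y\<close> but not on the
  accumulator, which excludes repeated doubling and keeps the total size polynomial.\<close>

lemma cmp_foldl_add:
  fixes step :: "'x::enc \<Rightarrow> 's::enc \<Rightarrow> 'y::enc \<Rightarrow> 's"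
  assumes xs: "cmp b xs" and a: "cmp b a"
    and step: "cmp b (\<lambda>p. step (fst p) (fst (snd p)) (snd (snd p)))"
    and size: "b \<Longrightarrow> \<exists>G. bnd b G \<and> (\<forall>x s y. sz (step x s y) \<le> sz s + G (sz (x, y)))"
  shows "cmp b (\<lambda>x. foldl (step x) (a x) (xs x))"
proof (rule cmp_foldl[OF xs a step])
  assume b
  then obtain G where G: "bnd b G" "\<And>x s y. sz (step x s y) \<le> sz s + G (sz (x, y))" using size by blast
  obtain L where L: "bnd b L" "\<And>x. sz (xs x) \<le> L (sz x)" using cmp_size[OF xs] by blast
  obtain A where A: "bnd b A" "\<And>x. sz (a x) \<le> A (sz x)" using cmp_size[OF a] by blast
  have *: "sz (foldl (step x) s ys) \<le> sz s + length ys * G M" if "\<And>y. y \<in> set ys \<Longrightarrow> sz (x, y) \<le> M" for x s ys M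
    using that
  proof (induction ys arbitrary: s)
    case (Cons y ys)
    have "G (sz (x, y)) \<le> G M" using Cons.prems by (intro bnd_mono[OF G(1)]) auto
    then have "sz (step x s y) \<le> sz s + G M" using G(2)[of x s y] by linarith
    then show ?case using Cons.IH[of "step x s y"] Cons.prems by simp
  qed simp
  have "sz (foldl (step x) (a x) (take n (xs x))) \<le> A (sz x) + L (sz x) * G (1 + sz x + L (sz x))" if "n \<le> length (xs x)" for x n
  proof -
    have "sz (foldl (step x) (a x) (take n (xs x))) \<le> sz (a x) + length (take n (xs x)) * G (1 + sz x + L (sz x))"
    proof (rule *)
      fix y assume "y \<in> set (take n (xs x))"
      then have "sz y < sz (xs x)" by (meson in_set_takeD sz_mem)
      then show "sz (x, y) \<le> 1 + sz x + L (sz x)" using L(2)[of x] by simp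
    qed
    moreover have "length (take n (xs x)) \<le> L (sz x)" using L(2)[of x] length_le_sz[of "xs x"] by simp
    ultimately show ?thesis using A(2)[of x]
      by (meson add_le_mono le_trans mult_le_mono1)
  qed
  moreover have "bnd b (\<lambda>n. A n + L n * G (1 + n + L n))" by (intro bnd_intros A L bnd_comp[OF G(1)])
  ultimately show "\<exists>B. bnd b B \<and> (\<forall>x n. n \<le> length (xs x) \<longrightarrow> sz (foldl (step x) (a x) (take n (xs x))) \<le> B (sz x))"
    by blast
qed

lemma cmp_foldl_unbounded:
  assumes "cmp False xs" "cmp False a" "cmp False (\<lambda>p. step (fst p) (fst (snd p)) (snd (snd p)))"
  shows "cmp False (\<lambda>x. foldl (step x) (a x) (xs x))"
  by (rule cmp_foldl[OF assms]) simp

lemma foldl_Cons_rev: "foldl (\<lambda>s y. y # s) a xs = rev xs @ a"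
  by (induction xs arbitrary: a) auto

lemma foldl_Suc: "foldl (\<lambda>s y. Suc s) n xs = n + length xs"
  by (induction xs arbitrary: n) auto

lemma foldl_plus: "foldl (\<lambda>s y. s + m) n xs = n + (m::nat) * length xs"
  by (induction xs arbitrary: n) auto

lemma cmp_rev [cmp_intros]:
  assumes "cmp b f" shows "cmp b (\<lambda>x. rev (f x))"
proof -
  have "cmp b (\<lambda>x. foldl (\<lambda>s y. y # s) [] (f x))"
    by (rule cmp_foldl_add[OF assms]) (intro cmp_intros exI[of _ "\<lambda>n. n"] conjI bnd_id | simp)+
  then show ?thesis by (simp add: foldl_Cons_rev)
qed

lemma cmp_append [cmp_intros]:
  assumes "cmp b f" "cmp b g" shows "cmp b (\<lambda>x. f x @ g x)"
proof -
  have "cmp b (\<lambda>x. foldl (\<lambda>s y. y # s) (g x) (rev (f x)))"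
    by (rule cmp_foldl_add) (intro assms cmp_intros exI[of _ "\<lambda>n. n"] conjI bnd_id | simp)+
  then show ?thesis by (simp add: foldl_Cons_rev)
qed

lemma cmp_map [cmp_intros]:
  assumes h: "cmp b (\<lambda>p. h (fst p) (snd p))" and xs: "cmp b xs"
  shows "cmp b (\<lambda>x. map (h x) (xs x))"
proof -
  obtain B where B: "bnd b B" "\<And>p. sz (h (fst p) (snd p)) \<le> B (sz p)" using cmp_size[OF h] by blast
  have "cmp b (\<lambda>x. foldl (\<lambda>s y. h x y # s) [] (xs x))"
  proof (rule cmp_foldl_add[OF xs cmp_const])
    have "cmp b (\<lambda>p. (\<lambda>p. h (fst p) (snd p)) (fst p, snd (snd p)))"
      by (rule cmp_comp[OF h]) (intro cmp_intros)
    then show "cmp b (\<lambda>p. h (fst p) (snd (snd p)) # fst (snd p))" by (intro cmp_intros) auto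
    show "\<exists>G. bnd b G \<and> (\<forall>x s y. sz (h x y # s) \<le> sz s + G (sz (x, y)))"
      by (intro exI[of _ "\<lambda>n. 1 + B n"] conjI bnd_intros B) (use B(2)[of "(_, _)"] in auto)
  qed
  moreover have "foldl (\<lambda>s y. h x y # s) a ys = rev (map (h x) ys) @ a" for x a ys
    by (induction ys arbitrary: a) auto
  ultimately have "cmp b (\<lambda>x. rev (map (h x) (xs x)))" by simp
  from cmp_rev[OF this] show ?thesis by simp
qed

lemma cmp_filter [cmp_intros]:
  assumes h: "cmp b (\<lambda>p. P (fst p) (snd p))" and xs: "cmp b xs"
  shows "cmp b (\<lambda>x. filter (P x) (xs x))"
proof -
  have "cmp b (\<lambda>x. foldl (\<lambda>s y. if P x y then y # s else s) [] (xs x))"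
  proof (rule cmp_foldl_add[OF xs cmp_const])
    have "cmp b (\<lambda>p. (\<lambda>p. P (fst p) (snd p)) (fst p, snd (snd p)))"
      by (rule cmp_comp[OF h]) (intro cmp_intros)
    then show "cmp b (\<lambda>p. if P (fst p) (snd (snd p)) then snd (snd p) # fst (snd p) else fst (snd p))"
      by (intro cmp_intros) auto
    show "\<exists>G. bnd b G \<and> (\<forall>x s y. sz (if P x y then y # s else s) \<le> sz s + G (sz (x, y)))"
      by (intro exI[of _ "\<lambda>n. n"] conjI bnd_intros) auto
  qed
  moreover have "foldl (\<lambda>s y. if P x y then y # s else s) a ys = rev (filter (P x) ys) @ a" for x a ys
    by (induction ys arbitrary: a) auto
  ultimately have "cmp b (\<lambda>x. rev (filter (P x) (xs x)))" by simp
  from cmp_rev[OF this] show ?thesis by simp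
qed

lemma cmp_concat [cmp_intros]:
  fixes f :: "'x::enc \<Rightarrow> 'y::enc list list"
  assumes "cmp b f" shows "cmp b (\<lambda>x. concat (f x))"
proof -
  have "cmp b (\<lambda>x. foldl (@) [] (f x))"
  proof (rule cmp_foldl_add[OF assms cmp_const, where step = "\<lambda>x s y. s @ y"])
    have "sz (s @ y) \<le> sz s + sz (x, y)" for x :: 'x and s y :: "'y list"
      using sz_append[of s y] by simp
    then show "\<exists>G. bnd b G \<and> (\<forall>(x::'x) (s::'y list) y. sz (s @ y) \<le> sz s + G (sz (x, y)))"
      using bnd_id by blast
  qed (intro cmp_intros)
  moreover have "foldl (@) a xss = a @ concat xss" for a :: "'y list" and xss
    by (induction xss arbitrary: a) auto
  ultimately show ?thesis by simp
qed

lemma cmp_Bex [cmp_intros]: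
  assumes h: "cmp b (\<lambda>p. P (fst p) (snd p))" and xs: "cmp b xs"
  shows "cmp b (\<lambda>x. \<exists>y\<in>set (xs x). P x y)"
proof -
  have "cmp b (\<lambda>x. filter (P x) (xs x) \<noteq> [])" by (intro cmp_not cmp_is_Nil cmp_filter assms)
  then show ?thesis by (simp add: filter_empty_conv)
qed

lemma cmp_Ball [cmp_intros]:
  assumes h: "cmp b (\<lambda>p. P (fst p) (snd p))" and xs: "cmp b xs"
  shows "cmp b (\<lambda>x. \<forall>y\<in>set (xs x). P x y)"
  using cmp_not[OF cmp_Bex[OF cmp_not[OF h] xs]] by simp

lemma cmp_length [cmp_intros]:
  assumes "cmp b f" shows "cmp b (\<lambda>x. length (f x))"
proof -
  have "cmp b (\<lambda>x. foldl (\<lambda>s y. Suc s) 0 (f x))"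
    by (rule cmp_foldl_add[OF assms]) (intro cmp_intros exI[of _ "\<lambda>n. 2"] conjI bnd_intros | simp)+
  then show ?thesis by (simp add: foldl_Suc)
qed

subsection \<open>Functional iteration and arithmetic\<close>

lemma foldl_replicate: "foldl (\<lambda>s y. f s) a (replicate n c) = (f ^^ n) a"
  by (induction n arbitrary: a) (auto simp: funpow_swap1)

text \<open>A unary number is encoded like a list of \<open>Lf\<close>, so iteration is a fold over
  that list.\<close>

lemma cmp_funpow:
  fixes f :: "'x::enc \<Rightarrow> 's::enc \<Rightarrow> 's"
  assumes n: "cmp b n" and a: "cmp b a" and f: "cmp b (\<lambda>p. f (fst p) (snd p))"
    and size: "b \<Longrightarrow> \<exists>B. bnd b B \<and> (\<forall>x i. i \<le> n x \<longrightarrow> sz ((f x ^^ i) (a x)) \<le> B (sz x))"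
  shows "cmp b (\<lambda>x. (f x ^^ n x) (a x))"
proof -
  have f': "cmp b (\<lambda>p. f (fst p) (fst (snd p)))"
    using cmp_comp[OF f, of "\<lambda>p. (fst p, fst (snd p))"] by (simp add: cmp_intros)
  have "cmp b (\<lambda>x. foldl (\<lambda>s y. f x s) (a x) (replicate (n x) Lf))"
    by (rule cmp_foldl[OF cmp_replicate_Lf[OF n] a f']) (use size in \<open>simp add: foldl_replicate min_def\<close>)
  then show ?thesis by (simp add: foldl_replicate)
qed

lemma cmp_funpow_unbounded:
  fixes f :: "'x::enc \<Rightarrow> 's::enc \<Rightarrow> 's"
  shows "cmp False n \<Longrightarrow> cmp False a \<Longrightarrow> cmp False (\<lambda>p. f (fst p) (snd p)) \<Longrightarrow> cmp False (\<lambda>x. (f x ^^ n x) (a x))"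
  by (rule cmp_funpow) simp_all

lemma cmp_add [cmp_intros]:
  fixes f :: "'x::enc \<Rightarrow> nat"
  assumes "cmp b f" "cmp b g" shows "cmp b (\<lambda>x. f x + g x)"
proof -
  have "cmp b (\<lambda>x. foldl (\<lambda>s y. Suc s) (f x) (replicate (g x) Lf))"
    by (rule cmp_foldl_add[OF cmp_replicate_Lf]) (intro assms cmp_intros exI[of _ "\<lambda>n. 2"] conjI bnd_intros | simp)+
  then show ?thesis by (simp add: foldl_Suc)
qed

lemma cmp_mult [cmp_intros]:
  fixes f :: "'x::enc \<Rightarrow> nat"
  assumes "cmp b f" "cmp b g" shows "cmp b (\<lambda>x. f x * g x)"
proof -
  obtain B where B: "bnd b B" "\<And>x. sz (f x) \<le> B (sz x)" using cmp_size[OF assms(1)] by blast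
  have "cmp b (\<lambda>x. foldl (\<lambda>s y. s + f x) 0 (replicate (g x) Lf))"
  proof (rule cmp_foldl_add[OF cmp_replicate_Lf, where step = "\<lambda>x s y. s + f x"])
    show "cmp b (\<lambda>p. fst (snd p) + f (fst p))" by (intro cmp_intros cmp_comp[OF assms(1)])
    have "sz (s + f x) \<le> sz s + B (sz (x, y))" for x :: 'x and s :: nat and y :: bt
    proof -
      have "B (sz x) \<le> B (sz (x, y))" by (rule bnd_mono[OF B(1)]) simp
      then show ?thesis using B(2)[of x] by simp
    qed
    then show "\<exists>G. bnd b G \<and> (\<forall>x s (y::bt). sz (s + f x) \<le> sz s + G (sz (x, y)))"
      using B(1) by blast
  qed (intro assms cmp_intros)+
  then show ?thesis by (simp add: foldl_plus)
qed

text \<open>Restricted to the unbounded case, since the unary result can be exponentially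
  long.\<close>

lemma cmp_power:
  fixes f :: "'x::enc \<Rightarrow> nat"
  assumes "cmp False f" "cmp False g" shows "cmp False (\<lambda>x. f x ^ g x)"
proof -
  have "cmp False (\<lambda>x. ((\<lambda>s. f x * s) ^^ g x) 1)"
    by (rule cmp_funpow_unbounded) (intro assms cmp_intros cmp_comp[OF assms(1)])+
  moreover have "((\<lambda>s. m * s) ^^ n) 1 = m ^ n" for m n :: nat
    by (induction n) auto
  ultimately show ?thesis by simp
qed

lemma cmp_upt [cmp_intros]:
  assumes "cmp b f" shows "cmp b (\<lambda>x. [0..<f x])"
proof -
  define g where "g = (\<lambda>s::nat list. case s of [] \<Rightarrow> [0] | y # ys \<Rightarrow> Suc y # y # ys)"
  have g: "(g ^^ n) [] = rev [0..<n]" for n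
  proof (induction n)
    case (Suc n) then show ?case by (cases n) (auto simp: g_def)
  qed simp
  have sz_upt: "sz (rev [0..<i]) \<le> i * (2 * i + 2) + 1" for i :: nat
  proof (induction i)
    case (Suc i)
    have "sz (rev [0..<Suc i]) = Suc (2 * i + 1 + sz [0..<i])" by simp
    then show ?case using Suc by simp
  qed simp
  obtain B where B: "bnd b B" "\<And>x. sz (f x) \<le> B (sz x)" using cmp_size[OF assms(1)] by blast
  have "cmp b (\<lambda>x. (g ^^ f x) [])"
  proof (rule cmp_funpow[OF assms cmp_const])
    show "cmp b (\<lambda>p::'a \<times> nat list. g (snd p))" unfolding g_def by (intro cmp_intros)
    have "i * (2 * i + 2) + 1 \<le> B (sz x) * (2 * B (sz x) + 2) + 1" if "i \<le> f x" for x i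
      using B(2)[of x] that by (intro add_mono mult_mono) auto
    then show "\<exists>B. bnd b B \<and> (\<forall>x i. i \<le> f x \<longrightarrow> sz ((g ^^ i) []) \<le> B (sz x))"
      by (intro exI[of _ "\<lambda>n. B n * (2 * B n + 2) + 1"] conjI bnd_intros B allI impI)
         (metis g le_trans sz_upt)
  qed
  then have "cmp b (\<lambda>x. rev [0..<f x])" by (simp only: g)
  from cmp_rev[OF this] show ?thesis by simp
qed

subsection \<open>Tree size and equality\<close>

text \<open>A stack of pending subtrees replaces recursion. The counter plus the total size of the
  stack is constant (\<open>w\<close>) and every step raises the counter, so there are at most
  \<open>bt_size x\<close> steps.\<close>

lemma cmp_bt_size [cmp_intros]:
  assumes "cmp b f" shows "cmp b (\<lambda>x. bt_size (f x))"
proof -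
  define c where "c = (\<lambda>s::bt list \<times> nat. fst s \<noteq> [])"
  define g where "g = (\<lambda>s::bt list \<times> nat. case fst s of [] \<Rightarrow> s
     | t # r \<Rightarrow> (if t = Lf then r else bt_hd t # bt_tl t # r, Suc (snd s)))"
  define F where "F = (\<lambda>s::bt list \<times> nat. ([]::bt list, snd s + sum_list (map bt_size (fst s))))"
  define w where "w = (\<lambda>s::bt list \<times> nat. snd s + sum_list (map bt_size (fst s)))"
  have w: "w (g s) = w s" "sz (fst (g s)) \<le> sz (fst s)" for s
    by (cases s; cases "fst s"; cases "hd (fst s)"; auto simp: w_def g_def)+
  have cmpF: "cmp b (\<lambda>x. F ([x], 0))"
  proof (rule cmp_while[where F = F and init = "\<lambda>x. ([x], 0)" and c = c and g = g and B = "\<lambda>n. n + 2 * n + 10"])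
    show "cmp b c" unfolding c_def by (intro cmp_not cmp_is_Nil cmp_intros)
    show "cmp b g" unfolding g_def by (intro cmp_intros)
    show "cmp b (\<lambda>x. ([x], 0))" by (intro cmp_intros)
    show "F s = (if c s then F (g s) else s)" for s
      by (cases s; cases "fst s"; cases "hd (fst s)") (auto simp: F_def c_def g_def)
    show "bnd b (\<lambda>n. n + 2 * n + 10)" by (intro bnd_intros)
    fix x :: bt and n assume c: "\<And>i. i < n \<Longrightarrow> c ((g ^^ i) ([x], 0))"
    have "w ((g ^^ n) ([x], 0)) = bt_size x \<and> sz (fst ((g ^^ n) ([x], 0))) \<le> bt_size x + 2 \<and> snd ((g ^^ n) ([x], 0)) = n"
      using c
    proof (induction n)
      case (Suc n)
      let ?s = "(g ^^ n) ([x], 0)"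
      have IH: "w ?s = bt_size x \<and> sz (fst ?s) \<le> bt_size x + 2 \<and> snd ?s = n"
        by (rule Suc.IH) (rule Suc.prems, simp)
      have "c ?s" by (rule Suc.prems) simp
      then have "snd (g ?s) = Suc (snd ?s)" by (auto simp: c_def g_def split: list.splits)
      then show ?case using IH w(1)[of ?s] w(2)[of ?s] by simp
    qed (auto simp: w_def)
    then show "n \<le> sz x + 2 * sz x + 10 \<and> sz ((g ^^ n) ([x], 0)) \<le> sz x + 2 * sz x + 10"
      by (cases "(g ^^ n) ([x], 0)") (auto simp: w_def)
  qed
  from cmp_comp[OF cmp_snd[OF cmpF] assms] show ?thesis by (simp add: F_def)
qed

text \<open>A stack of pairs still to be compared: \<open>E\<close> is invariant, and
  \<open>w\<close> drops in each step until the stack is empty, after which \<open>h\<close> idles.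
  Hence \<open>bt_size\<close> of the first tree is enough iterations.\<close>

lemma cmp_eq_bt:
  assumes "cmp b f" "cmp b g" shows "cmp b (\<lambda>x. f x = (g x :: bt))"
proof -
  define h where "h = (\<lambda>s::(bt \<times> bt) list \<times> bool. case fst s of [] \<Rightarrow> s
     | t # r \<Rightarrow> if fst t = Lf then (r, snd t = Lf \<and> snd s) else if snd t = Lf then (r, False)
        else ((bt_hd (fst t), bt_hd (snd t)) # (bt_tl (fst t), bt_tl (snd t)) # r, snd s))"
  define w where "w = (\<lambda>s::(bt \<times> bt) list \<times> bool. sum_list (map (bt_size \<circ> fst) (fst s)))"
  define E where "E = (\<lambda>s::(bt \<times> bt) list \<times> bool. snd s \<and> (\<forall>t\<in>set (fst s). fst t = snd t))"
  have E: "E (h s) \<longleftrightarrow> E s" for s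
    by (cases s; cases "fst s"; cases "fst (hd (fst s))"; cases "snd (hd (fst s))") (auto simp: E_def h_def)
  have w: "w (h s) \<le> w s - 1" for s
    by (cases s; cases "fst s"; cases "fst (hd (fst s))"; cases "snd (hd (fst s))") (auto simp: w_def h_def)
  have sz: "sz (h s) \<le> sz s + 2" "sz (fst (h s)) \<le> sz (fst s)" for s
    by (cases s; cases "fst s"; cases "fst (hd (fst s))"; cases "snd (hd (fst s))"; cases "snd s"; auto simp: h_def)+
  have E_iter: "E ((h ^^ n) s) \<longleftrightarrow> E s" for n s by (induction n) (auto simp: E)
  have w_iter: "w ((h ^^ n) s) \<le> w s - n" for n s
  proof (induction n)
    case (Suc n) then show ?case using w[of "(h ^^ n) s"] by simp
  qed simp
  have sz_iter: "sz (fst ((h ^^ n) s)) \<le> sz (fst s)" for n s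
  proof (induction n)
    case (Suc n) then show ?case using sz(2)[of "(h ^^ n) s"] by simp
  qed simp
  have main: "snd ((h ^^ bt_size x) ([(x, y)], True)) \<longleftrightarrow> x = y" for x y
  proof -
    let ?s = "(h ^^ bt_size x) ([(x, y)], True)"
    have "w ?s = 0" using w_iter[of "bt_size x" "([(x, y)], True)"] by (simp add: w_def)
    then have "fst ?s = []" by (cases "fst ?s") (auto simp: w_def)
    then show ?thesis using E_iter[of "bt_size x" "([(x, y)], True)"] by (simp add: E_def)
  qed
  have "cmp b (\<lambda>x. (h ^^ bt_size (f x)) ([(f x, g x)], True))"
  proof (rule cmp_funpow)
    show "cmp b (\<lambda>p::'a \<times> (bt \<times> bt) list \<times> bool. h (snd p))" unfolding h_def by (intro cmp_intros)
    obtain B where B: "bnd b B" "\<And>x. sz [(f x, g x)] \<le> B (sz x)"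
      using cmp_size[OF cmp_Cons[OF cmp_Pair[OF assms] cmp_const], of "[]"] by blast
    have "sz ((h ^^ i) ([(f x, g x)], True)) \<le> B (sz x) + 10" for x i
    proof -
      have "sz s \<le> sz (fst s) + 4" for s :: "(bt \<times> bt) list \<times> bool"
        using sz_bool[of "snd s"] by (cases s) auto
      from this[of "(h ^^ i) ([(f x, g x)], True)"] show ?thesis
        using sz_iter[of i "([(f x, g x)], True)"] B(2)[of x] unfolding fst_conv by linarith
    qed
    then show "\<exists>B. bnd b B \<and> (\<forall>x i. i \<le> bt_size (f x) \<longrightarrow> sz ((h ^^ i) ([(f x, g x)], True)) \<le> B (sz x))"
      by (intro exI[of _ "\<lambda>n. B n + 10"] conjI bnd_intros B) auto
  qed (intro assms cmp_intros)+
  from cmp_snd[OF this] show ?thesis by (simp add: main)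
qed

lemma cmp_eq [cmp_intros]:
  assumes "cmp b f" "cmp b g" shows "cmp b (\<lambda>x. f x = g x)"
  using cmp_eq_bt[OF cmp_enc[OF assms(1)] cmp_enc[OF assms(2)]] by simp

lemma cmp_mem [cmp_intros]:
  assumes "cmp b f" "cmp b g" shows "cmp b (\<lambda>x. f x \<in> set (g x))"
proof -
  have "cmp b (\<lambda>x. \<exists>y\<in>set (g x). y = f x)"
    by (intro cmp_intros assms cmp_comp[OF assms(1)])
  moreover have "(\<exists>y\<in>set (g x). y = f x) = (f x \<in> set (g x))" for x by blast
  ultimately show ?thesis by simp
qed

lemma cmp_less [cmp_intros]:
  fixes f :: "'x::enc \<Rightarrow> nat"
  assumes "cmp b f" "cmp b g" shows "cmp b (\<lambda>x. f x < g x)"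
proof -
  have "cmp b (\<lambda>x. f x \<in> set [0..<g x])" by (intro cmp_intros assms)
  then show ?thesis by simp
qed

text \<open>Saturated doubling: \<open>2 ^ a\<close> itself need not be polynomially bounded.\<close>

lemma cmp_less_power2 [cmp_intros]:
  fixes j :: "'x::enc \<Rightarrow> nat"
  assumes j: "cmp b j" and a: "cmp b a" shows "cmp b (\<lambda>x. j x < 2 ^ a x)"
proof -
  define d where "d m r = (if m < r then r else r + r)" for m r :: nat
  have inv: "(d m ^^ n) 1 = 2 ^ n \<or> m < (d m ^^ n) 1 \<and> (d m ^^ n) 1 \<le> 2 ^ n" for m n
    by (induction n) (auto simp: d_def)
  have le: "(d m ^^ n) 1 \<le> 2 * m + 1" for m n
    by (induction n) (auto simp: d_def)
  have main: "m < (d m ^^ n) 1 \<longleftrightarrow> m < 2 ^ n" for m n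
    using inv[where n = n and m = m] by auto
  obtain B where B: "bnd b B" "\<And>x. sz (j x) \<le> B (sz x)" using cmp_size[OF j] by blast
  have "cmp b (\<lambda>x. (d (j x) ^^ a x) 1)"
  proof (rule cmp_funpow[OF a cmp_const])
    show "cmp b (\<lambda>p::'x \<times> nat. d (j (fst p)) (snd p))"
      unfolding d_def by (intro cmp_intros cmp_comp[OF j])
    have "sz ((d (j x) ^^ i) 1) \<le> 10 * B (sz x) + 10" for x i
      using le[where m = "j x" and n = i] B(2)[of x] by simp
    then show "\<exists>B. bnd b B \<and> (\<forall>x i. i \<le> a x \<longrightarrow> sz ((d (j x) ^^ i) 1) \<le> B (sz x))"
      by (intro exI[of _ "\<lambda>n. 10 * B n + 10"] conjI bnd_intros B) auto
  qed
  from cmp_less[OF j this] show ?thesis by (simp only: main)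
qed

subsection \<open>List access\<close>

text \<open>A program must return a definite value on every index, so access beyond the end gets a
  default.\<close>

definition nthd :: "'a \<Rightarrow> nat \<Rightarrow> 'a list \<Rightarrow> 'a" where
  "nthd d i xs = (case drop i xs of [] \<Rightarrow> d | y # ys \<Rightarrow> y)"

lemma nthd_nth [simp]: "i < length xs \<Longrightarrow> nthd d i xs = xs ! i"
  by (simp add: nthd_def Cons_nth_drop_Suc[symmetric])

lemma cmp_drop:
  assumes "cmp b i" "cmp b f" shows "cmp b (\<lambda>x. drop (i x) (f x))"
proof -
  define t where "t = (\<lambda>s::'b list. case s of [] \<Rightarrow> [] | y # ys \<Rightarrow> ys)"
  have "t = tl" by (auto simp: t_def split: list.splits)
  then have t: "(t ^^ n) xs = drop n xs" for n xs
    by (induction n) (auto simp: drop_Suc tl_drop)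
  obtain B where B: "bnd b B" "\<And>x. sz (f x) \<le> B (sz x)" using cmp_size[OF assms(2)] by blast
  have "cmp b (\<lambda>x. (t ^^ i x) (f x))"
  proof (rule cmp_funpow[OF assms])
    show "cmp b (\<lambda>p::'a \<times> 'b list. t (snd p))" unfolding t_def by (intro cmp_intros)
    show "\<exists>B. bnd b B \<and> (\<forall>x n. n \<le> i x \<longrightarrow> sz ((t ^^ n) (f x)) \<le> B (sz x))"
      using B by (auto simp: t intro: le_trans[OF sz_drop])
  qed
  then show ?thesis by (simp only: t)
qed

lemma cmp_nthd [cmp_intros]:
  assumes "cmp b d" "cmp b i" "cmp b f" shows "cmp b (\<lambda>x. nthd (d x) (i x) (f x))"
  unfolding nthd_def by (intro cmp_intros cmp_drop assms)

text \<open>This renumbers vertices, variables and colours, so that the kernel is free of the names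
  of the input, whose length is not bounded in the parameter.\<close>

definition idx :: "'a list \<Rightarrow> 'a \<Rightarrow> nat" where
  "idx xs u = (case filter (\<lambda>i. nthd u i xs = u) [0..<length xs] of [] \<Rightarrow> 0 | i # _ \<Rightarrow> i)"

lemma idx_props:
  assumes "u \<in> set xs" shows "idx xs u < length xs" "xs ! idx xs u = u"
proof -
  obtain j where j: "j < length xs" "xs ! j = u" using assms by (auto simp: in_set_conv_nth)
  then have "filter (\<lambda>i. nthd u i xs = u) [0..<length xs] \<noteq> []"
    by (auto simp: filter_empty_conv intro!: bexI[of _ j])
  then obtain i js where f: "filter (\<lambda>i. nthd u i xs = u) [0..<length xs] = i # js"
    by (auto simp: neq_Nil_conv)
  then have "i \<in> set (filter (\<lambda>i. nthd u i xs = u) [0..<length xs])" by simp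
  then have "i < length xs" "xs ! i = u" by auto
  then show "idx xs u < length xs" "xs ! idx xs u = u" by (auto simp: idx_def f)
qed

lemma idx_nth: "distinct xs \<Longrightarrow> i < length xs \<Longrightarrow> idx xs (xs ! i) = i"
  by (meson idx_props nth_eq_iff_index_eq nth_mem)

lemma cmp_idx [cmp_intros]:
  assumes "cmp b f" "cmp b g" shows "cmp b (\<lambda>x. idx (f x) (g x))"
  unfolding idx_def
  by (intro cmp_intros assms cmp_comp[OF assms(1)] cmp_comp[OF assms(2)])

subsection \<open>Binary numbers\<close>

text \<open>The first component is the carry; the digits produced so far stand in reverse
  order.\<close>

definition bsucc_step :: "bool \<times> bt list \<Rightarrow> bt \<Rightarrow> bool \<times> bt list" where
  "bsucc_step s d = (if fst s then (if d = Lf then (False, Br Lf Lf # snd s) else (True, Lf # snd s))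
     else (False, d # snd s))"

definition bsucc_fin :: "bool \<times> bt list \<Rightarrow> bt" where
  "bsucc_fin s = enc (rev (if fst s then Br Lf Lf # snd s else snd s))"

definition bsucc :: "bt \<Rightarrow> bt" where
  "bsucc x = bsucc_fin (foldl bsucc_step (True, []) (bt_children x))"

lemma enc_bt_children [simp]: "enc (bt_children x) = x"
  by (induction x) auto

lemma bt_children_enc [simp]: "bt_children (enc (xs :: bt list)) = xs"
  by (induction xs) auto

lemma bt_of_nat_0 [simp]: "bt_of_nat 0 = Lf"
  by (simp add: bt_of_nat.simps)

lemma bt_of_nat_pos: "0 < n \<Longrightarrow> bt_of_nat n = Br (bt_of_bool (odd n)) (bt_of_nat (n div 2))"
  by (subst bt_of_nat.simps) simp

lemma bsucc_bt_of_nat: "bsucc (bt_of_nat n) = bt_of_nat (Suc n)"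
proof -
  have st: "bsucc_step (True, out) Lf = (False, Br Lf Lf # out)"
      "bsucc_step (True, out) (Br u v) = (True, Lf # out)" for out u v
    by (auto simp: bsucc_step_def)
  have no_carry: "foldl bsucc_step (False, out) ds = (False, rev ds @ out)" for ds out
    by (induction ds arbitrary: out) (auto simp: bsucc_step_def)
  have "bt_children (bsucc_fin (foldl bsucc_step (True, out) (bt_children (bt_of_nat n))))
     = rev out @ bt_children (bt_of_nat (Suc n))" for out
  proof (induction n arbitrary: out rule: less_induct)
    case (less n)
    show ?case
    proof (cases "n = 0")
      case True
      then show ?thesis by (simp add: bsucc_fin_def bt_of_nat_pos)
    next
      case False
      show ?thesis
      proof (cases "even n")
        case True
        then have "Suc n div 2 = n div 2" by presburger
        then show ?thesis using True False
          by (simp add: bt_of_nat_pos[of n] bt_of_nat_pos[of "Suc n"] st no_carry bsucc_fin_def)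
      next
        case odd: False
        then have *: "Suc n div 2 = Suc (n div 2)" by presburger
        show ?thesis using odd False less.IH[of "n div 2" "Lf # out"]
          by (simp add: bt_of_nat_pos[of n] bt_of_nat_pos[of "Suc n"] st *)
      qed
    qed
  qed
  from this[of "[]"] show ?thesis unfolding bsucc_def
    by (metis append_Nil enc_bt_children rev.simps(1))
qed

lemma cmp_bsucc: "cmp b bsucc"
proof -
  have "cmp b (\<lambda>x. foldl (\<lambda>s d. bsucc_step s d) (True, []) (bt_children x))"
  proof (rule cmp_foldl_add[where step = "\<lambda>x s d. bsucc_step s d"])
    show "cmp b (\<lambda>p::bt \<times> (bool \<times> bt list) \<times> bt. bsucc_step (fst (snd p)) (snd (snd p)))"
      unfolding bsucc_step_def by (intro cmp_intros)
    have "sz (bsucc_step s d) \<le> sz s + (10 + sz (x, d))" for x :: bt and s d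
      by (cases s; cases "fst s") (auto simp: bsucc_step_def)
    then show "\<exists>G. bnd b G \<and> (\<forall>(x::bt) s d. sz (bsucc_step s d) \<le> sz s + G (sz (x, d)))"
      by (intro exI[of _ "\<lambda>n. 10 + n"] conjI bnd_intros) auto
  qed (intro cmp_intros)+
  then show ?thesis unfolding bsucc_def bsucc_fin_def
    by (intro cmp_enc cmp_rev cmp_if cmp_fst cmp_Cons cmp_snd cmp_const)
qed

lemma bt_size_bt_of_nat: "bt_size (bt_of_nat n) \<le> 4 * n + 1"
proof (induction n rule: less_induct)
  case (less n)
  show ?case
  proof (cases "n = 0")
    case False
    have "bt_size (bt_of_bool (odd n)) \<le> 3" by (cases "odd n") auto
    moreover have "n div 2 < n" using False by simp
    moreover have "bt_size (bt_of_nat n) = 1 + bt_size (bt_of_bool (odd n)) + bt_size (bt_of_nat (n div 2))"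
      using False by (simp add: bt_of_nat_pos)
    ultimately show ?thesis using less[of "n div 2"] by linarith
  qed simp
qed

lemma cmp_bt_of_nat [cmp_intros]:
  assumes "cmp b f" shows "cmp b (\<lambda>x. bt_of_nat (f x))"
proof -
  have it: "(bsucc ^^ n) Lf = bt_of_nat n" for n
    by (induction n) (auto simp: bsucc_bt_of_nat)
  obtain B where B: "bnd b B" "\<And>x. sz (f x) \<le> B (sz x)" using cmp_size[OF assms] by blast
  have "cmp b (\<lambda>x. (bsucc ^^ f x) Lf)"
  proof (rule cmp_funpow[OF assms cmp_const])
    show "cmp b (\<lambda>p::'a \<times> bt. bsucc (snd p))" by (intro cmp_comp[OF cmp_bsucc] cmp_intros)
    have "sz ((bsucc ^^ i) Lf) \<le> 4 * B (sz x) + 1" if "i \<le> f x" for x i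
      using bt_size_bt_of_nat[of i] B(2)[of x] that by (simp add: it)
    then show "\<exists>B. bnd b B \<and> (\<forall>x i. i \<le> f x \<longrightarrow> sz ((bsucc ^^ i) Lf) \<le> B (sz x))"
      by (intro exI[of _ "\<lambda>n. 4 * B n + 1"] conjI bnd_intros B) auto
  qed
  then show ?thesis by (simp add: it)
qed

definition unary :: "bt \<Rightarrow> nat" where
  "unary x = foldl (\<lambda>n d. n + n + (if d = Lf then 0 else 1)) 0 (rev (bt_children x))"

lemma unary_bt_of_nat: "unary (bt_of_nat n) = n"
proof (induction n rule: less_induct)
  case (less n)
  show ?case
  proof (cases "n = 0")
    case True then show ?thesis by (simp add: unary_def)
  next
    case False
    have "unary (bt_of_nat n) = unary (bt_of_nat (n div 2)) + unary (bt_of_nat (n div 2)) + (if odd n then 1 else 0)"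
      using False by (cases "odd n") (auto simp: bt_of_nat_pos[of n] unary_def)
    then show ?thesis using less[of "n div 2"] False by (simp add: odd_iff_mod_2_eq_one) presburger
  qed
qed

text \<open>Unbounded case only: the unary value is in general exponentially longer than its binary
  notation. It suffices to turn \<open>cmp\<close> into \<open>computable\<close>.\<close>

lemma cmp_unary: "cmp False unary"
  unfolding unary_def by (intro cmp_foldl_unbounded cmp_intros)

lemma cmp_computable:
  assumes "cmp False f" shows "computable f"
proof -
  have "cmp False (\<lambda>x. bt_of_nat (f (unary x)))"
    by (intro cmp_bt_of_nat cmp_comp[OF assms] cmp_unary)
  then obtain p T where "\<And>x. \<exists>t. runs p x (bt_of_nat (f (unary x))) t \<and> t \<le> T (bt_size x)"
    unfolding cmp_def tr_def by auto
  then show ?thesis unfolding computable_def by (metis unary_bt_of_nat)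
qed

lemma cmpE:
  assumes "cmp b f"
  obtains p T where "bnd b T" "\<And>x. \<exists>t. runs p (enc x) (enc (f x)) t \<and> t \<le> T (sz x)"
  using assms unfolding cmp_def tr_def by auto

subsection \<open>Decoding\<close>

lemma cmp_dec_bt: "cmp b (dec :: bt \<Rightarrow> bt)"
  by (simp add: dec_bt_def[abs_def] cmp_id)

lemma cmp_dec_nat: "cmp b (dec :: bt \<Rightarrow> nat)"
  unfolding dec_nat_def[abs_def] by (intro cmp_intros)

lemma cmp_dec_prod: "cmp b (dec :: bt \<Rightarrow> 'a::enc) \<Longrightarrow> cmp b (dec :: bt \<Rightarrow> 'b::enc) \<Longrightarrow> cmp b (dec :: bt \<Rightarrow> 'a \<times> 'b)"
  unfolding dec_prod_def[abs_def] by (rule cmp_Pair; (erule cmp_comp, intro cmp_bt_hd cmp_bt_tl cmp_id))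

lemma cmp_dec_list: "cmp b (dec :: bt \<Rightarrow> 'a::enc) \<Longrightarrow> cmp b (dec :: bt \<Rightarrow> 'a list)"
  unfolding dec_list_def[abs_def] by (rule cmp_map, erule cmp_comp, intro cmp_intros) (intro cmp_intros)

lemmas cmp_decs = cmp_dec_bt cmp_dec_nat cmp_dec_prod cmp_dec_list

subsection \<open>Computable time bounds\<close>

lemma cmp_FalseI:
  assumes "\<And>x. \<exists>t. runs p (enc x) (enc (f x)) t" shows "cmp False f"
proof -
  obtain \<tau> where \<tau>: "\<And>x. runs p (enc x) (enc (f x)) (\<tau> x)" using assms by metis
  obtain B where "bnd False B" "\<And>x. \<tau> x \<le> B (sz x)" using bnd_False_exists[of \<tau>] by blast
  then show ?thesis unfolding cmp_def tr_def using \<tau> by blast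
qed

text \<open>By induction on the program, every construct can carry a unary counter next to its
  argument. \<open>A\<close> charges for a basic instruction; the unit charged by a composite one is
  an \<open>Lf\<close> put in front of the counter.\<close>

lemma clocked:
  "\<exists>p'. \<forall>x y t (n::nat). runs p x y t \<longrightarrow> (\<exists>t'. runs p' (Br x (enc n)) (Br y (enc (n + t))) t')"
proof -
  have "cmp False (\<lambda>p::bt \<times> nat. (fst p, Suc (snd p + bt_size (fst p))))" by (intro cmp_intros)
  then obtain A T where A0: "\<And>p::bt \<times> nat. \<exists>t. runs A (enc p) (enc (fst p, Suc (snd p + bt_size (fst p)))) t \<and> t \<le> T (sz p)"
    using cmpE by blast
  define R where "R p x y \<longleftrightarrow> (\<exists>t. runs p x y t)" for p x y
  have A: "R A (Br x (enc n)) (Br x (enc (n + (1 + bt_size x))))" for x and n :: nat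
    using A0[of "(x, n)"] unfolding R_def by auto
  have rI: "R Ident x x" "R Empty x Lf" "R Hd x (bt_hd x)" "R Tl x (bt_tl x)" for x
    unfolding R_def by (blast intro: runs.intros)+
  have rS: "R p x y \<Longrightarrow> R q y z \<Longrightarrow> R (Seq p q) x z" for p q x y z
    unfolding R_def by (blast intro: runs.intros)
  have rJ: "R p x y \<Longrightarrow> R q x z \<Longrightarrow> R (Join p q) x (Br y z)" for p q x y z
    unfolding R_def by (blast intro: runs.intros)
  have rC: "R b x c \<Longrightarrow> (c \<noteq> Lf \<Longrightarrow> R p x y) \<Longrightarrow> (c = Lf \<Longrightarrow> R q x y) \<Longrightarrow> R (Cond b p q) x y" for b c p q x y
    unfolding R_def by (cases "c = Lf") (blast intro: runs.intros)+
  have rWT: "R b x c \<Longrightarrow> c \<noteq> Lf \<Longrightarrow> R p x y \<Longrightarrow> R (While b p) y z \<Longrightarrow> R (While b p) x z" for b c p x y z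
    unfolding R_def by (blast intro: runs.intros)
  have rWF: "R b x Lf \<Longrightarrow> R (While b p) x x" for b p x
    unfolding R_def by (blast intro: runs.intros)
  have rH: "R (Seq p Hd) x (bt_hd y)" "R (Seq p Tl) x (bt_tl y)" if "R p x y" for p x y
    using that rS rI by blast+
  have "\<exists>p'. \<forall>x y t (n::nat). runs p x y t \<longrightarrow> R p' (Br x (enc n)) (Br y (enc (n + t)))"
  proof (induction p)
    case Ident
    show ?case using A by (intro exI[of _ A]) (auto elim!: runs_IdentE)
  next
    case Empty
    have "R (Seq A (Join Empty Tl)) (Br x (enc n)) (Br Lf (enc (n + (1 + bt_size x))))" for x and n :: nat
      by (rule rS[OF A rJ[OF rI(2)]]) (use rI(4)[of "Br x _"] in simp)
    then show ?case by (intro exI[of _ "Seq A (Join Empty Tl)"]) (auto elim!: runs_EmptyE)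
  next
    case Hd
    have "R (Seq A (Join (Seq Hd Hd) Tl)) (Br x (enc n)) (Br (bt_hd x) (enc (n + (1 + bt_size x))))" for x and n :: nat
      by (rule rS[OF A rJ]) (use rI(4)[of "Br x _"] rH(1)[OF rI(3)[of "Br x _"]] in simp_all)
    then show ?case by (intro exI[of _ "Seq A (Join (Seq Hd Hd) Tl)"]) (auto elim!: runs_HdE)
  next
    case Tl
    have "R (Seq A (Join (Seq Hd Tl) Tl)) (Br x (enc n)) (Br (bt_tl x) (enc (n + (1 + bt_size x))))" for x and n :: nat
      by (rule rS[OF A rJ]) (use rI(4)[of "Br x _"] rH(2)[OF rI(3)[of "Br x _"]] in simp_all)
    then show ?case by (intro exI[of _ "Seq A (Join (Seq Hd Tl) Tl)"]) (auto elim!: runs_TlE)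
  next
    case (Join p q)
    then obtain p' q' where p: "\<And>x y t (n::nat). runs p x y t \<Longrightarrow> R p' (Br x (enc n)) (Br y (enc (n + t)))"
      and q: "\<And>x y t (n::nat). runs q x y t \<Longrightarrow> R q' (Br x (enc n)) (Br y (enc (n + t)))" by metis
    \<comment> \<open>The argument is copied before \<open>p'\<close> consumes it, since
      \<open>q'\<close> needs it again; \<open>q'\<close> starts from the counter left by
      \<open>p'\<close>, and the last \<open>Join Empty\<close> adds the unit for
      \<open>Join\<close> itself.\<close>
    let ?P = "Seq (Join Hd p') (Seq (Join (Seq Tl Hd) (Seq (Join Hd (Seq Tl Tl)) q'))
       (Join (Join Hd (Seq Tl Hd)) (Join Empty (Seq Tl Tl))))"
    have "R ?P (Br x (enc n)) (Br (Br y z) (enc (n + (1 + s + t))))"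
      if "runs p x y s" "runs q x z t" for x y z s t and n :: nat
    proof (rule rS, rule rJ)
      show "R Hd (Br x (enc n)) x" using rI(3)[of "Br x _"] by simp
      show "R p' (Br x (enc n)) (Br y (enc (n + s)))" by (rule p[OF that(1)])
      let ?s1 = "Br x (Br y (enc (n + s)))"
      have 1: "R (Seq Tl Hd) ?s1 y" "R (Seq Tl Tl) ?s1 (enc (n + s))" "R Hd ?s1 x"
        using rH[OF rI(4)[of ?s1]] rI(3)[of ?s1] by simp_all
      have 2: "R (Join (Seq Tl Hd) (Seq (Join Hd (Seq Tl Tl)) q')) ?s1 (Br y (Br z (enc (n + s + t))))"
        by (intro rJ 1 rS[OF rJ[OF 1(3) 1(2)]] q that)
      let ?s2 = "Br y (Br z (enc (n + s + t)))"
      have 3: "R (Seq Tl Hd) ?s2 z" "R (Seq Tl Tl) ?s2 (enc (n + s + t))" "R Hd ?s2 y"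
        using rH[OF rI(4)[of ?s2]] rI(3)[of ?s2] by simp_all
      have "R (Join (Join Hd (Seq Tl Hd)) (Join Empty (Seq Tl Tl))) ?s2 (Br (Br y z) (Br Lf (enc (n + s + t))))"
        by (intro rJ 3 rI)
      from rS[OF 2 this] show "R (Seq (Join (Seq Tl Hd) (Seq (Join Hd (Seq Tl Tl)) q'))
         (Join (Join Hd (Seq Tl Hd)) (Join Empty (Seq Tl Tl)))) ?s1 (Br (Br y z) (enc (n + (1 + s + t))))"
        by (simp add: add.assoc)
    qed
    then show ?case by (intro exI[of _ ?P] allI impI) (auto elim!: runs_JoinE)
  next
    case (Seq p q)
    then obtain p' q' where p: "\<And>x y t (n::nat). runs p x y t \<Longrightarrow> R p' (Br x (enc n)) (Br y (enc (n + t)))"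
      and q: "\<And>x y t (n::nat). runs q x y t \<Longrightarrow> R q' (Br x (enc n)) (Br y (enc (n + t)))" by metis
    let ?P = "Seq p' (Seq q' (Join Hd (Join Empty Tl)))"
    have "R ?P (Br x (enc n)) (Br z (enc (n + (1 + s + t))))" if "runs p x y s" "runs q y z t" for x y z s t and n :: nat
    proof -
      let ?s = "Br z (enc (n + s + t))"
      have "R (Join Hd (Join Empty Tl)) ?s (Br z (Br Lf (enc (n + s + t))))"
        by (intro rJ rI) (use rI(3)[of ?s] rI(4)[of ?s] in simp_all)
      from rS[OF p[OF that(1)] rS[OF q[OF that(2)] this]] show ?thesis by (simp add: add.assoc)
    qed
    then show ?case by (intro exI[of _ ?P] allI impI) (auto elim!: runs_SeqE)
  next
    case (Cond b p q)
    then obtain b' p' q' where b: "\<And>x y t (n::nat). runs b x y t \<Longrightarrow> R b' (Br x (enc n)) (Br y (enc (n + t)))"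
      and p: "\<And>x y t (n::nat). runs p x y t \<Longrightarrow> R p' (Br x (enc n)) (Br y (enc (n + t)))"
      and q: "\<And>x y t (n::nat). runs q x y t \<Longrightarrow> R q' (Br x (enc n)) (Br y (enc (n + t)))" by metis
    \<comment> \<open>\<open>?U\<close> runs the test only for its clock: it keeps the argument,
      takes over the new counter and adds the unit for \<open>Cond\<close>. The branch is chosen by
      a separate run of the test whose counter is discarded.\<close>
    let ?U = "Join Hd (Join Empty (Seq b' Tl))"
    have U: "R ?U (Br x (enc n)) (Br x (enc (n + s + 1)))" if "runs b x c s" for x c s and n :: nat
    proof -
      have "R ?U (Br x (enc n)) (Br x (Br Lf (enc (n + s))))"
        by (intro rJ rI) (use rI(3)[of "Br x _"] rH(2)[OF b[OF that]] in simp_all)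
      then show ?thesis by simp
    qed
    have C: "R (Seq b' Hd) (Br x (enc n)) c" if "runs b x c s" for x c s and n :: nat
      using rH(1)[OF b[OF that, of n]] by simp
    let ?P = "Cond (Seq b' Hd) (Seq ?U p') (Seq ?U q')"
    have "R ?P (Br x (enc n)) (Br y (enc (n + (1 + s + t))))"
      if "runs b x c s" "c \<noteq> Lf \<Longrightarrow> runs p x y t" "c = Lf \<Longrightarrow> runs q x y t" for x y c s t and n :: nat
      by (rule rC[OF C[OF that(1)]])
         (use rS[OF U[OF that(1)] p[OF that(2)]] rS[OF U[OF that(1)] q[OF that(3)]] in \<open>simp_all add: add.assoc\<close>)
    moreover have "\<exists>c s u. runs b x c s \<and> (c \<noteq> Lf \<longrightarrow> runs p x y u) \<and> (c = Lf \<longrightarrow> runs q x y u) \<and> t = 1 + s + u"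
      if "runs (Cond b p q) x y t" for x y t
      using that by (rule runs_CondE) (simp only: plus_1_eq_Suc add_Suc, blast)+
    ultimately show ?case by (intro exI[of _ ?P] allI impI) blast
  next
    case (While b p)
    then obtain b' p' where b: "\<And>x y t (n::nat). runs b x y t \<Longrightarrow> R b' (Br x (enc n)) (Br y (enc (n + t)))"
      and p: "\<And>x y t (n::nat). runs p x y t \<Longrightarrow> R p' (Br x (enc n)) (Br y (enc (n + t)))" by metis
    let ?U = "Join Hd (Join Empty (Seq b' Tl))"
    have U: "R ?U (Br x (enc n)) (Br x (enc (n + s + 1)))" if "runs b x c s" for x c s and n :: nat
    proof -
      have "R ?U (Br x (enc n)) (Br x (Br Lf (enc (n + s))))"
        by (intro rJ rI) (use rI(3)[of "Br x _"] rH(2)[OF b[OF that]] in simp_all)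
      then show ?thesis by simp
    qed
    have C: "R (Seq b' Hd) (Br x (enc n)) c" if "runs b x c s" for x c s and n :: nat
      using rH(1)[OF b[OF that, of n]] by simp
    \<comment> \<open>A successful test is charged by \<open>?U\<close> at the start of the body.
      The failing test that ends the loop is charged afterwards, by one more \<open>?U\<close>
      behind \<open>?L\<close>.\<close>
    let ?L = "While (Seq b' Hd) (Seq ?U p')"
    have "\<exists>z (m::nat). R ?L (Br x (enc n)) (Br z (enc m)) \<and> R ?U (Br z (enc m)) (Br y (enc (n + t)))"
      if "runs w x y t" "w = While b p" for w x y t and n :: nat
      using that
    proof (induction arbitrary: n rule: runs.induct)
      case (WhileT b1 x c s p1 y t z u)
      then have *: "runs b x c s" "runs p x y t" by simp_all
      from WhileT.IH(3)[OF WhileT.prems, of "n + s + 1 + t"] obtain z' and m :: nat where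
        "R ?L (Br y (enc (n + s + 1 + t))) (Br z' (enc m))" "R ?U (Br z' (enc m)) (Br z (enc (n + s + 1 + t + u)))"
        by blast
      moreover from this(1) have "R ?L (Br x (enc n)) (Br z' (enc m))"
        by (rule rWT[OF C[OF *(1)] \<open>c \<noteq> Lf\<close> rS[OF U[OF *(1)] p[OF *(2)]]])
      ultimately show ?case by (intro exI[of _ z'] exI[of _ m]) (auto simp: algebra_simps)
    next
      case (WhileF b1 x s p1)
      then have *: "runs b x Lf s" by simp
      show ?case using rWF[OF C[OF *]] U[OF *, of n] by (intro exI[of _ x] exI[of _ n]) auto
    qed auto
    then have "R (Seq ?L ?U) (Br x (enc n)) (Br y (enc (n + t)))" if "runs (While b p) x y t" for x y t and n :: nat
      using that rS by blast
    then show ?case by blast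
  qed
  then show ?thesis unfolding R_def .
qed

text \<open>Composed with \<open>dec\<close>, the program halts on every tree, so its clocked
  version computes its running time \<open>\<tau>\<close>. Summing \<open>\<tau>\<close> over a list
  that contains all trees of size at most \<open>n\<close> gives the computable bound.\<close>

lemma computable_time_bound:
  fixes F :: "'a::enc \<Rightarrow> 'b::enc"
  assumes F: "cmp False F" and dec: "cmp False (dec :: bt \<Rightarrow> 'a)"
  shows "\<exists>p f. cmp False f \<and> (\<forall>x n. sz x \<le> n \<longrightarrow> (\<exists>t. runs p (enc x) (enc (F x)) t \<and> t \<le> f n))"
proof -
  have "cmp False (\<lambda>x. F (dec x))" by (rule cmp_comp[OF F dec])
  then obtain p T where "\<And>x. \<exists>t. runs p (enc x) (enc (F (dec x))) t \<and> t \<le> T (sz x)"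
    unfolding cmp_def tr_def by auto
  then obtain \<tau> where \<tau>: "\<And>x. runs p x (enc (F (dec x))) (\<tau> x)" by (metis enc_bt)
  obtain p' where "\<And>x y t n. runs p x y t \<Longrightarrow> \<exists>t'. runs p' (Br x (enc n)) (Br y (enc (n + t))) t'"
    using clocked[of p] by blast
  then have "\<exists>t'. runs p' (Br x (enc (0::nat))) (Br (enc (F (dec x))) (enc (0 + \<tau> x))) t'" for x using \<tau> by blast
  then have p': "\<exists>t'. runs p' (Br x Lf) (Br (enc (F (dec x))) (enc (\<tau> x))) t'" for x by simp
  have cmp_\<tau>: "cmp False \<tau>"
  proof (rule cmp_FalseI[of "Seq (Join Ident Empty) (Seq p' Tl)"])
    fix x :: bt
    obtain t' where t': "runs p' (Br x Lf) (Br (enc (F (dec x))) (enc (\<tau> x))) t'" using p' by blast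
    from runs.Seq[OF runs.Join[OF runs.Ident runs.Empty] runs.Seq[OF t' runs.Tl]]
    show "\<exists>t. runs (Seq (Join Ident Empty) (Seq p' Tl)) (enc x) (enc (\<tau> x)) t" by auto
  qed
  \<comment> \<open>After \<open>n\<close> rounds the list contains every tree of size at most
    \<open>n + 1\<close>; it may also contain larger ones, which only enlarges the sum.\<close>
  define G where "G = (\<lambda>L. Lf # concat (map (\<lambda>u. map (\<lambda>v. Br u v) L) L))"
  have G: "x \<in> set ((G ^^ n) [Lf])" if "bt_size x \<le> Suc n" for x n
    using that
  proof (induction n arbitrary: x)
    case 0
    have "x = Lf" using 0 by (cases x) auto
    then show ?case by simp
  next
    case (Suc n)
    show ?case
    proof (cases x)
      case (Br l r)
      then have "l \<in> set ((G ^^ n) [Lf])" "r \<in> set ((G ^^ n) [Lf])" using Suc by (auto intro!: Suc.IH)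
      then show ?thesis by (auto simp: G_def Br)
    qed (simp add: G_def)
  qed
  define f where "f n = foldl (\<lambda>s x. s + \<tau> x) 0 ((G ^^ n) [Lf])" for n
  have "cmp False f" unfolding f_def[abs_def] G_def
    by (intro cmp_foldl_unbounded cmp_funpow_unbounded cmp_intros cmp_comp[OF cmp_\<tau>])
  moreover have "\<exists>t. runs p (enc x) (enc (F x)) t \<and> t \<le> f n" if "sz x \<le> n" for x n
  proof -
    have f: "foldl (\<lambda>s x. s + \<tau> x) a xs = a + sum_list (map \<tau> xs)" for a xs
      by (induction xs arbitrary: a) auto
    have "\<tau> (enc x) \<in> set (map \<tau> ((G ^^ n) [Lf]))" using G[of "enc x" n] that by auto
    then have "\<tau> (enc x) \<le> f n" unfolding f_def using f[of 0] member_le_sum_list by fastforce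
    then show ?thesis using \<tau>[of "enc x"] by (auto simp: dec_enc)
  qed
  ultimately show ?thesis by blast
qed

text \<open>\<open>pre\<close> splits its result: the second part is the kernel, bounded in the
  parameter and passed to \<open>solve\<close>; the first part bypasses \<open>solve\<close> and
  lets \<open>post\<close> translate the answer back.\<close>

lemma fpt_solvable_kernel:
  fixes pre :: "'x::enc \<Rightarrow> 'r::enc \<times> 'k::enc" and solve :: "'k \<Rightarrow> 'o::enc" and post :: "'r \<times> 'o \<Rightarrow> 'z::enc"
  assumes pre: "cmp True pre" and solve: "cmp False solve" and post: "cmp True post"
    and dec: "cmp False (dec :: bt \<Rightarrow> 'k)" and g: "cmp False g"
    and rep: "\<And>x I. rep x I \<Longrightarrow> \<exists>i. x = enc i \<and> sz (snd (pre i)) \<le> g (\<kappa> I)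
        \<and> ans I (enc (post (fst (pre i), solve (snd (pre i)))))"
  shows "fpt_solvable rep \<kappa> ans"
proof -
  obtain p1 T1 where "bnd True T1" and p1: "\<And>x. \<exists>t. runs p1 (enc x) (enc (pre x)) t \<and> t \<le> T1 (sz x)"
    using cmpE[OF pre] by blast
  then obtain c1 where c1: "\<And>n. T1 n \<le> (n + 2) ^ c1" by (auto simp: bnd_def)
  obtain p3 T3 where T3: "bnd True T3" and p3: "\<And>x. \<exists>t. runs p3 (enc x) (enc (post x)) t \<and> t \<le> T3 (sz x)"
    using cmpE[OF post] by blast
  then obtain c3 where c3: "\<And>n. T3 n \<le> (n + 2) ^ c3" by (auto simp: bnd_def)
  obtain p2 f where f: "cmp False f"
    and p2: "\<And>x n. sz x \<le> n \<Longrightarrow> \<exists>t. runs p2 (enc x) (enc (solve x)) t \<and> t \<le> f n"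
    using computable_time_bound[OF solve dec] by blast
  define e where "e = c3 + 2"
  \<comment> \<open>The 3 comes from \<open>bt_size x + 2 \<le> 3 * bt_size x\<close>, the 8 from
    \<open>M + 2 \<le> N * (\<phi> + 8)\<close> with \<open>N\<close> at least 1, and the 2 in
    \<open>e\<close> from \<open>2 * m + m ^ c3 \<le> m ^ (c3 + 2)\<close> for
    \<open>m \<ge> 6\<close>.\<close>
  define h where "h k = 3 ^ (c1 * e) * (f (g k) + 8) ^ e" for k
  let ?p = "Seq p1 (Seq (Join Hd (Seq Tl p2)) p3)"
  have "cmp False h" unfolding h_def[abs_def] by (intro cmp_mult cmp_power cmp_add cmp_const cmp_comp[OF f] g)
  then have "computable h" by (rule cmp_computable)
  moreover have "\<exists>y t. runs ?p x y t \<and> ans I y \<and> t \<le> h (\<kappa> I) * bt_size x ^ (c1 * e)" if "rep x I" for x I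
  proof -
    obtain i where i: "x = enc i" "sz (snd (pre i)) \<le> g (\<kappa> I)"
      "ans I (enc (post (fst (pre i), solve (snd (pre i)))))" using rep[OF \<open>rep x I\<close>] by blast
    define N where "N = (bt_size x + 2) ^ c1"
    define \<phi> where "\<phi> = f (g (\<kappa> I))"
    obtain t1 where t1: "runs p1 x (Br (enc (fst (pre i))) (enc (snd (pre i)))) t1" "t1 \<le> N"
      using p1[of i] c1[of "sz i"] i(1) unfolding N_def enc_prod_def by (metis le_trans)
    let ?s1 = "Br (enc (fst (pre i))) (enc (snd (pre i)))"
    have s1: "bt_size ?s1 \<le> N" using runs_size[OF t1(1)] t1(2) by simp
    obtain t2 where t2: "runs p2 (enc (snd (pre i))) (enc (solve (snd (pre i)))) t2" "t2 \<le> \<phi>"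
      using p2[OF i(2)] unfolding \<phi>_def by blast
    let ?t = "1 + (1 + bt_size ?s1) + (1 + (1 + bt_size ?s1) + t2)"
    have r2: "runs (Join Hd (Seq Tl p2)) ?s1 (enc (fst (pre i), solve (snd (pre i)))) ?t"
      using runs.Join[OF runs.Hd[of ?s1] runs.Seq[OF runs.Tl[of ?s1]], of p2 "enc (solve (snd (pre i)))" t2] t2(1) by simp
    define M where "M = 4 + 2 * N + \<phi>"
    have t: "?t \<le> M" unfolding M_def using s1 t2(2) by linarith
    then have "sz (fst (pre i), solve (snd (pre i))) \<le> M" using runs_size[OF r2] by linarith
    then have "T3 (sz (fst (pre i), solve (snd (pre i)))) \<le> (M + 2) ^ c3"
      using bnd_mono[OF T3] c3[of M] le_trans by blast
    then obtain t3 where t3: "runs p3 (enc (fst (pre i), solve (snd (pre i)))) (enc (post (fst (pre i), solve (snd (pre i))))) t3"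
      "t3 \<le> (M + 2) ^ c3" using p3 le_trans by blast
    have r: "runs ?p x (enc (post (fst (pre i), solve (snd (pre i))))) (1 + t1 + (1 + ?t + t3))"
      by (rule runs.Seq[OF t1(1) runs.Seq[OF r2 t3(1)]])
    have "t1 \<le> M" using t1(2) by (simp add: M_def)
    then have "1 + t1 + (1 + ?t + t3) \<le> 2 * (M + 2) + (M + 2) ^ c3"
      using t t3(2) by (simp only: distrib_left)
    also have "\<dots> \<le> (M + 2) ^ e"
    proof -
      define m where "m = M + 2"
      have "6 \<le> m" by (simp add: m_def M_def)
      have 1: "1 \<le> m ^ c3" using \<open>6 \<le> m\<close> by simp
      have "2 * m + m ^ c3 \<le> 2 * m * m ^ c3 + m * m ^ c3"
        using mult_le_mono2[OF 1, of "2 * m"] \<open>6 \<le> m\<close> by (intro add_mono) auto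
      also have "\<dots> = 3 * m * m ^ c3" by simp
      also have "\<dots> \<le> m * m * m ^ c3" using \<open>6 \<le> m\<close> by (intro mult_right_mono) auto
      also have "\<dots> = m ^ e" by (simp add: e_def power_add power2_eq_square)
      finally show ?thesis by (simp add: m_def)
    qed
    also have "\<dots> \<le> (N * (\<phi> + 8)) ^ e"
    proof (rule power_mono)
      have "1 \<le> N" by (simp add: N_def)
      then show "M + 2 \<le> N * (\<phi> + 8)" unfolding M_def by (cases N) (auto simp: algebra_simps)
    qed simp
    also have "\<dots> = (bt_size x + 2) ^ (c1 * e) * (\<phi> + 8) ^ e"
      by (simp add: N_def power_mult_distrib power_mult)
    also have "\<dots> \<le> (3 * bt_size x) ^ (c1 * e) * (\<phi> + 8) ^ e"
    proof (intro mult_right_mono power_mono)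
      have "0 < bt_size x" by simp
      then show "bt_size x + 2 \<le> 3 * bt_size x" by linarith
    qed simp_all
    also have "\<dots> = h (\<kappa> I) * bt_size x ^ (c1 * e)" by (simp add: h_def \<phi>_def power_mult_distrib)
    finally show ?thesis using r i(3) by blast
  qed
  ultimately show ?thesis unfolding fpt_solvable_def by blast
qed

section \<open>Invariance of MSO2 under isomorphism and pruning\<close>

definition gmap :: "('v \<Rightarrow> 'w) \<Rightarrow> 'v cgraph \<Rightarrow> 'w cgraph" where
  "gmap h G = \<lparr>verts = h ` verts G, edges = image h ` edges G, colors = map (image h) (colors G)\<rparr>"

definition restr :: "'v cgraph \<Rightarrow> 'v set \<Rightarrow> 'v cgraph" where
  "restr G U = \<lparr>verts = verts G \<inter> U, edges = {e \<in> edges G. e \<subseteq> U}, colors = map (\<lambda>C. C \<inter> U) (colors G)\<rparr>"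

lemma gmap_simps [simp]:
  "verts (gmap h G) = h ` verts G" "edges (gmap h G) = image h ` edges G"
  "colors (gmap h G) = map (image h) (colors G)"
  by (auto simp: gmap_def)

lemma restr_simps [simp]:
  "verts (restr G U) = verts G \<inter> U" "edges (restr G U) = {e \<in> edges G. e \<subseteq> U}"
  "colors (restr G U) = map (\<lambda>C. C \<inter> U) (colors G)"
  by (auto simp: restr_def)

lemma restr_restr: "restr (restr G U) W = restr G (U \<inter> W)"
  by (auto simp: restr_def)

lemma cgraph_restr: "cgraph G \<Longrightarrow> cgraph (restr G U)"
  by (auto simp: cgraph_def)

text \<open>Assignments are total functions, while the maps considered are injective on the vertices
  only; so the values of the free variables are confined to the graph.\<close>

definition valid :: "'v cgraph \<Rightarrow> mso2 \<Rightarrow> (nat \<Rightarrow> 'v) \<Rightarrow> (nat \<Rightarrow> 'v set) \<Rightarrow> (nat \<Rightarrow> 'v set) \<Rightarrow> (nat \<Rightarrow> 'v set set) \<Rightarrow> bool" where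
  "valid G \<phi> a A b B \<longleftrightarrow> (\<forall>x. (Vertex, x) \<in> free_vars \<phi> \<longrightarrow> a x \<in> verts G)
    \<and> (\<forall>x. (VertexSet, x) \<in> free_vars \<phi> \<longrightarrow> A x \<subseteq> verts G)
    \<and> (\<forall>x. (Edge, x) \<in> free_vars \<phi> \<longrightarrow> b x \<in> edges G)
    \<and> (\<forall>x. (EdgeSet, x) \<in> free_vars \<phi> \<longrightarrow> B x \<subseteq> edges G)"

lemma sat_cong:
  assumes "\<And>x. (Vertex, x) \<in> free_vars \<phi> \<Longrightarrow> a x = a' x"
    and "\<And>x. (VertexSet, x) \<in> free_vars \<phi> \<Longrightarrow> A x = A' x"
    and "\<And>x. (Edge, x) \<in> free_vars \<phi> \<Longrightarrow> b x = b' x"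
    and "\<And>x. (EdgeSet, x) \<in> free_vars \<phi> \<Longrightarrow> B x = B' x"
  shows "sat G a A b B \<phi> \<longleftrightarrow> sat G a' A' b' B' \<phi>"
  using assms
proof (induction \<phi> arbitrary: a A b B a' A' b' B')
  case (Neg \<phi>) show ?case using Neg.IH[of a a' A A' b b' B B'] Neg.prems by simp
next
  case (Conj \<phi> \<psi>) show ?case using Conj.IH(1)[of a a' A A' b b' B B'] Conj.IH(2)[of a a' A A' b b' B B'] Conj.prems by simp
next
  case (Disj \<phi> \<psi>) show ?case using Disj.IH(1)[of a a' A A' b b' B B'] Disj.IH(2)[of a a' A A' b b' B B'] Disj.prems by simp
next
  case (Imp \<phi> \<psi>) show ?case using Imp.IH(1)[of a a' A A' b b' B B'] Imp.IH(2)[of a a' A A' b b' B B'] Imp.prems by simp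
next
  case (Iff \<phi> \<psi>) show ?case using Iff.IH(1)[of a a' A A' b b' B B'] Iff.IH(2)[of a a' A A' b b' B B'] Iff.prems by simp
next
  case (Exists s x \<phi>)
  show ?case
  proof (cases s)
    case Vertex
    have "sat G (a(x := v)) A b B \<phi> = sat G (a'(x := v)) A' b' B' \<phi>" for v
      by (rule Exists.IH) (use Exists.prems Vertex in auto)
    then show ?thesis by (simp add: Vertex)
  next
    case VertexSet
    have "sat G a (A(x := v)) b B \<phi> = sat G a' (A'(x := v)) b' B' \<phi>" for v
      by (rule Exists.IH) (use Exists.prems VertexSet in auto)
    then show ?thesis by (simp add: VertexSet)
  next
    case Edge
    have "sat G a A (b(x := v)) B \<phi> = sat G a' A' (b'(x := v)) B' \<phi>" for v
      by (rule Exists.IH) (use Exists.prems Edge in auto)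
    then show ?thesis by (simp add: Edge)
  next
    case EdgeSet
    have "sat G a A b (B(x := v)) \<phi> = sat G a' A' b' (B'(x := v)) \<phi>" for v
      by (rule Exists.IH) (use Exists.prems EdgeSet in auto)
    then show ?thesis by (simp add: EdgeSet)
  qed
next
  case (Forall s x \<phi>)
  show ?case
  proof (cases s)
    case Vertex
    have "sat G (a(x := v)) A b B \<phi> = sat G (a'(x := v)) A' b' B' \<phi>" for v
      by (rule Forall.IH) (use Forall.prems Vertex in auto)
    then show ?thesis by (simp add: Vertex)
  next
    case VertexSet
    have "sat G a (A(x := v)) b B \<phi> = sat G a' (A'(x := v)) b' B' \<phi>" for v
      by (rule Forall.IH) (use Forall.prems VertexSet in auto)
    then show ?thesis by (simp add: VertexSet)
  next
    case Edge
    have "sat G a A (b(x := v)) B \<phi> = sat G a' A' (b'(x := v)) B' \<phi>" for v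
      by (rule Forall.IH) (use Forall.prems Edge in auto)
    then show ?thesis by (simp add: Edge)
  next
    case EdgeSet
    have "sat G a A b (B(x := v)) \<phi> = sat G a' A' b' (B'(x := v)) \<phi>" for v
      by (rule Forall.IH) (use Forall.prems EdgeSet in auto)
    then show ?thesis by (simp add: EdgeSet)
  qed
qed auto

lemma sat_Forall: "sat G a A b B (Forall s x \<phi>) \<longleftrightarrow> \<not> sat G a A b B (Exists s x (Neg \<phi>))"
  by (cases s) auto

lemma comp_upd: "(f \<circ> g)(x := f y) = f \<circ> (g(x := y))"
  by auto

text \<open>Quantified values correspond under \<open>h\<close> and its images. The colour indices
  have to be in range because \<open>!\<close> beyond the end of a list need not commute with
  \<open>map\<close>.\<close>

lemma sat_gmap:
  assumes "cgraph G" "inj_on h (verts G)" "color_indices \<phi> \<subseteq> {..<length (colors G)}" "valid G \<phi> a A b B"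
  shows "sat (gmap h G) (h \<circ> a) (image h \<circ> A) (image h \<circ> b) (image (image h) \<circ> B) \<phi> \<longleftrightarrow> sat G a A b B \<phi>"
  using assms(3,4)
proof (induction \<phi> arbitrary: a A b B)
  note inj = assms(2)
  have edge: "e \<subseteq> verts G" if "e \<in> edges G" for e using assms(1) that by (auto simp: cgraph_def)
  have inj2: "inj_on (image h) (Pow (verts G))" by (rule inj_on_image_Pow[OF inj])
  {
    case (EqV x y)
    then show ?case using inj by (auto simp: valid_def inj_on_def)
  next
    case (EqE e f)
    then show ?case using inj_on_image_eq_iff[OF inj edge edge] by (auto simp: valid_def)
  next
    case (Adj x y)
    then have v: "{a x, a y} \<subseteq> verts G" by (auto simp: valid_def)
    have "{h (a x), h (a y)} = h ` {a x, a y}" by simp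
    moreover have "edges G \<subseteq> Pow (verts G)" using edge by auto
    ultimately show ?case using inj_on_image_mem_iff[OF inj2, of "{a x, a y}" "edges G"] v by auto
  next
    case (Col i x)
    then have "colors G ! i \<subseteq> verts G" using assms(1) by (auto simp: cgraph_def)
    then show ?case using Col inj_on_image_mem_iff[OF inj] by (auto simp: valid_def)
  next
    case (MemV x X)
    then show ?case using inj_on_image_mem_iff[OF inj] by (auto simp: valid_def)
  next
    case (MemE e Y)
    then have "b e \<in> Pow (verts G)" "B Y \<subseteq> Pow (verts G)" using edge by (auto simp: valid_def)
    then show ?case using inj_on_image_mem_iff[OF inj2] by auto
  next
    case (Inc e x)
    then show ?case using inj_on_image_mem_iff[OF inj _ edge] by (auto simp: valid_def)
  next
    case (Neg \<phi>)
    then show ?case by (auto simp: valid_def)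
  next
    case (Conj \<phi> \<psi>)
    then show ?case by (auto simp: valid_def)
  next
    case (Disj \<phi> \<psi>)
    then show ?case by (auto simp: valid_def)
  next
    case (Imp \<phi> \<psi>)
    then show ?case by (auto simp: valid_def)
  next
    case (Iff \<phi> \<psi>)
    then show ?case by (auto simp: valid_def)
  next
    case (Exists s x \<phi>)
    show ?case
    proof (cases s)
      case Vertex
      have "sat (gmap h G) ((h \<circ> a)(x := h v)) (image h \<circ> A) (image h \<circ> b) (image (image h) \<circ> B) \<phi>
          = sat G (a(x := v)) A b B \<phi>" if "v \<in> verts G" for v
        unfolding comp_upd by (rule Exists.IH) (use Exists.prems Vertex that in \<open>auto simp: valid_def\<close>)
      then show ?thesis by (simp add: Vertex o_def cong: bex_cong)
    next
      case VertexSet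
      have "sat (gmap h G) (h \<circ> a) ((image h \<circ> A)(x := h ` v)) (image h \<circ> b) (image (image h) \<circ> B) \<phi>
          = sat G a (A(x := v)) b B \<phi>" if "v \<subseteq> verts G" for v
        unfolding comp_upd by (rule Exists.IH) (use Exists.prems VertexSet that in \<open>auto simp: valid_def\<close>)
      then show ?thesis by (auto simp: VertexSet subset_image_iff o_def)
    next
      case Edge
      have "sat (gmap h G) (h \<circ> a) (image h \<circ> A) ((image h \<circ> b)(x := h ` v)) (image (image h) \<circ> B) \<phi>
          = sat G a A (b(x := v)) B \<phi>" if "v \<in> edges G" for v
        unfolding comp_upd by (rule Exists.IH) (use Exists.prems Edge that in \<open>auto simp: valid_def\<close>)
      then show ?thesis by (simp add: Edge o_def cong: bex_cong)
    next
      case EdgeSet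
      have "sat (gmap h G) (h \<circ> a) (image h \<circ> A) (image h \<circ> b) ((image (image h) \<circ> B)(x := image h ` v)) \<phi>
          = sat G a A b (B(x := v)) \<phi>" if "v \<subseteq> edges G" for v
        unfolding comp_upd by (rule Exists.IH) (use Exists.prems EdgeSet that in \<open>auto simp: valid_def\<close>)
      then show ?thesis by (auto simp: EdgeSet subset_image_iff o_def)
    qed
  next
    case (Forall s x \<phi>)
    show ?case
    proof (cases s)
      case Vertex
      have "sat (gmap h G) ((h \<circ> a)(x := h v)) (image h \<circ> A) (image h \<circ> b) (image (image h) \<circ> B) \<phi>
          = sat G (a(x := v)) A b B \<phi>" if "v \<in> verts G" for v
        unfolding comp_upd by (rule Forall.IH) (use Forall.prems Vertex that in \<open>auto simp: valid_def\<close>)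
      then show ?thesis by (simp add: Vertex o_def cong: bex_cong)
    next
      case VertexSet
      have "sat (gmap h G) (h \<circ> a) ((image h \<circ> A)(x := h ` v)) (image h \<circ> b) (image (image h) \<circ> B) \<phi>
          = sat G a (A(x := v)) b B \<phi>" if "v \<subseteq> verts G" for v
        unfolding comp_upd by (rule Forall.IH) (use Forall.prems VertexSet that in \<open>auto simp: valid_def\<close>)
      then show ?thesis by (auto simp: VertexSet subset_image_iff o_def)
    next
      case Edge
      have "sat (gmap h G) (h \<circ> a) (image h \<circ> A) ((image h \<circ> b)(x := h ` v)) (image (image h) \<circ> B) \<phi>
          = sat G a A (b(x := v)) B \<phi>" if "v \<in> edges G" for v
        unfolding comp_upd by (rule Forall.IH) (use Forall.prems Edge that in \<open>auto simp: valid_def\<close>)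
      then show ?thesis by (simp add: Edge o_def cong: bex_cong)
    next
      case EdgeSet
      have "sat (gmap h G) (h \<circ> a) (image h \<circ> A) (image h \<circ> b) ((image (image h) \<circ> B)(x := image h ` v)) \<phi>
          = sat G a A b (B(x := v)) \<phi>" if "v \<subseteq> edges G" for v
        unfolding comp_upd by (rule Forall.IH) (use Forall.prems EdgeSet that in \<open>auto simp: valid_def\<close>)
      then show ?thesis by (auto simp: EdgeSet subset_image_iff o_def)
    qed
  }
qed

lemma models_cong:
  assumes "free_vars \<phi> \<subseteq> {(VertexSet, 0)}" "A 0 = X"
  shows "sat G a A b B \<phi> \<longleftrightarrow> models G \<phi> X"
  unfolding models_def by (rule sat_cong) (use assms in auto)

lemma models_gmap:
  assumes "cgraph G" "inj_on h (verts G)" "formula_of_set G \<phi>" "X \<subseteq> verts G"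
  shows "models (gmap h G) \<phi> (h ` X) \<longleftrightarrow> models G \<phi> X"
proof -
  have fv: "free_vars \<phi> \<subseteq> {(VertexSet, 0)}" and ci: "color_indices \<phi> \<subseteq> {..<length (colors G)}"
    using assms(3) by (auto simp: formula_of_set_def)
  have "valid G \<phi> (\<lambda>_. undefined) (\<lambda>_. X) (\<lambda>_. undefined) (\<lambda>_. undefined)"
    using fv assms(4) by (auto simp: valid_def)
  from sat_gmap[OF assms(1,2) ci this] show ?thesis
    using models_cong[OF fv, of "image h \<circ> (\<lambda>_. X)" "h ` X"] models_cong[OF fv, of "\<lambda>_. X" X] by simp
qed

subsection \<open>Interchangeable blocks\<close>

definition sw :: "'v list \<Rightarrow> 'v list \<Rightarrow> 'v \<Rightarrow> 'v" where
  "sw l l' x = (if x \<in> set l then l' ! idx l x else if x \<in> set l' then l ! idx l' x else x)"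

text \<open>The view of a vertex from the block \<open>l\<close>: vertices of \<open>l\<close> lose
  their names and keep only their position, so that hyperedges at different copies become
  comparable.\<close>

definition pat :: "'v list \<Rightarrow> 'v \<Rightarrow> nat + 'v" where
  "pat l x = (if x \<in> set l then Inl (idx l x) else Inr x)"

fun unpat :: "'v list \<Rightarrow> nat + 'v \<Rightarrow> 'v" where
  "unpat l (Inl i) = l ! i"
| "unpat l (Inr x) = x"

lemma unpat_pat: "unpat l (pat l x) = x"
  by (auto simp: pat_def idx_props)

definition touch :: "'v list \<Rightarrow> 'v set \<Rightarrow> bool" where
  "touch l e \<longleftrightarrow> e \<inter> set l \<noteq> {}"

text \<open>The trace of \<open>D\<close> on the block \<open>l\<close>. Blocks with equal traces
  can be exchanged without changing \<open>D\<close> (\<open>ty_swap\<close>).\<close>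

definition ty :: "'v set set \<Rightarrow> 'v list \<Rightarrow> (nat + 'v) set set" where
  "ty D l = image (pat l) ` {e \<in> D. touch l e}"

abbreviation sing :: "'v set \<Rightarrow> 'v set set" where "sing U \<equiv> (\<lambda>v. {v}) ` U"

lemma pigeonhole_fiber:
  assumes "finite J" "finite T" "f ` J \<subseteq> T" "card T * m \<le> card J" "0 < m" "J \<noteq> {}"
  shows "\<exists>y. m \<le> card {l \<in> J. f l = y}"
proof (rule ccontr)
  assume "\<not> ?thesis"
  then have lt: "card {l \<in> J. f l = y} \<le> m - 1" for y by (metis Suc_pred' assms(5) not_less_eq_eq not_le)
  have "J = (\<Union>y\<in>T. {l \<in> J. f l = y})" using assms(3) by auto
  then have "card J \<le> (\<Sum>y\<in>T. card {l \<in> J. f l = y})" using card_UN_le[OF assms(2)] by metis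
  also have "\<dots> \<le> (\<Sum>y\<in>T. m - 1)" by (rule sum_mono) (rule lt)
  also have "\<dots> = card T * (m - 1)" by simp
  also have "\<dots> < card T * m" using assms by (auto simp: card_gt_0_iff)
  finally show False using assms(4) by simp
qed

locale disjoint_lists =
  fixes Bs :: "'v list set" and s :: nat
  assumes finB: "finite Bs" and len: "\<And>l. l \<in> Bs \<Longrightarrow> length l = s" and dis: "\<And>l. l \<in> Bs \<Longrightarrow> distinct l"
    and disj: "\<And>l l'. l \<in> Bs \<Longrightarrow> l' \<in> Bs \<Longrightarrow> l \<noteq> l' \<Longrightarrow> set l \<inter> set l' = {}"
begin

lemma sw_nth: "l \<in> Bs \<Longrightarrow> l' \<in> Bs \<Longrightarrow> i < s \<Longrightarrow> sw l l' (l ! i) = l' ! i"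
  by (simp add: sw_def idx_nth len dis)

lemma sw_out: "x \<notin> set l \<Longrightarrow> x \<notin> set l' \<Longrightarrow> sw l l' x = x"
  by (simp add: sw_def)

lemma sw_commute: "l \<in> Bs \<Longrightarrow> l' \<in> Bs \<Longrightarrow> sw l l' = sw l' l"
  using disj[of l l'] by (auto simp: sw_def fun_eq_iff)

lemma sw_invol: assumes "l \<in> Bs" "l' \<in> Bs" shows "sw l l' (sw l l' x) = x"
proof -
  have *: "sw l l' (sw l l' x) = x" if "x \<in> set l" "l \<in> Bs" "l' \<in> Bs" for l l'
  proof -
    have i: "idx l x < s" "x = l ! idx l x" using idx_props[OF that(1)] len that(2) by auto
    have "sw l l' x = l' ! idx l x" by (simp add: sw_def that)
    then show ?thesis using sw_nth[OF that(3,2) i(1)] sw_commute[OF that(2,3)] i(2) by metis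
  qed
  show ?thesis
    using *[OF _ assms] *[OF _ assms(2,1)] sw_commute[OF assms] sw_out[of x l l'] by (cases "x \<in> set l \<or> x \<in> set l'") metis+
qed

lemma sw_inj: "l \<in> Bs \<Longrightarrow> l' \<in> Bs \<Longrightarrow> inj (sw l l')"
  by (metis injI sw_invol)

lemma sw_image_invol: "l \<in> Bs \<Longrightarrow> l' \<in> Bs \<Longrightarrow> sw l l' ` sw l l' ` X = X"
  by (simp add: image_image sw_invol)

lemma sw_set: assumes "l \<in> Bs" "l' \<in> Bs" shows "sw l l' ` set l = set l'"
proof -
  have *: "sw l l' ` set l \<subseteq> set l'" if "l \<in> Bs" "l' \<in> Bs" for l l'
  proof
    fix y assume "y \<in> sw l l' ` set l"
    then obtain x where "x \<in> set l" "y = l' ! idx l x" by (auto simp: sw_def)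
    then show "y \<in> set l'" using idx_props(1)[of x l] len[OF that(1)] len[OF that(2)] by auto
  qed
  show ?thesis using *[OF assms] *[OF assms(2,1)] sw_commute[OF assms] sw_image_invol[OF assms, of "set l'"]
    by (metis image_mono subset_antisym)
qed

end

text \<open>One number \<open>w\<close> bounds the vertices of a block as well as the edges that
  meet it, since vertex sets and edge sets are treated alike. It will be the size of the common type
  of the subtrees.\<close>

locale blocks = disjoint_lists Bs s for Bs :: "'v list set" and s :: nat +
  fixes G :: "'v cgraph" and w :: nat
  assumes cg: "cgraph G"
    and noedge: "\<And>l l' e. l \<in> Bs \<Longrightarrow> l' \<in> Bs \<Longrightarrow> e \<in> edges G \<Longrightarrow> touch l e \<Longrightarrow> touch l' e \<Longrightarrow> l = l'"
    and aut: "\<And>l l'. l \<in> Bs \<Longrightarrow> l' \<in> Bs \<Longrightarrow> gmap (sw l l') G = G"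
    and cntE: "\<And>l. l \<in> Bs \<Longrightarrow> card {e \<in> edges G. touch l e} \<le> w"
    and cntV: "s \<le> w"
begin

lemma finE: "finite (edges G)"
proof -
  have "edges G \<subseteq> Pow (verts G)" "finite (verts G)" using cg by (auto simp: cgraph_def)
  then show ?thesis by (meson finite_Pow_iff finite_subset)
qed

lemma pat_sw: assumes "l \<in> Bs" "l' \<in> Bs" "x \<in> set l \<or> x \<notin> set l'" shows "pat l' (sw l l' x) = pat l x"
proof (cases "x \<in> set l")
  case True
  then have "idx l x < length l'" using idx_props(1)[OF True] len assms by simp
  then show ?thesis using True idx_nth[OF dis[OF assms(2)]] by (simp add: pat_def sw_def)
qed (use assms in \<open>auto simp: pat_def sw_def\<close>)

text \<open>Edges and singletons of vertices are treated alike, as hyperedges meeting at most one block each.\<close>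

definition hyperedges :: "'v set set \<Rightarrow> bool" where
  "hyperedges H \<longleftrightarrow> finite H \<and> (\<forall>l\<in>Bs. \<forall>l'\<in>Bs. \<forall>e\<in>H. touch l e \<longrightarrow> touch l' e \<longrightarrow> l = l') \<and>
    (\<forall>l\<in>Bs. \<forall>l'\<in>Bs. image (sw l l') ` H \<subseteq> H) \<and> (\<forall>l\<in>Bs. card {e \<in> H. touch l e} \<le> w)"

lemma hyperedges_image: "hyperedges H \<Longrightarrow> e \<in> H \<Longrightarrow> l \<in> Bs \<Longrightarrow> l' \<in> Bs \<Longrightarrow> sw l l' ` e \<in> H"
  unfolding hyperedges_def by (meson image_subset_iff)

lemma hyperedges_unique: "hyperedges H \<Longrightarrow> e \<in> H \<Longrightarrow> l \<in> Bs \<Longrightarrow> l' \<in> Bs \<Longrightarrow> touch l e \<Longrightarrow> touch l' e \<Longrightarrow> l = l'"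
  unfolding hyperedges_def by (meson image_subset_iff)

lemma hyperedges_card: "hyperedges H \<Longrightarrow> l \<in> Bs \<Longrightarrow> card {e \<in> H. touch l e} \<le> w"
  unfolding hyperedges_def by (meson image_subset_iff)

lemma hyperedges_edges: "hyperedges (edges G)"
proof -
  have "image (sw l l') ` edges G = edges G" if "l \<in> Bs" "l' \<in> Bs" for l l'
    using arg_cong[OF aut[OF that], of edges] by simp
  then show ?thesis using noedge cntE finE unfolding hyperedges_def by auto
qed

lemma hyperedges_sing: "hyperedges (sing (verts G))"
proof -
  have 1: "sw l l' ` verts G = verts G" if "l \<in> Bs" "l' \<in> Bs" for l l'
    using arg_cong[OF aut[OF that], of verts] by simp
  have 2: "card {e \<in> sing (verts G). touch l e} \<le> w" if "l \<in> Bs" for l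
  proof -
    have "{e \<in> sing (verts G). touch l e} \<subseteq> sing (set l)" by (auto simp: touch_def)
    then have "card {e \<in> sing (verts G). touch l e} \<le> card (set l)"
      by (meson card_image_le card_mono finite_imageI finite_set le_trans)
    then show ?thesis using len[OF that] card_length[of l] cntV by simp
  qed
  have 3: "l = l'" if "l \<in> Bs" "l' \<in> Bs" "v \<in> set l" "v \<in> set l'" for l l' v
    using disj[OF that(1,2)] that by auto
  have 4: "image (sw l l') ` sing (verts G) \<subseteq> sing (verts G)" if "l \<in> Bs" "l' \<in> Bs" for l l'
    using 1[OF that] by auto
  have "finite (sing (verts G))" using cg by (auto simp: cgraph_def)
  then show ?thesis unfolding hyperedges_def using 2 3 4 by (auto simp: touch_def)
qed

lemma touch_sw:
  assumes "hyperedges H" "e \<in> H" "l \<in> Bs" "l' \<in> Bs" "touch l e"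
  shows "touch l' (sw l l' ` e)" "image (pat l') (sw l l' ` e) = image (pat l) e"
proof -
  show "touch l' (sw l l' ` e)" using assms(5) sw_set[OF assms(3,4)] by (force simp: touch_def)
  have "touch l' e \<Longrightarrow> l = l'" using hyperedges_unique assms by blast
  then have "x \<in> set l \<or> x \<notin> set l'" if "x \<in> e" for x
    using that by (auto simp: touch_def)
  then show "image (pat l') (sw l l' ` e) = image (pat l) e"
    unfolding image_image by (intro image_cong refl pat_sw assms) auto
qed

text \<open>The exchange sends a hyperedge of \<open>D\<close> at \<open>l\<close> to one at
  \<open>l'\<close> with the same pattern. As the traces agree, some member of \<open>D\<close> at
  \<open>l'\<close> has this pattern, and a pattern determines its hyperedge through
  \<open>unpat\<close>.\<close>

lemma ty_swap:
  assumes H: "hyperedges H" "D \<subseteq> H" and l: "l \<in> Bs" "l' \<in> Bs" and t: "ty D l = ty D l'"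
  shows "image (sw l l') ` D = D"
proof -
  have *: "sw l l' ` e \<in> D" if e: "e \<in> D" "touch l e" and l: "l \<in> Bs" "l' \<in> Bs" "ty D l = ty D l'" for e l l'
  proof -
    have "pat l ` e \<in> ty D l'" using e l(3) unfolding ty_def by blast
    then obtain e' where e': "e' \<in> D" "pat l ` e = pat l' ` e'" unfolding ty_def by blast
    have "pat l' ` (sw l l' ` e) = pat l' ` e'"
      using touch_sw(2)[OF H(1) _ l(1,2) e(2)] e H(2) e'(2) by auto
    then have "unpat l' ` pat l' ` (sw l l' ` e) = unpat l' ` pat l' ` e'" by (simp only:)
    then have "sw l l' ` e = e'" by (simp add: image_image unpat_pat)
    then show ?thesis using e' by simp
  qed
  have "sw l l' ` e \<in> D" if "e \<in> D" for e
  proof (cases "touch l e \<or> touch l' e")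
    case True
    then show ?thesis using *[OF that _ l t] *[OF that _ l(2,1) t[symmetric]] sw_commute[OF l] by metis
  next
    case False
    then have "sw l l' ` e = e" using sw_out[of _ l l'] by (force simp: touch_def)
    then show ?thesis using that by simp
  qed
  then have sub: "image (sw l l') ` D \<subseteq> D" by blast
  have "image (sw l l') ` image (sw l l') ` D = D"
    using sw_image_invol[OF l] by (simp add: image_image[of "image (sw l l')" "image (sw l l')"])
  then have "D \<subseteq> image (sw l l') ` D" using image_mono[OF sub, of "image (sw l l')"] by simp
  with sub show ?thesis by blast
qed

lemma avoid_elem:
  assumes "hyperedges H" "e \<in> H" "J \<subseteq> Bs" shows "card J \<le> Suc (card {l \<in> J. \<not> touch l e})"
proof -
  have fin: "finite J" using assms(3) finB finite_subset by blast
  have "l = l'" if "l \<in> J" "touch l e" "l' \<in> J" "touch l' e" for l l'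
    using hyperedges_unique[OF assms(1,2)] assms(3) that by blast
  then have "card {l \<in> J. touch l e} \<le> Suc 0"
    using fin by (subst card_le_Suc0_iff_eq) auto
  moreover have "card J = card {l \<in> J. touch l e} + card {l \<in> J. \<not> touch l e}"
    using fin by (subst card_Un_disjoint[symmetric]) (auto intro: arg_cong[where f = card])
  ultimately show ?thesis by simp
qed

text \<open>Moving hyperedges to one fixed block \<open>l0\<close> shows that all patterns come from
  a set \<open>P\<close> of at most \<open>w\<close> patterns. So at most \<open>2 ^ w\<close>
  traces occur, and one of them occurs often.\<close>

lemma uniform_subfamily:
  assumes H: "hyperedges H" "D \<subseteq> H" and J: "J \<subseteq> Bs" "2 ^ w * m \<le> card J" "0 < m"
  shows "\<exists>J2 \<subseteq> J. m \<le> card J2 \<and> (\<forall>l\<in>J2. \<forall>l'\<in>J2. ty D l = ty D l')"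
proof -
  have finJ: "finite J" using J(1) finB finite_subset by blast
  have "0 < 2 ^ w * m" using J(3) by simp
  then have "0 < card J" using J(2) by (rule less_le_trans)
  then obtain l0 where l0: "l0 \<in> J" by (metis card.empty equals0I less_irrefl)
  have finH: "finite H" using H by (simp add: hyperedges_def)
  define P where "P = image (pat l0) ` {e \<in> H. touch l0 e}"
  have P: "finite P" "card P \<le> w"
  proof -
    show "finite P" using finH by (simp add: P_def)
    have "card P \<le> card {e \<in> H. touch l0 e}" unfolding P_def by (rule card_image_le) (use finH in auto)
    then show "card P \<le> w" using hyperedges_card[OF H(1)] l0 J(1) by (meson le_trans subsetD)
  qed
  have tyP: "ty D ` J \<subseteq> Pow P"
  proof -
    have "pat l ` e \<in> P" if "l \<in> J" "e \<in> D" "touch l e" for l e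
    proof -
      have lB: "l \<in> Bs" "l0 \<in> Bs" using that l0 J(1) by auto
      have "sw l l0 ` e \<in> H" using hyperedges_image[OF H(1) _ lB] H(2) that(2) by blast
      moreover have "touch l0 (sw l l0 ` e)" "pat l0 ` (sw l l0 ` e) = pat l ` e"
        using touch_sw[OF H(1) _ lB that(3)] that(2) H(2) by auto
      ultimately show ?thesis unfolding P_def by (metis (mono_tags, lifting) image_eqI mem_Collect_eq)
    qed
    then show ?thesis by (auto simp: ty_def)
  qed
  have "card (Pow P) * m \<le> card J"
  proof -
    have "card (Pow P) \<le> 2 ^ w" using P by (simp add: card_Pow)
    then show ?thesis using J(2) by (meson le_trans mult_le_mono1)
  qed
  then obtain y where y: "m \<le> card {l \<in> J. ty D l = y}"
    using pigeonhole_fiber[OF finJ _ tyP _ J(3)] P(1) l0 by blast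
  then show ?thesis by (intro exI[of _ "{l \<in> J. ty D l = y}"]) auto
qed

text \<open>For a witness found in the graph without \<open>j\<close>: it has to be completed on
  \<open>j\<close> so that \<open>j\<close> looks like many other blocks. The missing trace is
  copied from a block \<open>k\<close> of a uniform subfamily that avoids \<open>j\<close>.\<close>

lemma uniform_extension:
  assumes H: "hyperedges H" "D' \<subseteq> {e \<in> H. \<not> touch j e}" and J: "J \<subseteq> Bs" "j \<in> J" "2 ^ w * m < card J" "0 < m"
  shows "\<exists>D J2. D \<subseteq> H \<and> {e \<in> D. \<not> touch j e} = D' \<and> j \<in> J2 \<and> J2 \<subseteq> J \<and> m \<le> card J2
     \<and> (\<forall>l\<in>J2. \<forall>l'\<in>J2. ty D l = ty D l')"
proof -
  have finJ: "finite J" using J(1) finB finite_subset by blast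
  have jB: "j \<in> Bs" using J by auto
  \<comment> \<open>The strict inequality in the hypothesis pays for setting \<open>j\<close>
    aside.\<close>
  have "2 ^ w * m \<le> card (J - {j})" using J finJ by (simp add: card_Diff_singleton)
  then obtain J' where J': "J' \<subseteq> J - {j}" "m \<le> card J'" "\<forall>l\<in>J'. \<forall>l'\<in>J'. ty D' l = ty D' l'"
    using uniform_subfamily[OF H(1), of D' "J - {j}" m] H(2) J by blast
  obtain k where k: "k \<in> J'" using J'(2) J(4) by (metis card.empty equals0I not_le)
  have kB: "k \<in> Bs" "k \<noteq> j" using k J' J by auto
  define N where "N = image (sw k j) ` {e \<in> D'. touch k e}"
  have N: "e \<in> H \<and> touch j e" if "e \<in> N" for e
    using that H(2) touch_sw(1)[OF H(1) _ kB(1) jB] hyperedges_image[OF H(1) _ kB(1) jB] unfolding N_def by blast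
  define D where "D = D' \<union> N"
  have "ty D l = ty D' l" if "l \<in> J'" for l
  proof -
    have "\<not> touch l e" if "e \<in> N" for e
      using N[OF that] hyperedges_unique[OF H(1) _ _ jB] \<open>l \<in> J'\<close> J'(1) J(1) by blast
    then show ?thesis unfolding ty_def D_def by (intro arg_cong[where f = "image (image (pat l))"]) blast
  qed
  moreover have "ty D j = ty D' k"
  proof -
    have "{e \<in> D. touch j e} = N" using N H(2) unfolding D_def by blast
    then have "ty D j = (\<lambda>e. pat j ` sw k j ` e) ` {e \<in> D'. touch k e}"
      by (simp add: ty_def N_def image_image[of "image (pat j)"])
    also have "\<dots> = ty D' k" unfolding ty_def
    proof (rule image_cong[OF refl])
      fix e assume "e \<in> {e \<in> D'. touch k e}"
      then have "e \<in> H" "touch k e" using H(2) by auto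
      then show "pat j ` sw k j ` e = pat k ` e" by (rule touch_sw(2)[OF H(1) _ kB(1) jB])
    qed
    finally show ?thesis .
  qed
  ultimately have t: "\<forall>l\<in>insert j J'. \<forall>l'\<in>insert j J'. ty D l = ty D l'"
    using J'(3) k by (metis insert_iff)
  have "D \<subseteq> H" "{e \<in> D. \<not> touch j e} = D'" using N H(2) unfolding D_def by blast+
  moreover have "m \<le> card (insert j J')"
    using J' finJ by (meson card_insert_le finite_Diff le_trans finite_subset)
  moreover have "insert j J' \<subseteq> J" using J' J by auto
  ultimately show ?thesis using t by blast
qed

section \<open>Deleting one of many blocks that an assignment cannot tell apart\<close>

definition same :: "'v set set \<Rightarrow> 'v list set \<Rightarrow> bool" where
  "same D J \<longleftrightarrow> (\<forall>l\<in>J. \<forall>l'\<in>J. ty D l = ty D l')"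

lemma same_mono: "same D J \<Longrightarrow> J' \<subseteq> J \<Longrightarrow> same D J'"
  unfolding same_def by blast

text \<open>The assignment cannot distinguish the blocks of \<open>J\<close>: single elements stay
  away from them, and sets leave the same trace on each.\<close>

definition uniform :: "'v list set \<Rightarrow> mso2 \<Rightarrow> (nat \<Rightarrow> 'v) \<Rightarrow> (nat \<Rightarrow> 'v set) \<Rightarrow> (nat \<Rightarrow> 'v set) \<Rightarrow> (nat \<Rightarrow> 'v set set) \<Rightarrow> bool" where
  "uniform J \<phi> a A b B \<longleftrightarrow> (\<forall>x. (Vertex, x) \<in> free_vars \<phi> \<longrightarrow> a x \<in> verts G \<and> (\<forall>l\<in>J. a x \<notin> set l))
    \<and> (\<forall>x. (VertexSet, x) \<in> free_vars \<phi> \<longrightarrow> A x \<subseteq> verts G \<and> same (sing (A x)) J)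
    \<and> (\<forall>x. (Edge, x) \<in> free_vars \<phi> \<longrightarrow> b x \<in> edges G \<and> (\<forall>l\<in>J. \<not> touch l (b x)))
    \<and> (\<forall>x. (EdgeSet, x) \<in> free_vars \<phi> \<longrightarrow> B x \<subseteq> edges G \<and> same (B x) J)"

definition rsat :: "'v list \<Rightarrow> (nat \<Rightarrow> 'v) \<Rightarrow> (nat \<Rightarrow> 'v set) \<Rightarrow> (nat \<Rightarrow> 'v set) \<Rightarrow> (nat \<Rightarrow> 'v set set) \<Rightarrow> mso2 \<Rightarrow> bool" where
  "rsat j a A b B \<phi> \<longleftrightarrow> sat (restr G (- set j)) a (\<lambda>x. A x - set j) b (\<lambda>x. {e \<in> B x. \<not> touch j e}) \<phi>"

text \<open>Exchanging \<open>j\<close> and \<open>j'\<close> is an isomorphism between the graph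
  without \<open>j\<close> and the graph without \<open>j'\<close>. It fixes the elements of a
  uniform assignment by \<open>sw_out\<close> and matches its restricted sets by
  \<open>ty_swap\<close>.\<close>

lemma rsat_swap:
  assumes J: "J \<subseteq> Bs" "j \<in> J" "j' \<in> J" and uniform: "uniform J \<phi> a A b B" and ci: "color_indices \<phi> \<subseteq> {..<length (colors G)}"
  shows "rsat j a A b B \<phi> \<longleftrightarrow> rsat j' a A b B \<phi>"
proof -
  define h where "h = sw j j'"
  have jB: "j \<in> Bs" "j' \<in> Bs" using J by auto
  have inj: "inj h" unfolding h_def by (rule sw_inj[OF jB])
  have hh: "h (h x) = x" for x unfolding h_def by (rule sw_invol[OF jB])
  have hj: "h ` set j = set j'" unfolding h_def by (rule sw_set[OF jB])
  have hjc: "h ` (X - set j) = h ` X - set j'" for X using image_set_diff[OF inj, of X "set j"] hj by simp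
  have autG: "gmap h G = G" unfolding h_def by (rule aut[OF jB])
  have hv: "h ` verts G = verts G" using arg_cong[OF autG, of verts] by simp
  have he: "image h ` edges G = edges G" using arg_cong[OF autG, of edges] by simp
  have hc: "map (image h) (colors G) = colors G" using arg_cong[OF autG, of colors] by simp
  have htouch: "touch j' (h ` e) \<longleftrightarrow> touch j e" for e
    using hj inj unfolding touch_def by (metis image_Int image_is_empty)
  have sub_iff: "e \<subseteq> - set l \<longleftrightarrow> \<not> touch l e" for e and l :: "'v list" by (auto simp: touch_def)
  have fam: "image h ` {e \<in> D. \<not> touch j e} = {e \<in> image h ` D. \<not> touch j' e}" for D
    using htouch by auto
  have restrj: "gmap h (restr G (- set j)) = restr G (- set j')"
  proof -
    have "h ` (verts G \<inter> - set j) = verts G \<inter> - set j'" using hjc[of "verts G"] hv by (simp add: Diff_eq)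
    moreover have "image h ` {e \<in> edges G. e \<subseteq> - set j} = {e \<in> edges G. e \<subseteq> - set j'}"
      using fam[of "edges G"] he by (simp add: sub_iff)
    moreover have "map (image h) (map (\<lambda>C. C \<inter> - set j) (colors G)) = map (\<lambda>C. C \<inter> - set j') (colors G)"
    proof -
      have "map (\<lambda>C. C \<inter> - set j') (colors G) = map (\<lambda>C. C \<inter> - set j') (map (image h) (colors G))" by (simp add: hc)
      then show ?thesis using hjc by (simp add: Diff_eq)
    qed
    ultimately show ?thesis by (simp add: gmap_def restr_def)
  qed
  have "valid (restr G (- set j)) \<phi> a (\<lambda>x. A x - set j) b (\<lambda>x. {e \<in> B x. \<not> touch j e})"
    using uniform J unfolding valid_def uniform_def touch_def by (auto 0 3)
  from sat_gmap[OF cgraph_restr[OF cg] inj_on_subset[OF inj] _ this]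
  have "rsat j a A b B \<phi> \<longleftrightarrow> sat (restr G (- set j')) (h \<circ> a) (image h \<circ> (\<lambda>x. A x - set j)) (image h \<circ> b)
      (image (image h) \<circ> (\<lambda>x. {e \<in> B x. \<not> touch j e})) \<phi>"
    unfolding rsat_def using ci by (simp add: restrj)
  also have "\<dots> \<longleftrightarrow> rsat j' a A b B \<phi>" unfolding rsat_def
  proof (rule sat_cong)
    fix x
    show "(h \<circ> a) x = a x" if "(Vertex, x) \<in> free_vars \<phi>"
      using uniform that J unfolding uniform_def h_def by (auto intro!: sw_out)
    show "(image h \<circ> b) x = b x" if "(Edge, x) \<in> free_vars \<phi>"
    proof -
      have "\<not> touch j (b x)" "\<not> touch j' (b x)" using uniform that J unfolding uniform_def by blast+
      then have "h y = y" if "y \<in> b x" for y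
        using that unfolding h_def touch_def by (intro sw_out) auto
      then show ?thesis by simp
    qed
    show "(image h \<circ> (\<lambda>x. A x - set j)) x = A x - set j'" if "(VertexSet, x) \<in> free_vars \<phi>"
    proof -
      have "A x \<subseteq> verts G" "same (sing (A x)) J" using uniform that unfolding uniform_def by blast+
      then have "sing (A x) \<subseteq> sing (verts G)" "ty (sing (A x)) j = ty (sing (A x)) j'"
        using J unfolding same_def by blast+
      from ty_swap[OF hyperedges_sing this(1) jB this(2)] have "sing (h ` A x) = sing (A x)"
        unfolding h_def by (simp add: image_image)
      then have "\<Union> (sing (h ` A x)) = \<Union> (sing (A x))" by (simp only:)
      then have "h ` A x = A x" by simp
      then show ?thesis using hjc[of "A x"] by simp
    qed
    show "(image (image h) \<circ> (\<lambda>x. {e \<in> B x. \<not> touch j e})) x = {e \<in> B x. \<not> touch j' e}"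
      if "(EdgeSet, x) \<in> free_vars \<phi>"
    proof -
      have "B x \<subseteq> edges G" "same (B x) J" using uniform that unfolding uniform_def by blast+
      then have "B x \<subseteq> edges G" "ty (B x) j = ty (B x) j'" using J unfolding same_def by blast+
      from ty_swap[OF hyperedges_edges this(1) jB this(2)] show ?thesis using fam[of "B x"] by (simp add: h_def)
    qed
  qed
  finally show ?thesis .
qed

text \<open>There are at most \<open>2 ^ w\<close> types of blocks with respect to a set of hyperedges, so a set variable keeps
  a fraction \<open>2 ^ (- w)\<close> of the blocks uniform, and an element variable meets a single block: each
  quantifier costs a factor of at most \<open>2 ^ (w + 1)\<close>.\<close>

definition prunable :: "nat \<Rightarrow> mso2 \<Rightarrow> bool" where
  "prunable n \<phi> \<longleftrightarrow> (\<forall>J a A b B. J \<subseteq> Bs \<longrightarrow> 2 ^ ((w + 1) * n) \<le> card J \<longrightarrow> uniform J \<phi> a A b B \<longrightarrow>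
     (\<forall>j\<in>J. sat G a A b B \<phi> \<longleftrightarrow> rsat j a A b B \<phi>))"

lemma prunableD: "prunable n \<phi> \<Longrightarrow> J \<subseteq> Bs \<Longrightarrow> 2 ^ ((w + 1) * n) \<le> card J \<Longrightarrow> uniform J \<phi> a A b B \<Longrightarrow> j \<in> J
    \<Longrightarrow> sat G a A b B \<phi> \<longleftrightarrow> rsat j a A b B \<phi>"
  unfolding prunable_def by blast

lemma prunable_mono: "prunable m \<phi> \<Longrightarrow> m \<le> n \<Longrightarrow> prunable n \<phi>"
  unfolding prunable_def by (meson le_trans mult_le_mono2 one_le_numeral power_increasing)

lemma uniform_mono: "uniform J \<phi> a A b B \<Longrightarrow> free_vars \<psi> \<subseteq> free_vars \<phi> \<Longrightarrow> J' \<subseteq> J \<Longrightarrow> uniform J' \<psi> a A b B"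
  unfolding uniform_def by (meson subsetD same_mono)

text \<open>A witness in the whole graph leaves many blocks uniform, and the induction hypothesis
  deletes one of these, \<open>l\<close>; it need not be \<open>j\<close>, so
  \<open>rsat_swap\<close> passes from \<open>l\<close> to \<open>j\<close>. Conversely
  \<open>j\<close> must stay in the family: an element of the graph without \<open>j\<close> avoids
  \<open>j\<close> anyway, and for sets \<open>uniform_extension\<close> arranges it.\<close>

lemma prunable_Exists:
  assumes IH: "prunable n \<phi>" and ci: "color_indices \<phi> \<subseteq> {..<length (colors G)}"
  shows "prunable (Suc n) (Exists q x \<phi>)"
  unfolding prunable_def
proof (intro allI impI ballI)
  fix J a A b B j
  assume J: "J \<subseteq> Bs" and card: "2 ^ ((w + 1) * Suc n) \<le> card J" and uniform: "uniform J (Exists q x \<phi>) a A b B" and j: "j \<in> J"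
  \<comment> \<open>\<open>2 ^ (w + 1)\<close> splits into \<open>2 ^ w\<close> for the pigeonhole
    principle and a factor 2, the slack for losing one block.\<close>
  define m where "m = (2::nat) ^ ((w + 1) * n)"
  have m: "0 < m" "2 ^ w * m < card J" "Suc m \<le> card J" "2 ^ w * m \<le> card J"
  proof -
    show "0 < m" by (simp add: m_def)
    have c: "2 * (2 ^ w * m) \<le> card J" using card by (simp add: m_def power_add algebra_simps)
    have "0 < 2 ^ w * m" using \<open>0 < m\<close> by simp
    then show "2 ^ w * m < card J" using c by linarith
    have "1 * m \<le> 2 ^ w * m" by (rule mult_right_mono) auto
    then show "Suc m \<le> card J" "2 ^ w * m \<le> card J" using \<open>2 ^ w * m < card J\<close> by linarith+
  qed
  have prunable: "sat G a A b B \<phi> \<longleftrightarrow> rsat j a A b B \<phi>" if "J' \<subseteq> J" "m \<le> card J'" "uniform J' \<phi> a A b B" "j \<in> J'" for J' a A b B j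
    by (rule prunableD[OF IH _ _ that(3,4)]) (use that J in \<open>auto simp: m_def\<close>)
  have swap: "rsat j' a A b B (Exists q x \<phi>) \<Longrightarrow> rsat j a A b B (Exists q x \<phi>)" if "j' \<in> J" for j'
    using rsat_swap[OF J that j uniform] ci by simp
  have ne: "\<exists>l. l \<in> J'" if "m \<le> card J'" for J' :: "'v list set"
    using that m(1) by (metis card.empty equals0I not_le)
  have fv: "free_vars (Exists q x \<phi>) = free_vars \<phi> - {(q, x)}" by simp
  show "sat G a A b B (Exists q x \<phi>) \<longleftrightarrow> rsat j a A b B (Exists q x \<phi>)"
  proof (cases q)
    case Vertex
    have goodv: "uniform J' \<phi> (a(x := v)) A b B" if "J' \<subseteq> J" "v \<in> verts G" "\<And>l. l \<in> J' \<Longrightarrow> v \<notin> set l" for J' v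
      using uniform_mono[OF uniform subset_refl that(1)] that(2,3) unfolding uniform_def fv by (auto simp: Vertex)
    show ?thesis
    proof
      assume "sat G a A b B (Exists q x \<phi>)"
      then obtain v where v: "v \<in> verts G" "sat G (a(x := v)) A b B \<phi>" by (auto simp: Vertex)
      let ?J = "{l \<in> J. \<not> touch l {v}}"
      have "m \<le> card ?J" using avoid_elem[OF hyperedges_sing _ J, of "{v}"] v m(3) by simp
      moreover from ne[OF this] obtain l where l: "l \<in> ?J" by blast
      moreover have "uniform ?J \<phi> (a(x := v)) A b B" by (rule goodv) (use v in \<open>auto simp: touch_def\<close>)
      ultimately have "rsat l (a(x := v)) A b B \<phi>" using prunable[of ?J] v by blast
      then have "rsat l a A b B (Exists q x \<phi>)" using v l by (auto simp: rsat_def Vertex touch_def)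
      then show "rsat j a A b B (Exists q x \<phi>)" using swap l by blast
    next
      assume "rsat j a A b B (Exists q x \<phi>)"
      then obtain v where v: "v \<in> verts G" "v \<notin> set j" "rsat j (a(x := v)) A b B \<phi>" by (auto simp: Vertex rsat_def)
      let ?J = "{l \<in> J. \<not> touch l {v}}"
      have "m \<le> card ?J" using avoid_elem[OF hyperedges_sing _ J, of "{v}"] v m(3) by simp
      moreover have "uniform ?J \<phi> (a(x := v)) A b B" by (rule goodv) (use v in \<open>auto simp: touch_def\<close>)
      moreover have "j \<in> ?J" using j v by (auto simp: touch_def)
      ultimately have "sat G (a(x := v)) A b B \<phi>" using prunable[of ?J] v by blast
      then show "sat G a A b B (Exists q x \<phi>)" using v by (auto simp: Vertex)
    qed
  next
    case Edge
    have goodv: "uniform J' \<phi> a A (b(x := v)) B" if "J' \<subseteq> J" "v \<in> edges G" "\<And>l. l \<in> J' \<Longrightarrow> \<not> touch l v" for J' v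
      using uniform_mono[OF uniform subset_refl that(1)] that(2,3) unfolding uniform_def fv by (auto simp: Edge)
    have tj: "v \<subseteq> - set l \<longleftrightarrow> \<not> touch l v" for v and l :: "'v list" by (auto simp: touch_def)
    show ?thesis
    proof
      assume "sat G a A b B (Exists q x \<phi>)"
      then obtain v where v: "v \<in> edges G" "sat G a A (b(x := v)) B \<phi>" by (auto simp: Edge)
      let ?J = "{l \<in> J. \<not> touch l v}"
      have "m \<le> card ?J" using avoid_elem[OF hyperedges_edges v(1) J] m(3) by simp
      moreover from ne[OF this] obtain l where l: "l \<in> ?J" by blast
      moreover have "uniform ?J \<phi> a A (b(x := v)) B" by (rule goodv) (use v in auto)
      ultimately have "rsat l a A (b(x := v)) B \<phi>" using prunable[of ?J] v by blast
      then have "rsat l a A b B (Exists q x \<phi>)" using v l by (auto simp: rsat_def Edge tj)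
      then show "rsat j a A b B (Exists q x \<phi>)" using swap l by blast
    next
      assume "rsat j a A b B (Exists q x \<phi>)"
      then obtain v where v: "v \<in> edges G" "\<not> touch j v" "rsat j a A (b(x := v)) B \<phi>" by (auto simp: Edge rsat_def tj)
      let ?J = "{l \<in> J. \<not> touch l v}"
      have "m \<le> card ?J" using avoid_elem[OF hyperedges_edges v(1) J] m(3) by simp
      moreover have "uniform ?J \<phi> a A (b(x := v)) B" by (rule goodv) (use v in auto)
      moreover have "j \<in> ?J" using j v by auto
      ultimately have "sat G a A (b(x := v)) B \<phi>" using prunable[of ?J] v by blast
      then show "sat G a A b B (Exists q x \<phi>)" using v by (auto simp: Edge)
    qed
  next
    case VertexSet
    have goodv: "uniform J' \<phi> a (A(x := U)) b B"
      if "J' \<subseteq> J" "U \<subseteq> verts G" "same (sing U) J'" for J' U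
      using uniform_mono[OF uniform subset_refl that(1)] that(2,3) unfolding uniform_def fv by (auto simp: VertexSet)
    have upd: "(\<lambda>y. (A(x := U)) y - set l) = (\<lambda>y. A y - set l)(x := U - set l)" for U and l :: "'v list" by (simp add: fun_eq_iff)
    show ?thesis
    proof
      assume "sat G a A b B (Exists q x \<phi>)"
      then obtain U where U: "U \<subseteq> verts G" "sat G a (A(x := U)) b B \<phi>" by (auto simp: VertexSet)
      then have "sing U \<subseteq> sing (verts G)" by blast
      from uniform_subfamily[OF hyperedges_sing this J m(4,1), folded same_def] obtain J' where J': "J' \<subseteq> J" "m \<le> card J'"
        "same (sing U) J'" by blast
      obtain l where l: "l \<in> J'" using ne[OF J'(2)] by blast
      have "rsat l a (A(x := U)) b B \<phi>" using prunable[OF J'(1,2) goodv[OF J'(1) U(1) J'(3)] l] U by blast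
      then have "rsat l a A b B (Exists q x \<phi>)" unfolding rsat_def upd VertexSet
        using U by (auto intro!: exI[of _ "U - set l"])
      then show "rsat j a A b B (Exists q x \<phi>)" using swap l J' by blast
    next
      assume "rsat j a A b B (Exists q x \<phi>)"
      then obtain U' where U': "U' \<subseteq> verts G - set j"
        "sat (restr G (- set j)) a ((\<lambda>x. A x - set j)(x := U')) b (\<lambda>x. {e \<in> B x. \<not> touch j e}) \<phi>"
        by (auto simp: VertexSet rsat_def)
      have "sing U' \<subseteq> {e \<in> sing (verts G). \<not> touch j e}" using U' by (auto simp: touch_def)
      from uniform_extension[OF hyperedges_sing this J j m(2,1), folded same_def] obtain D J' where D: "D \<subseteq> sing (verts G)" "{e \<in> D. \<not> touch j e} = sing U'"
        "j \<in> J'" "J' \<subseteq> J" "m \<le> card J'" "same D J'" by blast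
      obtain U where U: "U \<subseteq> verts G" "D = sing U" using D(1) by (auto simp: subset_image_iff)
      have "{e \<in> sing U. \<not> touch j e} = sing (U - set j)" by (auto simp: touch_def)
      then have "sing (U - set j) = sing U'" using D(2) U(2) by simp
      then have "\<Union> (sing (U - set j)) = \<Union> (sing U')" by (simp only:)
      then have "U - set j = U'" by simp
      then have "rsat j a (A(x := U)) b B \<phi>" using U'(2) unfolding rsat_def upd by simp
      then have "sat G a (A(x := U)) b B \<phi>"
        using prunable[OF D(4,5) goodv[OF D(4) U(1)] D(3)] D(6) U(2) by blast
      then show "sat G a A b B (Exists q x \<phi>)" using U by (auto simp: VertexSet)
    qed
  next
    case EdgeSet
    have goodv: "uniform J' \<phi> a A b (B(x := U))"
      if "J' \<subseteq> J" "U \<subseteq> edges G" "same U J'" for J' U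
      using uniform_mono[OF uniform subset_refl that(1)] that(2,3) unfolding uniform_def fv by (auto simp: EdgeSet)
    have upd: "(\<lambda>y. {e \<in> (B(x := U)) y. \<not> touch l e}) = (\<lambda>y. {e \<in> B y. \<not> touch l e})(x := {e \<in> U. \<not> touch l e})" for U and l :: "'v list" by (simp add: fun_eq_iff)
    have tj: "v \<subseteq> - set l \<longleftrightarrow> \<not> touch l v" for v and l :: "'v list" by (auto simp: touch_def)
    show ?thesis
    proof
      assume "sat G a A b B (Exists q x \<phi>)"
      then obtain U where U: "U \<subseteq> edges G" "sat G a A b (B(x := U)) \<phi>" by (auto simp: EdgeSet)
      from uniform_subfamily[OF hyperedges_edges U(1) J m(4,1), folded same_def] obtain J' where J': "J' \<subseteq> J" "m \<le> card J'"
        "same U J'" by blast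
      obtain l where l: "l \<in> J'" using ne[OF J'(2)] by blast
      have "rsat l a A b (B(x := U)) \<phi>" using prunable[OF J'(1,2) goodv[OF J'(1) U(1) J'(3)] l] U by blast
      then have "rsat l a A b B (Exists q x \<phi>)" unfolding rsat_def upd EdgeSet
        using U by (auto intro!: exI[of _ "{e \<in> U. \<not> touch l e}"] simp: tj)
      then show "rsat j a A b B (Exists q x \<phi>)" using swap l J' by blast
    next
      assume "rsat j a A b B (Exists q x \<phi>)"
      then obtain U' where U': "U' \<subseteq> {e \<in> edges G. \<not> touch j e}"
        "sat (restr G (- set j)) a (\<lambda>x. A x - set j) b ((\<lambda>x. {e \<in> B x. \<not> touch j e})(x := U')) \<phi>"
        by (auto simp: EdgeSet rsat_def tj)
      from uniform_extension[OF hyperedges_edges U'(1) J j m(2,1), folded same_def] obtain D J' where D: "D \<subseteq> edges G" "{e \<in> D. \<not> touch j e} = U'"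
        "j \<in> J'" "J' \<subseteq> J" "m \<le> card J'" "same D J'" by blast
      have "rsat j a A b (B(x := D)) \<phi>" using U'(2) D(2) unfolding rsat_def upd by simp
      then have "sat G a A b (B(x := D)) \<phi>"
        using prunable[OF D(4,5) goodv[OF D(4) D(1) D(6)] D(3)] by blast
      then show "sat G a A b B (Exists q x \<phi>)" using D by (auto simp: EdgeSet)
    qed
  qed
qed

end

text \<open>An upper bound for the number of quantifiers that is also the number of tokens in the
  linear form of the formula (\<open>length_lin\<close>).\<close>

fun nodes :: "mso2 \<Rightarrow> nat" where
  "nodes (Neg \<phi>) = Suc (nodes \<phi>)"
| "nodes (Conj \<phi> \<psi>) = Suc (nodes \<phi> + nodes \<psi>)"
| "nodes (Disj \<phi> \<psi>) = Suc (nodes \<phi> + nodes \<psi>)"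
| "nodes (Imp \<phi> \<psi>) = Suc (nodes \<phi> + nodes \<psi>)"
| "nodes (Iff \<phi> \<psi>) = Suc (nodes \<phi> + nodes \<psi>)"
| "nodes (Exists s x \<phi>) = Suc (nodes \<phi>)"
| "nodes (Forall s x \<phi>) = Suc (nodes \<phi>)"
| "nodes _ = 1"

context blocks begin

lemma prunable_Neg: "prunable n \<phi> \<Longrightarrow> prunable n (Neg \<phi>)"
  unfolding prunable_def rsat_def uniform_def by simp

lemma prunable_binary:
  assumes "prunable n \<phi>" "prunable n \<psi>" "free_vars \<theta> = free_vars \<phi> \<union> free_vars \<psi>"
    "\<And>(H::'v cgraph) a A b B. sat H a A b B \<theta> \<longleftrightarrow> F (sat H a A b B \<phi>) (sat H a A b B \<psi>)"
  shows "prunable n \<theta>"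
  unfolding prunable_def
proof (intro allI impI ballI)
  fix J a A b B j
  assume J: "J \<subseteq> Bs" "2 ^ ((w + 1) * n) \<le> card J" "uniform J \<theta> a A b B" "j \<in> J"
  have "uniform J \<phi> a A b B" "uniform J \<psi> a A b B" using uniform_mono[OF J(3)] assms(3) by auto
  then have "sat G a A b B \<phi> \<longleftrightarrow> rsat j a A b B \<phi>" "sat G a A b B \<psi> \<longleftrightarrow> rsat j a A b B \<psi>"
    using prunableD[OF assms(1) J(1,2) _ J(4)] prunableD[OF assms(2) J(1,2) _ J(4)] by blast+
  then show "sat G a A b B \<theta> \<longleftrightarrow> rsat j a A b B \<theta>" unfolding rsat_def by (simp add: assms(4))
qed

lemma prunable_nodes:
  "color_indices \<phi> \<subseteq> {..<length (colors G)} \<Longrightarrow> prunable (nodes \<phi>) \<phi>"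
proof (induction \<phi>)
  case (Neg \<phi>)
  then show ?case using prunable_Neg prunable_mono[of "nodes \<phi>"] by simp
next
  case (Conj \<phi> \<psi>)
  show ?case by (rule prunable_binary[where F = "(\<and>)", OF prunable_mono[of "nodes \<phi>" \<phi>] prunable_mono[of "nodes \<psi>" \<psi>]]) (use Conj in auto)
next
  case (Disj \<phi> \<psi>)
  show ?case by (rule prunable_binary[where F = "(\<or>)", OF prunable_mono[of "nodes \<phi>" \<phi>] prunable_mono[of "nodes \<psi>" \<psi>]]) (use Disj in auto)
next
  case (Imp \<phi> \<psi>)
  show ?case by (rule prunable_binary[where F = "(\<longrightarrow>)", OF prunable_mono[of "nodes \<phi>" \<phi>] prunable_mono[of "nodes \<psi>" \<psi>]]) (use Imp in auto)
next
  case (Iff \<phi> \<psi>)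
  show ?case by (rule prunable_binary[where F = "(\<longleftrightarrow>)", OF prunable_mono[of "nodes \<phi>" \<phi>] prunable_mono[of "nodes \<psi>" \<psi>]]) (use Iff in auto)
next
  case (Exists q x \<phi>)
  then show ?case using prunable_Exists by simp
next
  case (Forall q x \<phi>)
  then have "prunable (Suc (nodes \<phi>)) (Exists q x (Neg \<phi>))" by (intro prunable_Exists prunable_Neg) simp_all
  then show ?case unfolding prunable_def rsat_def uniform_def sat_Forall by simp
qed (auto simp: prunable_def uniform_def rsat_def touch_def)

text \<open>The blocks met by \<open>X\<close> are left out of the family. On the others the trace
  of \<open>X\<close> is empty, so the assignment is uniform.\<close>

theorem models_remove:
  assumes "formula_of_set G \<phi>" "X \<subseteq> verts G" "j \<in> Bs" "X \<inter> set j = {}"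
    "2 ^ ((w + 1) * nodes \<phi>) \<le> card {l \<in> Bs. X \<inter> set l = {}}"
  shows "models G \<phi> X \<longleftrightarrow> models (restr G (- set j)) \<phi> X"
proof -
  have fv: "free_vars \<phi> \<subseteq> {(VertexSet, 0)}" and ci: "color_indices \<phi> \<subseteq> {..<length (colors G)}"
    using assms(1) by (auto simp: formula_of_set_def)
  let ?J = "{l \<in> Bs. X \<inter> set l = {}}"
  let ?s = "\<lambda>P. P (\<lambda>_. undefined) (\<lambda>_. X) (\<lambda>_. undefined) (\<lambda>_. undefined)"
  have t: "ty (sing X) l = {}" if "l \<in> ?J" for l using that by (auto simp: ty_def touch_def)
  have "uniform ?J \<phi> (\<lambda>_. undefined) (\<lambda>_. X) (\<lambda>_. undefined) (\<lambda>_. undefined)"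
    using fv assms(2) t unfolding uniform_def same_def by auto
  then have "sat G (\<lambda>_. undefined) (\<lambda>_. X) (\<lambda>_. undefined) (\<lambda>_. undefined) \<phi>
     \<longleftrightarrow> rsat j (\<lambda>_. undefined) (\<lambda>_. X) (\<lambda>_. undefined) (\<lambda>_. undefined) \<phi>"
    using assms(3,4) by (intro prunableD[OF prunable_nodes[OF ci] _ assms(5)]) auto
  moreover have "X - set j = X" using assms(4) by auto
  ultimately show ?thesis unfolding rsat_def
    using models_cong[OF fv, of "\<lambda>_. X" X] by simp
qed

end

section \<open>Token jumping sequences and pruning\<close>

definition tj_step :: "'v set \<Rightarrow> 'v set \<Rightarrow> bool" where
  "tj_step T T' \<longleftrightarrow> card (T - T') = 1 \<and> card (T' - T) = 1"

lemma tj_sequence_iff: "tj_sequence G \<phi> S S' Ss \<longleftrightarrow> Ss \<noteq> [] \<and> hd Ss = S \<and> last Ss = S' \<and>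
    (\<forall>T \<in> set Ss. T \<subseteq> verts G \<and> models G \<phi> T) \<and> successively tj_step Ss"
  by (simp add: tj_sequence_def tj_step_def[abs_def])

lemma tj_step_card: "tj_step T T' \<Longrightarrow> finite T \<Longrightarrow> finite T' \<Longrightarrow> card T' = card T"
proof -
  assume *: "tj_step T T'" "finite T" "finite T'"
  have "card T = card (T - T') + card (T \<inter> T')" "card T' = card (T' - T) + card (T' \<inter> T)"
    using * by (metis Diff_Diff_Int Diff_disjoint Int_commute add.commute card_Int_Diff)+
  then show "card T' = card T" using * by (simp add: tj_step_def Int_commute)
qed

lemma tj_step_image: "inj h \<Longrightarrow> tj_step T T' \<Longrightarrow> tj_step (h ` T) (h ` T')"
  unfolding tj_step_def by (simp add: image_set_diff[symmetric] card_image inj_on_subset)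

lemma successively_tj_card:
  assumes "successively tj_step Ts" "\<forall>T\<in>set Ts. finite T" "T \<in> set Ts"
  shows "card T = card (hd Ts)"
  using assms
proof (induction Ts)
  case (Cons T1 Ts)
  show ?case
  proof (cases "T \<in> set Ts")
    case True
    then obtain T2 R where Ts: "Ts = T2 # R" by (cases Ts) auto
    have "card T = card T2" using Cons True by (auto simp: Ts successively_Cons)
    moreover have "card T2 = card T1" by (rule tj_step_card) (use Cons.prems in \<open>auto simp: Ts\<close>)
    ultimately show ?thesis by simp
  qed (use Cons.prems in auto)
qed simp

lemma tj_sequence_card:
  assumes "finite (verts G)" "tj_sequence G \<phi> S S' Ss" "T \<in> set Ss" shows "card T = card S"
proof -
  have "\<forall>T\<in>set Ss. finite T" using assms(1,2) finite_subset unfolding tj_sequence_iff by blast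
  with successively_tj_card[of Ss T] show ?thesis using assms(2,3) by (simp add: tj_sequence_iff)
qed

text \<open>For sequences only one direction is demanded, the other follows from the first clause
  (\<open>tj_equiv_back\<close>). Equality of lengths is what preserves shortest sequences.\<close>

definition tj_equiv :: "'v cgraph \<Rightarrow> mso2 \<Rightarrow> 'v set \<Rightarrow> 'v set \<Rightarrow> 'v set \<Rightarrow> bool" where
  "tj_equiv G \<phi> S S' U \<longleftrightarrow>
    (\<forall>X. X \<subseteq> verts G \<inter> U \<longrightarrow> card X = card S \<longrightarrow> (models G \<phi> X \<longleftrightarrow> models (restr G U) \<phi> X)) \<and>
    (\<forall>Ss. tj_sequence G \<phi> S S' Ss \<longrightarrow> (\<exists>Rs. tj_sequence (restr G U) \<phi> S S' Rs \<and> length Rs = length Ss))"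

lemma tj_equiv_models: "tj_equiv G \<phi> S S' U \<Longrightarrow> X \<subseteq> verts G \<inter> U \<Longrightarrow> card X = card S \<Longrightarrow>
    models G \<phi> X \<longleftrightarrow> models (restr G U) \<phi> X"
  unfolding tj_equiv_def by blast

lemma tj_equiv_seq: "tj_equiv G \<phi> S S' U \<Longrightarrow> tj_sequence G \<phi> S S' Ss \<Longrightarrow>
    \<exists>Rs. tj_sequence (restr G U) \<phi> S S' Rs \<and> length Rs = length Ss"
  unfolding tj_equiv_def by blast

lemma tj_equiv_back:
  assumes "tj_equiv G \<phi> S S' U" "finite (verts G)" "tj_sequence (restr G U) \<phi> S S' Ss"
  shows "tj_sequence G \<phi> S S' Ss"
proof -
  have "T \<subseteq> verts G \<and> models G \<phi> T" if T: "T \<in> set Ss" for T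
  proof -
    have "T \<subseteq> verts G \<inter> U" "models (restr G U) \<phi> T" using assms(3) T by (auto simp: tj_sequence_iff)
    moreover have "card T = card S" using tj_sequence_card[OF _ assms(3) T] assms(2) by simp
    ultimately show ?thesis using tj_equiv_models[OF assms(1)] by simp
  qed
  then show ?thesis using assms(3) by (simp add: tj_sequence_iff)
qed

lemma tj_equiv_trans:
  assumes "tj_equiv G \<phi> S S' U" "tj_equiv (restr G U) \<phi> S S' W"
  shows "tj_equiv G \<phi> S S' (U \<inter> W)"
  unfolding tj_equiv_def
proof (intro conjI allI impI)
  fix X assume X: "X \<subseteq> verts G \<inter> (U \<inter> W)" "card X = card S"
  then show "models G \<phi> X \<longleftrightarrow> models (restr G (U \<inter> W)) \<phi> X"
    using tj_equiv_models[OF assms(1), of X] tj_equiv_models[OF assms(2), of X] by (auto simp: restr_restr)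
next
  fix Ss assume "tj_sequence G \<phi> S S' Ss"
  then obtain Rs where "tj_sequence (restr G U) \<phi> S S' Rs" "length Rs = length Ss"
    using tj_equiv_seq[OF assms(1)] by blast
  then show "\<exists>Rs. tj_sequence (restr G (U \<inter> W)) \<phi> S S' Rs \<and> length Rs = length Ss"
    using tj_equiv_seq[OF assms(2)] by (metis restr_restr)
qed

section \<open>Rerouting a sequence around a deleted block\<close>

context blocks begin

text \<open>Automorphisms composed of block exchanges. They fix everything outside the blocks, in
  particular the two input sets once these meet no block.\<close>

definition Aut :: "('v \<Rightarrow> 'v) \<Rightarrow> bool" where
  "Aut p \<longleftrightarrow> inj p \<and> gmap p G = G \<and> (\<forall>x. (\<forall>l\<in>Bs. x \<notin> set l) \<longrightarrow> p x = x)"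

lemma Aut_id: "Aut id"
  by (auto simp: Aut_def gmap_def)

lemma Aut_sw: assumes "Aut p" "l \<in> Bs" "l' \<in> Bs" shows "Aut (sw l l' \<circ> p)"
proof -
  have "gmap (sw l l' \<circ> p) G = gmap (sw l l') (gmap p G)"
    by (simp add: gmap_def image_comp comp_def)
  then have "gmap (sw l l' \<circ> p) G = G" using assms aut by (simp add: Aut_def)
  moreover have "inj (sw l l' \<circ> p)" using assms sw_inj by (simp add: Aut_def inj_compose)
  ultimately show ?thesis using assms sw_out[of _ l l'] by (simp add: Aut_def)
qed

lemma Aut_models:
  assumes "Aut p" "formula_of_set G \<phi>" "X \<subseteq> verts G"
  shows "p ` X \<subseteq> verts G" "models G \<phi> (p ` X) \<longleftrightarrow> models G \<phi> X"
proof -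
  have 1: "gmap p G = G" "inj p" using assms(1) by (auto simp: Aut_def)
  have "p ` verts G = verts G" using arg_cong[OF 1(1), of verts] by simp
  then show "p ` X \<subseteq> verts G" using assms(3) by blast
  show "models G \<phi> (p ` X) \<longleftrightarrow> models G \<phi> X"
    using models_gmap[OF cg inj_on_subset[OF 1(2)] assms(2,3)] 1(1) by simp
qed

lemma card_touched:
  assumes "finite X" shows "card {l \<in> Bs. X \<inter> set l \<noteq> {}} \<le> card X"
proof -
  define f where "f l = (SOME x. x \<in> X \<inter> set l)" for l
  have f: "f l \<in> X \<inter> set l" if "X \<inter> set l \<noteq> {}" for l
    unfolding f_def using that by (meson ex_in_conv someI_ex)
  show ?thesis
  proof (rule card_inj_on_le[OF _ _ assms])
    show "inj_on f {l \<in> Bs. X \<inter> set l \<noteq> {}}"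
    proof (rule inj_onI)
      fix l l' assume l: "l \<in> {l \<in> Bs. X \<inter> set l \<noteq> {}}" "l' \<in> {l \<in> Bs. X \<inter> set l \<noteq> {}}" "f l = f l'"
      then have "f l \<in> set l \<inter> set l'" using f[of l] f[of l'] by auto
      then show "l = l'" using disj[of l l'] l by auto
    qed
    show "f ` {l \<in> Bs. X \<inter> set l \<noteq> {}} \<subseteq> X" using f by blast
  qed
qed

text \<open>A token that would enter \<open>j\<close> is sent to a copy untouched by both sets; the automorphism \<open>q\<close> records the swaps.\<close>

lemma tj_step_avoid:
  assumes p: "Aut p" and j: "j \<in> Bs" and av: "p ` T \<inter> set j = {}" and st: "tj_step T T1"
    and fin: "finite T" "finite T1" and big: "card T + 2 \<le> card Bs"
  shows "\<exists>q. Aut q \<and> q ` T1 \<inter> set j = {} \<and> tj_step (p ` T) (q ` T1)"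
proof -
  have inj: "inj p" using p by (simp add: Aut_def)
  define R where "R = p ` T"
  define R1 where "R1 = p ` T1"
  have st': "tj_step R R1" unfolding R_def R1_def by (rule tj_step_image[OF inj st])
  have finR: "finite R" "finite R1" using fin by (auto simp: R_def R1_def)
  show ?thesis
  proof (cases "R1 \<inter> set j = {}")
    case True
    then show ?thesis using p st' by (intro exI[of _ p]) (simp add: R_def R1_def)
  next
    case False
    obtain y where y: "R1 - R = {y}" using st' by (auto simp: tj_step_def card_1_singleton_iff)
    have "R \<union> R1 = insert y R" using y by blast
    moreover have "card R \<le> card T" unfolding R_def by (rule card_image_le[OF fin(1)])
    ultimately have "card (R \<union> R1) \<le> card T + 1" using card_insert_le_m1[of "card T + 1" R y] finR
      by (simp add: card_insert_if)
    \<comment> \<open>Two consecutive sets have at most \<open>card T + 1\<close> vertices together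
      and meet at most that many blocks; with \<open>card T + 2\<close> blocks one is untouched by
      both.\<close>
    then have "card {l \<in> Bs. (R \<union> R1) \<inter> set l \<noteq> {}} < card Bs"
      using card_touched[of "R \<union> R1"] finR big by simp
    then have "{l \<in> Bs. (R \<union> R1) \<inter> set l \<noteq> {}} \<noteq> Bs" by auto
    then obtain l where l: "l \<in> Bs" "(R \<union> R1) \<inter> set l = {}" by blast
    have "l \<noteq> j" using l False by auto
    have yj: "y \<in> set j" "y \<in> R1" "y \<notin> R" using y False av unfolding R_def[symmetric] by auto
    define z where "z = sw j l y"
    have zl: "z \<in> set l" using sw_set[OF j l(1)] yj(1) unfolding z_def by blast
    have fixed: "sw j l x = x" if "x \<in> R \<inter> R1" for x
      by (rule sw_out) (use that av l in \<open>auto simp: R_def[symmetric]\<close>)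
    have R1: "R1 = insert y (R \<inter> R1)" using y by blast
    have "sw j l ` R1 = insert z ((\<lambda>x. x) ` (R \<inter> R1))"
      using image_cong[OF refl fixed, of "R \<inter> R1"] by (subst R1) (simp add: z_def)
    then have img: "sw j l ` R1 = insert z (R \<inter> R1)" by simp
    have zR: "z \<notin> R" using zl l by blast
    have zj: "z \<notin> set j" using zl disj[OF l(1) j \<open>l \<noteq> j\<close>] by blast
    have "R - insert z (R \<inter> R1) = R - R1" "insert z (R \<inter> R1) - R = {z}" using zR by auto
    then have "tj_step R (sw j l ` R1)" unfolding img using st' by (simp add: tj_step_def)
    moreover have "sw j l ` R1 \<inter> set j = {}" unfolding img using zj av by (auto simp: R_def[symmetric])
    moreover have "(sw j l \<circ> p) ` T1 = sw j l ` R1" by (simp add: R1_def image_comp)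
    ultimately show ?thesis using Aut_sw[OF p j l(1)] by (intro exI[of _ "sw j l \<circ> p"]) (simp add: R_def)
  qed
qed

text \<open>The exchanges accumulate along the sequence, so the induction starts from an arbitrary
  automorphism \<open>p\<close> and yields another one, \<open>q\<close>, for the last set.\<close>

lemma tj_list_avoid:
  assumes \<phi>: "formula_of_set G \<phi>" and j: "j \<in> Bs"
  shows "Ts \<noteq> [] \<Longrightarrow> successively tj_step Ts \<Longrightarrow> \<forall>T\<in>set Ts. T \<subseteq> verts G \<and> models G \<phi> T \<Longrightarrow>
    card (hd Ts) + 2 \<le> card Bs \<Longrightarrow> Aut p \<Longrightarrow> p ` hd Ts \<inter> set j = {} \<Longrightarrow>
    \<exists>Rs q. Rs \<noteq> [] \<and> length Rs = length Ts \<and> hd Rs = p ` hd Ts \<and> Aut q \<and> last Rs = q ` last Ts \<and>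
      successively tj_step Rs \<and> (\<forall>R\<in>set Rs. R \<subseteq> verts G \<and> models G \<phi> R \<and> R \<inter> set j = {})"
proof (induction Ts arbitrary: p)
  case (Cons T Ts)
  have T: "T \<subseteq> verts G" "models G \<phi> T" using Cons.prems(3) by auto
  have pT: "p ` T \<subseteq> verts G \<and> models G \<phi> (p ` T) \<and> p ` T \<inter> set j = {}"
    using Aut_models[OF Cons.prems(5) \<phi> T(1)] T(2) Cons.prems(6) by simp
  have fin: "finite X" if "X \<in> set (T # Ts)" for X
  proof -
    have "finite (verts G)" using cg by (simp add: cgraph_def)
    moreover have "X \<subseteq> verts G" using Cons.prems(3) that by blast
    ultimately show ?thesis using finite_subset by blast
  qed
  show ?case
  proof (cases Ts)
    case Nil
    then show ?thesis using pT Cons.prems(5) by (intro exI[of _ "[p ` T]"] exI[of _ p]) simp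
  next
    case (Cons T1 Ts')
    have st: "tj_step T T1" using Cons.prems(2) by (simp add: Cons)
    have fin2: "finite T" "finite T1" using fin by (auto simp: Cons)
    obtain q where q: "Aut q" "q ` T1 \<inter> set j = {}" "tj_step (p ` T) (q ` T1)"
      using tj_step_avoid[OF Cons.prems(5) j _ st fin2] Cons.prems(4,6) by auto
    have h1: "Ts \<noteq> []" by (simp add: Cons)
    have h2: "successively tj_step Ts" using Cons.prems(2) by (simp add: Cons)
    have h3: "\<forall>T\<in>set Ts. T \<subseteq> verts G \<and> models G \<phi> T" using Cons.prems(3) by (meson list.set_intros(2))
    have h4: "card (hd Ts) + 2 \<le> card Bs" using tj_step_card[OF st fin2] Cons.prems(4) by (simp add: Cons)
    have h5: "q ` hd Ts \<inter> set j = {}" using q(2) by (simp add: Cons)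
    note IH = Cons.IH[OF h1 h2 h3 h4 q(1) h5]
    obtain Rs q' where Rs: "Rs \<noteq> []" "length Rs = length Ts" "hd Rs = q ` hd Ts" "Aut q'" "last Rs = q' ` last Ts"
      "successively tj_step Rs" "\<forall>R\<in>set Rs. R \<subseteq> verts G \<and> models G \<phi> R \<and> R \<inter> set j = {}" using IH by (elim exE conjE) (rule that; assumption)
    have "successively tj_step (p ` T # Rs)" using Rs(1,3,6) q(3) by (cases Rs) (auto simp: Cons)
    then show ?thesis using Rs pT by (intro exI[of _ "p ` T # Rs"] exI[of _ q']) (simp add: Cons)
  qed
qed simp

lemma tj_equiv_remove:
  assumes \<phi>: "formula_of_set G \<phi>" and j: "j \<in> Bs" and S: "S \<subseteq> verts G" "S' \<subseteq> verts G"
    and unt: "\<And>l. l \<in> Bs \<Longrightarrow> S \<inter> set l = {}" "\<And>l. l \<in> Bs \<Longrightarrow> S' \<inter> set l = {}"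
    and big: "2 ^ ((w + 1) * nodes \<phi>) + card S + 2 \<le> card Bs"
  shows "tj_equiv G \<phi> S S' (- set j)"
proof -
  have finV: "finite (verts G)" using cg by (simp add: cgraph_def)
  have mod: "models G \<phi> X \<longleftrightarrow> models (restr G (- set j)) \<phi> X"
    if X: "X \<subseteq> verts G" "X \<inter> set j = {}" "card X = card S" for X
  proof (rule models_remove[OF \<phi> X(1) j X(2)])
    have "finite X" using X(1) finV finite_subset by blast
    from card_touched[OF this] have "card {l \<in> Bs. X \<inter> set l \<noteq> {}} \<le> card S" using X(3) by simp
    moreover have "card Bs = card {l \<in> Bs. X \<inter> set l \<noteq> {}} + card {l \<in> Bs. X \<inter> set l = {}}"
      using finB by (subst card_Un_disjoint[symmetric]) (auto intro: arg_cong[where f = card])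
    ultimately show "2 ^ ((w + 1) * nodes \<phi>) \<le> card {l \<in> Bs. X \<inter> set l = {}}" using big by simp
  qed
  have seq: "\<exists>Rs. tj_sequence (restr G (- set j)) \<phi> S S' Rs \<and> length Rs = length Ss" if Ss: "tj_sequence G \<phi> S S' Ss" for Ss
  proof -
    have Ss': "Ss \<noteq> []" "hd Ss = S" "last Ss = S'" "\<forall>T \<in> set Ss. T \<subseteq> verts G \<and> models G \<phi> T" "successively tj_step Ss"
      using Ss by (simp_all add: tj_sequence_iff)
    have "card (hd Ss) + 2 \<le> card Bs" "id ` hd Ss \<inter> set j = {}" using big unt j Ss' by auto
    from tj_list_avoid[OF \<phi> j Ss'(1,5,4) this(1) Aut_id this(2)] obtain Rs q where
      Rs: "Rs \<noteq> []" "length Rs = length Ss" "hd Rs = id ` S" "Aut q" "last Rs = q ` S'"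
      "successively tj_step Rs" "\<forall>R\<in>set Rs. R \<subseteq> verts G \<and> models G \<phi> R \<and> R \<inter> set j = {}"
      using Ss' by auto
    have "q ` S' = (\<lambda>x. x) ` S'" 
    proof (rule image_cong[OF refl])
      fix x assume "x \<in> S'"
      then have "\<forall>l\<in>Bs. x \<notin> set l" using unt(2) by blast
      then show "q x = x" using Rs(4) by (simp add: Aut_def)
    qed
    then have seq: "tj_sequence G \<phi> S S' Rs" using Rs by (simp add: tj_sequence_iff)
    have "T \<subseteq> verts G \<inter> - set j \<and> models (restr G (- set j)) \<phi> T" if T: "T \<in> set Rs" for T
    proof -
      have T': "T \<subseteq> verts G" "models G \<phi> T" "T \<inter> set j = {}" using Rs(7) T by auto
      then show ?thesis using mod[OF T'(1,3) tj_sequence_card[OF finV seq T]] by auto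
    qed
    then show ?thesis using seq Rs(2) by (intro exI[of _ Rs]) (simp add: tj_sequence_iff)
  qed
  show ?thesis unfolding tj_equiv_def
  proof (intro conjI allI impI)
    fix X assume X: "X \<subseteq> verts G \<inter> - set j" "card X = card S"
    show "models G \<phi> X \<longleftrightarrow> models (restr G (- set j)) \<phi> X" by (rule mod) (use X in auto)
  qed (rule seq)
qed

end

section \<open>Paths in graphs of bounded treedepth\<close>

definition gpath :: "'v cgraph \<Rightarrow> 'v list \<Rightarrow> bool" where
  "gpath G xs \<longleftrightarrow> distinct xs \<and> set xs \<subseteq> verts G \<and> successively (\<lambda>u v. {u, v} \<in> edges G) xs"

text \<open>The ancestors of a vertex form a chain. Hence the topmost vertex of a walk stays
  comparable with each vertex that is put in front, and one of the two is above everything.\<close>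

lemma forest_top:
  assumes F: "single_valued (F\<inverse>)"
  shows "xs \<noteq> [] \<Longrightarrow> successively (\<lambda>u v. (u, v) \<in> F\<^sup>+ \<or> (v, u) \<in> F\<^sup>+) xs \<Longrightarrow>
    \<exists>r\<in>set xs. \<forall>x\<in>set xs. (r, x) \<in> F\<^sup>*"
proof (induction xs)
  case (Cons x xs)
  show ?case
  proof (cases xs)
    case (Cons y ys)
    obtain r where r: "r \<in> set xs" "\<forall>z\<in>set xs. (r, z) \<in> F\<^sup>*" using Cons.IH Cons.prems by (auto simp: Cons)
    have ry: "(r, y) \<in> F\<^sup>*" using r(2) by (simp add: Cons)
    consider "(x, y) \<in> F\<^sup>+" | "(y, x) \<in> F\<^sup>+" using Cons.prems by (auto simp: Cons)
    then show ?thesis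
    proof cases
      case 1
      have "(y, r) \<in> (F\<inverse>)\<^sup>*" "(y, x) \<in> (F\<inverse>)\<^sup>*" using ry trancl_into_rtrancl[OF 1] by (simp_all add: rtrancl_converse)
      from single_valued_confluent[OF F this] have "(x, r) \<in> F\<^sup>* \<or> (r, x) \<in> F\<^sup>*" by (simp add: rtrancl_converse)
      then show ?thesis
      proof
        assume "(x, r) \<in> F\<^sup>*"
        then show ?thesis using r(2) by (intro bexI[of _ x]) (auto intro: rtrancl_trans)
      next
        assume "(r, x) \<in> F\<^sup>*"
        then show ?thesis using r by (intro bexI[of _ r]) auto
      qed
    next
      case 2
      have "(r, x) \<in> F\<^sup>*" using ry trancl_into_rtrancl[OF 2] by (rule rtrancl_trans)
      then show ?thesis using r by (intro bexI[of _ r]) auto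
    qed
  qed simp
qed simp

text \<open>The topmost vertex cuts the walk in two, and the longer half lies below it. Each link of
  the chain thus at most halves the length, whence the power of 2.\<close>

lemma forest_chain:
  assumes F: "single_valued (F\<inverse>)"
  shows "xs \<noteq> [] \<Longrightarrow> distinct xs \<Longrightarrow> successively (\<lambda>u v. (u, v) \<in> F\<^sup>+ \<or> (v, u) \<in> F\<^sup>+) xs \<Longrightarrow>
    \<exists>cs. cs \<noteq> [] \<and> set cs \<subseteq> set xs \<and> successively (\<lambda>u v. (u, v) \<in> F\<^sup>+) cs \<and> length xs < 2 ^ length cs"
proof (induction "length xs" arbitrary: xs rule: less_induct)
  case less
  obtain r where r: "r \<in> set xs" "\<And>x. x \<in> set xs \<Longrightarrow> (r, x) \<in> F\<^sup>*" using forest_top[OF F less.prems(1,3)] by blast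
  obtain ys zs where xs: "xs = ys @ r # zs" using r(1) by (auto simp: in_set_conv_decomp)
  define us where "us = (if length ys \<le> length zs then zs else ys)"
  have us: "length xs \<le> 2 * length us + 1" "set us \<subseteq> set xs" "r \<notin> set us" "length us < length xs" "distinct us"
    using less.prems(2) by (auto simp: us_def xs)
  have sus: "successively (\<lambda>u v. (u, v) \<in> F\<^sup>+ \<or> (v, u) \<in> F\<^sup>+) us"
    using less.prems(3) by (auto simp: us_def xs successively_append_iff successively_Cons)
  show ?case
  proof (cases "us = []")
    case True
    then show ?thesis using us(1) r(1) by (intro exI[of _ "[r]"]) auto
  next
    case False
    from less.hyps[OF us(4) False us(5) sus] obtain cs where
      cs: "cs \<noteq> []" "set cs \<subseteq> set us" "successively (\<lambda>u v. (u, v) \<in> F\<^sup>+) cs" "length us < 2 ^ length cs" by blast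
    have hcs: "hd cs \<in> set us" using cs(1,2) hd_in_set by blast
    then have "(r, hd cs) \<in> F\<^sup>*" "r \<noteq> hd cs" using r(2) us(2,3) by auto
    then have "(r, hd cs) \<in> F\<^sup>+" by (simp add: rtrancl_eq_or_trancl)
    then have "successively (\<lambda>u v. (u, v) \<in> F\<^sup>+) (r # cs)" using cs(1,3) by (cases cs) auto
    moreover have "set (r # cs) \<subseteq> set xs" using cs(2) us(2) r(1) by auto
    moreover have "length xs < 2 ^ length (r # cs)" using us(1) cs(4) by simp
    ultimately show ?thesis by blast
  qed
qed

lemma trancl_path:
  assumes "(u, v) \<in> F\<^sup>+"
  shows "\<exists>ps. ps \<noteq> [] \<and> successively (\<lambda>u v. (u, v) \<in> F) (u # ps) \<and> last ps = v"
  using assms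
proof (induction rule: trancl_induct)
  case (base y)
  then show ?case by (intro exI[of _ "[y]"]) simp
next
  case (step y z)
  then obtain ps where "ps \<noteq> []" "successively (\<lambda>u v. (u, v) \<in> F) (u # ps)" "last ps = y" by blast
  then show ?case using step(2)
    by (intro exI[of _ "ps @ [z]"]) (simp add: successively_append_iff flip: append_Cons)
qed

lemma chain_path:
  "cs \<noteq> [] \<Longrightarrow> successively (\<lambda>u v. (u, v) \<in> F\<^sup>+) cs \<Longrightarrow>
    \<exists>ps. ps \<noteq> [] \<and> hd ps = hd cs \<and> successively (\<lambda>u v. (u, v) \<in> F) ps \<and> length cs \<le> length ps"
proof (induction cs)
  case (Cons c cs)
  show ?case
  proof (cases cs)
    case Nil
    then show ?thesis by (intro exI[of _ "[c]"]) simp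
  next
    case (Cons d ds)
    obtain ps where ps: "ps \<noteq> []" "hd ps = d" "successively (\<lambda>u v. (u, v) \<in> F) ps" "length cs \<le> length ps"
      using Cons.IH Cons.prems by (auto simp: Cons)
    have "(c, d) \<in> F\<^sup>+" using Cons.prems by (simp add: Cons)
    from trancl_path[OF this] obtain qs where
      qs: "qs \<noteq> []" "successively (\<lambda>u v. (u, v) \<in> F) (c # qs)" "last qs = d" by blast
    have split: "qs = butlast qs @ [d]" using qs by (metis append_butlast_last_id)
    have "successively (\<lambda>u v. (u, v) \<in> F) ((c # butlast qs) @ [d])" using qs(2) split by simp
    then have "successively (\<lambda>u v. (u, v) \<in> F) ((c # butlast qs) @ ps)"
      using ps(1-3) unfolding successively_append_iff by (cases ps) auto
    then show ?thesis using ps by (intro exI[of _ "(c # butlast qs) @ ps"]) auto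
  qed
qed simp

lemma path_trancl: "successively (\<lambda>u v. (u, v) \<in> F) (x # xs) \<Longrightarrow> y \<in> set xs \<Longrightarrow> (x, y) \<in> F\<^sup>+"
proof (induction xs arbitrary: x)
  case (Cons z zs)
  then have xz: "(x, z) \<in> F" "successively (\<lambda>u v. (u, v) \<in> F) (z # zs)" by auto
  show ?case
  proof (cases "y = z")
    case False
    then have "(z, y) \<in> F\<^sup>+" using Cons.IH[OF xz(2)] Cons.prems(2) by simp
    then show ?thesis using xz(1) by (meson trancl_into_trancl2)
  qed (use xz in auto)
qed simp

lemma path_distinct: "acyclic F \<Longrightarrow> successively (\<lambda>u v. (u, v) \<in> F) xs \<Longrightarrow> distinct xs"
proof (induction xs)
  case (Cons x xs)
  have "x \<notin> set xs" using path_trancl[OF Cons.prems(2)] Cons.prems(1) unfolding acyclic_def by blast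
  moreover have "successively (\<lambda>u v. (u, v) \<in> F) xs" using Cons.prems(2) by (cases xs) auto
  ultimately show ?case using Cons by simp
qed simp

text \<open>A descending chain refines to a parent-child path, and a longest such path cannot be
  prolonged at either end, so it runs from a root to a leaf.\<close>

lemma chain_le_forest_depth:
  assumes F: "rooted_forest V F" "finite V" and cs: "cs \<noteq> []" "set cs \<subseteq> V" "successively (\<lambda>u v. (u, v) \<in> F\<^sup>+) cs"
  shows "length cs \<le> forest_depth V F"
proof -
  have FV: "F \<subseteq> V \<times> V" and ac: "acyclic F" using F by (auto simp: rooted_forest_def)
  define P where "P = {xs. xs \<noteq> [] \<and> set xs \<subseteq> V \<and> successively (\<lambda>u v. (u, v) \<in> F) xs}"
  have finP: "finite P"
  proof (rule finite_subset)
    show "P \<subseteq> {xs. set xs \<subseteq> V \<and> length xs \<le> card V}"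
    proof
      fix xs assume xs: "xs \<in> P"
      then have "distinct xs" using path_distinct[OF ac] by (simp add: P_def)
      then show "xs \<in> {xs. set xs \<subseteq> V \<and> length xs \<le> card V}"
        using xs card_mono[OF F(2), of "set xs"] by (auto simp: P_def distinct_card)
    qed
    show "finite {xs. set xs \<subseteq> V \<and> length xs \<le> card V}" by (rule finite_lists_length_le[OF F(2)])
  qed
  obtain ps where ps: "ps \<noteq> []" "hd ps = hd cs" "successively (\<lambda>u v. (u, v) \<in> F) ps" "length cs \<le> length ps"
    using chain_path[OF cs(1,3)] by blast
  have "set ps \<subseteq> V"
  proof
    fix y assume y: "y \<in> set ps"
    have hV: "hd ps \<in> V" using ps(2) cs(1,2) by (simp add: subset_iff)
    obtain p qs where pq: "ps = p # qs" using ps(1) by (cases ps) auto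
    have "y \<in> Range F" if "(p, y) \<in> F\<^sup>+" using that by (metis Range.intros tranclE)
    then show "y \<in> V" using y hV FV path_trancl[of F p qs y] ps(3) by (auto simp: pq)
  qed
  then have "ps \<in> P" using ps by (simp add: P_def)
  then have "Max (length ` P) \<in> length ` P" using finP by (intro Max_in) auto
  then obtain m where m: "m \<in> P" "length m = Max (length ` P)" by auto
  have max: "length xs \<le> length m" if "xs \<in> P" for xs using that finP by (simp add: m(2))
  have mP: "m \<noteq> []" "set m \<subseteq> V" "successively (\<lambda>u v. (u, v) \<in> F) m" using m(1) by (auto simp: P_def)
  have "hd m \<notin> Range F"
  proof
    assume "hd m \<in> Range F"
    then obtain u where u: "(u, hd m) \<in> F" by auto
    then have "u # m \<in> P" using mP FV by (cases m) (auto simp: P_def)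
    from max[OF this] show False by simp
  qed
  moreover have "last m \<notin> Domain F"
  proof
    assume "last m \<in> Domain F"
    then obtain u where u: "(last m, u) \<in> F" by auto
    then have "m @ [u] \<in> P" using mP FV by (auto simp: P_def successively_append_iff)
    from max[OF this] show False by simp
  qed
  ultimately have mr: "root_to_leaf_path V F m" using mP by (simp add: root_to_leaf_path_def)
  have "{xs. root_to_leaf_path V F xs} \<subseteq> P" by (auto simp: P_def root_to_leaf_path_def)
  then have "finite {xs. root_to_leaf_path V F xs}" using finP finite_subset by blast
  then have "length m \<le> forest_depth V F" unfolding forest_depth_def using mr by (intro Max_ge) auto
  then show ?thesis using max[OF \<open>ps \<in> P\<close>] ps(4) by simp
qed

text \<open>A single path through all vertices makes any two of them comparable. So the
  \<open>LEAST\<close> in the definition of treedepth is attained.\<close>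

lemma elimination_forest_exists:
  assumes "cgraph G"
  shows "\<exists>F. rooted_forest (verts G) F \<and> (\<forall>u v. {u, v} \<in> edges G \<longrightarrow> (u, v) \<in> F\<^sup>+ \<or> (v, u) \<in> F\<^sup>+)"
proof -
  have "finite (verts G)" using assms by (simp add: cgraph_def)
  then obtain vs where vs: "set vs = verts G" "distinct vs" using finite_distinct_list by blast
  define F where "F = {(vs ! i, vs ! Suc i) | i. Suc i < length vs}"
  have "F \<subseteq> inv_image less_than (idx vs)" using vs by (auto simp: F_def idx_nth)
  then have "wf F" by (meson wf_inv_image wf_less_than wf_subset)
  then have "acyclic F" by (rule wf_acyclic)
  moreover have "F \<subseteq> verts G \<times> verts G" unfolding vs(1)[symmetric] by (auto simp: F_def)
  moreover have "single_valued (F\<inverse>)"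
  proof (rule single_valuedI)
    fix x y z assume "(x, y) \<in> F\<inverse>" "(x, z) \<in> F\<inverse>"
    then obtain i j where "Suc i < length vs" "x = vs ! Suc i" "y = vs ! i" "Suc j < length vs" "x = vs ! Suc j" "z = vs ! j"
      by (auto simp: F_def)
    then show "y = z" using nth_eq_iff_index_eq[OF vs(2), of "Suc i" "Suc j"] by simp
  qed
  moreover have path: "(vs ! i, vs ! (i + Suc k)) \<in> F\<^sup>+" if "i + Suc k < length vs" for i k
    using that
  proof (induction k)
    case 0
    then show ?case by (intro r_into_trancl) (auto simp: F_def)
  next
    case (Suc k)
    have "(vs ! (i + Suc k), vs ! Suc (i + Suc k)) \<in> F" unfolding F_def using Suc.prems by (intro CollectI exI[of _ "i + Suc k"]) simp
    moreover have "(vs ! i, vs ! (i + Suc k)) \<in> F\<^sup>+" using Suc by simp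
    ultimately show ?case by (simp add: trancl.trancl_into_trancl)
  qed
  have "(u, v) \<in> F\<^sup>+ \<or> (v, u) \<in> F\<^sup>+" if e: "{u, v} \<in> edges G" for u v
  proof -
    have "{u, v} \<subseteq> verts G" "card {u, v} = 2" using assms e by (auto simp: cgraph_def)
    then have uv: "u \<in> set vs" "v \<in> set vs" "u \<noteq> v" using vs by auto
    obtain i j where ij: "i < length vs" "u = vs ! i" "j < length vs" "v = vs ! j"
      using uv by (auto simp: in_set_conv_nth)
    then have "i \<noteq> j" using uv by auto
    then consider k where "j = i + Suc k" | k where "i = j + Suc k" by (metis less_imp_Suc_add linorder_neqE_nat add_Suc_right)
    then show ?thesis by cases (use path ij in auto)
  qed
  ultimately show ?thesis by (auto simp: rooted_forest_def)
qed

theorem gpath_length: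
  assumes G: "cgraph G" and xs: "gpath G xs" shows "length xs < 2 ^ treedepth G"
proof (cases "xs = []")
  case False
  let ?P = "\<lambda>d. \<exists>F. rooted_forest (verts G) F \<and> (\<forall>u v. {u, v} \<in> edges G \<longrightarrow> (u, v) \<in> F\<^sup>+ \<or> (v, u) \<in> F\<^sup>+) \<and>
    forest_depth (verts G) F = d"
  have "?P (treedepth G)" unfolding treedepth_def by (rule LeastI_ex) (use elimination_forest_exists[OF G] in blast)
  then obtain F where F: "rooted_forest (verts G) F" "\<And>u v. {u, v} \<in> edges G \<Longrightarrow> (u, v) \<in> F\<^sup>+ \<or> (v, u) \<in> F\<^sup>+"
    "forest_depth (verts G) F = treedepth G" by blast
  have sv: "single_valued (F\<inverse>)" using F(1) by (simp add: rooted_forest_def)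
  have "successively (\<lambda>u v. (u, v) \<in> F\<^sup>+ \<or> (v, u) \<in> F\<^sup>+) xs"
    using xs F(2) successively_mono[of "\<lambda>u v. {u, v} \<in> edges G" xs "\<lambda>u v. (u, v) \<in> F\<^sup>+ \<or> (v, u) \<in> F\<^sup>+"]
    unfolding gpath_def by blast
  from forest_chain[OF sv False _ this] obtain cs where
    cs: "cs \<noteq> []" "set cs \<subseteq> set xs" "successively (\<lambda>u v. (u, v) \<in> F\<^sup>+) cs" "length xs < 2 ^ length cs"
    using xs unfolding gpath_def by blast
  have "length cs \<le> treedepth G"
    using chain_le_forest_depth[OF F(1) _ cs(1) _ cs(3)] cs(2) xs G F(3) by (auto simp: gpath_def cgraph_def)
  then have "(2::nat) ^ length cs \<le> 2 ^ treedepth G" by (simp add: power_increasing)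
  then show ?thesis using cs(4) by linarith
qed simp

section \<open>Depth-first search with pruning\<close>

type_synonym 'v dfs_state = "'v list \<times> 'v list \<times> (bt \<times> 'v list) list list"

definition attach :: "(bt \<Rightarrow> nat) \<Rightarrow> bt \<times> 'v list \<Rightarrow> (bt \<times> 'v list) list \<Rightarrow> (bt \<times> 'v list) list" where
  "attach thr c cs = (if length (filter (\<lambda>d. fst d = fst c) cs) < 2 ^ thr (fst c) then c # cs else cs)"

text \<open>The size of this tree bounds the vertices of the subtree (\<open>ok_length_size\<close>)
  and the edges that meet it (\<open>ok_edges_size\<close>), so the type itself tells how many
  copies to keep.\<close>

definition subtree_type :: "('v \<Rightarrow> 'v \<Rightarrow> bool) \<Rightarrow> ('v \<Rightarrow> bool list) \<Rightarrow> 'v \<Rightarrow> 'v list \<Rightarrow> (bt \<times> 'v list) list \<Rightarrow> bt" where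
  "subtree_type adj info v p cs = enc ((map (adj v) p, info v), map fst cs)"

text \<open>A state consists of the visited vertices, the current path (deepest vertex first), and for
  every vertex on it, and finally for the virtual root, the finished subtrees below it. A finished
  subtree is a type together with its vertices in preorder.\<close>

definition dfs_step :: "'v list \<Rightarrow> ('v \<Rightarrow> 'v \<Rightarrow> bool) \<Rightarrow> ('v \<Rightarrow> bool list) \<Rightarrow> (bt \<Rightarrow> nat) \<Rightarrow> 'v dfs_state \<Rightarrow> 'v dfs_state" where
  "dfs_step vs adj info thr st = (let vis = fst st; path = fst (snd st); css = snd (snd st) in
    (case filter (\<lambda>w. w \<notin> set vis \<and> (case path of [] \<Rightarrow> True | v # p \<Rightarrow> adj v w)) vs of
      w # ws \<Rightarrow> (w # vis, w # path, [] # css)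
    | [] \<Rightarrow> (case path of [] \<Rightarrow> st | v # p \<Rightarrow> (case css of [] \<Rightarrow> st | cs # css' \<Rightarrow> (case css' of [] \<Rightarrow> st
        | cs' # css'' \<Rightarrow> (vis, p, attach thr (subtree_type adj info v p cs, v # concat (map snd cs)) cs' # css''))))))"

section \<open>Counting types, and the subtrees that the search leaves\<close>

lemma card_bt_size: "card {x. bt_size x \<le> n} \<le> 2 ^ 2 ^ n"
proof -
  \<comment> \<open>A tree is \<open>Lf\<close> or a pair of smaller trees, so a count
    \<open>a\<close> is followed by at most \<open>a * a + 1\<close>. The added 1 turns this into
    plain squaring, which \<open>2 ^ 2 ^ n\<close> matches.\<close>
  have "card {x. bt_size x \<le> n} + 1 \<le> 2 ^ 2 ^ n"
  proof (induction n)
    case 0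
    have "{x. bt_size x \<le> 0} = {}" by (simp add: bt_size_neq_0)
    then have "card {x. bt_size x \<le> 0} = 0" by (simp only: card.empty)
    then show ?case by simp
  next
    case (Suc n)
    let ?A = "{x. bt_size x \<le> n}"
    have "{x. bt_size x \<le> Suc n} \<subseteq> insert Lf ((\<lambda>(l, r). Br l r) ` (?A \<times> ?A))"
    proof
      fix x assume "x \<in> {x. bt_size x \<le> Suc n}"
      then show "x \<in> insert Lf ((\<lambda>(l, r). Br l r) ` (?A \<times> ?A))"
        by (cases x) (auto simp: image_iff)
    qed
    then have "card {x. bt_size x \<le> Suc n} \<le> card (insert Lf ((\<lambda>(l, r). Br l r) ` (?A \<times> ?A)))"
      by (rule card_mono[rotated]) (simp add: finite_bt_size)
    also have "\<dots> \<le> Suc (card ((\<lambda>(l, r). Br l r) ` (?A \<times> ?A)))" by (simp add: card_insert_if finite_bt_size)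
    also have "\<dots> \<le> Suc (card (?A \<times> ?A))" using card_image_le[of "?A \<times> ?A"] by (simp add: finite_bt_size)
    finally have 1: "card {x. bt_size x \<le> Suc n} \<le> Suc (card ?A * card ?A)" by (simp add: card_cartesian_product)
    define a where "a = card ?A"
    have "(a + 1) * (a + 1) \<le> 2 ^ 2 ^ n * 2 ^ 2 ^ n" using Suc unfolding a_def by (intro mult_mono) auto
    also have "\<dots> = (2::nat) ^ 2 ^ Suc n" by (simp flip: power_add add: mult_2)
    finally have "(a + 1) * (a + 1) \<le> 2 ^ 2 ^ Suc n" .
    moreover have "card {x. bt_size x \<le> Suc n} + 1 \<le> 2 + a * a" using 1 by (simp add: a_def)
    ultimately show ?case
    proof (cases "a = 0")
      case True
      then have "card {x. bt_size x \<le> Suc n} + 1 \<le> 2" using 1 by (simp add: a_def)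
      also have "(2::nat) \<le> 2 ^ 2 ^ Suc n" using power_increasing[of 1 "2 ^ Suc n" "2::nat"] by simp
      finally show ?thesis .
    qed (simp add: algebra_simps)
  qed
  then show ?thesis by simp
qed

lemma length_le_count_sum:
  fixes xs :: "bt list"
  assumes "\<And>x. x \<in> set xs \<Longrightarrow> bt_size x \<le> M" "\<And>x. x \<in> set xs \<Longrightarrow> length (filter (\<lambda>y. y = x) xs) \<le> C"
  shows "length xs \<le> 2 ^ 2 ^ M * C"
proof -
  have "length xs = (\<Sum>x\<in>set xs. count_list xs x)" by (simp add: sum_count_set)
  also have "\<dots> \<le> (\<Sum>x\<in>set xs. C)"
  proof (rule sum_mono)
    fix x assume "x \<in> set xs"
    moreover have "(\<lambda>y. y = x) = (=) x" by (rule ext) auto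
    ultimately show "count_list xs x \<le> C" using assms(2)[of x] by (simp add: count_list_eq_length_filter)
  qed
  also have "\<dots> = card (set xs) * C" by simp
  also have "\<dots> \<le> 2 ^ 2 ^ M * C"
  proof (rule mult_le_mono1)
    have "card (set xs) \<le> card {x. bt_size x \<le> M}" using assms(1) by (intro card_mono finite_bt_size) auto
    then show "card (set xs) \<le> 2 ^ 2 ^ M" using card_bt_size[of M] by simp
  qed
  finally show ?thesis .
qed

text \<open>For an involution, preservation in one direction already gives equality.\<close>

lemma gmap_eqI:
  assumes cg: "cgraph H" and inv: "\<And>x. x \<in> verts H \<Longrightarrow> h (h x) = x" and V: "\<And>x. x \<in> verts H \<Longrightarrow> h x \<in> verts H"
    and E: "\<And>x y. x \<in> verts H \<Longrightarrow> y \<in> verts H \<Longrightarrow> {x, y} \<in> edges H \<Longrightarrow> {h x, h y} \<in> edges H"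
    and C: "\<And>C x. C \<in> set (colors H) \<Longrightarrow> x \<in> C \<Longrightarrow> h x \<in> C"
  shows "gmap h H = H"
proof -
  have "verts (gmap h H) = verts H" using inv V by (force simp: image_iff)
  moreover have img: "h ` h ` X = X" if "X \<subseteq> verts H" for X
    using that inv by (force simp: image_iff subset_iff)
  have e1: "h ` e \<in> edges H" if "e \<in> edges H" for e
  proof -
    have "card e = 2" "e \<subseteq> verts H" using cg that by (auto simp: cgraph_def)
    then obtain x y where "e = {x, y}" "x \<in> verts H" "y \<in> verts H" by (auto simp: card_2_iff)
    then show ?thesis using E[of x y] that by simp
  qed
  have "edges (gmap h H) = edges H"
  proof
    show "edges (gmap h H) \<subseteq> edges H" using e1 by auto
    show "edges H \<subseteq> edges (gmap h H)"
    proof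
      fix e assume e: "e \<in> edges H"
      then have "e \<subseteq> verts H" using cg by (auto simp: cgraph_def)
      then have "e = h ` (h ` e)" using img by simp
      then show "e \<in> edges (gmap h H)" using e1[OF e] unfolding gmap_simps by (rule image_eqI)
    qed
  qed
  moreover have "colors (gmap h H) = colors H"
    unfolding gmap_simps
  proof (rule map_idI)
    fix K assume K: "K \<in> set (colors H)"
    then have "K \<subseteq> verts H" using cg by (auto simp: cgraph_def)
    then have "h ` h ` K = K" by (rule img)
    moreover have "h ` K \<subseteq> K" using C[OF K] by blast
    ultimately show "h ` K = K" by blast
  qed
  ultimately show ?thesis by (intro cgraph.equality) auto
qed

text \<open>\<open>U\<close> is the set of vertices not yet deleted and \<open>anc\<close> the path
  to the root. The closure clause forbids edges between different children, which makes equal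
  children interchangeable.\<close>

inductive pruned_subtree :: "('v \<Rightarrow> 'v \<Rightarrow> bool) \<Rightarrow> ('v \<Rightarrow> bool list) \<Rightarrow> (bt \<Rightarrow> nat) \<Rightarrow> nat \<Rightarrow> 'v set \<Rightarrow> 'v list \<Rightarrow> bt \<Rightarrow> 'v list \<Rightarrow> bool"
  for adj info thr P U where
  pruned_subtreeI: "length anc < P \<Longrightarrow> v \<in> U \<Longrightarrow> v \<notin> set anc \<Longrightarrow>
    (\<And>c. c \<in> set cs \<Longrightarrow> pruned_subtree adj info thr P U (v # anc) (fst c) (snd c)) \<Longrightarrow>
    (\<And>c x y. c \<in> set cs \<Longrightarrow> x \<in> set (snd c) \<Longrightarrow> y \<in> U \<Longrightarrow> adj x y \<Longrightarrow> y \<in> set (snd c) \<or> y \<in> set (v # anc)) \<Longrightarrow>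
    (\<And>c. c \<in> set cs \<Longrightarrow> length (filter (\<lambda>d. fst d = fst c) cs) \<le> 2 ^ thr (fst c)) \<Longrightarrow>
    distinct (v # concat (map snd cs)) \<Longrightarrow> set (concat (map snd cs)) \<inter> set anc = {} \<Longrightarrow>
    pruned_subtree adj info thr P U anc (subtree_type adj info v anc cs) (v # concat (map snd cs))"

text \<open>In the exponent \<open>thr t\<close>, the part \<open>(bt_size t + 1) * q\<close> is
  what deletion of a block with \<open>w = bt_size t\<close> requires, and \<open>r\<close> makes
  room for the copies that tokens touch. \<open>P\<close> bounds the depth of the search.\<close>

locale dfs =
  fixes G :: "'v cgraph" and \<phi> :: mso2 and S S' :: "'v set" and vs :: "'v list" and adj :: "'v \<Rightarrow> 'v \<Rightarrow> bool"
    and info :: "'v \<Rightarrow> bool list" and thr :: "bt \<Rightarrow> nat" and q r I P :: nat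
  assumes cg: "cgraph G" and vs: "set vs = verts G" "distinct vs"
    and adj: "\<And>u v. adj u v \<longleftrightarrow> {u, v} \<in> edges G"
    and form: "formula_of_set G \<phi>" and S: "S \<subseteq> verts G" "S' \<subseteq> verts G" "card S' = card S"
    and info_colors: "\<And>u v C. info u = info v \<Longrightarrow> C \<in> set (colors G) \<Longrightarrow> u \<in> C \<Longrightarrow> v \<in> C"
    and info_S: "\<And>u v. info u = info v \<Longrightarrow> u \<in> S \<Longrightarrow> v \<in> S" "\<And>u v. info u = info v \<Longrightarrow> u \<in> S' \<Longrightarrow> v \<in> S'"
    and info_length: "\<And>v. length (info v) \<le> I"
    and thr: "\<And>t. thr t = (bt_size t + 1) * q + r" and q: "nodes \<phi> \<le> q" and r: "card S + 3 \<le> r"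
    and P: "\<And>xs. gpath G xs \<Longrightarrow> length xs \<le> P"
begin

abbreviation ok :: "'v set \<Rightarrow> 'v list \<Rightarrow> bt \<Rightarrow> 'v list \<Rightarrow> bool" where "ok \<equiv> pruned_subtree adj info thr P"

lemma adj_sym: "adj u v \<Longrightarrow> adj v u" by (simp add: adj insert_commute)

lemma adj_irrefl: "\<not> adj v v"
  using cg by (auto simp: adj cgraph_def)

definition closed :: "'v set \<Rightarrow> 'v list \<Rightarrow> 'v list \<Rightarrow> bool" where
  "closed U anc ns \<longleftrightarrow> (\<forall>x\<in>set ns. \<forall>y\<in>U. adj x y \<longrightarrow> y \<in> set ns \<or> y \<in> set anc)"

lemma closedD: "closed U anc ns \<Longrightarrow> x \<in> set ns \<Longrightarrow> y \<in> U \<Longrightarrow> adj x y \<Longrightarrow> y \<in> set ns \<or> y \<in> set anc"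
  unfolding closed_def by blast

lemma closed_mono: "closed U anc ns \<Longrightarrow> U' \<subseteq> U \<Longrightarrow> closed U' anc ns"
  unfolding closed_def by blast

lemma ok_subset: "ok U anc t ns \<Longrightarrow> set ns \<subseteq> U \<and> set ns \<inter> set anc = {} \<and> distinct ns \<and> ns \<noteq> []"
proof (induction rule: pruned_subtree.induct)
  case (pruned_subtreeI anc v cs)
  have "set (concat (map snd cs)) \<subseteq> U" using pruned_subtreeI.IH by fastforce
  then show ?case using pruned_subtreeI.hyps(2,3,7,8) by auto
qed

lemma ok_mono: "ok U anc t ns \<Longrightarrow> U' \<subseteq> U \<Longrightarrow> set ns \<subseteq> U' \<Longrightarrow> ok U' anc t ns"
proof (induction rule: pruned_subtree.induct)
  case (pruned_subtreeI anc v cs)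
  show ?case
  proof (rule pruned_subtree.pruned_subtreeI[OF pruned_subtreeI(1) _ pruned_subtreeI(3)])
    show "v \<in> U'" using pruned_subtreeI.prems by simp
    show "pruned_subtree adj info thr P U' (v # anc) (fst c) (snd c)" if "c \<in> set cs" for c
    proof -
      have "set (snd c) \<subseteq> U'" using pruned_subtreeI.prems(2) that by auto
      then show ?thesis using pruned_subtreeI.IH[OF that] pruned_subtreeI.prems(1) by blast
    qed
    show "y \<in> set (snd c) \<or> y \<in> set (v # anc)" if "c \<in> set cs" "x \<in> set (snd c)" "y \<in> U'" "adj x y" for c x y
      using pruned_subtreeI.hyps(5)[OF that(1,2) _ that(4)] that(3) pruned_subtreeI.prems(1) by blast
  qed (use pruned_subtreeI.hyps in auto)
qed

lemma ok_length_size: "ok U anc t ns \<Longrightarrow> length ns \<le> bt_size t"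
proof (induction rule: pruned_subtree.induct)
  case (pruned_subtreeI anc v cs)
  have "sum_list (map (\<lambda>c. length (snd c)) cs) \<le> sum_list (map (\<lambda>c. Suc (sz (fst c))) cs)"
    using pruned_subtreeI.IH by (intro sum_list_mono) (auto intro: le_SucI)
  then show ?case by (simp add: subtree_type_def length_concat sz_list comp_def)
qed

lemma finite_edges: "finite (edges G)"
proof -
  have "edges G \<subseteq> Pow (verts G)" "finite (verts G)" using cg by (auto simp: cgraph_def)
  then show ?thesis by (meson finite_Pow_iff finite_subset)
qed

text \<open>An edge that meets the subtree and none of the child subtrees joins the root
  \<open>v\<close> to an ancestor, hence has an entry in the adjacency row of \<open>v\<close>. So
  the rows inside the type count all edges.\<close>

lemma ok_edges_size:
  "ok U anc t ns \<Longrightarrow> closed U anc ns \<Longrightarrow> card {e \<in> edges G. e \<subseteq> U \<and> e \<inter> set ns \<noteq> {}} \<le> bt_size t"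
proof (induction rule: pruned_subtree.induct)
  case (pruned_subtreeI anc v cs)
  let ?E = "\<lambda>ns. {e \<in> edges G. e \<subseteq> U \<and> e \<inter> set ns \<noteq> {}}"
  have sub: "?E (v # concat (map snd cs)) \<subseteq> (\<lambda>a. {v, a}) ` set anc \<union> (\<Union>c\<in>set cs. ?E (snd c))"
  proof
    fix e assume e: "e \<in> ?E (v # concat (map snd cs))"
    show "e \<in> (\<lambda>a. {v, a}) ` set anc \<union> (\<Union>c\<in>set cs. ?E (snd c))"
    proof (cases "\<exists>c\<in>set cs. e \<inter> set (snd c) \<noteq> {}")
      case True
      then show ?thesis using e by blast
    next
      case False
      then have v: "v \<in> e" and nc: "e \<inter> set (concat (map snd cs)) = {}" using e by auto
      have "card e = 2" using e cg by (auto simp: cgraph_def)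
      then obtain y where y: "e = {v, y}" "v \<noteq> y" using v by (auto simp: card_2_iff doubleton_eq_iff)
      have "adj v y" "y \<in> U" using e y by (auto simp: adj)
      then have "y \<in> set (v # concat (map snd cs)) \<or> y \<in> set anc"
        by (intro closedD[OF pruned_subtreeI.prems]) auto
      then have "y \<in> set anc" using nc y by auto
      then show ?thesis using y by blast
    qed
  qed
  have fin: "finite (?E ns)" for ns using finite_edges by simp
  have "card (?E (snd c)) \<le> bt_size (fst c)" if "c \<in> set cs" for c
  proof -
    have "closed U (v # anc) (snd c)" unfolding closed_def using pruned_subtreeI.hyps(5)[OF that] by blast
    then show ?thesis using pruned_subtreeI.IH[OF that] by blast
  qed
  then have a: "(\<Sum>c\<in>set cs. card (?E (snd c))) \<le> (\<Sum>c\<in>set cs. bt_size (fst c))" by (rule sum_mono)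
  have b: "(\<Sum>c\<in>set cs. bt_size (fst c)) \<le> (\<Sum>c\<leftarrow>cs. bt_size (fst c))" for cs :: "(bt \<times> 'v list) list"
    by (induction cs) (auto simp: sum.insert_if intro: le_trans le_add2)
  have "card (?E (v # concat (map snd cs))) \<le> card ((\<lambda>a. {v, a}) ` set anc \<union> (\<Union>c\<in>set cs. ?E (snd c)))"
    by (rule card_mono[OF _ sub]) (use fin in auto)
  also have "\<dots> \<le> card ((\<lambda>a. {v, a}) ` set anc) + card (\<Union>c\<in>set cs. ?E (snd c))" by (rule card_Un_le)
  also have "\<dots> \<le> length anc + (\<Sum>c\<leftarrow>cs. bt_size (fst c))"
  proof (rule add_mono)
    show "card ((\<lambda>a. {v, a}) ` set anc) \<le> length anc"
      using card_image_le[of "set anc" "\<lambda>a. {v, a}"] card_length[of anc] by simp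
    show "card (\<Union>c\<in>set cs. ?E (snd c)) \<le> (\<Sum>c\<leftarrow>cs. bt_size (fst c))"
      using card_UN_le[of "set cs" "\<lambda>c. ?E (snd c)"] a b[of cs] by simp
  qed
  also have "\<dots> \<le> bt_size (subtree_type adj info v anc cs)"
  proof -
    have "length anc \<le> sz (map (adj v) anc)" using length_le_sz[of "map (adj v) anc"] by simp
    moreover have "(\<Sum>c\<leftarrow>cs. bt_size (fst c)) \<le> sz (map fst cs)" by (induction cs) auto
    ultimately show ?thesis by (simp add: subtree_type_def)
  qed
  finally show ?case .
qed

text \<open>Vertices correspond by their positions in preorder. Edges within a child agree by
  induction, edges to ancestors by the adjacency rows, and between different children there are none
  on either side.\<close>

lemma ok_iso:
  "ok U anc t ns \<Longrightarrow> ok U anc' t ns' \<Longrightarrow> length anc = length anc' \<Longrightarrow>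
   length ns = length ns' \<and> (\<forall>(x, x')\<in>set (zip ns ns'). info x = info x' \<and>
      (\<forall>(y, y')\<in>set (zip ns ns') \<union> set (zip anc anc'). adj x y \<longleftrightarrow> adj x' y'))"
proof (induction arbitrary: anc' ns' rule: pruned_subtree.induct)
  case (pruned_subtreeI anc v cs)
  from pruned_subtreeI.prems(1) obtain v' cs' where
    t: "subtree_type adj info v anc cs = subtree_type adj info v' anc' cs'" and ns': "ns' = v' # concat (map snd cs')"
    and ok': "\<And>c. c \<in> set cs' \<Longrightarrow> ok U (v' # anc') (fst c) (snd c)"
    and cl': "\<And>c x y. c \<in> set cs' \<Longrightarrow> x \<in> set (snd c) \<Longrightarrow> y \<in> U \<Longrightarrow> adj x y \<Longrightarrow> y \<in> set (snd c) \<or> y \<in> set (v' # anc')"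
    and dist': "distinct (v' # concat (map snd cs'))" and dj': "set (concat (map snd cs')) \<inter> set anc' = {}"
    by (cases rule: pruned_subtree.cases) blast
  from t have lab: "map (adj v) anc = map (adj v') anc'" "info v = info v'" "map fst cs = map fst cs'"
    by (auto simp: subtree_type_def simp del: enc_Pair)
  define n where "n = length cs"
  have n': "length cs' = n" using lab(3) map_eq_imp_length_eq by (fastforce simp: n_def)
  define Z where "Z i = set (zip (snd (cs ! i)) (snd (cs' ! i)))" for i
  define A where "A = set (zip anc anc')"
  have IH: "length (snd (cs ! i)) = length (snd (cs' ! i)) \<and> (\<forall>(x, x')\<in>Z i. info x = info x' \<and>
      (\<forall>(y, y')\<in>Z i \<union> insert (v, v') A. adj x y \<longleftrightarrow> adj x' y'))" if i: "i < n" for i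
  proof -
    have "cs ! i \<in> set cs" "cs' ! i \<in> set cs'" using i n' by (auto simp: n_def)
    moreover have "fst (cs ! i) = fst (cs' ! i)" using lab(3) i n' by (metis n_def nth_map)
    ultimately show ?thesis using pruned_subtreeI.IH[of "cs ! i" "v' # anc'" "snd (cs' ! i)"] ok'[of "cs' ! i"] pruned_subtreeI.prems(2)
      by (simp add: Z_def A_def)
  qed
  have len: "length (concat (map snd cs)) = length (concat (map snd cs'))"
  proof -
    have "map (length \<circ> snd) cs = map (length \<circ> snd) cs'"
      by (rule nth_equalityI) (use IH n' in \<open>auto simp: n_def\<close>)
    then show ?thesis by (simp add: length_concat)
  qed
  have zc: "set (zip (concat (map snd cs)) (concat (map snd cs'))) = (\<Union>i<n. Z i)"
  proof -
    have eqlen: "map length (map snd cs) = map length (map snd cs')"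
      by (rule nth_equalityI) (use IH n' in \<open>auto simp: n_def\<close>)
    have *: "map length xss = map length yss \<Longrightarrow>
        set (zip (concat xss) (concat yss)) = (\<Union>i<length xss. set (zip (xss ! i) (yss ! i)))" for xss yss :: "'v list list"
    proof (induction xss arbitrary: yss)
      case (Cons xs xss)
      then obtain ys yss' where yss: "yss = ys # yss'" "length xs = length ys" "map length xss = map length yss'"
        by (cases yss) auto
      have "(\<Union>i<Suc (length xss). set (zip ((xs # xss) ! i) ((ys # yss') ! i))) =
         set (zip xs ys) \<union> (\<Union>i<length xss. set (zip (xss ! i) (yss' ! i)))"
        by (subst lessThan_Suc_eq_insert_0) (auto simp: image_iff)
      then show ?case using Cons.IH[OF yss(3)] yss(1,2) by simp
    qed simp
    show ?thesis using *[OF eqlen] n' by (simp add: n_def Z_def)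
  qed
  define T where "T = (\<Union>i<n. Z i)"
  have AZ: "adj v y \<longleftrightarrow> adj v' y'" if "(y, y') \<in> A" for y y'
  proof -
    obtain k where "k < length anc" "y = anc ! k" "y' = anc' ! k" using \<open>(y, y') \<in> A\<close> unfolding A_def
      by (auto simp: in_set_zip)
    then show ?thesis using lab(1) pruned_subtreeI.prems(2) by (metis nth_map)
  qed
  have VT: "(adj x v \<longleftrightarrow> adj x' v') \<and> info x = info x'" if "(x, x') \<in> T" for x x'
    using that IH unfolding T_def by fastforce
  have TA: "adj x y \<longleftrightarrow> adj x' y'" if "(x, x') \<in> T" "(y, y') \<in> A" for x x' y y'
    using that IH unfolding T_def by fastforce
  \<comment> \<open>For two different children the closure clause would put \<open>y\<close> into
    the child of \<open>x\<close> or among the ancestors; disjointness excludes both, so neither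
    adjacency holds.\<close>
  have TT: "adj x y \<longleftrightarrow> adj x' y'" if xyT: "(x, x') \<in> T" "(y, y') \<in> T" for x x' y y'
  proof -
    obtain i j where ij: "i < n" "(x, x') \<in> Z i" "j < n" "(y, y') \<in> Z j" using xyT unfolding T_def by blast
    show ?thesis
    proof (cases "i = j")
      case True
      then show ?thesis using IH[OF ij(1)] ij by fastforce
    next
      case False
      have mem: "cs ! i \<in> set cs" "cs ! j \<in> set cs" "cs' ! i \<in> set cs'" "cs' ! j \<in> set cs'" using ij n' by (auto simp: n_def)
      have x: "x \<in> set (snd (cs ! i))" "y \<in> set (snd (cs ! j))" "x' \<in> set (snd (cs' ! i))" "y' \<in> set (snd (cs' ! j))"
        using ij unfolding Z_def by (meson set_zip_leftD set_zip_rightD)+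
      have disj: "set (snd (ds ! i)) \<inter> set (snd (ds ! j)) = {}"
        if "distinct (concat (map snd ds))" "length ds = n" for ds :: "(bt \<times> 'v list) list"
      proof -
        have *: "k < length xss \<Longrightarrow> l < length xss \<Longrightarrow> k < l \<Longrightarrow> distinct (concat xss) \<Longrightarrow> set (xss ! k) \<inter> set (xss ! l) = {}" for k l and xss :: "'v list list"
        proof (induction xss arbitrary: k l)
          case (Cons xs xss)
          then obtain l' where l: "l = Suc l'" by (cases l) auto
          show ?case
          proof (cases k)
            case 0
            have "xss ! l' \<in> set xss" using Cons.prems l by simp
            then show ?thesis using Cons.prems(4) by (auto simp: 0 l)
          next
            case (Suc k')
            then show ?thesis using Cons l by simp
          qed
        qed simp
        show ?thesis using *[of i "map snd ds" j] *[of j "map snd ds" i] that ij False by (cases "i < j") auto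
      qed
      have U: "y \<in> U" "y' \<in> U" using ok_subset[OF pruned_subtreeI.hyps(4)] ok_subset[OF ok'] mem x pruned_subtreeI ok_subset by blast+
      have "\<not> adj x y"
      proof
        assume "adj x y"
        then have "y \<in> set (snd (cs ! i)) \<or> y \<in> set (v # anc)" using pruned_subtreeI.hyps(5)[OF mem(1) x(1) U(1)] by blast
        moreover have "y \<in> set (concat (map snd cs))" using mem(2) x(2) by auto
        ultimately show False using disj[of cs] pruned_subtreeI.hyps x by (auto simp: n_def)
      qed
      moreover have "\<not> adj x' y'"
      proof
        assume "adj x' y'"
        then have "y' \<in> set (snd (cs' ! i)) \<or> y' \<in> set (v' # anc')" using cl'[OF mem(3) x(3) U(2)] by blast
        moreover have "y' \<in> set (concat (map snd cs'))" using mem(4) x(4) by auto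
        ultimately show False using disj[of cs'] dist' dj' n' x by auto
      qed
      ultimately show ?thesis by simp
    qed
  qed
  have Z: "set (zip (v # concat (map snd cs)) ns') = insert (v, v') T" using zc by (simp add: ns' T_def)
  have VT': "adj v x \<longleftrightarrow> adj v' x'" if "(x, x') \<in> T" for x x'
    using VT[OF that] adj_sym by blast
  have *: "info x = info x' \<and> (adj x y \<longleftrightarrow> adj x' y')"
    if xx: "(x, x') \<in> insert (v, v') T" and yy: "(y, y') \<in> insert (v, v') T \<union> A" for x x' y y'
  proof (cases "(x, x') \<in> T")
    case True
    then show ?thesis using VT[OF True] TT[OF True] TA[OF True] yy by blast
  next
    case False
    then have "x = v" "x' = v'" using xx by auto
    moreover have "y = v \<and> y' = v' \<or> (y, y') \<in> T \<or> (y, y') \<in> A" using yy by blast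
    ultimately show ?thesis using lab(2) VT'[of y y'] AZ[of y y'] adj_irrefl[of v] adj_irrefl[of v'] by metis
  qed
  have "\<forall>(x, x')\<in>insert (v, v') T. info x = info x' \<and> (\<forall>(y, y')\<in>insert (v, v') T \<union> A. adj x y \<longleftrightarrow> adj x' y')"
  proof (intro ballI, clarify, intro conjI ballI)
    fix x x' assume x: "(x, x') \<in> insert (v, v') T"
    show "info x = info x'" using *[OF x, of v v'] by simp
    fix z assume "z \<in> insert (v, v') T \<union> A"
    then show "case z of (y, y') \<Rightarrow> adj x y \<longleftrightarrow> adj x' y'" using *[OF x, of "fst z" "snd z"] by (cases z) simp
  qed
  then show ?case using len by (simp only: Z flip: A_def) (simp add: ns')
qed

text \<open>Sibling subtrees of one type satisfy the locale \<open>blocks\<close>, with the size of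
  the type as \<open>w\<close>. The exchange of two of them preserves labels, hence colours and
  membership in the input sets.\<close>

lemma ok_block_facts:
  assumes L: "\<And>l. l \<in> set L \<Longrightarrow> ok U p t l \<and> closed U p l" "distinct (concat L)" and U: "U \<subseteq> verts G" and ns: "ns \<in> set L"
  shows "blocks (set L) (length ns) (restr G U) (bt_size t)" "card (set L) = length L"
    "\<And>l l' x. l \<in> set L \<Longrightarrow> l' \<in> set L \<Longrightarrow> x \<in> set l \<Longrightarrow> sw l l' x \<in> set l' \<and> info (sw l l' x) = info x"
proof -
  have okL: "ok U p t l" "closed U p l" "set l \<subseteq> U" "set l \<inter> set p = {}" "distinct l" "l \<noteq> []" if "l \<in> set L" for l
    using L(1)[OF that] ok_subset[of U p t l] by auto
  have "removeAll [] L = L" using okL(6) by (metis removeAll_id)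
  then have dL: "distinct L" and disj: "\<And>l l'. l \<in> set L \<Longrightarrow> l' \<in> set L \<Longrightarrow> l \<noteq> l' \<Longrightarrow> set l \<inter> set l' = {}"
    using L(2) unfolding distinct_concat_iff by metis+
  show "card (set L) = length L" by (rule distinct_card[OF dL])
  have len: "length l = length l'" if "l \<in> set L" "l' \<in> set L" for l l'
    using ok_iso[OF okL(1)[OF that(1)] okL(1)[OF that(2)]] by simp
  interpret B: disjoint_lists "set L" "length ns"
  proof
    show "length l = length ns" if "l \<in> set L" for l by (rule len[OF that ns])
  qed (use okL(5) disj in blast)+
  have zip: "(x, sw l l' x) \<in> set (zip l l')" if l: "l \<in> set L" "l' \<in> set L" "x \<in> set l" for l l' x
  proof -
    have "idx l x < length l" "x = l ! idx l x" using idx_props[OF l(3)] by auto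
    moreover have "sw l l' x = l' ! idx l x" using l(3) by (simp add: sw_def)
    ultimately show ?thesis using len[OF l(1,2)] by (metis in_set_zip fst_conv snd_conv)
  qed
  have iso: "info x = info (sw l l' x)" "\<And>y. y \<in> U \<Longrightarrow> adj x y \<Longrightarrow> adj (sw l l' x) (sw l l' y)"
    if l: "l \<in> set L" "l' \<in> set L" "x \<in> set l" for l l' x
  proof -
    have I: "\<forall>(x, x')\<in>set (zip l l'). info x = info x' \<and>
      (\<forall>(y, y')\<in>set (zip l l') \<union> set (zip p p). adj x y \<longleftrightarrow> adj x' y')"
      using ok_iso[OF okL(1)[OF l(1)] okL(1)[OF l(2)]] by simp
    then show "info x = info (sw l l' x)" using zip[OF l] by blast
    show "adj (sw l l' x) (sw l l' y)" if y: "y \<in> U" "adj x y" for y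
    proof -
      have "(y, sw l l' y) \<in> set (zip l l') \<union> set (zip p p)"
      proof (cases "y \<in> set l")
        case True
        then show ?thesis using zip[OF l(1,2)] by blast
      next
        case False
        then have yp: "y \<in> set p" using closedD[OF okL(2)[OF l(1)] l(3) y] by blast
        then have "sw l l' y = y" using okL(4)[OF l(1)] okL(4)[OF l(2)] by (intro B.sw_out) auto
        then show ?thesis using yp by (auto simp: in_set_conv_nth in_set_zip)
      qed
      then show ?thesis using I zip[OF l] y(2) by blast
    qed
  qed
  show "sw l l' x \<in> set l' \<and> info (sw l l' x) = info x" if "l \<in> set L" "l' \<in> set L" "x \<in> set l" for l l' x
    using iso(1)[OF that] zip[OF that] by (metis set_zip_rightD)
  show "blocks (set L) (length ns) (restr G U) (bt_size t)"
  proof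
    show "cgraph (restr G U)" by (rule cgraph_restr[OF cg])
    show "length ns \<le> bt_size t" using ok_length_size okL(1)[OF ns] by blast
    show "card {e \<in> edges (restr G U). touch l e} \<le> bt_size t" if "l \<in> set L" for l
      using ok_edges_size[OF okL(1)[OF that] okL(2)[OF that]] by (simp add: touch_def conj_assoc)
    show "l = l'" if l: "l \<in> set L" "l' \<in> set L" and e: "e \<in> edges (restr G U)" "touch l e" "touch l' e" for l l' e
    proof (rule ccontr)
      assume "l \<noteq> l'"
      then have d: "set l \<inter> set l' = {}" using disj l by blast
      obtain x y where xy: "x \<in> e" "x \<in> set l" "y \<in> e" "y \<in> set l'" using e by (auto simp: touch_def)
      then have "x \<noteq> y" using d by auto
      moreover have "card e = 2" using e(1) cg by (auto simp: cgraph_def)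
      ultimately have "e = {x, y}" using xy by (auto simp: card_2_iff)
      then have "adj x y" "y \<in> U" using e(1) by (auto simp: adj)
      then have "y \<in> set l \<or> y \<in> set p" using closedD[OF okL(2)[OF l(1)] xy(2)] by blast
      then show False using d xy okL(4)[OF l(2)] by auto
    qed
    show "gmap (sw l l') (restr G U) = restr G U" if l: "l \<in> set L" "l' \<in> set L" for l l'
    proof (rule gmap_eqI[OF cgraph_restr[OF cg]])
      have cm: "sw l' l = sw l l'" by (rule B.sw_commute[OF l(2,1)])
      have swU: "sw l l' x \<in> U" if "x \<in> U" for x
      proof -
        consider "x \<in> set l" | "x \<in> set l'" | "x \<notin> set l" "x \<notin> set l'" by blast
        then show ?thesis
        proof cases
          case 1
          then have "sw l l' x \<in> set l'" unfolding B.sw_set[OF l, symmetric] by (rule imageI)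
          then show ?thesis using okL(3)[OF l(2)] by (rule subsetD[rotated])
        next
          case 2
          then have "sw l' l x \<in> set l" unfolding B.sw_set[OF l(2,1), symmetric] by (rule imageI)
          then show ?thesis using okL(3)[OF l(1)] unfolding cm by (rule subsetD[rotated])
        next
          case 3
          then show ?thesis using that by (simp add: B.sw_out)
        qed
      qed
      have inf: "info (sw l l' x) = info x" for x
      proof -
        consider "x \<in> set l" | "x \<in> set l'" | "x \<notin> set l" "x \<notin> set l'" by blast
        then show ?thesis
        proof cases
          case 1
          then show ?thesis using iso(1)[OF l] by simp
        next
          case 2
          then show ?thesis using iso(1)[OF l(2,1)] unfolding cm by simp
        qed (simp add: B.sw_out)
      qed
      have adj1: "adj (sw l l' x) (sw l l' y)" if "x \<in> set l \<or> x \<in> set l'" "y \<in> U" "adj x y" for x y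
        using that(1)
      proof
        assume "x \<in> set l"
        then show ?thesis by (rule iso(2)[OF l _ that(2,3)])
      next
        assume "x \<in> set l'"
        from iso(2)[OF l(2,1) this that(2,3)] show ?thesis unfolding cm .
      qed
      show "sw l l' (sw l l' x) = x" for x by (rule B.sw_invol[OF l])
      show "sw l l' x \<in> verts (restr G U)" if "x \<in> verts (restr G U)" for x using swU[of x] that U by auto
      show "{sw l l' x, sw l l' y} \<in> edges (restr G U)"
        if xy: "x \<in> verts (restr G U)" "y \<in> verts (restr G U)" "{x, y} \<in> edges (restr G U)" for x y
      proof -
        have a: "adj x y" "x \<in> U" "y \<in> U" using xy by (auto simp: adj)
        have "adj (sw l l' x) (sw l l' y)"
        proof (cases "x \<in> set l \<or> x \<in> set l'")
          case True then show ?thesis using adj1 a by blast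
        next
          case False
          then have x: "sw l l' x = x" by (intro B.sw_out) auto
          show ?thesis
          proof (cases "y \<in> set l \<or> y \<in> set l'")
            case True then show ?thesis using adj1[OF _ a(2) adj_sym[OF a(1)]] adj_sym by blast
          next
            case False
            then have "sw l l' y = y" by (intro B.sw_out) auto
            then show ?thesis using x a by simp
          qed
        qed
        then show ?thesis using swU a by (simp add: adj)
      qed
      show "sw l l' x \<in> C" if C: "C \<in> set (colors (restr G U))" "x \<in> C" for C x
      proof -
        obtain C0 where C0: "C0 \<in> set (colors G)" "C = C0 \<inter> U" using C(1) by auto
        then show ?thesis using info_colors[OF inf[symmetric] C0(1)] swU[of x] C(2) by auto
      qed
    qed
  qed
qed

text \<open>An input set that met one copy would meet all of them, as labels are preserved; but
  there are more copies than tokens. So all copies avoid both sets, and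
  \<open>tj_equiv_remove\<close> applies.\<close>

lemma drop_equiv:
  assumes L: "\<And>l. l \<in> set L \<Longrightarrow> ok U p t l \<and> closed U p l" "distinct (concat L)" and U: "U \<subseteq> verts G"
    and ns: "ns \<in> set L" and big: "2 ^ thr t < length L" and SU: "S \<subseteq> U" "S' \<subseteq> U"
  shows "tj_equiv (restr G U) \<phi> S S' (- set ns)" "S \<inter> set ns = {}" "S' \<inter> set ns = {}"
proof -
  note cgG = cg
  interpret blocks "set L" "length ns" "restr G U" "bt_size t" by (rule ok_block_facts(1)[OF L U ns])
  have card: "card (set L) = length L" by (rule ok_block_facts(2)[OF L U ns])
  have "r < 2 ^ r" by (rule less_exp)
  have pr: "(2::nat) ^ thr t = 2 ^ ((bt_size t + 1) * q) * 2 ^ r" by (simp add: thr power_add)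
  have "finite (verts G)" using cgG by (simp add: cgraph_def)
  then have finS: "finite S" "finite S'" using S finite_subset by blast+
  have "1 * 2 ^ r \<le> (2::nat) ^ thr t" unfolding pr by (intro mult_right_mono) auto
  then have big2: "card S < length L" using big r \<open>r < 2 ^ r\<close> by linarith
  have unt: "X \<inter> set l = {}" if l: "l \<in> set L" and X: "finite X" "card X = card S"
    and inf: "\<And>u v. info u = info v \<Longrightarrow> u \<in> X \<Longrightarrow> v \<in> X" for X l
  proof (rule ccontr)
    assume "X \<inter> set l \<noteq> {}"
    then obtain x where x: "x \<in> X" "x \<in> set l" by blast
    have "X \<inter> set l' \<noteq> {}" if "l' \<in> set L" for l'
      using ok_block_facts(3)[OF L U ns l that x(2)] inf[of x "sw l l' x"] x(1) by auto
    then have "{l \<in> set L. X \<inter> set l \<noteq> {}} = set L" by blast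
    then show False using card_touched[OF X(1)] card big2 X(2) by simp
  qed
  have untS: "S \<inter> set l = {}" "S' \<inter> set l = {}" if "l \<in> set L" for l
    using unt[OF that finS(1)] unt[OF that finS(2) S(3)] info_S by blast+
  then show "S \<inter> set ns = {}" "S' \<inter> set ns = {}" using ns by auto
  show "tj_equiv (restr G U) \<phi> S S' (- set ns)"
  proof (rule tj_equiv_remove[OF _ ns])
    show "formula_of_set (restr G U) \<phi>" using form by (simp add: formula_of_set_def)
    show "S \<subseteq> verts (restr G U)" "S' \<subseteq> verts (restr G U)" using S SU by auto
    \<comment> \<open>The number of copies exceeds \<open>x * y\<close> with
      \<open>y \<ge> card S + 3\<close>, and \<open>x * (card S + 3) \<ge> x + card S + 2\<close>
      since \<open>x \<ge> 1\<close>.\<close>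
    define x where "x = (2::nat) ^ ((bt_size t + 1) * nodes \<phi>)"
    define y where "y = (2::nat) ^ r"
    have "x * y \<le> 2 ^ thr t" unfolding pr x_def y_def using q by (intro mult_right_mono power_increasing mult_left_mono) auto
    moreover have "x + card S + 2 \<le> x * y"
    proof -
      have "1 \<le> x" by (simp add: x_def)
      have "card S + 3 \<le> y" using r \<open>r < 2 ^ r\<close> unfolding y_def by linarith
      then have "x * (card S + 3) \<le> x * y" by (rule mult_le_mono2)
      moreover have "1 * (card S + 2) \<le> x * (card S + 2)" using \<open>1 \<le> x\<close> by (rule mult_le_mono1)
      ultimately show ?thesis by (simp add: algebra_simps)
    qed
    ultimately show "2 ^ ((bt_size t + 1) * nodes \<phi>) + card S + 2 \<le> card (set L)"
      using big card by (simp add: x_def)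
  qed (use untS in auto)
qed

section \<open>The invariant of the search\<close>

definition pruned_children :: "'v set \<Rightarrow> 'v list \<Rightarrow> (bt \<times> 'v list) list \<Rightarrow> bool" where
  "pruned_children U p cs \<longleftrightarrow> (\<forall>c\<in>set cs. ok U p (fst c) (snd c) \<and> closed U p (snd c) \<and>
     length (filter (\<lambda>d. fst d = fst c) cs) \<le> 2 ^ thr (fst c))"

lemma pruned_childrenD: "pruned_children U p cs \<Longrightarrow> c \<in> set cs \<Longrightarrow> ok U p (fst c) (snd c) \<and> closed U p (snd c) \<and>
     length (filter (\<lambda>d. fst d = fst c) cs) \<le> 2 ^ thr (fst c)"
  unfolding pruned_children_def by blast

definition names :: "(bt \<times> 'v list) list list \<Rightarrow> 'v list" where
  "names css = concat (map snd (concat css))"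

lemma names_Cons: "names (cs # css) = concat (map snd cs) @ names css"
  by (simp add: names_def)

lemma pruned_children_mono: "pruned_children U p cs \<Longrightarrow> U' \<subseteq> U \<Longrightarrow> set (concat (map snd cs)) \<subseteq> U' \<Longrightarrow> pruned_children U' p cs"
  unfolding pruned_children_def
proof (intro ballI)
  fix c assume a: "\<forall>c\<in>set cs. ok U p (fst c) (snd c) \<and> closed U p (snd c) \<and>
     length (filter (\<lambda>d. fst d = fst c) cs) \<le> 2 ^ thr (fst c)" "U' \<subseteq> U" "set (concat (map snd cs)) \<subseteq> U'" "c \<in> set cs"
  then have "set (snd c) \<subseteq> U'" by auto
  then show "ok U' p (fst c) (snd c) \<and> closed U' p (snd c) \<and> length (filter (\<lambda>d. fst d = fst c) cs) \<le> 2 ^ thr (fst c)"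
    using a ok_mono[of U p "fst c" "snd c" U'] closed_mono[of U p "snd c" U'] by simp
qed

text \<open>There is one list of children more than there are vertices on the path; the last list
  belongs to the virtual root.\<close>

fun pruned_stack :: "'v set \<Rightarrow> 'v list \<Rightarrow> (bt \<times> 'v list) list list \<Rightarrow> bool" where
  "pruned_stack U p [] \<longleftrightarrow> False"
| "pruned_stack U p (cs # css) \<longleftrightarrow> pruned_children U p cs \<and> (case p of [] \<Rightarrow> css = [] | v # p' \<Rightarrow> pruned_stack U p' css)"

lemma pruned_stack_mono: "pruned_stack U p css \<Longrightarrow> U' \<subseteq> U \<Longrightarrow> set (names css) \<subseteq> U' \<Longrightarrow> pruned_stack U' p css"
proof (induction css arbitrary: p)
  case (Cons cs css)
  then show ?case using pruned_children_mono[of U p cs U'] by (cases p) (auto simp: names_Cons)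
qed simp

text \<open>The familiar property of depth-first search that there are no cross edges, restricted to
  the vertices still present.\<close>

lemma pruned_stack_closed: "pruned_stack U p css \<Longrightarrow> y \<in> set (names css) \<Longrightarrow> x \<in> U \<Longrightarrow> adj y x \<Longrightarrow> x \<in> set (names css) \<or> x \<in> set p"
proof (induction css arbitrary: p)
  case (Cons cs css)
  show ?case
  proof (cases "y \<in> set (concat (map snd cs))")
    case True
    then obtain c where c: "c \<in> set cs" "y \<in> set (snd c)" by auto
    have "closed U p (snd c)" using pruned_childrenD[of U p cs c] Cons.prems(1) c(1) by simp
    then have "x \<in> set (snd c) \<or> x \<in> set p" using closedD c(2) Cons.prems(3,4) by blast
    then show ?thesis using c(1) by (auto simp: names_Cons)
  next
    case False
    then have y: "y \<in> set (names css)" using Cons.prems(2) by (simp add: names_Cons)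
    then obtain v p' where p: "p = v # p'" "pruned_stack U p' css"
      using Cons.prems(1) by (cases p) (auto simp: names_def)
    then show ?thesis using Cons.IH[OF p(2) y Cons.prems(3,4)] by (auto simp: names_Cons)
  qed
qed simp

text \<open>Visited vertices that are neither on the path nor in a finished subtree are the deleted
  ones.\<close>

definition alive :: "'v list \<Rightarrow> 'v list \<Rightarrow> (bt \<times> 'v list) list list \<Rightarrow> 'v set" where
  "alive vis p css = set p \<union> set (names css) \<union> (set vs - set vis)"

definition inv :: "'v list \<Rightarrow> 'v list \<Rightarrow> (bt \<times> 'v list) list list \<Rightarrow> bool" where
  "inv vis p css \<longleftrightarrow> set p \<subseteq> set vis \<and> set (names css) \<subseteq> set vis \<and> set vis \<subseteq> set vs \<and> distinct (p @ names css) \<and> gpath G p \<and>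
    pruned_stack (alive vis p css) p css \<and> tj_equiv G \<phi> S S' (alive vis p css) \<and> S \<subseteq> alive vis p css \<and> S' \<subseteq> alive vis p css"

lemma inv_init: "inv [] [] [[]]"
proof -
  have U: "alive [] [] [[]] = verts G" by (simp add: alive_def names_def vs)
  have "restr G (verts G) = G"
  proof -
    have 1: "C \<inter> verts G = C" if "C \<in> set (colors G)" for C using cg that by (auto simp: cgraph_def)
    have 2: "e \<subseteq> verts G" if "e \<in> edges G" for e using cg that by (auto simp: cgraph_def)
    have "map (\<lambda>C. C \<inter> verts G) (colors G) = colors G" by (rule map_idI) (rule 1)
    moreover have "{e \<in> edges G. e \<subseteq> verts G} = edges G" using 2 by blast
    ultimately show ?thesis by (simp add: restr_def)
  qed
  then have "tj_equiv G \<phi> S S' (verts G)" by (auto simp: tj_equiv_def)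
  then show ?thesis unfolding inv_def U using S by (simp add: names_def gpath_def pruned_children_def)
qed

lemma inv_push:
  assumes "inv vis p css" "w \<in> set vs" "w \<notin> set vis" "p = [] \<or> adj (hd p) w"
  shows "inv (w # vis) (w # p) ([] # css)"
proof -
  have n: "names ([] # css) = names css" by (simp add: names_def)
  have U: "alive (w # vis) (w # p) ([] # css) = alive vis p css"
    using assms(2,3) by (auto simp: alive_def n)
  have "gpath G (w # p)"
    using assms by (cases p) (auto simp: inv_def gpath_def vs adj insert_commute)
  moreover have "pruned_children U (w # p) []" for U by (simp add: pruned_children_def)
  ultimately show ?thesis using assms unfolding inv_def U n by auto
qed

text \<open>All neighbours of \<open>v\<close> have been visited, so the subtree of \<open>v\<close>
  is closed. Either it joins its siblings, or its type is already exhausted and it is deleted by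
  \<open>drop_equiv\<close>.\<close>

lemma inv_pop:
  assumes inv: "inv vis (v # p) (cs # css)" and none: "\<And>w. w \<in> set vs \<Longrightarrow> adj v w \<Longrightarrow> w \<in> set vis"
  shows "\<exists>cs' css'. css = cs' # css' \<and>
    inv vis p (attach thr (subtree_type adj info v p cs, v # concat (map snd cs)) cs' # css')"
proof -
  let ?U = "alive vis (v # p) (cs # css)"
  let ?ns = "v # concat (map snd cs)"
  let ?t = "subtree_type adj info v p cs"
  have i: "set (v # p) \<subseteq> set vis" "set (names (cs # css)) \<subseteq> set vis" "set vis \<subseteq> set vs" "distinct ((v # p) @ names (cs # css))"
    "gpath G (v # p)" "pruned_stack ?U (v # p) (cs # css)" "tj_equiv G \<phi> S S' ?U" "S \<subseteq> ?U" "S' \<subseteq> ?U"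
    using inv unfolding inv_def by blast+
  have okcs: "pruned_children ?U (v # p) cs" and okp: "pruned_stack ?U p css" using i(6) by auto
  then obtain cs' css' where css: "css = cs' # css'" by (cases css) auto
  have okcs': "pruned_children ?U p cs'" using okp by (simp add: css)
  have UV: "?U \<subseteq> verts G" using i(1-3) by (auto simp: alive_def vs(1)[symmetric])
  have d: "distinct (v # p @ concat (map snd cs) @ names css)" using i(4) by (simp add: names_Cons)
  have "length (v # p) \<le> P" by (rule P[OF i(5)])
  then have ok: "ok ?U p ?t ?ns"
  proof (intro pruned_subtree.pruned_subtreeI)
    show "v \<in> ?U" by (simp add: alive_def)
    show "v \<notin> set p" "distinct ?ns" "set (concat (map snd cs)) \<inter> set p = {}" using d by auto
    show "pruned_subtree adj info thr P ?U (v # p) (fst c) (snd c)" if "c \<in> set cs" for c using pruned_childrenD[OF okcs that] by blast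
    show "length (filter (\<lambda>d. fst d = fst c) cs) \<le> 2 ^ thr (fst c)" if "c \<in> set cs" for c using pruned_childrenD[OF okcs that] by blast
    show "y \<in> set (snd c) \<or> y \<in> set (v # p)" if "c \<in> set cs" "x \<in> set (snd c)" "y \<in> ?U" "adj x y" for c x y
      using pruned_childrenD[OF okcs that(1)] closedD that(2-4) by blast
  qed simp
  have cl: "closed ?U p ?ns" unfolding closed_def
  proof (intro ballI impI)
    fix x y assume x: "x \<in> set ?ns" and y: "y \<in> ?U" "adj x y"
    show "y \<in> set ?ns \<or> y \<in> set p"
    proof (cases "x = v")
      case True
      have "y \<in> set vis" using none[of y] y True UV vs(1) by auto
      then have "y \<in> set (v # p) \<or> y \<in> set (concat (map snd cs)) \<or> y \<in> set (names css)"
        using y(1) by (auto simp: alive_def names_Cons)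
      \<comment> \<open>A vertex finished outside this subtree has its present neighbours among such
        vertices and the proper ancestors of \<open>v\<close>, so it is not adjacent to
        \<open>v\<close>.\<close>
      moreover have False if yc: "y \<in> set (names css)"
      proof -
        have "v \<in> set (names css) \<or> v \<in> set p"
          by (rule pruned_stack_closed[OF okp yc _ adj_sym]) (use y(2) True in \<open>auto simp: alive_def\<close>)
        then show False using d by auto
      qed
      ultimately show ?thesis by auto
    next
      case False
      then obtain c where c: "c \<in> set cs" "x \<in> set (snd c)" using x by auto
      have "y \<in> set (snd c) \<or> y \<in> set (v # p)" using pruned_childrenD[OF okcs c(1)] closedD c(2) y by blast
      then show ?thesis using c(1) by auto
    qed
  qed
  show ?thesis
  proof (cases "length (filter (\<lambda>d. fst d = ?t) cs') < 2 ^ thr ?t")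
    case True
    let ?css = "((?t, ?ns) # cs') # css'"
    have att: "attach thr (?t, ?ns) cs' = (?t, ?ns) # cs'" using True by (simp add: attach_def)
    have nm: "names ?css = ?ns @ names css" by (simp add: names_Cons css)
    have U: "alive vis p ?css = ?U" by (auto simp: alive_def names_Cons css)
    have "pruned_children ?U p ((?t, ?ns) # cs')" unfolding pruned_children_def
    proof (intro ballI)
      fix c assume c: "c \<in> set ((?t, ?ns) # cs')"
      show "ok ?U p (fst c) (snd c) \<and> closed ?U p (snd c) \<and>
        length (filter (\<lambda>d. fst d = fst c) ((?t, ?ns) # cs')) \<le> 2 ^ thr (fst c)"
      proof (cases "c = (?t, ?ns)")
        case True2: True
        then show ?thesis using ok cl True by simp
      next
        case False
        then have "c \<in> set cs'" using c by simp
        from pruned_childrenD[OF okcs' this] show ?thesis using True by auto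
      qed
    qed
    then have "pruned_stack ?U p ?css" using okp by (simp add: css)
    moreover have "distinct (p @ names ?css)" using d by (auto simp: nm)
    moreover have "gpath G p" using i(5) by (cases p) (auto simp: gpath_def)
    moreover have "set p \<subseteq> set vis" "set (names ?css) \<subseteq> set vis" using i(1,2) by (auto simp: css names_Cons)
    ultimately have "inv vis p ?css" unfolding inv_def U using i(3,7,8,9) by blast
    then show ?thesis using css att by auto
  next
    case False
    have att: "attach thr (?t, ?ns) cs' = cs'" using False by (simp add: attach_def)
    have U: "alive vis p css = ?U \<inter> - set ?ns"
      using d i(1,2) by (auto simp: alive_def names_Cons)
    \<comment> \<open>The new copy together with the at least \<open>2 ^ thr ?t\<close> copies kept
      before; it is the new one that goes.\<close>
    define L where "L = ?ns # map snd (filter (\<lambda>d. fst d = ?t) cs')"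
    have L1: "ok ?U p ?t l \<and> closed ?U p l" if "l \<in> set L" for l
    proof (cases "l = ?ns")
      case False
      then have "l \<in> snd ` {d \<in> set cs'. fst d = ?t}" using that by (simp add: L_def)
      then obtain c where "c \<in> set cs'" "fst c = ?t" "l = snd c" by (elim imageE CollectE conjE)
      then show ?thesis using pruned_childrenD[OF okcs'] by metis
    qed (use ok cl in simp)
    have L2: "distinct (concat L)"
    proof -
      have sub: "set (concat (map snd (filter Q xs))) \<subseteq> set (concat (map snd xs))" for Q and xs :: "(bt \<times> 'v list) list" by auto
      have "distinct (concat (map snd xs)) \<Longrightarrow> distinct (concat (map snd (filter Q xs)))" for Q and xs :: "(bt \<times> 'v list) list"
        by (induction xs) (use sub in auto)
      then show ?thesis using d by (auto simp: L_def css names_Cons)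
    qed
    have nsL: "?ns \<in> set L" by (simp add: L_def)
    have big: "2 ^ thr ?t < length L" using False by (simp add: L_def)
    note D = drop_equiv[OF L1 L2 UV nsL big i(8,9)]
    have "tj_equiv G \<phi> S S' (alive vis p css)" unfolding U by (rule tj_equiv_trans[OF i(7) D(1)])
    moreover have "S \<subseteq> alive vis p css" "S' \<subseteq> alive vis p css" unfolding U using i(8,9) D(2,3) by auto
    moreover have "pruned_stack (alive vis p css) p css"
    proof (rule pruned_stack_mono[OF okp])
      show "alive vis p css \<subseteq> ?U" using U by blast
      show "set (names css) \<subseteq> alive vis p css" by (auto simp: alive_def)
    qed
    moreover have "distinct (p @ names css)" using d by auto
    moreover have "gpath G p" using i(5) by (cases p) (auto simp: gpath_def)
    moreover have "set p \<subseteq> set vis" "set (names css) \<subseteq> set vis" using i(1,2) by (auto simp: names_Cons)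
    ultimately have "inv vis p css" unfolding inv_def using i(3) by blast
    then show ?thesis using css att by simp
  qed
qed

end

section \<open>The size of what the search keeps\<close>

definition dfs_names :: "'v list \<Rightarrow> ('v \<Rightarrow> 'v \<Rightarrow> bool) \<Rightarrow> ('v \<Rightarrow> bool list) \<Rightarrow> (bt \<Rightarrow> nat) \<Rightarrow> 'v list" where
  "dfs_names vs adj info thr =
    concat (map snd (concat (snd (snd ((dfs_step vs adj info thr ^^ (length vs + length vs)) ([], [], [[]]))))))"

text \<open>\<open>2 ^ 2 ^ M\<close> bounds the number of types of size at most \<open>M\<close>
  (\<open>card_bt_size\<close>), and the other factor the copies kept of each.\<close>

definition width :: "nat \<Rightarrow> nat \<Rightarrow> nat \<Rightarrow> nat" where
  "width q r M = 2 ^ 2 ^ M * 2 ^ ((M + 1) * q + r)"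

text \<open>The last argument is the height left, \<open>P - length anc\<close> in
  \<open>ok_size\<close>. The summands bound the adjacency row and the label, with 4 tree nodes per
  bit by \<open>sz_bool_list\<close>, and the list of at most \<open>width\<close> child
  types.\<close>

primrec type_bound :: "nat \<Rightarrow> nat \<Rightarrow> nat \<Rightarrow> nat \<Rightarrow> nat \<Rightarrow> nat" where
  "type_bound q r I P 0 = 0"
| "type_bound q r I P (Suc h) = 5 + 4 * P + 4 * I
     + width q r (type_bound q r I P h) * (type_bound q r I P h + 1)"

lemma sz_bool_list: "sz (bs :: bool list) \<le> 4 * length bs + 1"
proof (induction bs)
  case (Cons c bs)
  then show ?case using sz_bool[of c] by simp
qed simp

context dfs begin

lemma count_bound:
  assumes "\<And>c. c \<in> set cs \<Longrightarrow> bt_size (fst c) \<le> M"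
    and "\<And>c. c \<in> set cs \<Longrightarrow> length (filter (\<lambda>d. fst d = fst c) cs) \<le> 2 ^ thr (fst c)"
  shows "length cs \<le> width q r M"
proof -
  have "length (map fst cs) \<le> 2 ^ 2 ^ M * 2 ^ ((M + 1) * q + r)"
  proof (rule length_le_count_sum)
    fix x assume "x \<in> set (map fst cs)"
    then obtain c where c: "c \<in> set cs" "x = fst c" by auto
    show "bt_size x \<le> M" using assms(1) c by simp
    have "thr x \<le> (M + 1) * q + r" unfolding thr using assms(1)[OF c(1)] c(2) by (intro add_mono mult_mono) auto
    then have "(2::nat) ^ thr x \<le> 2 ^ ((M + 1) * q + r)" by (intro power_increasing) auto
    moreover have "length (filter (\<lambda>y. y = x) (map fst cs)) \<le> 2 ^ thr x"
      using assms(2)[OF c(1)] c(2) by (simp add: filter_map comp_def)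
    ultimately show "length (filter (\<lambda>y. y = x) (map fst cs)) \<le> 2 ^ ((M + 1) * q + r)" by linarith
  qed
  then show ?thesis by (simp add: width_def)
qed

lemma ok_size: "ok U anc t ns \<Longrightarrow> bt_size t \<le> type_bound q r I P (P - length anc)"
proof (induction rule: pruned_subtree.induct)
  case (pruned_subtreeI anc v cs)
  define h where "h = P - Suc (length anc)"
  define M where "M = type_bound q r I P h"
  have h: "P - length anc = Suc h" using pruned_subtreeI.hyps(1) by (simp add: h_def)
  have size: "bt_size (fst c) \<le> M" if "c \<in> set cs" for c
    using pruned_subtreeI.IH[OF that] by (simp add: M_def h_def)
  have len: "length cs \<le> width q r M" by (rule count_bound[OF size pruned_subtreeI.hyps(6)])
  have "sum_list (map (\<lambda>c. Suc (bt_size (fst c))) cs) \<le> sum_list (map (\<lambda>c. M + 1) cs)"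
    by (rule sum_list_mono) (use size in simp)
  then have "sz (map fst cs) \<le> 1 + length cs * (M + 1)"
    by (simp add: sz_list comp_def sum_list_triv)
  also have "\<dots> \<le> 1 + width q r M * (M + 1)" using len by (intro add_mono mult_right_mono) auto
  finally have 1: "sz (map fst cs) \<le> 1 + width q r M * (M + 1)" .
  have 2: "sz (map (adj v) anc) \<le> 4 * P + 1" using sz_bool_list[of "map (adj v) anc"] pruned_subtreeI.hyps(1) by simp
  have 3: "sz (info v) \<le> 4 * I + 1" using sz_bool_list[of "info v"] info_length[of v] by simp
  show ?case unfolding h type_bound.simps M_def[symmetric] using 1 2 3 by (simp add: subtree_type_def)
qed

text \<open>An unvisited vertex still costs a push and a pop, one on the path only a pop. Hence the
  \<open>2 * length vs\<close> steps taken in \<open>dfs_names\<close> finish the search.\<close>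

definition todo :: "'v dfs_state \<Rightarrow> nat" where
  "todo st = 2 * card (set vs - set (fst st)) + length (fst (snd st))"

abbreviation step :: "'v dfs_state \<Rightarrow> 'v dfs_state" where "step \<equiv> dfs_step vs adj info thr"

lemma step_inv:
  assumes inv: "inv vis p css" shows "\<exists>vis' p' css'. step (vis, p, css) = (vis', p', css') \<and> inv vis' p' css' \<and>
    todo (vis', p', css') = todo (vis, p, css) - 1"
proof -
  let ?Q = "\<lambda>w. w \<notin> set vis \<and> (case p of [] \<Rightarrow> True | v # p \<Rightarrow> adj v w)"
  show ?thesis
  proof (cases "filter ?Q vs")
    case (Cons w ws)
    then have "w \<in> set (filter ?Q vs)" by simp
    then have w: "w \<in> set vs" "w \<notin> set vis" "p = [] \<or> adj (hd p) w" by (auto split: list.splits)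
    have st: "step (vis, p, css) = (w # vis, w # p, [] # css)" by (simp add: dfs_step_def Cons)
    have eq: "set vs - set (w # vis) = (set vs - set vis) - {w}" by auto
    have "Suc (card ((set vs - set vis) - {w})) = card (set vs - set vis)" by (rule card_Suc_Diff1) (use w in auto)
    then have "card (set vs - set vis) = Suc (card (set vs - set (w # vis)))" by (simp only: eq)
    then show ?thesis using inv_push[OF inv w] st by (simp add: todo_def)
  next
    case Nil
    then have none: "\<not> ?Q w" if "w \<in> set vs" for w using that by (simp add: filter_empty_conv)
    show ?thesis
    proof (cases p)
      case pNil: Nil
      have "set vs - set vis = {}" using none by (auto simp: pNil)
      then have "todo (vis, p, css) = 0" using pNil by (simp add: todo_def del: Diff_eq_empty_iff)
      moreover have "filter (\<lambda>w. w \<notin> set vis) vs = []" using Nil by (simp add: pNil)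
      then have "step (vis, p, css) = (vis, p, css)" by (simp only: dfs_step_def pNil Let_def fst_conv snd_conv list.case simp_thms)
      ultimately show ?thesis using inv by auto
    next
      case (Cons v p')
      have vis: "w \<in> set vis" if "w \<in> set vs" "adj v w" for w using none[OF that(1)] that(2) by (simp add: Cons)
      have "css \<noteq> []" using inv by (auto simp: inv_def)
      then obtain cs css1 where css: "css = cs # css1" by (cases css) auto
      from inv_pop[OF inv[unfolded Cons css] vis] obtain cs' css' where c: "css1 = cs' # css'"
        "inv vis p' (attach thr (subtree_type adj info v p' cs, v # concat (map snd cs)) cs' # css')" by blast
      have "filter (\<lambda>w. w \<notin> set vis \<and> adj v w) vs = []" using Nil by (simp add: Cons)
      then have "step (vis, p, css) = (vis, p', attach thr (subtree_type adj info v p' cs, v # concat (map snd cs)) cs' # css')"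
        by (simp add: dfs_step_def Cons css c(1))
      then show ?thesis using c(2) by (simp add: todo_def Cons)
    qed
  qed
qed

theorem dfs_names_correct:
  defines "ns \<equiv> dfs_names vs adj info thr"
  shows "distinct ns" "set ns \<subseteq> verts G" "S \<subseteq> set ns" "S' \<subseteq> set ns" "tj_equiv G \<phi> S S' (set ns)"
    "length ns \<le> width q r (type_bound q r I P P) * type_bound q r I P P"
proof -
  have iter: "\<exists>vis p css. (step ^^ n) ([], [], [[]]) = (vis, p, css) \<and> inv vis p css \<and>
      todo (vis, p, css) = 2 * length vs - n" for n
  proof (induction n)
    case 0
    show ?case using inv_init vs(2) by (simp add: todo_def distinct_card)
  next
    case (Suc n)
    then obtain vis p css where "(step ^^ n) ([], [], [[]]) = (vis, p, css)" "inv vis p css"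
      "todo (vis, p, css) = 2 * length vs - n" by blast
    with step_inv[of vis p css] show ?case by force
  qed
  obtain vis p css where st: "(step ^^ (length vs + length vs)) ([], [], [[]]) = (vis, p, css)" and inv: "inv vis p css"
    and m: "todo (vis, p, css) = 0" using iter[of "length vs + length vs"] by auto
  have p: "p = []" and vis: "set vs - set vis = {}" using m by (auto simp: todo_def)
  have i: "set (names css) \<subseteq> set vis" "set vis \<subseteq> set vs" "distinct (p @ names css)" "pruned_stack (alive vis p css) p css"
    "tj_equiv G \<phi> S S' (alive vis p css)" "S \<subseteq> alive vis p css" "S' \<subseteq> alive vis p css"
    using inv unfolding inv_def by blast+
  have ns: "ns = names css" by (simp add: ns_def dfs_names_def st names_def)
  have U: "alive vis p css = set ns" unfolding alive_def vis p ns by simp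
  show "distinct ns" using i(3) by (simp add: ns)
  show "set ns \<subseteq> verts G" using i(1,2) vs(1) by (simp add: ns)
  show "S \<subseteq> set ns" "S' \<subseteq> set ns" "tj_equiv G \<phi> S S' (set ns)" using i(5-7) by (simp_all only: U)
  have "pruned_stack (set ns) [] css" using i(4) unfolding U by (simp only: p)
  then obtain cs where css: "css = [cs]" "pruned_children (set ns) [] cs" by (cases css) auto
  define M where "M = type_bound q r I P P"
  have M: "bt_size (fst c) \<le> M" if "c \<in> set cs" for c
    using ok_size[of "set ns" "[]" "fst c" "snd c"] pruned_childrenD[OF css(2) that] by (simp add: M_def)
  have "length cs \<le> width q r M" by (rule count_bound[OF M]) (use pruned_childrenD[OF css(2)] in auto)
  moreover have "length ns \<le> length cs * M"
  proof -
    have "length (snd c) \<le> M" if "c \<in> set cs" for c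
      using ok_length_size[of "set ns" "[]" "fst c" "snd c"] pruned_childrenD[OF css(2) that] M[OF that] by simp
    then have "sum_list (map (\<lambda>c. length (snd c)) cs) \<le> sum_list (map (\<lambda>c. M) cs)" by (intro sum_list_mono)
    then show ?thesis by (simp add: ns names_def css(1) length_concat comp_def sum_list_triv)
  qed
  ultimately show "length ns \<le> width q r (type_bound q r I P P) * type_bound q r I P P"
    unfolding M_def[symmetric] by (meson le_trans mult_le_mono1)
qed

end

subsection \<open>The search runs in polynomial time\<close>

definition adj_list :: "('v \<times> 'v) list \<Rightarrow> 'v \<Rightarrow> 'v \<Rightarrow> bool" where
  "adj_list es u v \<longleftrightarrow> (u, v) \<in> set es \<or> (v, u) \<in> set es"

definition membership :: "'v list list \<Rightarrow> 'v \<Rightarrow> bool list" where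
  "membership cls v = map (\<lambda>C. v \<in> set C) cls"

definition threshold :: "nat \<Rightarrow> nat \<Rightarrow> bt \<Rightarrow> nat" where
  "threshold q r t = (bt_size t + 1) * q + r"

text \<open>On leaving a vertex, the types and the vertex lists of its children are separated.
  Nothing is copied, so the state does not multiply.\<close>

lemma sz_map_concat: "sz (map fst cs) + sz (concat (map snd cs)) \<le> sz (cs :: ('a::enc \<times> 'b::enc list) list) + 1"
proof (induction cs)
  case (Cons c cs)
  have "sz (snd c @ concat (map snd cs)) + 1 = sz (snd c) + sz (concat (map snd cs))" by (rule sz_append)
  then show ?case using Cons by (cases c) simp
qed simp

text \<open>Growth is additive per step: at most one name for the visited list and the path, and one
  adjacency row, label and name for the stack. The row is short because the path has at most
  \<open>i\<close> vertices after \<open>i\<close> steps.\<close>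

lemma dfs_step_size:
  fixes vs :: "'v::enc list"
  assumes A: "\<And>w. w \<in> set vs \<Longrightarrow> sz w < A" and J: "\<And>v. sz (info v) \<le> J"
  shows "i \<le> N \<Longrightarrow> (dfs_step vs adj info thr ^^ i) ([], [], [[]]) = (vis, p, css) \<Longrightarrow>
    length p \<le> i \<and> set p \<subseteq> set vs \<and> sz vis \<le> 1 + i * (A + 1) \<and> sz p \<le> 1 + i * (A + 1) \<and> sz css \<le> 3 + i * (4 * N + J + A + 10)"
proof (induction i arbitrary: vis p css)
  case 0
  then show ?case by auto
next
  case (Suc i)
  obtain vis0 p0 css0 where st: "(dfs_step vs adj info thr ^^ i) ([], [], [[]]) = (vis0, p0, css0)" by (metis prod_cases3)
  define K where "K = 4 * N + J + A + 10"
  have IH: "length p0 \<le> i" "set p0 \<subseteq> set vs" "sz vis0 \<le> 1 + i * (A + 1)" "sz p0 \<le> 1 + i * (A + 1)" "sz css0 \<le> 3 + i * K"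
    using Suc.IH[OF _ st] Suc.prems(1) by (auto simp: K_def)
  have step: "dfs_step vs adj info thr (vis0, p0, css0) = (vis, p, css)" using Suc.prems(2) st by simp
  have same: ?case if "(vis, p, css) = (vis0, p0, css0)" using IH that unfolding K_def[symmetric] by auto
  let ?Q = "\<lambda>w. w \<notin> set vis0 \<and> (case p0 of [] \<Rightarrow> True | v # p \<Rightarrow> adj v w)"
  show ?case
  proof (cases "filter ?Q vs")
    case (Cons w ws)
    then have "w \<in> set (filter ?Q vs)" by simp
    then have w: "w \<in> set vs" by simp
    have "vis = w # vis0" "p = w # p0" "css = [] # css0" using step by (simp_all add: dfs_step_def Cons)
    then show ?thesis unfolding K_def[symmetric] using IH A[OF w] w by (simp add: K_def)
  next
    case Nil
    show ?thesis
    proof (cases p0)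
      case pN: Nil
      then show ?thesis using step Nil by (intro same) (simp add: dfs_step_def)
    next
      case p0: (Cons v p1)
      show ?thesis
      proof (cases css0)
        case cN: Nil
        then show ?thesis using step Nil by (intro same) (simp add: dfs_step_def p0)
      next
        case c0: (Cons cs css1)
        show ?thesis
        proof (cases css1)
          case cN: Nil
          then show ?thesis using step Nil by (intro same) (simp add: dfs_step_def p0 c0)
        next
          case c1: (Cons cs' css')
          define c where "c = (subtree_type adj info v p1 cs, v # concat (map snd cs))"
          have res: "vis = vis0" "p = p1" "css = attach thr c cs' # css'"
            using step Nil by (auto simp add: dfs_step_def p0 c0 c1 c_def)
          have v: "v \<in> set vs" using IH(2) by (simp add: p0)
          have "sz (map (adj v) p1) \<le> 4 * i + 1" using sz_bool_list[of "map (adj v) p1"] IH(1) by (simp add: p0)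
          then have "sz c \<le> sz cs + (4 * i + J + A + 7)"
            using sz_map_concat[of cs] J[of v] A[OF v] by (simp add: c_def subtree_type_def)
          moreover have "sz (attach thr c cs') \<le> sz cs' + sz c + 1" by (simp add: attach_def)
          ultimately have "sz css \<le> sz css0 + (4 * i + J + A + 7)" by (simp add: res c0 c1)
          moreover have "i \<le> N" using Suc.prems(1) by simp
          ultimately have "sz css \<le> 3 + i * K + K" using IH(5) unfolding K_def by linarith
          then show ?thesis unfolding K_def[symmetric] using IH by (simp add: res p0)
        qed
      qed
    qed
  qed
qed

lemma cmp_adj_list [cmp_intros]:
  "cmp b es \<Longrightarrow> cmp b u \<Longrightarrow> cmp b v \<Longrightarrow> cmp b (\<lambda>x. adj_list (es x) (u x) (v x))"
  unfolding adj_list_def by (intro cmp_intros)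

lemma cmp_membership [cmp_intros]:
  assumes "cmp b cls" "cmp b v" shows "cmp b (\<lambda>x. membership (cls x) (v x))"
  unfolding membership_def by (intro cmp_map cmp_mem cmp_snd cmp_id cmp_comp[OF assms(2)] cmp_fst assms(1))

lemma cmp_threshold [cmp_intros]:
  "cmp b q \<Longrightarrow> cmp b r \<Longrightarrow> cmp b t \<Longrightarrow> cmp b (\<lambda>x. threshold (q x) (r x) (t x))"
  unfolding threshold_def by (intro cmp_intros)

text \<open>Vertices stay the trees that encode them in the input, and only equality of them is
  tested. Turning them into unary numbers could be exponentially long.\<close>

type_synonym dfs_input = "bt list \<times> (bt \<times> bt) list \<times> bt list list \<times> nat \<times> nat"

definition run_dfs :: "dfs_input \<Rightarrow> bt list" where
  "run_dfs y = dfs_names (fst y) (adj_list (fst (snd y))) (membership (fst (snd (snd y))))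
     (threshold (fst (snd (snd (snd y)))) (snd (snd (snd (snd y)))))"

lemma cmp_run_dfs: "cmp b run_dfs"
proof -
  let ?step = "\<lambda>y::dfs_input. dfs_step (fst y) (adj_list (fst (snd y))) (membership (fst (snd (snd y))))
     (threshold (fst (snd (snd (snd y)))) (snd (snd (snd (snd y)))))"
  have "cmp b (\<lambda>y::dfs_input. (?step y ^^ (length (fst y) + length (fst y))) ([], [], [[]]))"
  proof (rule cmp_funpow)
    show "cmp b (\<lambda>y::dfs_input. length (fst y) + length (fst y))" by (intro cmp_intros)
    show "cmp b (\<lambda>y::dfs_input. ([], [], [[]]) :: bt dfs_state)" by (rule cmp_const)
    show "cmp b (\<lambda>p. ?step (fst p) (snd p))"
      unfolding dfs_step_def attach_def subtree_type_def Let_def by (intro cmp_intros)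
    have "sz ((?step y ^^ i) ([], [], [[]])) \<le> 10 + 2 * sz y * (50 * sz y + 50)"
      if "i \<le> length (fst y) + length (fst y)" for y i
    proof -
      obtain vis p css where st: "(?step y ^^ i) ([], [], [[]]) = (vis, p, css)" by (metis prod_cases3)
      have A: "sz w < sz y" if "w \<in> set (fst y)" for w
        using sz_mem[OF that] by (cases y) simp
      have J: "sz (membership (fst (snd (snd y))) v) \<le> 4 * sz y + 1" for v
        using sz_bool_list[of "membership (fst (snd (snd y))) v"] length_le_sz[of "fst (snd (snd y))"]
        by (cases y) (simp add: membership_def)
      have N: "i \<le> 2 * sz y" using that length_le_sz[of "fst y"] by (cases y) simp
      have "length p \<le> i \<and> set p \<subseteq> set (fst y) \<and> sz vis \<le> 1 + i * (sz y + 1) \<and> sz p \<le> 1 + i * (sz y + 1)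
          \<and> sz css \<le> 3 + i * (4 * (2 * sz y) + (4 * sz y + 1) + sz y + 10)"
        by (rule dfs_step_size[OF A J N st])
      then have "sz (vis, p, css) \<le> 7 + i * (20 * sz y + 20)" by (simp add: algebra_simps)
      also have "\<dots> \<le> 7 + 2 * sz y * (20 * sz y + 20)" using N by (intro add_mono mult_right_mono) auto
      also have "\<dots> \<le> 10 + 2 * sz y * (50 * sz y + 50)" by (intro add_mono mult_left_mono) auto
      finally show ?thesis by (simp only: st)
    qed
    then show "\<exists>B. bnd b B \<and> (\<forall>y i. i \<le> length (fst y) + length (fst y) \<longrightarrow> sz ((?step y ^^ i) ([], [], [[]])) \<le> B (sz y))"
      by (intro exI[of _ "\<lambda>n. 10 + 2 * n * (50 * n + 50)"] conjI bnd_intros) blast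
  qed
  from cmp_concat[OF cmp_map[OF cmp_snd[OF cmp_snd[OF cmp_id]] cmp_concat[OF cmp_snd[OF cmp_snd[OF this]]]]]
  show ?thesis unfolding run_dfs_def dfs_names_def .
qed

section \<open>Solving the kernel\<close>

lemma cmp_foldr_unbounded:
  assumes "cmp False xs" "cmp False a" "cmp False (\<lambda>p. f (fst p) (fst (snd p)) (snd (snd p)))"
  shows "cmp False (\<lambda>x. foldr (f x) (xs x) (a x))"
proof -
  have "cmp False (\<lambda>p. (\<lambda>p. f (fst p) (fst (snd p)) (snd (snd p))) (fst p, snd (snd p), fst (snd p)))"
    by (rule cmp_comp[OF assms(3)]) (intro cmp_intros)
  then have "cmp False (\<lambda>p. f (fst p) (snd (snd p)) (fst (snd p)))" by simp
  from cmp_foldl_unbounded[OF cmp_rev[OF assms(1)] assms(2), of "\<lambda>x s y. f x y s", OF this]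
  show ?thesis by (simp add: foldr_conv_foldl)
qed

lemma cmp_subseqs:
  assumes "cmp False f" shows "cmp False (\<lambda>x. subseqs (f x))"
proof -
  have "subseqs xs = foldr (\<lambda>y yss. map (\<lambda>ys. y # ys) yss @ yss) xs [[]]" for xs :: "'b list"
    by (induction xs) (auto simp: Let_def)
  moreover have "cmp False (\<lambda>x. foldr (\<lambda>y yss. map (\<lambda>ys. y # ys) yss @ yss) (f x) [[]])"
    by (rule cmp_foldr_unbounded[OF assms]) (intro cmp_intros)+
  ultimately show ?thesis by simp
qed

lemma cmp_n_lists:
  assumes n: "cmp False n" and f: "cmp False f" shows "cmp False (\<lambda>x. List.n_lists (n x) (f x))"
proof -
  have "List.n_lists k xs = ((\<lambda>yss. concat (map (\<lambda>ys. map (\<lambda>y. y # ys) xs) yss)) ^^ k) [[]]" for k and xs :: "'b list"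
    by (induction k) auto
  moreover have "cmp False (\<lambda>x. ((\<lambda>yss. concat (map (\<lambda>ys. map (\<lambda>y. y # ys) (f x)) yss)) ^^ n x) [[]])"
    by (rule cmp_funpow_unbounded[OF n cmp_const]) (intro cmp_intros cmp_comp[OF f])
  ultimately show ?thesis by simp
qed

lemma bt_of_nat_inject [simp]: "bt_of_nat m = bt_of_nat n \<longleftrightarrow> m = n"
  by (metis unary_bt_of_nat)

lemma bt_of_nat_eq_Lf [simp]: "bt_of_nat n = Lf \<longleftrightarrow> n = 0" "Lf = bt_of_nat n \<longleftrightarrow> n = 0"
  using bt_of_nat_inject[of n 0] by auto

definition lset :: "nat \<Rightarrow> 'a list \<Rightarrow> 'a list list \<Rightarrow> 'a list list" where
  "lset i d \<alpha> = map (\<lambda>j. if j = i then d else nthd [] j \<alpha>) [0..<length \<alpha>]"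

lemma lset_update: "lset i d \<alpha> = \<alpha>[i := d]"
  by (rule nth_equalityI) (auto simp: lset_def nth_list_update)

text \<open>Tokens of a formula in prefix notation: operator, sort, and two indices into the list of variables
  and colours. The operators and sorts are numbered as in \<open>bt_of_mso2\<close> and \<open>bt_of_sort\<close>. Values of
  every sort are lists of numbers; an edge is given by its position in the edge list, and
  single vertices and edges are one-element lists.\<close>

type_synonym tok = "bt \<times> bt \<times> nat \<times> nat"
type_synonym kernel = "nat \<times> (nat \<times> nat) list \<times> nat list list \<times> tok list \<times> nat list \<times> nat list"

definition sort_dom :: "nat \<Rightarrow> (nat \<times> nat) list \<Rightarrow> bt \<Rightarrow> nat list list" where
  "sort_dom m es c = (if c = bt_of_nat 0 then map (\<lambda>v. [v]) [0..<m] else if c = bt_of_nat 1 then subseqs [0..<m]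
     else if c = bt_of_nat 2 then map (\<lambda>v. [v]) [0..<length es] else subseqs [0..<length es])"

text \<open>Every slot ranges over the values of all four sorts. Ill-sorted assignments do no harm,
  since \<open>correct\<close> speaks only of those that represent an interpretation.\<close>

definition all_assigns :: "nat \<Rightarrow> (nat \<times> nat) list \<Rightarrow> nat \<Rightarrow> nat list list list" where
  "all_assigns m es L = List.n_lists L (sort_dom m es (bt_of_nat 0) @ sort_dom m es (bt_of_nat 1)
     @ sort_dom m es (bt_of_nat 2) @ sort_dom m es (bt_of_nat 3))"

text \<open>As single elements are one-element lists, membership becomes inclusion of lists. Edges
  may be compared by position because each is listed once.\<close>

definition atom_test :: "(nat \<times> nat) list \<Rightarrow> nat list list \<Rightarrow> bt \<Rightarrow> nat \<Rightarrow> nat \<Rightarrow> nat list list \<Rightarrow> bool" where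
  "atom_test es cols c i j \<alpha> = (
     if c = bt_of_nat 0 \<or> c = bt_of_nat 1 then nthd [] i \<alpha> = nthd [] j \<alpha>
     else if c = bt_of_nat 2 then \<exists>e\<in>set es. nthd [] i \<alpha> = [fst e] \<and> nthd [] j \<alpha> = [snd e]
        \<or> nthd [] i \<alpha> = [snd e] \<and> nthd [] j \<alpha> = [fst e]
     else if c = bt_of_nat 3 then \<exists>v\<in>set (nthd [] i cols). nthd [] j \<alpha> = [v]
     else if c = bt_of_nat 4 \<or> c = bt_of_nat 5 then \<forall>v\<in>set (nthd [] i \<alpha>). v \<in> set (nthd [] j \<alpha>)
     else \<exists>p\<in>set [0..<length es]. nthd [] i \<alpha> = [p] \<and>
        (nthd [] j \<alpha> = [fst (nthd (0, 0) p es)] \<or> nthd [] j \<alpha> = [snd (nthd (0, 0) p es)]))"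

definition bin_op :: "bt \<Rightarrow> bool \<Rightarrow> bool \<Rightarrow> bool" where
  "bin_op c P Q = (if c = bt_of_nat 8 then P \<and> Q else if c = bt_of_nat 9 then P \<or> Q
     else if c = bt_of_nat 10 then \<not> P \<or> Q else P = Q)"

text \<open>The stack contains for every pending subformula the list of its satisfying assignments.\<close>

definition tok_step :: "nat \<Rightarrow> (nat \<times> nat) list \<Rightarrow> nat list list \<Rightarrow> nat list list list \<Rightarrow> tok \<Rightarrow> nat list list list list \<Rightarrow> nat list list list list" where
  "tok_step m es cols AA tk st = (let c = fst tk; q = fst (snd tk); i = fst (snd (snd tk)); j = snd (snd (snd tk)) in
     if c = bt_of_nat 7 then (case st of [] \<Rightarrow> [] | T # r \<Rightarrow> filter (\<lambda>\<alpha>. \<alpha> \<notin> set T) AA # r)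
     else if c = bt_of_nat 8 \<or> c = bt_of_nat 9 \<or> c = bt_of_nat 10 \<or> c = bt_of_nat 11 then
       (case st of [] \<Rightarrow> [] | T # r \<Rightarrow> (case r of [] \<Rightarrow> [] | T' # r' \<Rightarrow> filter (\<lambda>\<alpha>. bin_op c (\<alpha> \<in> set T) (\<alpha> \<in> set T')) AA # r'))
     else if c = bt_of_nat 12 then
       (case st of [] \<Rightarrow> [] | T # r \<Rightarrow> filter (\<lambda>\<alpha>. \<exists>d\<in>set (sort_dom m es q). lset i d \<alpha> \<in> set T) AA # r)
     else if c = bt_of_nat 13 then
       (case st of [] \<Rightarrow> [] | T # r \<Rightarrow> filter (\<lambda>\<alpha>. \<forall>d\<in>set (sort_dom m es q). lset i d \<alpha> \<in> set T) AA # r)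
     else filter (atom_test es cols c i j) AA # st)"

text \<open>Folding from the right evaluates prefix notation: the operands are on the stack when
  their operator is reached.\<close>

definition eval_toks :: "nat \<Rightarrow> (nat \<times> nat) list \<Rightarrow> nat list list \<Rightarrow> tok list \<Rightarrow> nat list list list" where
  "eval_toks m es cols toks =
     (case foldr (tok_step m es cols (all_assigns m es (length cols))) toks [] of [] \<Rightarrow> [] | T # _ \<Rightarrow> T)"

text \<open>Slot 0 belongs to the free variable, which \<open>keys_of\<close> puts first. The other
  slots get the empty list, a legal value of the set sorts.\<close>

definition configs :: "nat \<Rightarrow> (nat \<times> nat) list \<Rightarrow> nat list list \<Rightarrow> tok list \<Rightarrow> nat list list" where
  "configs m es cols toks = (let T = eval_toks m es cols toks in
     filter (\<lambda>X. map (\<lambda>j. if j = 0 then X else []) [0..<length cols] \<in> set T) (subseqs [0..<m]))"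

definition tj_lists :: "nat list \<Rightarrow> nat list \<Rightarrow> bool" where
  "tj_lists X Y \<longleftrightarrow> length (filter (\<lambda>v. v \<notin> set Y) X) = 1 \<and> length (filter (\<lambda>v. v \<notin> set X) Y) = 1"

definition top :: "nat list list \<Rightarrow> nat list" where
  "top p = (case p of [] \<Rightarrow> [] | X # _ \<Rightarrow> X)"

definition extend :: "nat list list \<Rightarrow> nat list list list \<Rightarrow> nat list list list" where
  "extend cf P = concat (map (\<lambda>p. map (\<lambda>X. X # p) (filter (tj_lists (top p)) cf)) P)"

text \<open>Walks are listed in order of length, so the first one that ends in \<open>t\<close> is
  shortest. \<open>length cf\<close> rounds suffice, as a shortest sequence repeats no set; walks
  carry their latest set in front, whence \<open>rev\<close>.\<close>

definition search :: "nat list list \<Rightarrow> nat list \<Rightarrow> nat list \<Rightarrow> nat list list" where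
  "search cf s t = (let out = snd (((\<lambda>z. (extend cf (fst z), snd z @ extend cf (fst z))) ^^ length cf) ([[s]], [[s]])) in
     (case filter (\<lambda>p. top p = t) out of [] \<Rightarrow> [] | p # _ \<Rightarrow> rev p))"

definition solve :: "kernel \<Rightarrow> nat list list" where
  "solve K = search (configs (fst K) (fst (snd K)) (fst (snd (snd K))) (fst (snd (snd (snd K)))))
     (fst (snd (snd (snd (snd K))))) (snd (snd (snd (snd (snd K)))))"

lemma cmp_sort_dom:
  assumes "cmp False m" "cmp False es" "cmp False c" shows "cmp False (\<lambda>x. sort_dom (m x) (es x) (c x))"
  unfolding sort_dom_def by (intro cmp_if cmp_eq cmp_map cmp_upt cmp_subseqs cmp_length cmp_Cons cmp_const cmp_snd cmp_id assms)

lemma cmp_atom_test: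
  assumes "cmp False es" "cmp False cols" "cmp False c" "cmp False i" "cmp False j" "cmp False \<alpha>"
  shows "cmp False (\<lambda>x. atom_test (es x) (cols x) (c x) (i x) (j x) (\<alpha> x))"
  unfolding atom_test_def by (intro cmp_intros assms assms[THEN cmp_comp])

lemma cmp_lset:
  assumes "cmp False i" "cmp False d" "cmp False \<alpha>" shows "cmp False (\<lambda>x. lset (i x) (d x) (\<alpha> x))"
  unfolding lset_def by (intro cmp_intros assms assms[THEN cmp_comp])

lemma cmp_bin_op:
  assumes "cmp False c" "cmp False P" "cmp False Q" shows "cmp False (\<lambda>x. bin_op (c x) (P x) (Q x))"
  unfolding bin_op_def by (intro cmp_intros assms)

lemma cmp_eval_toks:
  assumes "cmp False m" "cmp False es" "cmp False cols" "cmp False toks"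
  shows "cmp False (\<lambda>x. eval_toks (m x) (es x) (cols x) (toks x))"
proof -
  have "cmp False (\<lambda>x. all_assigns (m x) (es x) (length (cols x)))"
    unfolding all_assigns_def by (intro cmp_n_lists cmp_append cmp_sort_dom cmp_const cmp_length assms)
  note A = assms this
  show ?thesis unfolding eval_toks_def tok_step_def Let_def
    by (intro cmp_case_list cmp_foldr_unbounded cmp_if cmp_disj cmp_eq cmp_filter cmp_Cons cmp_not cmp_mem cmp_Bex cmp_Ball
        cmp_lset cmp_bin_op cmp_atom_test cmp_sort_dom A A[THEN cmp_comp] cmp_fst cmp_snd cmp_const cmp_id)
qed

lemma cmp_solve: "cmp False solve"
proof -
  have cf: "cmp False (\<lambda>K::kernel. configs (fst K) (fst (snd K)) (fst (snd (snd K))) (fst (snd (snd (snd K)))))"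
    unfolding configs_def
    by (intro cmp_Let cmp_filter cmp_eval_toks cmp_mem cmp_map cmp_if cmp_eq cmp_upt cmp_length cmp_subseqs cmp_fst cmp_snd cmp_const cmp_id)
  show ?thesis unfolding solve_def search_def extend_def top_def tj_lists_def
    by (intro cmp_Let cmp_case_list cmp_filter cmp_eq cmp_conj cmp_not cmp_mem cmp_funpow_unbounded cmp_append cmp_concat cmp_map
        cmp_Pair cmp_Cons cmp_rev cmp_length cf cf[THEN cmp_comp] cmp_fst cmp_snd cmp_const cmp_id)
qed

subsection \<open>Correctness of the evaluation\<close>

text \<open>The sorts use the codes 0 to 3, so colour indices get a name space of their own among
  the keys.\<close>

definition color_code :: bt where "color_code = bt_of_nat 4"

type_synonym rawtok = "bt \<times> (bt \<times> bt) \<times> (bt \<times> bt)"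

abbreviation key :: "sort \<Rightarrow> nat \<Rightarrow> bt \<times> bt" where "key s x \<equiv> (bt_of_sort s, bt_of_nat x)"
abbreviation ckey :: "nat \<Rightarrow> bt \<times> bt" where "ckey i \<equiv> (color_code, bt_of_nat i)"
abbreviation nokey :: "bt \<times> bt" where "nokey \<equiv> (Lf, Lf)"

fun lin :: "mso2 \<Rightarrow> rawtok list" where
  "lin (EqV x y) = [(bt_of_nat 0, key Vertex x, key Vertex y)]"
| "lin (EqE x y) = [(bt_of_nat 1, key Edge x, key Edge y)]"
| "lin (Adj x y) = [(bt_of_nat 2, key Vertex x, key Vertex y)]"
| "lin (Col i x) = [(bt_of_nat 3, ckey i, key Vertex x)]"
| "lin (MemV x X) = [(bt_of_nat 4, key Vertex x, key VertexSet X)]"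
| "lin (MemE x X) = [(bt_of_nat 5, key Edge x, key EdgeSet X)]"
| "lin (Inc e x) = [(bt_of_nat 6, key Edge e, key Vertex x)]"
| "lin (Neg \<phi>) = (bt_of_nat 7, nokey, nokey) # lin \<phi>"
| "lin (Conj \<phi> \<psi>) = (bt_of_nat 8, nokey, nokey) # lin \<phi> @ lin \<psi>"
| "lin (Disj \<phi> \<psi>) = (bt_of_nat 9, nokey, nokey) # lin \<phi> @ lin \<psi>"
| "lin (Imp \<phi> \<psi>) = (bt_of_nat 10, nokey, nokey) # lin \<phi> @ lin \<psi>"
| "lin (Iff \<phi> \<psi>) = (bt_of_nat 11, nokey, nokey) # lin \<phi> @ lin \<psi>"
| "lin (Exists s x \<phi>) = (bt_of_nat 12, key s x, nokey) # lin \<phi>"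
| "lin (Forall s x \<phi>) = (bt_of_nat 13, key s x, nokey) # lin \<phi>"

lemma lin_neq_Nil: "lin \<phi> \<noteq> []"
  by (cases \<phi>) auto

text \<open>The sort of the first key is kept because a quantifier has to know its domain; otherwise
  keys become slot numbers.\<close>

definition norm_tok :: "(bt \<times> bt) list \<Rightarrow> rawtok \<Rightarrow> tok" where
  "norm_tok ks tk = (fst tk, fst (fst (snd tk)), idx ks (fst (snd tk)), idx ks (snd (snd tk)))"

definition tok_keys :: "rawtok list \<Rightarrow> (bt \<times> bt) set" where
  "tok_keys tks = (\<Union>tk\<in>set tks. {fst (snd tk), snd (snd tk)})"

lemma tok_keys_simps [simp]: "tok_keys [] = {}" "tok_keys (tk # tks) = {fst (snd tk), snd (snd tk)} \<union> tok_keys tks"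
  "tok_keys (tks @ tks') = tok_keys tks \<union> tok_keys tks'"
  by (auto simp: tok_keys_def)

lemma free_vars_keys: "(s, x) \<in> free_vars \<phi> \<Longrightarrow> key s x \<in> tok_keys (lin \<phi>)"
  by (induction \<phi>) auto

lemma key_inject [simp]: "key s x = key s' y \<longleftrightarrow> s = s' \<and> x = y"
  by (cases s; cases s') simp_all

text \<open>A subset of a duplicate-free list is thus represented by exactly one
  subsequence.\<close>

lemma subseq_props: "ys \<in> set (subseqs xs) \<Longrightarrow> distinct xs \<Longrightarrow> set ys \<subseteq> set xs \<and> distinct ys \<and> filter (\<lambda>x. x \<in> set ys) xs = ys"
proof (induction xs arbitrary: ys)
  case (Cons x xs)
  from Cons.prems(1) consider zs where "zs \<in> set (subseqs xs)" "ys = x # zs" | "ys \<in> set (subseqs xs)"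
    by (auto simp: Let_def)
  then show ?case
  proof cases
    case 1
    then have IH: "set zs \<subseteq> set xs" "distinct zs" "filter (\<lambda>x. x \<in> set zs) xs = zs" using Cons by auto
    have "filter (\<lambda>y. y \<in> set ys) xs = filter (\<lambda>y. y \<in> set zs) xs"
      by (rule filter_cong[OF refl]) (use Cons.prems(2) 1(2) in auto)
    then show ?thesis using IH Cons.prems(2) 1(2) by auto
  next
    case 2
    then have "set ys \<subseteq> set xs" "distinct ys" "filter (\<lambda>x. x \<in> set ys) xs = ys" using Cons by auto
    then show ?thesis using Cons.prems(2) by auto
  qed
qed simp

lemma filter_in_subseqs: "filter P xs \<in> set (subseqs xs)"
  by (induction xs) (auto simp: Let_def)

text \<open>\<open>cols\<close> runs parallel to \<open>ks\<close>: the colour with index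
  \<open>i\<close> sits at the position of its key. The table therefore has one entry per key,
  however many colours the graph has.\<close>

locale kern =
  fixes KG :: "nat cgraph" and m :: nat and es :: "(nat \<times> nat) list" and cols :: "nat list list" and ks :: "(bt \<times> bt) list"
  assumes verts: "verts KG = {..<m}" and edges: "edges KG = (\<lambda>e. {fst e, snd e}) ` set es"
    and dist_es: "distinct (map (\<lambda>e. {fst e, snd e}) es)"
    and len: "length cols = length ks"
    and cols: "\<And>i. ckey i \<in> set ks \<Longrightarrow> i < length (colors KG) \<Longrightarrow> set (cols ! idx ks (ckey i)) = colors KG ! i"
begin

definition edge :: "nat \<Rightarrow> nat set" where "edge p = {fst (es ! p), snd (es ! p)}"

lemma edge_inj: "p < length es \<Longrightarrow> p' < length es \<Longrightarrow> edge p = edge p' \<longleftrightarrow> p = p'"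
  using dist_es by (auto simp: edge_def distinct_conv_nth)

lemma edges_edge: "edges KG = edge ` {..<length es}"
proof -
  have "set es = (\<lambda>p. es ! p) ` {..<length es}" 
    using nth_image[of "length es" es] by (simp add: lessThan_atLeast0)
  then show ?thesis unfolding edges by (simp add: image_image edge_def)
qed

abbreviation ix :: "sort \<Rightarrow> nat \<Rightarrow> nat" where "ix s x \<equiv> idx ks (key s x)"

fun rv :: "nat list list \<Rightarrow> (nat \<Rightarrow> nat) \<Rightarrow> (nat \<Rightarrow> nat set) \<Rightarrow> (nat \<Rightarrow> nat set) \<Rightarrow> (nat \<Rightarrow> nat set set) \<Rightarrow> sort \<Rightarrow> nat \<Rightarrow> bool" where
  "rv \<alpha> a A b B Vertex x \<longleftrightarrow> \<alpha> ! ix Vertex x = [a x] \<and> a x < m"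
| "rv \<alpha> a A b B VertexSet x \<longleftrightarrow> \<alpha> ! ix VertexSet x \<in> set (subseqs [0..<m]) \<and> set (\<alpha> ! ix VertexSet x) = A x"
| "rv \<alpha> a A b B Edge x \<longleftrightarrow> (\<exists>p<length es. \<alpha> ! ix Edge x = [p] \<and> b x = edge p)"
| "rv \<alpha> a A b B EdgeSet x \<longleftrightarrow> \<alpha> ! ix EdgeSet x \<in> set (subseqs [0..<length es]) \<and> edge ` set (\<alpha> ! ix EdgeSet x) = B x"

definition rel :: "mso2 \<Rightarrow> nat list list \<Rightarrow> (nat \<Rightarrow> nat) \<Rightarrow> (nat \<Rightarrow> nat set) \<Rightarrow> (nat \<Rightarrow> nat set) \<Rightarrow> (nat \<Rightarrow> nat set set) \<Rightarrow> bool" where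
  "rel \<phi> \<alpha> a A b B \<longleftrightarrow> (\<forall>s x. (s, x) \<in> free_vars \<phi> \<longrightarrow> rv \<alpha> a A b B s x)"

lemma relD: "rel \<phi> \<alpha> a A b B \<Longrightarrow> (s, x) \<in> free_vars \<phi> \<Longrightarrow> rv \<alpha> a A b B s x"
  unfolding rel_def by blast

abbreviation AA :: "nat list list list" where "AA \<equiv> all_assigns m es (length cols)"

lemma AA: "\<alpha> \<in> set AA \<longleftrightarrow> length \<alpha> = length ks \<and> set \<alpha> \<subseteq> (\<Union>q\<in>{Vertex, VertexSet, Edge, EdgeSet}. set (sort_dom m es (bt_of_sort q)))"
  by (simp add: all_assigns_def set_n_lists len Un_assoc)

definition correct :: "mso2 \<Rightarrow> nat list list list \<Rightarrow> bool" where
  "correct \<phi> T \<longleftrightarrow> (\<forall>\<alpha>\<in>set AA. \<forall>a A b B. rel \<phi> \<alpha> a A b B \<longrightarrow> (\<alpha> \<in> set T \<longleftrightarrow> sat KG a A b B \<phi>))"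

lemma correctD: "correct \<phi> T \<Longrightarrow> \<alpha> \<in> set AA \<Longrightarrow> rel \<phi> \<alpha> a A b B \<Longrightarrow> \<alpha> \<in> set T \<longleftrightarrow> sat KG a A b B \<phi>"
  unfolding correct_def by blast

lemma correctI: "(\<And>\<alpha> a A b B. \<alpha> \<in> set AA \<Longrightarrow> rel \<phi> \<alpha> a A b B \<Longrightarrow> \<alpha> \<in> set T \<longleftrightarrow> sat KG a A b B \<phi>) \<Longrightarrow> correct \<phi> T"
  unfolding correct_def by blast

lemma ix_less: "k \<in> set ks \<Longrightarrow> \<alpha> \<in> set AA \<Longrightarrow> idx ks k < length \<alpha>"
  using idx_props[of k ks] by (simp add: AA)

lemma ix_inject: "k \<in> set ks \<Longrightarrow> k' \<in> set ks \<Longrightarrow> idx ks k = idx ks k' \<longleftrightarrow> k = k'"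
  by (metis idx_props(2))

lemma AA_update:
  assumes "\<alpha> \<in> set AA" "d \<in> set (sort_dom m es (bt_of_sort q))" shows "\<alpha>[i := d] \<in> set AA"
proof -
  have "d \<in> (\<Union>q\<in>{Vertex, VertexSet, Edge, EdgeSet}. set (sort_dom m es (bt_of_sort q)))" using assms(2) by (cases q) auto
  then show ?thesis using assms(1) set_update_subset_insert[of \<alpha> i d] unfolding AA by (simp only: length_list_update) blast
qed

lemma rv_other:
  assumes "key s x \<in> set ks" "key q y \<in> set ks" "(s, x) \<noteq> (q, y)"
  shows "rv (\<alpha>[ix q y := d]) a A b B s x \<longleftrightarrow> rv \<alpha> a A b B s x"
proof -
  have "ix s x \<noteq> ix q y" using ix_inject[OF assms(1,2)] assms(3) key_inject[of s x q y] by blast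
  then have "\<alpha>[ix q y := d] ! ix s x = \<alpha> ! ix s x" by simp
  then show ?thesis by (cases s) simp_all
qed

lemma rel_update:
  assumes rel: "rel \<psi> \<alpha> a A b B" and fv: "free_vars \<phi> \<subseteq> insert (q, y) (free_vars \<psi>)"
    and ks: "tok_keys (lin \<phi>) \<subseteq> set ks" "key q y \<in> set ks"
    and same: "\<And>s x. (s, x) \<noteq> (q, y) \<Longrightarrow> rv (\<alpha>[ix q y := d]) a A b B s x \<longleftrightarrow> rv (\<alpha>[ix q y := d]) a' A' b' B' s x"
    and new: "rv (\<alpha>[ix q y := d]) a' A' b' B' q y"
  shows "rel \<phi> (\<alpha>[ix q y := d]) a' A' b' B'"
  unfolding rel_def
proof (intro allI impI)
  fix s x assume sx: "(s, x) \<in> free_vars \<phi>"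
  show "rv (\<alpha>[ix q y := d]) a' A' b' B' s x"
  proof (cases "(s, x) = (q, y)")
    case False
    then have "rv \<alpha> a A b B s x" using relD[OF rel] sx fv by blast
    then show ?thesis using same[OF False] rv_other[OF _ ks(2) False] free_vars_keys[OF sx] ks(1) by blast
  qed (use new in simp)
qed

lemma quantifier:
  assumes T: "correct \<phi> T" and \<alpha>: "\<alpha> \<in> set AA" and ks: "tok_keys (lin \<phi>) \<subseteq> set ks" "key q y \<in> set ks"
    and rel: "rel \<psi> \<alpha> a A b B" and fv: "free_vars \<psi> = free_vars \<phi> - {(q, y)}"
  shows "(\<exists>d\<in>set (sort_dom m es (bt_of_sort q)). lset (ix q y) d \<alpha> \<in> set T) \<longleftrightarrow> sat KG a A b B (Exists q y \<phi>)"
    and "(\<forall>d\<in>set (sort_dom m es (bt_of_sort q)). lset (ix q y) d \<alpha> \<in> set T) \<longleftrightarrow> sat KG a A b B (Forall q y \<phi>)"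
proof -
  have fv': "free_vars \<phi> \<subseteq> insert (q, y) (free_vars \<psi>)" using fv by auto
  have less: "ix q y < length \<alpha>" by (rule ix_less[OF ks(2) \<alpha>])
  note upd = rel_update[OF rel fv' ks]
  have main: "lset (ix q y) d \<alpha> \<in> set T \<longleftrightarrow> sat KG a' A' b' B' \<phi>"
    if "d \<in> set (sort_dom m es (bt_of_sort q))" "rel \<phi> (\<alpha>[ix q y := d]) a' A' b' B'" for d a' A' b' B'
    unfolding lset_update by (rule correctD[OF T AA_update[OF \<alpha> that(1)] that(2)])
  have dom: "sort_dom m es (bt_of_sort Vertex) = map (\<lambda>v. [v]) [0..<m]" "sort_dom m es (bt_of_sort VertexSet) = subseqs [0..<m]"
    "sort_dom m es (bt_of_sort Edge) = map (\<lambda>v. [v]) [0..<length es]" "sort_dom m es (bt_of_sort EdgeSet) = subseqs [0..<length es]"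
    by (simp_all add: sort_dom_def del: bt_of_nat_0)
  have "((\<exists>d\<in>set (sort_dom m es (bt_of_sort q)). lset (ix q y) d \<alpha> \<in> set T) \<longleftrightarrow> sat KG a A b B (Exists q y \<phi>)) \<and>
    ((\<forall>d\<in>set (sort_dom m es (bt_of_sort q)). lset (ix q y) d \<alpha> \<in> set T) \<longleftrightarrow> sat KG a A b B (Forall q y \<phi>))"
  proof (cases q)
    case Vertex
    have *: "lset (ix Vertex y) [v] \<alpha> \<in> set T \<longleftrightarrow> sat KG (a(y := v)) A b B \<phi>" if "v < m" for v
    proof -
      have "rv (\<alpha>[ix q y := [v]]) a A b B s x = rv (\<alpha>[ix q y := [v]]) (a(y := v)) A b B s x" if "(s, x) \<noteq> (q, y)" for s x
        using that Vertex by (cases s) auto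
      from upd[OF this] main[of "[v]" "a(y := v)" A b B] show ?thesis using less that unfolding Vertex dom by simp
    qed
    then show ?thesis unfolding Vertex dom by (auto simp: verts *)
  next
    case VertexSet
    have *: "lset (ix VertexSet y) d \<alpha> \<in> set T \<longleftrightarrow> sat KG a (A(y := set d)) b B \<phi>" if "d \<in> set (subseqs [0..<m])" for d
    proof -
      have "rv (\<alpha>[ix q y := d]) a A b B s x = rv (\<alpha>[ix q y := d]) a (A(y := set d)) b B s x" if "(s, x) \<noteq> (q, y)" for s x
        using that VertexSet by (cases s) auto
      from upd[OF this] main[of d a "A(y := set d)" b B] show ?thesis using less that unfolding VertexSet dom by simp
    qed
    have pow: "set ` set (subseqs [0..<m]) = Pow {..<m}" by (simp add: subseqs_powset lessThan_atLeast0)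
    then have "(\<exists>U\<subseteq>{..<m}. Q U) \<longleftrightarrow> (\<exists>d\<in>set (subseqs [0..<m]). Q (set d))"
      "(\<forall>U\<subseteq>{..<m}. Q U) \<longleftrightarrow> (\<forall>d\<in>set (subseqs [0..<m]). Q (set d))" for Q
      by (metis (no_types, lifting) PowD PowI image_iff)+
    note P = this
    show ?thesis unfolding VertexSet dom using * by (simp add: verts P cong: bex_cong ball_cong)
  next
    case Edge
    have *: "lset (ix Edge y) [p] \<alpha> \<in> set T \<longleftrightarrow> sat KG a A (b(y := edge p)) B \<phi>" if "p < length es" for p
    proof -
      have "rv (\<alpha>[ix q y := [p]]) a A b B s x = rv (\<alpha>[ix q y := [p]]) a A (b(y := edge p)) B s x" if "(s, x) \<noteq> (q, y)" for s x
        using that Edge by (cases s) auto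
      from upd[OF this] main[of "[p]" a A "b(y := edge p)" B] show ?thesis using less that unfolding Edge dom by simp
    qed
    then show ?thesis unfolding Edge dom by (auto simp: edges_edge *)
  next
    case EdgeSet
    have *: "lset (ix EdgeSet y) d \<alpha> \<in> set T \<longleftrightarrow> sat KG a A b (B(y := edge ` set d)) \<phi>" if "d \<in> set (subseqs [0..<length es])" for d
    proof -
      have "rv (\<alpha>[ix q y := d]) a A b B s x = rv (\<alpha>[ix q y := d]) a A b (B(y := edge ` set d)) s x" if "(s, x) \<noteq> (q, y)" for s x
        using that EdgeSet by (cases s) auto
      from upd[OF this] main[of d a A b "B(y := edge ` set d)"] show ?thesis using less that unfolding EdgeSet dom by simp
    qed
    have pow: "set ` set (subseqs [0..<length es]) = Pow {..<length es}" by (simp add: subseqs_powset lessThan_atLeast0)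
    have "(\<lambda>d. edge ` set d) ` set (subseqs [0..<length es]) = Pow (edges KG)"
      using arg_cong[OF pow, of "image (image edge)"] by (simp add: image_image edges_edge image_Pow_surj)
    then have "(\<exists>U\<subseteq>edges KG. Q U) \<longleftrightarrow> (\<exists>d\<in>set (subseqs [0..<length es]). Q (edge ` set d))"
      "(\<forall>U\<subseteq>edges KG. Q U) \<longleftrightarrow> (\<forall>d\<in>set (subseqs [0..<length es]). Q (edge ` set d))" for Q
      by (metis (no_types, lifting) PowD PowI image_iff)+
    note P = this
    show ?thesis unfolding EdgeSet dom using * by (simp add: P cong: bex_cong ball_cong)
  qed
  then show "(\<exists>d\<in>set (sort_dom m es (bt_of_sort q)). lset (ix q y) d \<alpha> \<in> set T) \<longleftrightarrow> sat KG a A b B (Exists q y \<phi>)"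
    "(\<forall>d\<in>set (sort_dom m es (bt_of_sort q)). lset (ix q y) d \<alpha> \<in> set T) \<longleftrightarrow> sat KG a A b B (Forall q y \<phi>)" by blast+
qed

lemma atom:
  assumes "\<alpha> \<in> set AA" "\<And>s x. (s, x) \<in> free_vars \<phi> \<Longrightarrow> rv \<alpha> a A b B s x" "tok_keys (lin \<phi>) \<subseteq> set ks" "color_indices \<phi> \<subseteq> {..<length (colors KG)}"
    "lin \<phi> = [(c, k, k')]"
  shows "atom_test es cols c (idx ks k) (idx ks k') \<alpha> \<longleftrightarrow> sat KG a A b B \<phi>"
proof -
  have k: "nthd [] (idx ks k) \<alpha> = \<alpha> ! idx ks k" "nthd [] (idx ks k') \<alpha> = \<alpha> ! idx ks k'" "nthd [] (idx ks k) cols = cols ! idx ks k"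
    using ix_less[OF _ assms(1), of k] ix_less[OF _ assms(1), of k'] idx_props(1)[of k ks] assms(3,5) len by auto
  have rv: "rv \<alpha> a A b B s x" if "(s, x) \<in> free_vars \<phi>" for s x using assms(2)[OF that] .
  show ?thesis
  proof (cases \<phi>)
    case (EqV x y)
    then show ?thesis using rv[of Vertex x] rv[of Vertex y] k assms(5) by (auto simp: atom_test_def)
  next
    case (EqE e f)
    then obtain p p' where "p < length es" "\<alpha> ! ix Edge e = [p]" "b e = edge p" "p' < length es" "\<alpha> ! ix Edge f = [p']" "b f = edge p'"
      using rv[of Edge e] rv[of Edge f] by auto
    then show ?thesis using EqE k assms(5) edge_inj[of p p'] by (auto simp: atom_test_def)
  next
    case (Adj x y)
    then have "\<alpha> ! ix Vertex x = [a x]" "\<alpha> ! ix Vertex y = [a y]" using rv[of Vertex x] rv[of Vertex y] by auto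
    then show ?thesis using Adj k assms(5) by (auto simp: atom_test_def edges image_iff doubleton_eq_iff)
  next
    case (Col i x)
    then have "\<alpha> ! ix Vertex x = [a x]" "set (cols ! idx ks (ckey i)) = colors KG ! i"
      using rv[of Vertex x] cols[of i] assms(3,4) by auto
    moreover have c: "c = bt_of_nat 3" "k = ckey i" "k' = key Vertex x" using assms(5) by (simp_all add: Col)
    moreover have "nthd [] (idx ks (ckey i)) cols = cols ! idx ks (ckey i)" "nthd [] (ix Vertex x) \<alpha> = \<alpha> ! ix Vertex x"
      using k(2,3) by (simp_all only: c)
    moreover have "atom_test es cols (bt_of_nat 3) i' j' \<alpha> \<longleftrightarrow> (\<exists>v\<in>set (nthd [] i' cols). nthd [] j' \<alpha> = [v])" for i' j'
      by (simp add: atom_test_def)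
    ultimately show ?thesis by (simp only: Col sat.simps) simp
  next
    case (MemV x X)
    then have "\<alpha> ! ix Vertex x = [a x]" "set (\<alpha> ! ix VertexSet X) = A X" using rv[of Vertex x] rv[of VertexSet X] by auto
    moreover have c: "c = bt_of_nat 4" "k = key Vertex x" "k' = key VertexSet X" using assms(5) by (simp_all add: MemV)
    moreover have "nthd [] (ix Vertex x) \<alpha> = \<alpha> ! ix Vertex x" "nthd [] (ix VertexSet X) \<alpha> = \<alpha> ! ix VertexSet X"
      using k(1,2) by (simp_all only: c)
    moreover have "atom_test es cols (bt_of_nat 4) i' j' \<alpha> \<longleftrightarrow> (\<forall>v\<in>set (nthd [] i' \<alpha>). v \<in> set (nthd [] j' \<alpha>))" for i' j'
      by (simp add: atom_test_def)
    ultimately show ?thesis by (simp only: MemV sat.simps) simp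
  next
    case (MemE e Y)
    then obtain p where p: "p < length es" "\<alpha> ! ix Edge e = [p]" "b e = edge p" using rv[of Edge e] by auto
    have Y: "\<alpha> ! ix EdgeSet Y \<in> set (subseqs [0..<length es])" "edge ` set (\<alpha> ! ix EdgeSet Y) = B Y" using MemE rv[of EdgeSet Y] by auto
    have "set (\<alpha> ! ix EdgeSet Y) \<subseteq> {..<length es}" using subseq_props[OF Y(1)] by auto
    then have "edge p \<in> B Y \<longleftrightarrow> p \<in> set (\<alpha> ! ix EdgeSet Y)" unfolding Y(2)[symmetric] using edge_inj[OF p(1)] by (auto simp: subset_iff)
    moreover have c: "c = bt_of_nat 5" "k = key Edge e" "k' = key EdgeSet Y" using assms(5) by (simp_all add: MemE)
    moreover have "nthd [] (ix Edge e) \<alpha> = \<alpha> ! ix Edge e" "nthd [] (ix EdgeSet Y) \<alpha> = \<alpha> ! ix EdgeSet Y"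
      using k(1,2) by (simp_all only: c)
    moreover have "atom_test es cols (bt_of_nat 5) i' j' \<alpha> \<longleftrightarrow> (\<forall>v\<in>set (nthd [] i' \<alpha>). v \<in> set (nthd [] j' \<alpha>))" for i' j'
      by (simp add: atom_test_def)
    ultimately show ?thesis using p by (simp only: MemE sat.simps) simp
  next
    case (Inc e x)
    then obtain p where p: "p < length es" "\<alpha> ! ix Edge e = [p]" "b e = edge p" using rv[of Edge e] by auto
    have "\<alpha> ! ix Vertex x = [a x]" using Inc rv[of Vertex x] by auto
    moreover have c: "c = bt_of_nat 6" "k = key Edge e" "k' = key Vertex x" using assms(5) by (simp_all add: Inc)
    moreover have "nthd [] (ix Edge e) \<alpha> = \<alpha> ! ix Edge e" "nthd [] (ix Vertex x) \<alpha> = \<alpha> ! ix Vertex x"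
      using k(1,2) by (simp_all only: c)
    moreover have "atom_test es cols (bt_of_nat 6) i' j' \<alpha> \<longleftrightarrow> (\<exists>p\<in>set [0..<length es]. nthd [] i' \<alpha> = [p] \<and> (nthd [] j' \<alpha> = [fst (nthd (0, 0) p es)] \<or> nthd [] j' \<alpha> = [snd (nthd (0, 0) p es)]))" for i' j'
      by (simp add: atom_test_def)
    ultimately show ?thesis using p by (simp only: Inc sat.simps) (auto simp: edge_def)
  qed (use assms(5) in \<open>simp_all add: lin_neq_Nil\<close>)
qed

lemma rel_mono: "rel \<psi> \<alpha> a A b B \<Longrightarrow> free_vars \<phi> \<subseteq> free_vars \<psi> \<Longrightarrow> rel \<phi> \<alpha> a A b B"
  unfolding rel_def by blast

abbreviation ts :: "tok \<Rightarrow> nat list list list list \<Rightarrow> nat list list list list" where "ts \<equiv> tok_step m es cols AA"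

lemma binary_correct:
  assumes T: "correct \<phi> T" "correct \<psi> T'" and fv: "free_vars \<theta> = free_vars \<phi> \<union> free_vars \<psi>"
    and sat: "\<And>a A b B. sat KG a A b B \<theta> \<longleftrightarrow> bin_op c (sat KG a A b B \<phi>) (sat KG a A b B \<psi>)"
  shows "correct \<theta> (filter (\<lambda>\<alpha>. bin_op c (\<alpha> \<in> set T) (\<alpha> \<in> set T')) AA)"
proof (rule correctI)
  fix \<alpha> a A b B assume \<alpha>: "\<alpha> \<in> set AA" and rel: "rel \<theta> \<alpha> a A b B"
  have "rel \<phi> \<alpha> a A b B" "rel \<psi> \<alpha> a A b B" by (rule rel_mono[OF rel]; simp add: fv)+
  then show "\<alpha> \<in> set (filter (\<lambda>\<alpha>. bin_op c (\<alpha> \<in> set T) (\<alpha> \<in> set T')) AA) \<longleftrightarrow> sat KG a A b B \<theta>"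
    using correctD[OF T(1) \<alpha>] correctD[OF T(2) \<alpha>] \<alpha> by (simp add: sat)
qed

lemma binary_foldr:
  assumes "\<exists>T. correct \<phi> T \<and> (\<forall>st. foldr ts (map (norm_tok ks) (lin \<phi>)) st = T # st)"
    "\<exists>T. correct \<psi> T \<and> (\<forall>st. foldr ts (map (norm_tok ks) (lin \<psi>)) st = T # st)"
    "free_vars \<theta> = free_vars \<phi> \<union> free_vars \<psi>" "lin \<theta> = (bt_of_nat n, nokey, nokey) # lin \<phi> @ lin \<psi>"
    "n \<in> {8, 9, 10, 11}"
    "\<And>a A b B. sat KG a A b B \<theta> \<longleftrightarrow> bin_op (bt_of_nat n) (sat KG a A b B \<phi>) (sat KG a A b B \<psi>)"
  shows "\<exists>T. correct \<theta> T \<and> (\<forall>st. foldr ts (map (norm_tok ks) (lin \<theta>)) st = T # st)"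
proof -
  obtain T T' where T: "correct \<phi> T" "\<And>st. foldr ts (map (norm_tok ks) (lin \<phi>)) st = T # st"
    "correct \<psi> T'" "\<And>st. foldr ts (map (norm_tok ks) (lin \<psi>)) st = T' # st" using assms(1,2) by blast
  have "foldr ts (map (norm_tok ks) (lin \<theta>)) st = filter (\<lambda>\<alpha>. bin_op (bt_of_nat n) (\<alpha> \<in> set T) (\<alpha> \<in> set T')) AA # st" for st
    using assms(5) by (auto simp: assms(4) T(2,4) tok_step_def norm_tok_def Let_def)
  then show ?thesis using binary_correct[OF T(1,3) assms(3,6)] by blast
qed

lemma atom_foldr:
  assumes "lin \<phi> = [(bt_of_nat n, k, k')]" "n < 7" "tok_keys (lin \<phi>) \<subseteq> set ks" "color_indices \<phi> \<subseteq> {..<length (colors KG)}"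
  shows "\<exists>T. correct \<phi> T \<and> (\<forall>st. foldr ts (map (norm_tok ks) (lin \<phi>)) st = T # st)"
proof -
  let ?T = "filter (atom_test es cols (bt_of_nat n) (idx ks k) (idx ks k')) AA"
  have "correct \<phi> ?T"
  proof (rule correctI)
    fix \<alpha> a A b B assume \<alpha>: "\<alpha> \<in> set AA" and rel: "rel \<phi> \<alpha> a A b B"
    show "\<alpha> \<in> set ?T \<longleftrightarrow> sat KG a A b B \<phi>"
      using atom[OF \<alpha> relD[OF rel] assms(3,4,1)] \<alpha> by simp
  qed
  moreover have "foldr ts (map (norm_tok ks) (lin \<phi>)) st = ?T # st" for st
    using assms(2) by (simp add: assms(1) tok_step_def norm_tok_def Let_def)
  ultimately show ?thesis by blast
qed

text \<open>The tokens of a formula push exactly one table on any stack; the claim for all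
  \<open>st\<close> is what lets the two operands of a connective be evaluated one after the
  other.\<close>

lemma foldr_correct:
  "tok_keys (lin \<phi>) \<subseteq> set ks \<Longrightarrow> color_indices \<phi> \<subseteq> {..<length (colors KG)} \<Longrightarrow>
    \<exists>T. correct \<phi> T \<and> (\<forall>st. foldr ts (map (norm_tok ks) (lin \<phi>)) st = T # st)"
proof (induction \<phi>)
  case (Neg \<phi>)
  then obtain T where T: "correct \<phi> T" "\<And>st. foldr ts (map (norm_tok ks) (lin \<phi>)) st = T # st" by auto
  have "correct (Neg \<phi>) (filter (\<lambda>\<alpha>. \<alpha> \<notin> set T) AA)"
    by (rule correctI) (use correctD[OF T(1)] rel_mono[of "Neg \<phi>" _ _ _ _ _ \<phi>] in auto)
  moreover have "foldr ts (map (norm_tok ks) (lin (Neg \<phi>))) st = filter (\<lambda>\<alpha>. \<alpha> \<notin> set T) AA # st" for st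
    by (simp add: T(2) tok_step_def norm_tok_def Let_def)
  ultimately show ?case by blast
next
  case (Exists q y \<phi>)
  then obtain T where T: "correct \<phi> T" "\<And>st. foldr ts (map (norm_tok ks) (lin \<phi>)) st = T # st" by auto
  let ?T = "filter (\<lambda>\<alpha>. \<exists>d\<in>set (sort_dom m es (bt_of_sort q)). lset (ix q y) d \<alpha> \<in> set T) AA"
  have "correct (Exists q y \<phi>) ?T"
    by (rule correctI) (use quantifier(1)[OF T(1)] Exists.prems in auto)
  moreover have "foldr ts (map (norm_tok ks) (lin (Exists q y \<phi>))) st = ?T # st" for st
    by (simp add: T(2) tok_step_def norm_tok_def Let_def)
  ultimately show ?case by blast
next
  case (Forall q y \<phi>)
  then obtain T where T: "correct \<phi> T" "\<And>st. foldr ts (map (norm_tok ks) (lin \<phi>)) st = T # st" by auto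
  let ?T = "filter (\<lambda>\<alpha>. \<forall>d\<in>set (sort_dom m es (bt_of_sort q)). lset (ix q y) d \<alpha> \<in> set T) AA"
  have "correct (Forall q y \<phi>) ?T"
    by (rule correctI) (use quantifier(2)[OF T(1)] Forall.prems in auto)
  moreover have "foldr ts (map (norm_tok ks) (lin (Forall q y \<phi>))) st = ?T # st" for st
    by (simp add: T(2) tok_step_def norm_tok_def Let_def)
  ultimately show ?case by blast
next
  case (Conj \<phi> \<psi>)
  show ?case by (rule binary_foldr[where n = 8 and \<phi> = \<phi> and \<psi> = \<psi>]) (use Conj in \<open>auto simp: bin_op_def\<close>)
next
  case (Disj \<phi> \<psi>)
  show ?case by (rule binary_foldr[where n = 9 and \<phi> = \<phi> and \<psi> = \<psi>]) (use Disj in \<open>auto simp: bin_op_def\<close>)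
next
  case (Imp \<phi> \<psi>)
  show ?case by (rule binary_foldr[where n = 10 and \<phi> = \<phi> and \<psi> = \<psi>]) (use Imp in \<open>auto simp: bin_op_def\<close>)
next
  case (Iff \<phi> \<psi>)
  show ?case by (rule binary_foldr[where n = 11 and \<phi> = \<phi> and \<psi> = \<psi>]) (use Iff in \<open>auto simp: bin_op_def\<close>)
next
  case (EqV x y)
  show ?case by (rule atom_foldr[where n = 0]) (use EqV in auto)
next
  case (EqE x y)
  show ?case by (rule atom_foldr[where n = 1]) (use EqE in auto)
next
  case (Adj x y)
  show ?case by (rule atom_foldr[where n = 2]) (use Adj in auto)
next
  case (Col x y)
  show ?case by (rule atom_foldr[where n = 3]) (use Col in auto)
next
  case (MemV x y)
  show ?case by (rule atom_foldr[where n = 4]) (use MemV in auto)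
next
  case (MemE x y)
  show ?case by (rule atom_foldr[where n = 5]) (use MemE in auto)
next
  case (Inc x y)
  show ?case by (rule atom_foldr[where n = 6]) (use Inc in auto)
qed

lemma configs_correct:
  assumes fv: "free_vars \<phi> \<subseteq> {(VertexSet, 0)}" and ks: "tok_keys (lin \<phi>) \<subseteq> set ks" "ks = key VertexSet 0 # ks'"
    and ci: "color_indices \<phi> \<subseteq> {..<length (colors KG)}"
  shows "X \<in> set (configs m es cols (map (norm_tok ks) (lin \<phi>))) \<longleftrightarrow> X \<in> set (subseqs [0..<m]) \<and> models KG \<phi> (set X)"
proof -
  obtain T where T: "correct \<phi> T" "\<And>st. foldr ts (map (norm_tok ks) (lin \<phi>)) st = T # st"
    using foldr_correct[OF ks(1) ci] by blast
  have ev: "eval_toks m es cols (map (norm_tok ks) (lin \<phi>)) = T" by (simp add: eval_toks_def T(2))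
  have "map (\<lambda>j. if j = 0 then X else []) [0..<length cols] \<in> set T \<longleftrightarrow> models KG \<phi> (set X)"
    if X: "X \<in> set (subseqs [0..<m])"
  proof -
    let ?\<alpha> = "map (\<lambda>j. if j = 0 then X else []) [0..<length cols]"
    have i0: "ix VertexSet 0 = 0" unfolding ks(2) idx_def by (simp add: upt_conv_Cons nthd_def del: upt_Suc)
    have "[] \<in> set (subseqs [0..<m])" using filter_in_subseqs[of "\<lambda>_. False" "[0..<m]"] by simp
    then have "set ?\<alpha> \<subseteq> set (sort_dom m es (bt_of_sort VertexSet))" using X by (auto simp: sort_dom_def)
    then have A: "?\<alpha> \<in> set AA" unfolding AA using len by auto
    have "0 < length cols" using len ks(2) by simp
    then have "?\<alpha> ! 0 = X" by (subst nth_map) (simp_all del: upt_Suc)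
    then have "rel \<phi> ?\<alpha> (\<lambda>_. undefined) (\<lambda>_. set X) (\<lambda>_. undefined) (\<lambda>_. undefined)"
      using fv X i0 unfolding rel_def by auto
    from correctD[OF T(1) A this] show ?thesis by (simp add: models_def)
  qed
  then show ?thesis unfolding configs_def ev by (auto simp: Let_def)
qed

end

subsection \<open>Correctness of the search\<close>

lemma extend_iter:
  "set ((extend cf ^^ n) [[s]]) = {p. length p = Suc n \<and> last p = s \<and> set (butlast p) \<subseteq> set cf \<and> successively (\<lambda>X Y. tj_lists Y X) p}"
proof (induction n)
  case 0
  show ?case by (auto simp: length_Suc_conv)
next
  case (Suc n)
  have *: "p \<in> set (extend cf P) \<longleftrightarrow> (\<exists>q\<in>set P. \<exists>X\<in>set cf. tj_lists (top q) X \<and> p = X # q)" for p P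
    by (auto simp: extend_def)
  show ?case
  proof (rule set_eqI)
    fix p
    show "p \<in> set ((extend cf ^^ Suc n) [[s]]) \<longleftrightarrow> p \<in> {p. length p = Suc (Suc n) \<and> last p = s \<and>
       set (butlast p) \<subseteq> set cf \<and> successively (\<lambda>X Y. tj_lists Y X) p}"
    proof (cases p)
      case (Cons X q)
      show ?thesis
      proof (cases q)
        case Nil
        then show ?thesis by (simp add: * Suc Cons)
      next
        case (Cons Y q')
        show ?thesis unfolding funpow.simps comp_apply * Suc
          by (auto simp: \<open>p = X # q\<close> Cons top_def)
      qed
    qed (simp add: *)
  qed
qed

lemma search_result:
  fixes cf s t
  defines "W \<equiv> {p. p \<noteq> [] \<and> length p \<le> Suc (length cf) \<and> last p = s \<and> hd p = t \<and> set (butlast p) \<subseteq> set cf \<and>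
    successively (\<lambda>X Y. tj_lists Y X) p}"
  shows "W = {} \<and> search cf s t = [] \<or> (\<exists>p\<in>W. search cf s t = rev p \<and> (\<forall>p'\<in>W. length p \<le> length p'))"
proof -
  let ?f = "\<lambda>z. (extend cf (fst z), snd z @ extend cf (fst z))"
  have it: "fst ((?f ^^ n) ([[s]], [[s]])) = (extend cf ^^ n) [[s]] \<and>
     set (snd ((?f ^^ n) ([[s]], [[s]]))) = (\<Union>i\<le>n. set ((extend cf ^^ i) [[s]])) \<and>
     sorted (map length (snd ((?f ^^ n) ([[s]], [[s]]))))" for n
  proof (induction n)
    case (Suc n)
    let ?z = "(?f ^^ n) ([[s]], [[s]])"
    have st: "(?f ^^ Suc n) ([[s]], [[s]]) = ?f ?z" by simp
    have ex: "extend cf (fst ?z) = (extend cf ^^ Suc n) [[s]]" using Suc by simp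
    have l1: "length p = Suc (Suc n)" if "p \<in> set (extend cf (fst ?z))" for p
      using that extend_iter[where cf = cf and n = "Suc n" and s = s] by (simp only: ex) auto
    have l2: "length p \<le> Suc n" if p: "p \<in> set (snd ?z)" for p
    proof -
      obtain i where "i \<le> n" "p \<in> set ((extend cf ^^ i) [[s]])" using p Suc by auto
      then show ?thesis unfolding extend_iter by simp
    qed
    have "sorted (map length (snd ?z @ extend cf (fst ?z)))"
      unfolding map_append sorted_append using Suc l1 l2 by (auto simp: sorted_iff_nth_mono le_SucI)
    moreover have "set (snd ?z @ extend cf (fst ?z)) = (\<Union>i\<le>Suc n. set ((extend cf ^^ i) [[s]]))"
      unfolding atMost_Suc set_append ex using Suc by auto
    ultimately show ?case unfolding st fst_conv snd_conv using ex by blast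
  qed simp
  define out where "out = snd ((?f ^^ length cf) ([[s]], [[s]]))"
  have W: "set (filter (\<lambda>p. top p = t) out) = W"
  proof (rule set_eqI)
    fix p
    have "p \<in> set out \<longleftrightarrow> (\<exists>i\<le>length cf. length p = Suc i \<and> last p = s \<and> set (butlast p) \<subseteq> set cf \<and> successively (\<lambda>X Y. tj_lists Y X) p)"
      using it[of "length cf"] unfolding out_def extend_iter by auto
    moreover have "(\<exists>i\<le>length cf. length p = Suc i) \<longleftrightarrow> p \<noteq> [] \<and> length p \<le> Suc (length cf)"
      by (cases p) auto
    moreover have "p \<noteq> [] \<Longrightarrow> top p = hd p" by (cases p) (auto simp: top_def)
    ultimately show "p \<in> set (filter (\<lambda>p. top p = t) out) \<longleftrightarrow> p \<in> W" unfolding W_def by auto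
  qed
  have sr: "search cf s t = (case filter (\<lambda>p. top p = t) out of [] \<Rightarrow> [] | p # _ \<Rightarrow> rev p)"
    by (simp add: search_def out_def)
  show ?thesis
  proof (cases "filter (\<lambda>p. top p = t) out")
    case Nil
    then show ?thesis using W sr by simp
  next
    case (Cons p ps)
    have "sorted (map length (filter (\<lambda>p. top p = t) out))"
      using it[of "length cf"] unfolding out_def by (intro sorted_filter) blast
    then have min: "\<forall>p'\<in>set ps. length p \<le> length p'" unfolding Cons by simp
    have WW: "W = insert p (set ps)" using W unfolding Cons by simp
    have "search cf s t = rev p" unfolding sr Cons by simp
    then show ?thesis unfolding WW using min by auto
  qed
qed

lemma tj_lists_step: "distinct X \<Longrightarrow> distinct Y \<Longrightarrow> tj_lists X Y \<longleftrightarrow> tj_step (set X) (set Y)"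
proof -
  have "length (filter (\<lambda>v. v \<notin> set B) A) = card (set A - set B)" if "distinct A" for A B :: "nat list"
  proof -
    have "length (filter (\<lambda>v. v \<notin> set B) A) = card (set (filter (\<lambda>v. v \<notin> set B) A))"
      by (rule distinct_card[symmetric]) (use that in simp)
    moreover have "set (filter (\<lambda>v. v \<notin> set B) A) = set A - set B" by auto
    ultimately show ?thesis by simp
  qed
  then show "distinct X \<Longrightarrow> distinct Y \<Longrightarrow> tj_lists X Y \<longleftrightarrow> tj_step (set X) (set Y)"
    by (simp add: tj_lists_def tj_step_def)
qed

text \<open>Cutting out the part between two occurrences of a set shortens the sequence. This bounds
  the depth of the search by the number of feasible sets.\<close>

lemma shortest_distinct:
  assumes "shortest_tj_sequence G \<phi> S S' Ss" shows "distinct Ss"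
proof (rule ccontr)
  assume "\<not> distinct Ss"
  then obtain xs ys zs y where Ss: "Ss = xs @ [y] @ ys @ [y] @ zs" using not_distinct_decomp by blast
  have seq: "tj_sequence G \<phi> S S' Ss" using assms by (simp add: shortest_tj_sequence_def)
  have S: "successively tj_step Ss" "hd Ss = S" "last Ss = S'" "\<forall>T\<in>set Ss. T \<subseteq> verts G \<and> models G \<phi> T"
    using seq by (simp_all add: tj_sequence_iff)
  have "Ss = (xs @ [y]) @ (ys @ [y] @ zs)" "Ss = (xs @ [y] @ ys) @ (y # zs)" by (simp_all add: Ss)
  then have *: "successively tj_step ((xs @ [y]) @ (ys @ [y] @ zs))" "successively tj_step ((xs @ [y] @ ys) @ (y # zs))"
    using S(1) by metis+
  have "successively tj_step (xs @ [y])" by (rule successively_append_iff[THEN iffD1, THEN conjunct1, OF *(1)])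
  moreover have "successively tj_step (y # zs)"
    by (rule successively_append_iff[THEN iffD1, THEN conjunct2, THEN conjunct1, OF *(2)])
  ultimately have "successively tj_step ((xs @ [y]) @ zs)"
    unfolding successively_append_iff[of _ "xs @ [y]"] by (cases zs) auto
  moreover have "hd (xs @ [y] @ zs) = S" using S(2) by (cases xs) (auto simp: Ss)
  moreover have "last (xs @ [y] @ zs) = S'" using S(3) by (cases zs) (auto simp: Ss)
  moreover have "\<forall>T\<in>set (xs @ [y] @ zs). T \<subseteq> verts G \<and> models G \<phi> T" using S(4) by (auto simp: Ss)
  ultimately have "tj_sequence G \<phi> S S' (xs @ [y] @ zs)" by (simp add: tj_sequence_iff)
  then have "length Ss \<le> length (xs @ [y] @ zs)" using assms by (auto simp: shortest_tj_sequence_def)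
  then show False by (simp add: Ss)
qed

lemma shortest_exists:
  assumes "tj_sequence G \<phi> S S' Ss" shows "\<exists>Rs. shortest_tj_sequence G \<phi> S S' Rs"
proof -
  have "\<exists>Rs. tj_sequence G \<phi> S S' Rs \<and> (\<forall>Ts. tj_sequence G \<phi> S S' Ts \<longrightarrow> length Rs \<le> length Ts)"
    using ex_has_least_nat[of "tj_sequence G \<phi> S S'" Ss length] assms by blast
  then show ?thesis by (simp add: shortest_tj_sequence_def)
qed

context kern begin

theorem search_correct:
  assumes fv: "free_vars \<phi> \<subseteq> {(VertexSet, 0)}" and ks: "tok_keys (lin \<phi>) \<subseteq> set ks" "ks = key VertexSet 0 # ks'"
    and ci: "color_indices \<phi> \<subseteq> {..<length (colors KG)}"
    and s: "s \<in> set (subseqs [0..<m])" "models KG \<phi> (set s)" and t: "t \<in> set (subseqs [0..<m])" "models KG \<phi> (set t)"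
  defines "res \<equiv> search (configs m es cols (map (norm_tok ks) (lin \<phi>))) s t"
  shows "res \<noteq> [] \<longleftrightarrow> (\<exists>Ss. tj_sequence KG \<phi> (set s) (set t) Ss)"
    "res \<noteq> [] \<Longrightarrow> shortest_tj_sequence KG \<phi> (set s) (set t) (map set res) \<and> (\<forall>X\<in>set res. distinct X \<and> set X \<subseteq> {..<m})"
proof -
  define cf where "cf = configs m es cols (map (norm_tok ks) (lin \<phi>))"
  have cf: "X \<in> set cf \<longleftrightarrow> X \<in> set (subseqs [0..<m]) \<and> models KG \<phi> (set X)" for X
    unfolding cf_def by (rule configs_correct[OF fv ks ci])
  have scf: "s \<in> set cf" "t \<in> set cf" using s t cf by auto
  have props: "set X \<subseteq> {..<m}" "distinct X" "filter (\<lambda>x. x \<in> set X) [0..<m] = X" if "X \<in> set cf" for X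
    using subseq_props[of X "[0..<m]"] that cf by auto
  define W where "W = {p. p \<noteq> [] \<and> length p \<le> Suc (length cf) \<and> last p = s \<and> hd p = t \<and> set (butlast p) \<subseteq> set cf \<and>
    successively (\<lambda>X Y. tj_lists Y X) p}"
  have to_seq: "tj_sequence KG \<phi> (set s) (set t) (map set (rev p))" "set p \<subseteq> set cf" if p: "p \<in> W" for p
  proof -
    have pp: "p \<noteq> []" "last p = s" "hd p = t" "set (butlast p) \<subseteq> set cf" "successively (\<lambda>X Y. tj_lists Y X) p"
      using p by (auto simp: W_def)
    have "set p = insert (last p) (set (butlast p))" using pp(1) by (metis append_butlast_last_id Un_insert_right set_append list.simps(15) empty_set sup_bot.right_neutral)
    then show sub: "set p \<subseteq> set cf" using pp scf by auto
    have "successively (\<lambda>X Y. tj_step (set Y) (set X)) p"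
      by (rule successively_mono[OF pp(5)]) (use tj_lists_step props(2) sub in blast)
    then have "successively tj_step (map set (rev p))" by (simp add: successively_map)
    moreover have "\<forall>T\<in>set (map set (rev p)). T \<subseteq> verts KG \<and> models KG \<phi> T" using sub cf props(1) by (auto simp: verts)
    ultimately show "tj_sequence KG \<phi> (set s) (set t) (map set (rev p))"
      unfolding tj_sequence_iff using pp(1-3) by (simp add: hd_map last_map hd_rev last_rev)
  qed
  \<comment> \<open>The increasing list of \<open>U\<close> is its only representative among the
    subsequences, so sequences of sets turn into walks in \<open>cf\<close>.\<close>
  define canon where "canon U = filter (\<lambda>x. x \<in> U) [0..<m]" for U
  have canon_set: "set (canon U) = U" if "U \<subseteq> verts KG" for U using that by (auto simp: canon_def verts)
  have from_seq: "rev (map canon Ts) \<in> W" if Ts: "tj_sequence KG \<phi> (set s) (set t) Ts" "length Ts \<le> Suc (length cf)" for Ts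
  proof -
    have T: "Ts \<noteq> []" "hd Ts = set s" "last Ts = set t" "\<And>T. T \<in> set Ts \<Longrightarrow> T \<subseteq> verts KG" "\<And>T. T \<in> set Ts \<Longrightarrow> models KG \<phi> T" "successively tj_step Ts"
      using Ts(1) by (auto simp: tj_sequence_iff)
    have in_cf: "canon T \<in> set cf" if "T \<in> set Ts" for T
      using cf T(5)[OF that] canon_set[OF T(4)[OF that]] filter_in_subseqs[of "\<lambda>x. x \<in> T" "[0..<m]"] by (simp add: canon_def)
    have st: "canon (set s) = s" "canon (set t) = t" using props(3) scf by (simp_all add: canon_def)
    have "set (butlast (rev (map canon Ts))) \<subseteq> set (rev (map canon Ts))" by (meson in_set_butlastD subsetI)
    then have 1: "set (butlast (rev (map canon Ts))) \<subseteq> set cf" using in_cf by auto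
    have "successively (\<lambda>X Y. tj_lists (canon X) (canon Y)) Ts"
    proof (rule successively_mono[OF T(6)])
      fix X Y assume "X \<in> set Ts" "Y \<in> set Ts" "tj_step X Y"
      then show "tj_lists (canon X) (canon Y)"
        using tj_lists_step[of "canon X" "canon Y"] props(2)[OF in_cf] canon_set T(4) by simp
    qed
    then have "successively (\<lambda>X Y. tj_lists Y X) (rev (map canon Ts))" by (simp add: successively_map)
    then show ?thesis unfolding W_def using 1 T(1-3) Ts(2) st by (simp add: hd_rev last_rev last_map hd_map)
  qed
  have short: "length Ts \<le> Suc (length cf)" if Ts: "shortest_tj_sequence KG \<phi> (set s) (set t) Ts" for Ts
  proof -
    have seq: "tj_sequence KG \<phi> (set s) (set t) Ts" using Ts by (simp add: shortest_tj_sequence_def)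
    have "set Ts \<subseteq> set ` set cf"
    proof
      fix T assume "T \<in> set Ts"
      then have "T \<subseteq> verts KG" "models KG \<phi> T" using seq by (auto simp: tj_sequence_iff)
      then have "canon T \<in> set cf" "T = set (canon T)"
        using cf canon_set filter_in_subseqs[of "\<lambda>x. x \<in> T" "[0..<m]"] by (auto simp: canon_def)
      then show "T \<in> set ` set cf" by blast
    qed
    then have "card (set Ts) \<le> card (set ` set cf)" by (intro card_mono) auto
    also have "\<dots> \<le> card (set cf)" by (rule card_image_le) simp
    also have "\<dots> \<le> length cf" by (rule card_length)
    finally show ?thesis using distinct_card[OF shortest_distinct[OF Ts]] by simp
  qed
  have res: "W = {} \<and> res = [] \<or> (\<exists>p\<in>W. res = rev p \<and> (\<forall>p'\<in>W. length p \<le> length p'))"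
    using search_result[of cf s t] unfolding res_def cf_def[symmetric] W_def .
  show "res \<noteq> [] \<longleftrightarrow> (\<exists>Ss. tj_sequence KG \<phi> (set s) (set t) Ss)"
  proof
    assume "res \<noteq> []"
    then obtain p where "p \<in> W" using res by auto
    then show "\<exists>Ss. tj_sequence KG \<phi> (set s) (set t) Ss" using to_seq(1) by blast
  next
    assume "\<exists>Ss. tj_sequence KG \<phi> (set s) (set t) Ss"
    then obtain Rs where Rs: "shortest_tj_sequence KG \<phi> (set s) (set t) Rs" using shortest_exists by blast
    then have "rev (map canon Rs) \<in> W" using from_seq short by (simp add: shortest_tj_sequence_def)
    moreover have "p \<noteq> []" if "p \<in> W" for p using that by (simp add: W_def)
    ultimately show "res \<noteq> []" using res by (metis empty_iff rev_is_Nil_conv)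
  qed
  assume "res \<noteq> []"
  then obtain p where p: "p \<in> W" "res = rev p" "\<And>p'. p' \<in> W \<Longrightarrow> length p \<le> length p'" using res by blast
  have seq: "tj_sequence KG \<phi> (set s) (set t) (map set res)" using to_seq(1)[OF p(1)] by (simp add: p(2))
  have "length (map set res) \<le> length Ts" if Ts: "tj_sequence KG \<phi> (set s) (set t) Ts" for Ts
  proof -
    obtain Rs where Rs: "shortest_tj_sequence KG \<phi> (set s) (set t) Rs" using shortest_exists[OF Ts] by blast
    then have "rev (map canon Rs) \<in> W" using from_seq short by (simp add: shortest_tj_sequence_def)
    then have "length p \<le> length Rs" using p(3) by fastforce
    also have "length Rs \<le> length Ts" using Rs Ts by (simp add: shortest_tj_sequence_def)
    finally show ?thesis by (simp add: p(2))
  qed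
  moreover have "\<forall>X\<in>set res. distinct X \<and> set X \<subseteq> {..<m}"
    using to_seq(2)[OF p(1)] props(1,2) by (auto simp only: p(2) set_rev subset_iff)
  ultimately show "shortest_tj_sequence KG \<phi> (set s) (set t) (map set res) \<and> (\<forall>X\<in>set res. distinct X \<and> set X \<subseteq> {..<m})"
    using seq by (simp add: shortest_tj_sequence_def)
qed

end

section \<open>Kernelization in polynomial time\<close>

text \<open>An encoded atom does not mention the sorts of its arguments; \<open>code1\<close> and
  \<open>code2\<close> recover the name space of the first and the second argument from the
  operator.\<close>

definition code1 :: "bt \<Rightarrow> bt" where
  "code1 c = (if c = bt_of_nat 1 \<or> c = bt_of_nat 5 \<or> c = bt_of_nat 6 then bt_of_nat 2
     else if c = bt_of_nat 3 then color_code else bt_of_nat 0)"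

definition code2 :: "bt \<Rightarrow> bt" where
  "code2 c = (if c = bt_of_nat 1 then bt_of_nat 2 else if c = bt_of_nat 4 then bt_of_nat 1
     else if c = bt_of_nat 5 then bt_of_nat 3 else bt_of_nat 0)"

definition lin_step :: "bt list \<times> rawtok list \<Rightarrow> bt list \<times> rawtok list" where
  "lin_step st = (case fst st of [] \<Rightarrow> st | f # r \<Rightarrow> (let c = bt_hd f; d = bt_tl f in
     if c = bt_of_nat 7 then (d # r, (c, nokey, nokey) # snd st)
     else if c = bt_of_nat 8 \<or> c = bt_of_nat 9 \<or> c = bt_of_nat 10 \<or> c = bt_of_nat 11 then
       (bt_hd d # bt_tl d # r, (c, nokey, nokey) # snd st)
     else if c = bt_of_nat 12 \<or> c = bt_of_nat 13 then
       (bt_tl (bt_tl d) # r, (c, (bt_hd d, bt_hd (bt_tl d)), nokey) # snd st)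
     else (r, (c, (code1 c, bt_hd d), (code2 c, bt_tl d)) # snd st)))"

text \<open>Each round emits one token, so \<open>bt_size x\<close> rounds suffice by
  \<open>nodes_le_size\<close>; later rounds idle on the empty stack.\<close>

definition linp :: "bt \<Rightarrow> rawtok list" where
  "linp x = rev (snd ((lin_step ^^ bt_size x) ([x], [])))"

lemma lin_step_iter:
  "sum_list (map nodes fs) \<le> n \<Longrightarrow>
    (lin_step ^^ n) (map bt_of_mso2 fs, out) = ([], rev (concat (map lin fs)) @ out)"
proof (induction n arbitrary: fs out)
  case 0
  have [simp]: "nodes \<phi> \<noteq> 0" for \<phi> by (cases \<phi>) auto
  then have "fs = []" using 0 by (cases fs) auto
  then show ?case by simp
next
  case (Suc n)
  show ?case
  proof (cases fs)
    case Nil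
    have "lin_step ([], out) = ([], out)" by (simp add: lin_step_def)
    then have "(lin_step ^^ k) ([], out) = ([], out)" for k by (induction k) auto
    then show ?thesis by (simp only: Nil list.map concat.simps rev.simps append_Nil)
  next
    case (Cons \<phi> fs')
    have step: "(lin_step ^^ Suc n) z = (lin_step ^^ n) (lin_step z)" for z by (simp add: funpow_swap1)
    have IH: "(lin_step ^^ n) (map bt_of_mso2 gs, out') = ([], rev (concat (map lin gs)) @ out')"
      if "sum_list (map nodes gs) \<le> n" for gs out' by (rule Suc.IH[OF that])
    note defs = lin_step_def Cons code1_def code2_def color_code_def Let_def
    show ?thesis unfolding step
    proof (cases \<phi>)
      case (Neg \<psi>)
      then show "(lin_step ^^ n) (lin_step (map bt_of_mso2 fs, out)) = ([], rev (concat (map lin fs)) @ out)"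
        using IH[of "\<psi> # fs'" "(bt_of_nat 7, nokey, nokey) # out"] Suc.prems by (simp add: defs)
    next
      case (Conj \<psi> \<chi>)
      then show "(lin_step ^^ n) (lin_step (map bt_of_mso2 fs, out)) = ([], rev (concat (map lin fs)) @ out)"
        using IH[of "\<psi> # \<chi> # fs'" "(bt_of_nat 8, nokey, nokey) # out"] Suc.prems by (simp add: defs)
    next
      case (Disj \<psi> \<chi>)
      then show "(lin_step ^^ n) (lin_step (map bt_of_mso2 fs, out)) = ([], rev (concat (map lin fs)) @ out)"
        using IH[of "\<psi> # \<chi> # fs'" "(bt_of_nat 9, nokey, nokey) # out"] Suc.prems by (simp add: defs)
    next
      case (Imp \<psi> \<chi>)
      then show "(lin_step ^^ n) (lin_step (map bt_of_mso2 fs, out)) = ([], rev (concat (map lin fs)) @ out)"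
        using IH[of "\<psi> # \<chi> # fs'" "(bt_of_nat 10, nokey, nokey) # out"] Suc.prems by (simp add: defs)
    next
      case (Iff \<psi> \<chi>)
      then show "(lin_step ^^ n) (lin_step (map bt_of_mso2 fs, out)) = ([], rev (concat (map lin fs)) @ out)"
        using IH[of "\<psi> # \<chi> # fs'" "(bt_of_nat 11, nokey, nokey) # out"] Suc.prems by (simp add: defs)
    next
      case (Exists s x \<psi>)
      then show "(lin_step ^^ n) (lin_step (map bt_of_mso2 fs, out)) = ([], rev (concat (map lin fs)) @ out)"
        using IH[of "\<psi> # fs'" "(bt_of_nat 12, key s x, nokey) # out"] Suc.prems by (simp add: defs)
    next
      case (Forall s x \<psi>)
      then show "(lin_step ^^ n) (lin_step (map bt_of_mso2 fs, out)) = ([], rev (concat (map lin fs)) @ out)"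
        using IH[of "\<psi> # fs'" "(bt_of_nat 13, key s x, nokey) # out"] Suc.prems by (simp add: defs)
    qed (use Suc.prems in \<open>simp_all add: IH defs\<close>)
  qed
qed

lemma nodes_le_size: "nodes \<phi> \<le> bt_size (bt_of_mso2 \<phi>)"
  by (induction \<phi>) simp_all

lemma linp_correct: "linp (bt_of_mso2 \<phi>) = lin \<phi>"
  using lin_step_iter[of "[\<phi>]" "bt_size (bt_of_mso2 \<phi>)" "[]"] nodes_le_size[of \<phi>] by (simp add: linp_def)

lemma bt_size_hd: "bt_size (bt_hd x) \<le> bt_size x" and bt_size_tl: "bt_size (bt_tl x) \<le> bt_size x"
  by (cases x; simp)+

lemma code_size: "bt_size (code1 c) \<le> 17" "bt_size (code2 c) \<le> 17"
  using bt_size_bt_of_nat[of 1] bt_size_bt_of_nat[of 2] bt_size_bt_of_nat[of 3] bt_size_bt_of_nat[of 4]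
  by (auto simp: code1_def code2_def color_code_def)

text \<open>The bound is needed on all trees, also on those that encode no formula. The operands
  taken from a tree fit into its size, so the pending stack never grows, and each token is linear in
  it.\<close>

lemma lin_step_size:
  "sz (fst (lin_step st)) \<le> sz (fst st) \<and> sz (snd (lin_step st)) \<le> sz (snd st) + 3 * sz (fst st) + 60"
proof (cases "fst st")
  case Nil
  then show ?thesis by (simp add: lin_step_def)
next
  case (Cons f r)
  define c where "c = bt_hd f"
  define d where "d = bt_tl f"
  have f: "sz (fst st) = 1 + bt_size f + sz r" by (simp add: Cons)
  have sizes: "bt_size c \<le> bt_size f" "bt_size (bt_hd d) \<le> bt_size f" "bt_size (bt_tl d) \<le> bt_size f"
    "bt_size (bt_hd (bt_tl d)) \<le> bt_size f" "bt_size (bt_tl (bt_tl d)) \<le> bt_size f" "bt_size d \<le> bt_size f"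
    unfolding c_def d_def by (meson bt_size_hd bt_size_tl le_trans)+
  \<comment> \<open>\<open>bt_hd\<close> and \<open>bt_tl\<close> return \<open>Lf\<close> on
    \<open>Lf\<close>, so two operands could outgrow their tree; a nonzero operator code excludes
    \<open>f = Lf\<close>.\<close>
  have two: "bt_size (bt_hd d) + bt_size (bt_tl d) + 1 \<le> bt_size f" if "c \<noteq> Lf"
  proof (cases f)
    case (Br l e)
    then have "d = e" by (simp add: d_def)
    moreover have "0 < bt_size l" by simp
    ultimately show ?thesis unfolding Br by (cases e) (auto simp: Suc_le_eq)
  qed (use that in \<open>simp add: c_def\<close>)
  have ls: "lin_step st = (if c = bt_of_nat 7 then (d # r, (c, nokey, nokey) # snd st)
     else if c = bt_of_nat 8 \<or> c = bt_of_nat 9 \<or> c = bt_of_nat 10 \<or> c = bt_of_nat 11 then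
       (bt_hd d # bt_tl d # r, (c, nokey, nokey) # snd st)
     else if c = bt_of_nat 12 \<or> c = bt_of_nat 13 then
       (bt_tl (bt_tl d) # r, (c, (bt_hd d, bt_hd (bt_tl d)), nokey) # snd st)
     else (r, (c, (code1 c, bt_hd d), (code2 c, bt_tl d)) # snd st))"
    by (simp add: lin_step_def Cons c_def d_def Let_def)
  consider "c = bt_of_nat 7" | "c \<noteq> bt_of_nat 7" "c = bt_of_nat 8 \<or> c = bt_of_nat 9 \<or> c = bt_of_nat 10 \<or> c = bt_of_nat 11"
    | "c \<noteq> bt_of_nat 7" "\<not> (c = bt_of_nat 8 \<or> c = bt_of_nat 9 \<or> c = bt_of_nat 10 \<or> c = bt_of_nat 11)" "c = bt_of_nat 12 \<or> c = bt_of_nat 13"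
    | "c \<noteq> bt_of_nat 7" "\<not> (c = bt_of_nat 8 \<or> c = bt_of_nat 9 \<or> c = bt_of_nat 10 \<or> c = bt_of_nat 11)" "\<not> (c = bt_of_nat 12 \<or> c = bt_of_nat 13)"
    by blast
  then show ?thesis
  proof cases
    case 1
    then have "lin_step st = (d # r, (c, nokey, nokey) # snd st)" unfolding ls by simp
    then show ?thesis unfolding f using sizes by simp
  next
    case 2
    then have "lin_step st = (bt_hd d # bt_tl d # r, (c, nokey, nokey) # snd st)" unfolding ls by simp
    moreover have "c \<noteq> Lf" using 2(2) by auto
    ultimately show ?thesis unfolding f using sizes two by simp
  next
    case 3
    then have "lin_step st = (bt_tl (bt_tl d) # r, (c, (bt_hd d, bt_hd (bt_tl d)), nokey) # snd st)" unfolding ls by simp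
    then show ?thesis unfolding f using sizes by simp
  next
    case 4
    then have "lin_step st = (r, (c, (code1 c, bt_hd d), (code2 c, bt_tl d)) # snd st)" unfolding ls by simp
    then show ?thesis unfolding f using sizes code_size[of c] by simp
  qed
qed

lemma cmp_linp: "cmp b linp"
proof -
  have "cmp b (\<lambda>x. (lin_step ^^ bt_size x) ([x], []))"
  proof (rule cmp_funpow)
    show "cmp b (\<lambda>p::bt \<times> bt list \<times> rawtok list. lin_step (snd p))"
      unfolding lin_step_def code1_def code2_def color_code_def by (intro cmp_intros)
    have it: "sz (fst ((lin_step ^^ i) ([x], []))) \<le> sz x + 2 \<and>
      sz (snd ((lin_step ^^ i) ([x], []))) \<le> 1 + i * (3 * (sz x + 2) + 60)" for x i
    proof (induction i)
      case (Suc i)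
      then show ?case using lin_step_size[of "(lin_step ^^ i) ([x], [])"] by simp
    qed simp
    have "sz ((lin_step ^^ i) ([x], [])) \<le> 10 + sz x + sz x * (3 * (sz x + 2) + 60)" if "i \<le> bt_size x" for x i
    proof -
      define K where "K = 3 * (sz x + 2) + 60"
      have "i * K \<le> sz x * K" using that by (intro mult_right_mono) simp_all
      moreover have "sz ((lin_step ^^ i) ([x], [])) = 1 + sz (fst ((lin_step ^^ i) ([x], []))) + sz (snd ((lin_step ^^ i) ([x], [])))"
        by (cases "(lin_step ^^ i) ([x], [])") simp
      ultimately show ?thesis using it[of i x] unfolding K_def[symmetric] by linarith
    qed
    then show "\<exists>B. bnd b B \<and> (\<forall>x i. i \<le> bt_size x \<longrightarrow> sz ((lin_step ^^ i) ([x], [])) \<le> B (sz x))"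
      by (intro exI[of _ "\<lambda>n. 10 + n + n * (3 * (n + 2) + 60)"] conjI bnd_intros) blast
  qed (intro cmp_intros)+
  from cmp_rev[OF cmp_snd[OF this]] show ?thesis by (simp add: linp_def[abs_def])
qed

text \<open>The free variable comes first so that it gets slot 0. Repeated keys are harmless, as
  \<open>idx\<close> finds one position for each.\<close>

definition keys_of :: "rawtok list \<Rightarrow> (bt \<times> bt) list" where
  "keys_of raw = key VertexSet 0 # concat (map (\<lambda>t. [fst (snd t), snd (snd t)]) raw)"

text \<open>The index \<open>c\<close> is binary. Comparing it with the codes of the indices in
  range avoids the conversion to unary, which is not polynomial.\<close>

definition colget :: "bt \<Rightarrow> bt list list \<Rightarrow> bt list" where
  "colget c cs = (case filter (\<lambda>i. bt_of_nat i = c) [0..<length cs] of [] \<Rightarrow> [] | i # _ \<Rightarrow> nthd [] i cs)"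

lemma colget_nth: "i < length cs \<Longrightarrow> colget (bt_of_nat i) cs = cs ! i"
proof -
  assume i: "i < length cs"
  then have "i \<in> set (filter (\<lambda>j. j = i) [0..<length cs])" by simp
  then obtain j js where f: "filter (\<lambda>j. j = i) [0..<length cs] = j # js" by (cases "filter (\<lambda>j. j = i) [0..<length cs]") auto
  then have "j \<in> set (filter (\<lambda>j. j = i) [0..<length cs])" by simp
  then have "j = i" by simp
  then show ?thesis using f i by (simp add: colget_def)
qed

definition color_lists :: "(bt \<times> bt) list \<Rightarrow> bt list list \<Rightarrow> bt list list" where
  "color_lists ks cs = map (\<lambda>k. if fst k = color_code then colget (snd k) cs else []) ks"

text \<open>Filtering \<open>[0..<length ns]\<close> yields the positions in increasing order, that
  is, the canonical list that also occurs among the subsequences in \<open>configs\<close>.\<close>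

definition positions :: "bt list \<Rightarrow> bt list \<Rightarrow> nat list" where
  "positions ns C = filter (\<lambda>i. nthd Lf i ns \<in> set C) [0..<length ns]"

type_synonym input = "(bt list \<times> (bt \<times> bt) list \<times> bt list list) \<times> bt \<times> bt list \<times> bt list"

definition kernel_of :: "bt list \<Rightarrow> (bt \<times> bt) list \<Rightarrow> bt list list \<Rightarrow> rawtok list \<Rightarrow> (bt \<times> bt) list \<Rightarrow> bt list \<Rightarrow> bt list \<Rightarrow> kernel" where
  "kernel_of ns es cls raw ks s t = (length ns,
     map (\<lambda>e. (idx ns (fst e), idx ns (snd e))) (filter (\<lambda>e. fst e \<in> set ns \<and> snd e \<in> set ns) es),
     map (positions ns) cls, map (norm_tok ks) raw, positions ns s, positions ns t)"

text \<open>\<open>length raw\<close> is the number of nodes of the formula, and the offset 3 is the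
  one in the locale \<open>dfs\<close>. The two input sets act as two more colours of the
  label.\<close>

definition kernel_names :: "input \<Rightarrow> rawtok list \<Rightarrow> bt list list \<Rightarrow> bt list" where
  "kernel_names x raw cls = run_dfs (fst (fst x), fst (snd (fst x)), cls @ [fst (snd (snd x)), snd (snd (snd x))],
     length raw, length (fst (snd (snd x))) + 3)"

definition kernelize :: "input \<Rightarrow> bt list \<times> kernel" where
  "kernelize x = (let raw = linp (fst (snd x)); ks = keys_of raw; cls = color_lists ks (snd (snd (fst x)));
     ns = kernel_names x raw cls in
     (ns, kernel_of ns (fst (snd (fst x))) cls raw ks (fst (snd (snd x))) (snd (snd (snd x)))))"

lemma cmp_keys_of [cmp_intros]: "cmp b f \<Longrightarrow> cmp b (\<lambda>x. keys_of (f x))"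
  unfolding keys_of_def by (intro cmp_intros)

lemma cmp_colget [cmp_intros]: "cmp b f \<Longrightarrow> cmp b g \<Longrightarrow> cmp b (\<lambda>x. colget (f x) (g x))"
proof -
  have "cmp b (\<lambda>p. colget (fst p) (snd p))" unfolding colget_def by (intro cmp_intros)
  from cmp_comp[OF this cmp_Pair] show "cmp b f \<Longrightarrow> cmp b g \<Longrightarrow> cmp b (\<lambda>x. colget (f x) (g x))" by simp
qed

lemma cmp_color_lists [cmp_intros]: "cmp b f \<Longrightarrow> cmp b g \<Longrightarrow> cmp b (\<lambda>x. color_lists (f x) (g x))"
proof -
  have "cmp b (\<lambda>p. color_lists (fst p) (snd p))" unfolding color_lists_def by (intro cmp_intros)
  from cmp_comp[OF this cmp_Pair] show "cmp b f \<Longrightarrow> cmp b g \<Longrightarrow> cmp b (\<lambda>x. color_lists (f x) (g x))" by simp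
qed

lemma cmp_positions [cmp_intros]: "cmp b f \<Longrightarrow> cmp b g \<Longrightarrow> cmp b (\<lambda>x. positions (f x) (g x))"
proof -
  have "cmp b (\<lambda>p. positions (fst p) (snd p))" unfolding positions_def by (intro cmp_intros)
  from cmp_comp[OF this cmp_Pair] show "cmp b f \<Longrightarrow> cmp b g \<Longrightarrow> cmp b (\<lambda>x. positions (f x) (g x))" by simp
qed

lemma cmp_norm_tok [cmp_intros]: "cmp b f \<Longrightarrow> cmp b g \<Longrightarrow> cmp b (\<lambda>x. norm_tok (f x) (g x))"
  unfolding norm_tok_def by (intro cmp_intros)

lemma cmp_kernelize: "cmp b kernelize"
proof -
  have raw: "cmp b (\<lambda>x::input. linp (fst (snd x)))" by (intro cmp_comp[OF cmp_linp] cmp_intros)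
  have names: "cmp b (\<lambda>p. kernel_names (fst p) (fst (snd p)) (snd (snd p)))"
    unfolding kernel_names_def by (intro cmp_comp[OF cmp_run_dfs] cmp_intros)
  have ker: "cmp b (\<lambda>p. kernel_of (fst p) (fst (snd p)) (fst (snd (snd p))) (fst (snd (snd (snd p))))
      (fst (snd (snd (snd (snd p))))) (fst (snd (snd (snd (snd (snd p)))))) (snd (snd (snd (snd (snd (snd p)))))))"
    unfolding kernel_of_def by (intro cmp_intros)
  have 1: "cmp b (\<lambda>x::input. (linp (fst (snd x)), color_lists (keys_of (linp (fst (snd x)))) (snd (snd (fst x)))))"
    by (intro cmp_Pair cmp_color_lists cmp_keys_of raw cmp_snd cmp_fst cmp_id)
  from cmp_comp[OF names cmp_Pair[OF cmp_id 1]]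
  have 2: "cmp b (\<lambda>x::input. kernel_names x (linp (fst (snd x))) (color_lists (keys_of (linp (fst (snd x)))) (snd (snd (fst x)))))"
    by simp
  have 3: "cmp b (\<lambda>x::input. (kernel_names x (linp (fst (snd x))) (color_lists (keys_of (linp (fst (snd x)))) (snd (snd (fst x)))),
     fst (snd (fst x)), color_lists (keys_of (linp (fst (snd x)))) (snd (snd (fst x))), linp (fst (snd x)), keys_of (linp (fst (snd x))),
     fst (snd (snd x)), snd (snd (snd x))))"
    by (intro cmp_Pair 2 cmp_color_lists cmp_keys_of raw cmp_snd cmp_fst cmp_id)
  from cmp_comp[OF ker 3] have 4: "cmp b (\<lambda>x::input. kernel_of (kernel_names x (linp (fst (snd x))) (color_lists (keys_of (linp (fst (snd x)))) (snd (snd (fst x)))))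
     (fst (snd (fst x))) (color_lists (keys_of (linp (fst (snd x)))) (snd (snd (fst x)))) (linp (fst (snd x))) (keys_of (linp (fst (snd x))))
     (fst (snd (snd x))) (snd (snd (snd x))))"
    by simp
  from cmp_Pair[OF 2 4] show ?thesis by (simp add: kernelize_def[abs_def] Let_def)
qed

subsection \<open>The size of the kernel\<close>

definition kernel_bound :: "nat \<Rightarrow> nat \<Rightarrow> nat" where
  "kernel_bound m q = 2 * m + (m * m * (4 * m + 4)) + ((2 * q + 1) * (m * (2 * m + 2) + 2))
     + (q * (100 + 8 * q)) + 2 * (m * (2 * m + 2)) + 20"

lemma sz_list_le: "(\<And>x. x \<in> set xs \<Longrightarrow> sz x \<le> c) \<Longrightarrow> sz xs \<le> 1 + length xs * (c + 1)"
proof (induction xs)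
  case (Cons x xs)
  have "sz x \<le> c" using Cons.prems by simp
  moreover have "sz xs \<le> 1 + length xs * (c + 1)" using Cons by simp
  ultimately show ?case by simp
qed simp

lemma sz_positions: "sz (positions ns C) \<le> 1 + length ns * (2 * length ns + 2)"
proof -
  have "sz (positions ns C) \<le> 1 + length (positions ns C) * (2 * length ns + 1 + 1)"
    by (rule sz_list_le) (auto simp: positions_def)
  moreover have "length (positions ns C) \<le> length ns"
    unfolding positions_def using length_filter_le[of _ "[0..<length ns]"] by simp
  then have "length (positions ns C) * (2 * length ns + 1 + 1) \<le> length ns * (2 * length ns + 1 + 1)"
    by (rule mult_le_mono1)
  ultimately have "sz (positions ns C) \<le> 1 + length ns * (2 * length ns + 1 + 1)" by linarith
  then show ?thesis by simp
qed

text \<open>By \<open>bt_size_bt_of_nat\<close>, 53 is \<open>4 * 13 + 1\<close> for the largest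
  operator code, and 17 is \<open>4 * 4 + 1\<close> for \<open>color_code\<close>, the largest code
  of a name space.\<close>

lemma lin_code_size: "tk \<in> set (lin \<phi>) \<Longrightarrow> bt_size (fst tk) \<le> 53 \<and> bt_size (fst (fst (snd tk))) \<le> 17"
proof (induction \<phi>)
  have n: "bt_size (bt_of_nat n) \<le> 53" if "n \<le> 13" for n using bt_size_bt_of_nat[of n] that by simp
  have s: "bt_size (bt_of_sort s) \<le> 17" for s
    using bt_size_bt_of_nat[of 1] bt_size_bt_of_nat[of 2] bt_size_bt_of_nat[of 3] by (cases s) auto
  have c: "bt_size color_code \<le> 17" using bt_size_bt_of_nat[of 4] by (simp add: color_code_def)
  have s': "bt_size (bt_of_nat 1) \<le> 17" "bt_size (bt_of_nat 2) \<le> 17" "bt_size (bt_of_nat 3) \<le> 17" "bt_size (bt_of_nat 0) \<le> 17"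
    using s[of VertexSet] s[of Edge] s[of EdgeSet] by simp_all
  {
    case (EqV x y) then show ?case using n[of 0] by auto
  next
    case (EqE x y) then show ?case using n[of 1] s' by auto
  next
    case (Adj x y) then show ?case using n[of 2] by auto
  next
    case (Col x y) then show ?case using n[of 3] c by auto
  next
    case (MemV x y) then show ?case using n[of 4] by auto
  next
    case (MemE x y) then show ?case using n[of 5] s' by auto
  next
    case (Inc x y) then show ?case using n[of 6] s' by auto
  next
    case (Neg \<phi>) then show ?case using n[of 7] by auto
  next
    case (Conj \<phi> \<psi>) then show ?case using n[of 8] by auto
  next
    case (Disj \<phi> \<psi>) then show ?case using n[of 9] by auto
  next
    case (Imp \<phi> \<psi>) then show ?case using n[of 10] by auto
  next
    case (Iff \<phi> \<psi>) then show ?case using n[of 11] by auto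
  next
    case (Exists q x \<phi>) then show ?case using n[of 12] s[of q] by auto
  next
    case (Forall q x \<phi>) then show ?case using n[of 13] s[of q] by auto
  }
qed

lemma length_lin: "length (lin \<phi>) = nodes \<phi>"
  by (induction \<phi>) auto

lemma nodes_le_length: "nodes \<phi> \<le> mso2_length \<phi>"
  by (induction \<phi>) auto

lemma length_keys_of: "length (keys_of raw) = 2 * length raw + 1"
  by (induction raw) (auto simp: keys_of_def)

lemma set_keys_of: "set (keys_of raw) = insert (key VertexSet 0) (tok_keys raw)"
  by (auto simp: keys_of_def tok_keys_def)

text \<open>Edges are listed without repetition and renumbered injectively, so at most
  \<open>m * m\<close> pairs remain; slot numbers stay below the number of keys,
  \<open>2 * q + 1\<close>.\<close>

lemma sz_kernel_of:
  assumes es: "distinct (map (\<lambda>e. {fst e, snd e}) es)" and ns: "distinct ns"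
    and cls: "length cls = 2 * nodes \<phi> + 1" and ks: "ks = keys_of (lin \<phi>)"
  shows "sz (kernel_of ns es cls (lin \<phi>) ks s t) \<le> kernel_bound (length ns) (nodes \<phi>)"
proof -
  define m where "m = length ns"
  define q where "q = nodes \<phi>"
  let ?es = "filter (\<lambda>e. fst e \<in> set ns \<and> snd e \<in> set ns) es"
  let ?f = "\<lambda>e. (idx ns (fst e), idx ns (snd e))"
  have d: "distinct ?es" using es by (simp add: distinct_map)
  have "inj_on ?f (set ?es)"
  proof (rule inj_onI)
    fix e e' assume a: "e \<in> set ?es" "e' \<in> set ?es" "?f e = ?f e'"
    have inj: "u = u'" if "u \<in> set ns" "u' \<in> set ns" "idx ns u = idx ns u'" for u u'
      using idx_props(2)[OF that(1)] idx_props(2)[OF that(2)] that(3) by metis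
    have "fst e = fst e'" by (rule inj) (use a in simp_all)
    moreover have "snd e = snd e'" by (rule inj) (use a in simp_all)
    ultimately show "e = e'" by (rule prod_eqI)
  qed
  then have "distinct (map ?f ?es)" using d by (simp only: distinct_map)
  then have "length (map ?f ?es) = card (set (map ?f ?es))" by (rule distinct_card[symmetric])
  also have "\<dots> = card (?f ` set ?es)" by (simp only: set_map)
  also have "\<dots> \<le> card ({..<m} \<times> {..<m})"
    by (rule card_mono) (auto simp: m_def intro: idx_props)
  finally have l1: "length (map ?f ?es) \<le> m * m" by (simp add: card_cartesian_product)
  have "sz (map ?f ?es) \<le> 1 + length (map ?f ?es) * (4 * m + 3 + 1)"
  proof (rule sz_list_le)
    fix x assume "x \<in> set (map ?f ?es)"
    then obtain e where e: "x = ?f e" "fst e \<in> set ns" "snd e \<in> set ns" by auto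
    show "sz x \<le> 4 * m + 3" using idx_props(1)[OF e(2)] idx_props(1)[OF e(3)] by (simp add: e(1) m_def)
  qed
  also have "\<dots> \<le> 1 + m * m * (4 * m + 4)" using mult_le_mono1[OF l1, of "4 * m + 4"] by (simp add: algebra_simps)
  finally have 1: "sz (map ?f ?es) \<le> 1 + m * m * (4 * m + 4)" .
  have "sz (map (positions ns) cls) \<le> 1 + length (map (positions ns) cls) * (1 + m * (2 * m + 2) + 1)"
    by (rule sz_list_le) (use sz_positions[of ns] in \<open>auto simp: m_def\<close>)
  then have 2: "sz (map (positions ns) cls) \<le> 1 + (2 * q + 1) * (m * (2 * m + 2) + 2)" by (simp add: cls q_def)
  have "sz (map (norm_tok ks) (lin \<phi>)) \<le> 1 + length (map (norm_tok ks) (lin \<phi>)) * (99 + 8 * q + 1)"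
  proof (rule sz_list_le)
    fix x assume "x \<in> set (map (norm_tok ks) (lin \<phi>))"
    then obtain tk where tk: "tk \<in> set (lin \<phi>)" "x = norm_tok ks tk" by auto
    have "fst (snd tk) \<in> set ks" "snd (snd tk) \<in> set ks" using tk(1) unfolding ks set_keys_of tok_keys_def by auto
    then have "idx ks (fst (snd tk)) < 2 * q + 1" "idx ks (snd (snd tk)) < 2 * q + 1"
      using idx_props(1)[of _ ks] length_keys_of[of "lin \<phi>"] by (simp_all add: ks q_def length_lin)
    then show "sz x \<le> 99 + 8 * q" using lin_code_size[OF tk(1)] by (simp add: tk(2) norm_tok_def)
  qed
  then have 3: "sz (map (norm_tok ks) (lin \<phi>)) \<le> 1 + q * (100 + 8 * q)" by (simp add: length_lin q_def add.commute)
  have 4: "sz (positions ns C) \<le> 1 + m * (2 * m + 2)" for C using sz_positions[of ns C] by (simp add: m_def)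
  show ?thesis unfolding kernel_of_def kernel_bound_def m_def[symmetric] q_def[symmetric]
    using 1 2 3 4[of s] 4[of t] by simp
qed

lemma width_mono: "q \<le> q' \<Longrightarrow> r \<le> r' \<Longrightarrow> M \<le> M' \<Longrightarrow> width q r M \<le> width q' r' M'"
  unfolding width_def by (intro mult_mono power_increasing add_mono) auto

lemma type_bound_mono:
  assumes "q \<le> q'" "r \<le> r'" "I \<le> I'" "P \<le> P'" "h \<le> h'"
  shows "type_bound q r I P h \<le> type_bound q' r' I' P' h'"
proof -
  have same: "type_bound q r I P h \<le> type_bound q' r' I' P' h" for h
    using assms by (induction h) (auto intro!: add_mono mult_mono width_mono)
  have F: "5 + 4 * P' + 4 * I' + width q' r' M * (M + 1) \<le> 5 + 4 * P' + 4 * I' + width q' r' M' * (M' + 1)"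
    if "M \<le> M'" for M M' using that by (intro add_mono mult_mono width_mono) auto
  have "type_bound q' r' I' P' n \<le> type_bound q' r' I' P' (Suc n)" for n
  proof (induction n)
    case (Suc n)
    from F[OF this] show ?case by (simp only: type_bound.simps)
  qed simp
  then have "type_bound q' r' I' P' h \<le> type_bound q' r' I' P' h'" using assms(5) by (rule lift_Suc_mono_le)
  then show ?thesis using same[of h] by linarith
qed

lemma kernel_bound_mono: "m \<le> m' \<Longrightarrow> q \<le> q' \<Longrightarrow> kernel_bound m q \<le> kernel_bound m' q'"
  unfolding kernel_bound_def by (intro add_mono mult_mono) auto

text \<open>The label has one bit per key, at most \<open>2 * k + 1\<close> of them, and two for the
  input sets; \<open>2 ^ k\<close> bounds the length of paths by
  \<open>gpath_length\<close>.\<close>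

definition total_bound :: "nat \<Rightarrow> nat" where
  "total_bound k = (let T = type_bound k (k + 3) (2 * k + 3) (2 ^ k) (2 ^ k) in
     kernel_bound (width k (k + 3) T * T) k)"

lemma cmp_total_bound: "cmp False total_bound"
proof -
  have tb: "type_bound q r I P h = ((\<lambda>M. 5 + 4 * P + 4 * I + width q r M * (M + 1)) ^^ h) 0" for q r I P h
    by (induction h) auto
  show ?thesis unfolding total_bound_def[abs_def] kernel_bound_def tb width_def
    by (intro cmp_Let cmp_funpow_unbounded cmp_add cmp_mult cmp_power cmp_const cmp_fst cmp_snd cmp_id)
qed

section \<open>Reconfiguration sequences in the kernel and in the input graph\<close>

lemma sat_same_colors:
  assumes "verts G = verts G'" "edges G = edges G'"
  shows "(\<And>i. i \<in> color_indices \<phi> \<Longrightarrow> colors G ! i = colors G' ! i) \<Longrightarrow> sat G a A b B \<phi> \<longleftrightarrow> sat G' a A b B \<phi>"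
proof (induction \<phi> arbitrary: a A b B)
  case (Exists s x \<phi>)
  then have "sat G a A b B \<phi> \<longleftrightarrow> sat G' a A b B \<phi>" for a A b B by simp
  then show ?case by (cases s) (simp_all add: assms)
next
  case (Forall s x \<phi>)
  then have "sat G a A b B \<phi> \<longleftrightarrow> sat G' a A b B \<phi>" for a A b B by simp
  then show ?case by (cases s) (simp_all add: assms)
qed (simp_all add: assms)

lemma tj_step_inj_on:
  assumes "inj_on h V" "T \<subseteq> V" "T' \<subseteq> V" shows "tj_step (h ` T) (h ` T') \<longleftrightarrow> tj_step T T'"
proof -
  have "card (h ` A - h ` B) = card (A - B)" if "A \<subseteq> V" "B \<subseteq> V" for A B
  proof -
    have "h ` A - h ` B = h ` (A - B)" by (rule inj_on_image_set_diff[symmetric, OF assms(1)]) (use that in auto)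
    moreover have "inj_on h (A - B)" using assms(1) that by (meson Diff_subset inj_on_subset subset_trans)
    ultimately show ?thesis by (simp add: card_image)
  qed
  then show ?thesis using assms by (simp add: tj_step_def)
qed

lemma cgraph_gmap: assumes "cgraph G" "inj_on h (verts G)" shows "cgraph (gmap h G)"
proof -
  have "card (h ` e) = 2" if "e \<in> edges G" for e
  proof -
    have "card e = 2" "e \<subseteq> verts G" using assms(1) that by (auto simp: cgraph_def)
    then show ?thesis using card_image[OF inj_on_subset[OF assms(2)], of e] by simp
  qed
  then show ?thesis using assms(1) unfolding cgraph_def by (auto intro!: imageI)
qed

lemma formula_of_set_gmap: "formula_of_set (gmap h G) \<phi> \<longleftrightarrow> formula_of_set G \<phi>"
  by (simp add: formula_of_set_def)

lemma formula_of_set_restr: "formula_of_set (restr G U) \<phi> \<longleftrightarrow> formula_of_set G \<phi>"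
  by (simp add: formula_of_set_def)

lemma tj_sequence_gmap:
  assumes G: "cgraph G" "inj_on h (verts G)" "formula_of_set G \<phi>" and S: "S \<subseteq> verts G" "S' \<subseteq> verts G"
    and Ss: "\<forall>T\<in>set Ss. T \<subseteq> verts G"
  shows "tj_sequence (gmap h G) \<phi> (h ` S) (h ` S') (map (image h) Ss) \<longleftrightarrow> tj_sequence G \<phi> S S' Ss"
proof (cases "Ss = []")
  case False
  then have hl: "hd Ss \<subseteq> verts G" "last Ss \<subseteq> verts G" using Ss by auto
  have "h ` hd Ss = h ` S \<longleftrightarrow> hd Ss = S" "h ` last Ss = h ` S' \<longleftrightarrow> last Ss = S'"
    using inj_on_image_eq_iff[OF G(2)] hl S by auto
  moreover have "successively tj_step (map (image h) Ss) \<longleftrightarrow> successively tj_step Ss"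
    unfolding successively_map by (rule successively_cong[OF _ refl]) (use tj_step_inj_on[OF G(2)] Ss in blast)
  moreover have "(\<forall>T\<in>set (map (image h) Ss). T \<subseteq> verts (gmap h G) \<and> models (gmap h G) \<phi> T) \<longleftrightarrow>
      (\<forall>T\<in>set Ss. T \<subseteq> verts G \<and> models G \<phi> T)"
    using models_gmap[OF G] Ss by (auto intro!: imageI)
  ultimately show ?thesis using False by (simp add: tj_sequence_iff hd_map last_map)
qed (simp add: tj_sequence_iff)

lemma tj_sequence_gmap_ex:
  assumes G: "cgraph G" "inj_on h (verts G)" "formula_of_set G \<phi>" and S: "S \<subseteq> verts G" "S' \<subseteq> verts G"
    and Rs: "tj_sequence (gmap h G) \<phi> (h ` S) (h ` S') Rs"
  shows "tj_sequence G \<phi> S S' (map (\<lambda>R. {v \<in> verts G. h v \<in> R}) Rs)"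
proof -
  let ?Ss = "map (\<lambda>R. {v \<in> verts G. h v \<in> R}) Rs"
  have "map (image h) ?Ss = Rs" unfolding map_map
  proof (rule map_idI)
    fix R assume "R \<in> set Rs"
    then have "R \<subseteq> h ` verts G" using Rs by (auto simp: tj_sequence_iff)
    then show "(image h \<circ> (\<lambda>R. {v \<in> verts G. h v \<in> R})) R = R" by auto
  qed
  moreover have "\<forall>T\<in>set ?Ss. T \<subseteq> verts G" by auto
  ultimately show ?thesis using tj_sequence_gmap[OF G S, of ?Ss] Rs by simp
qed

lemma ckey_color: "ckey i \<in> tok_keys (lin \<phi>) \<longleftrightarrow> i \<in> color_indices \<phi>"
proof (induction \<phi>)
  have s: "color_code \<noteq> bt_of_sort s" "color_code \<noteq> Lf" for s by (cases s; simp add: color_code_def)+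
  have n: "color_code \<noteq> bt_of_nat 1" "color_code \<noteq> bt_of_nat 2" "color_code \<noteq> bt_of_nat 3" by (simp_all add: color_code_def)
  {
    case (Exists q x \<phi>) then show ?case using s by auto
  next
    case (Forall q x \<phi>) then show ?case using s by auto
  next
    case (EqV x y) then show ?case using s n by auto
  next
    case (EqE x y) then show ?case using s n by auto
  next
    case (Adj x y) then show ?case using s n by auto
  next
    case (Col x y) then show ?case using s n by auto
  next
    case (MemV x y) then show ?case using s n by auto
  next
    case (MemE x y) then show ?case using s n by auto
  next
    case (Inc x y) then show ?case using s n by auto
  }
qed (auto simp: color_code_def)

lemma membership_eq: "membership cls u = membership cls v \<Longrightarrow> C \<in> set cls \<Longrightarrow> u \<in> set C \<Longrightarrow> v \<in> set C"
  by (auto simp: membership_def)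

lemma inj_bt_of_nat: "inj_on bt_of_nat A"
  by (rule inj_onI) simp

text \<open>Fixes one listing of the instance, chosen arbitrarily, since \<open>fpt_solvable\<close>
  demands correctness on every representation.\<close>

locale msor2_input =
  fixes I :: msor2 and vsn :: "nat list" and esn :: "(nat \<times> nat) list" and csn :: "nat list list" and sn tn :: "nat list"
  assumes inst: "msor2_instance I"
    and vsn: "distinct vsn" "set vsn = verts (graph I)"
    and esn: "distinct (map (\<lambda>e. {fst e, snd e}) esn)" "(\<lambda>e. {fst e, snd e}) ` set esn = edges (graph I)"
    and csn: "map set csn = colors (graph I)"
    and sn: "distinct sn" "set sn = source I" and tn: "distinct tn" "set tn = target I"
begin

abbreviation N :: "nat \<Rightarrow> bt" where "N \<equiv> bt_of_nat"
abbreviation G :: "nat cgraph" where "G \<equiv> graph I"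
abbreviation \<phi> :: mso2 where "\<phi> \<equiv> formula I"

definition es :: "(bt \<times> bt) list" where "es = map (\<lambda>e. (N (fst e), N (snd e))) esn"
definition inp :: input where "inp = ((map N vsn, es, map (map N) csn), bt_of_mso2 \<phi>, map N sn, map N tn)"
definition ks :: "(bt \<times> bt) list" where "ks = keys_of (lin \<phi>)"
definition cls :: "bt list list" where "cls = color_lists ks (map (map N) csn)"
definition ns :: "bt list" where "ns = kernel_names inp (lin \<phi>) cls"

text \<open>Colours that do not occur in the formula are emptied: the types ignore them, so swapping two copies
  need not preserve them.\<close>

definition G0 :: "nat cgraph" where
  "G0 = \<lparr>verts = verts G, edges = edges G,
     colors = map (\<lambda>i. if i \<in> color_indices \<phi> then colors G ! i else {}) [0..<length (colors G)]\<rparr>"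

text \<open>The search handles vertices as trees, so its correctness is applied to a copy of
  \<open>G0\<close> whose vertices are the encodings.\<close>

definition H :: "bt cgraph" where "H = gmap N G0"

lemma G: "cgraph G" "formula_of_set G \<phi>" "source I \<subseteq> verts G" "target I \<subseteq> verts G" "card (source I) = card (target I)"
  "models G \<phi> (source I)" "models G \<phi> (target I)"
  using inst by (auto simp: msor2_instance_def)

lemma ci: "color_indices \<phi> \<subseteq> {..<length (colors G)}" and fv: "free_vars \<phi> \<subseteq> {(VertexSet, 0)}"
  using G(2) by (auto simp: formula_of_set_def)

lemma G0_simps [simp]: "verts G0 = verts G" "edges G0 = edges G" "length (colors G0) = length (colors G)"
  by (simp_all add: G0_def)

lemma colors_G0: "i < length (colors G) \<Longrightarrow> colors G0 ! i = (if i \<in> color_indices \<phi> then colors G ! i else {})"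
  by (simp add: G0_def)

lemma G0: "cgraph G0" "formula_of_set G0 \<phi>"
proof -
  have "C \<subseteq> verts G" if C: "C \<in> set (colors G0)" for C
  proof -
    obtain i where i: "i < length (colors G)" "C = colors G0 ! i" using C by (auto simp: in_set_conv_nth)
    have "colors G ! i \<in> set (colors G)" using i(1) by simp
    then have "colors G ! i \<subseteq> verts G" using G(1) unfolding cgraph_def by blast
    then show ?thesis using i by (simp add: colors_G0)
  qed
  then show "cgraph G0" using G(1) by (simp add: cgraph_def)
  show "formula_of_set G0 \<phi>" using G(2) by (simp add: formula_of_set_def)
qed

lemma models_G0: "models G0 \<phi> X \<longleftrightarrow> models G \<phi> X"
  unfolding models_def by (rule sat_same_colors) (use ci in \<open>auto simp: colors_G0\<close>)

lemma tj_G0: "tj_sequence G0 \<phi> S S' Ss \<longleftrightarrow> tj_sequence G \<phi> S S' Ss"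
  by (simp add: tj_sequence_iff models_G0)

lemma H: "cgraph H" "formula_of_set H \<phi>" "verts H = N ` verts G" "edges H = image N ` edges G"
  using cgraph_gmap[OF G0(1) inj_bt_of_nat] G0(2) by (simp_all add: H_def formula_of_set_gmap)

lemma edges_H: "edges H = (\<lambda>e. {fst e, snd e}) ` set es"
  unfolding H(4) esn(2)[symmetric] es_def by (simp add: image_image)

lemma colors_H: "i < length (colors G) \<Longrightarrow> colors H ! i = (if i \<in> color_indices \<phi> then set (map N (csn ! i)) else {})"
  "length (colors H) = length (colors G)"
proof -
  assume i: "i < length (colors G)"
  have "length csn = length (colors G)" using csn by (metis length_map)
  then have "set (csn ! i) = colors G ! i" using i by (simp flip: csn)
  then show "colors H ! i = (if i \<in> color_indices \<phi> then set (map N (csn ! i)) else {})"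
    using i by (simp add: H_def colors_G0)
qed (simp add: H_def)

lemma len_csn: "length csn = length (colors G)"
  using csn by (metis length_map)

lemma cls: "length cls = 2 * nodes \<phi> + 1" "length cls = length ks"
  by (simp_all add: cls_def color_lists_def ks_def length_keys_of length_lin)

lemma cls_nth: assumes "ckey i \<in> set ks" "i < length (colors G)" shows "cls ! idx ks (ckey i) = map N (csn ! i)" "map N (csn ! i) \<in> set cls"
proof -
  have x: "idx ks (ckey i) < length ks" "ks ! idx ks (ckey i) = ckey i" using idx_props[OF assms(1)] by auto
  have "colget (bt_of_nat i) (map (map N) csn) = map N (csn ! i)" using assms(2) len_csn by (simp add: colget_nth)
  then show 1: "cls ! idx ks (ckey i) = map N (csn ! i)" using x by (simp add: cls_def color_lists_def)
  show "map N (csn ! i) \<in> set cls" using x(1) cls(2) unfolding 1[symmetric] by (intro nth_mem) simp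
qed

lemma ckey_ks: "ckey i \<in> set ks \<longleftrightarrow> i \<in> color_indices \<phi>"
  using ckey_color[of i \<phi>] by (simp add: ks_def set_keys_of color_code_def)

abbreviation S :: "bt set" where "S \<equiv> N ` source I"
abbreviation T :: "bt set" where "T \<equiv> N ` target I"
abbreviation info :: "bt \<Rightarrow> bool list" where "info \<equiv> membership (cls @ [map N sn, map N tn])"

text \<open>Labels determine colours because the colours outside the formula are empty in
  \<open>H\<close>, while every other one is recorded in \<open>cls\<close>. Paths of
  \<open>H\<close> are paths of the input graph, whose treedepth bounds them.\<close>

lemma dfs: "dfs H \<phi> S T (map N vsn) (adj_list es) info (threshold (nodes \<phi>) (card (source I) + 3))
   (nodes \<phi>) (card (source I) + 3) (2 * nodes \<phi> + 3) (2 ^ treedepth G)"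
proof
  show "cgraph H" "formula_of_set H \<phi>" by (rule H)+
  show "set (map N vsn) = verts H" using vsn(2) by (simp add: H(3))
  show "distinct (map N vsn)" using vsn(1) by (simp add: distinct_map inj_bt_of_nat)
  show "adj_list es u v \<longleftrightarrow> {u, v} \<in> edges H" for u v
    unfolding edges_H adj_list_def by (auto simp: doubleton_eq_iff image_iff) force+
  show "S \<subseteq> verts H" "T \<subseteq> verts H" using G(3,4) by (auto simp: H(3))
  show "card T = card S" using G(5) by (simp add: card_image inj_bt_of_nat)
  show "v \<in> C" if eq: "info u = info v" and C: "C \<in> set (colors H)" "u \<in> C" for u v C
  proof -
    obtain i where i: "i < length (colors G)" "C = colors H ! i" using C(1) colors_H(2) by (auto simp: in_set_conv_nth)
    then have ii: "i \<in> color_indices \<phi>" "C = set (map N (csn ! i))" using C(2) colors_H(1)[OF i(1)] by (auto split: if_splits)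
    then have "map N (csn ! i) \<in> set (cls @ [map N sn, map N tn])" using cls_nth(2)[OF _ i(1)] ckey_ks by simp
    from membership_eq[OF eq this] show ?thesis using C(2) ii(2) by simp
  qed
  show "v \<in> S" if "info u = info v" "u \<in> S" for u v
    using membership_eq[OF that(1), of "map N sn"] that(2) sn(2) by simp
  show "v \<in> T" if "info u = info v" "u \<in> T" for u v
    using membership_eq[OF that(1), of "map N tn"] that(2) tn(2) by simp
  show "length (info v) \<le> 2 * nodes \<phi> + 3" for v by (simp add: membership_def cls(1))
  show "threshold (nodes \<phi>) (card (source I) + 3) t = (bt_size t + 1) * nodes \<phi> + (card (source I) + 3)" for t
    by (simp add: threshold_def)
  show "card S + 3 \<le> card (source I) + 3" by (simp add: card_image inj_bt_of_nat)
  show "length xs \<le> 2 ^ treedepth G" if xs: "gpath H xs" for xs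
  proof -
    have "set xs \<subseteq> N ` verts G" using xs by (simp add: gpath_def H(3))
    then obtain ys where ys: "xs = map N ys" "set ys \<subseteq> verts G"
    proof (induction xs arbitrary: thesis)
      case (Cons x xs)
      obtain ys where "xs = map N ys" "set ys \<subseteq> verts G" using Cons.IH Cons.prems(2) by auto
      moreover obtain y where "x = N y" "y \<in> verts G" using Cons.prems(2) by auto
      ultimately show ?case using Cons.prems(1)[of "y # ys"] by simp
    qed simp
    have e: "{N u, N v} \<in> edges H \<longleftrightarrow> {u, v} \<in> edges G" for u v
    proof -
      have "N ` {u, v} \<in> image N ` edges G \<longleftrightarrow> {u, v} \<in> edges G"
        by (rule inj_image_mem_iff) (simp add: inj_image_eq_iff inj_def inj_bt_of_nat)
      then show ?thesis by (simp add: H(4))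
    qed
    have "gpath G ys" using xs ys unfolding gpath_def by (simp add: distinct_map successively_map e)
    then show ?thesis using gpath_length[OF G(1)] ys(1) by (simp add: less_imp_le)
  qed
qed simp_all

lemma ns_dfs: "ns = dfs_names (map N vsn) (adj_list es) info (threshold (nodes \<phi>) (card (source I) + 3))"
  using distinct_card[OF sn(1)] sn(2) by (simp add: ns_def kernel_names_def run_dfs_def inp_def length_lin)

lemma ns: "distinct ns" "set ns \<subseteq> verts H" "S \<subseteq> set ns" "T \<subseteq> set ns" "tj_equiv H \<phi> S T (set ns)"
  "kernel_bound (length ns) (nodes \<phi>) \<le> total_bound (msor2_param I)"
proof -
  note D = dfs.dfs_names_correct[OF dfs, folded ns_dfs]
  show "distinct ns" "set ns \<subseteq> verts H" "S \<subseteq> set ns" "T \<subseteq> set ns" "tj_equiv H \<phi> S T (set ns)" by (rule D)+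
  define k where "k = msor2_param I"
  have q: "nodes \<phi> \<le> k" using nodes_le_length[of \<phi>] by (simp add: k_def msor2_param_def)
  have P: "(2::nat) ^ treedepth G \<le> 2 ^ k" by (rule power_increasing) (simp_all add: k_def msor2_param_def)
  have c: "card (source I) + 3 \<le> k + 3" by (simp add: k_def msor2_param_def)
  have "type_bound (nodes \<phi>) (card (source I) + 3) (2 * nodes \<phi> + 3) (2 ^ treedepth G) (2 ^ treedepth G)
      \<le> type_bound k (k + 3) (2 * k + 3) (2 ^ k) (2 ^ k)"
    by (rule type_bound_mono[OF q c _ P P]) (use q in simp)
  then have "length ns \<le> width k (k + 3) (type_bound k (k + 3) (2 * k + 3) (2 ^ k) (2 ^ k)) * type_bound k (k + 3) (2 * k + 3) (2 ^ k) (2 ^ k)"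
    by (intro le_trans[OF D(6)] mult_mono width_mono q c) auto
  then show "kernel_bound (length ns) (nodes \<phi>) \<le> total_bound (msor2_param I)"
    unfolding total_bound_def Let_def k_def[symmetric] by (rule kernel_bound_mono[OF _ q])
qed

definition U :: "bt cgraph" where "U = restr H (set ns)"
definition KG :: "nat cgraph" where "KG = gmap (idx ns) U"
definition kes :: "(nat \<times> nat) list" where
  "kes = map (\<lambda>e. (idx ns (fst e), idx ns (snd e))) (filter (\<lambda>e. fst e \<in> set ns \<and> snd e \<in> set ns) es)"
definition res :: "nat list list" where "res = solve (snd (kernelize inp))"

lemma kernelize_inp: "kernelize inp = (ns, kernel_of ns es cls (lin \<phi>) ks (map N sn) (map N tn))"
  by (simp add: kernelize_def inp_def linp_correct Let_def ns_def ks_def cls_def)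

lemma idx_inj: "inj_on (idx ns) (set ns)"
  by (rule inj_onI) (metis idx_props(2))

lemma verts_U: "verts U = set ns"
  using ns(2) by (auto simp: U_def)

lemma U: "cgraph U" "formula_of_set U \<phi>" "inj_on (idx ns) (verts U)" "S \<subseteq> verts U" "T \<subseteq> verts U"
proof -
  show "cgraph U" "formula_of_set U \<phi>" unfolding U_def by (simp_all add: cgraph_restr[OF H(1)] formula_of_set_restr H(2))
  show "inj_on (idx ns) (verts U)" "S \<subseteq> verts U" "T \<subseteq> verts U" unfolding verts_U by (rule idx_inj ns(3) ns(4))+
qed

lemma set_positions: "set (positions ns D) = idx ns ` (set D \<inter> set ns)"
proof
  show "set (positions ns D) \<subseteq> idx ns ` (set D \<inter> set ns)"
  proof
    fix i assume "i \<in> set (positions ns D)"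
    then have i: "i < length ns" "ns ! i \<in> set D" by (auto simp: positions_def)
    then show "i \<in> idx ns ` (set D \<inter> set ns)" using idx_nth[OF ns(1) i(1)] by (intro image_eqI[of _ _ "ns ! i"]) auto
  qed
  show "idx ns ` (set D \<inter> set ns) \<subseteq> set (positions ns D)"
    using idx_props[of _ ns] by (auto simp: positions_def)
qed

lemma kern: "kern KG (length ns) kes (map (positions ns) cls) ks"
proof
  show "verts KG = {..<length ns}"
  proof -
    have "idx ns ` set ns = {..<length ns}"
    proof
      show "idx ns ` set ns \<subseteq> {..<length ns}" using idx_props(1) by auto
      show "{..<length ns} \<subseteq> idx ns ` set ns"
      proof
        fix i assume "i \<in> {..<length ns}"
        then show "i \<in> idx ns ` set ns" using idx_nth[OF ns(1), of i] by (intro image_eqI[of _ _ "ns ! i"]) auto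
      qed
    qed
    then show ?thesis by (simp add: KG_def verts_U)
  qed
  have U_edges: "edges U = (\<lambda>e. {fst e, snd e}) ` {e \<in> set es. fst e \<in> set ns \<and> snd e \<in> set ns}"
    by (auto simp: U_def edges_H)
  then show "edges KG = (\<lambda>e. {fst e, snd e}) ` set kes"
    by (simp add: KG_def kes_def image_image)
  show "distinct (map (\<lambda>e. {fst e, snd e}) kes)"
  proof -
    have "distinct (map (\<lambda>e. {fst e, snd e}) es)"
    proof -
      have "map (\<lambda>e. {fst e, snd e}) es = map (image N) (map (\<lambda>e. {fst e, snd e}) esn)" by (simp add: es_def)
      moreover have "inj_on (image N) X" for X by (rule inj_onI) (simp add: inj_image_eq_iff inj_bt_of_nat)
      ultimately show ?thesis using esn(1) by (simp add: distinct_map[of "image N"] del: map_map)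
    qed
    then have d: "distinct (map (\<lambda>e. {fst e, snd e}) (filter (\<lambda>e. fst e \<in> set ns \<and> snd e \<in> set ns) es))"
      by (rule distinct_map_filter)
    have "map (\<lambda>e. {fst e, snd e}) kes = map (image (idx ns)) (map (\<lambda>e. {fst e, snd e}) (filter (\<lambda>e. fst e \<in> set ns \<and> snd e \<in> set ns) es))"
      by (simp add: kes_def)
    moreover have "inj_on (image (idx ns)) (set (map (\<lambda>e. {fst e, snd e}) (filter (\<lambda>e. fst e \<in> set ns \<and> snd e \<in> set ns) es)))"
      by (rule inj_on_subset[OF inj_on_image_Pow[OF idx_inj]]) auto
    ultimately show ?thesis using d by (simp only: distinct_map[of "image (idx ns)"])
  qed
  show "length (map (positions ns) cls) = length ks" by (simp add: cls(2))
  show "set (map (positions ns) cls ! idx ks (ckey i)) = colors KG ! i" if i: "ckey i \<in> set ks" "i < length (colors KG)" for i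
  proof -
    have l: "i < length (colors G)" using i(2) by (simp add: KG_def U_def colors_H(2))
    have "idx ks (ckey i) < length cls" using idx_props(1)[OF i(1)] by (simp add: cls(2))
    then have "map (positions ns) cls ! idx ks (ckey i) = positions ns (map N (csn ! i))" using cls_nth(1)[OF i(1) l] by simp
    moreover have "colors H ! i = set (map N (csn ! i))" using colors_H(1)[OF l] i(1) ckey_ks by simp
    then have "colors KG ! i = idx ns ` (set (map N (csn ! i)) \<inter> set ns)" using l by (simp add: KG_def U_def colors_H(2))
    ultimately show ?thesis by (simp add: set_positions)
  qed
qed

lemma models_U: "X \<subseteq> verts G \<Longrightarrow> N ` X \<subseteq> set ns \<Longrightarrow> card X = card (source I) \<Longrightarrow> models U \<phi> (N ` X) \<longleftrightarrow> models G \<phi> X"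
proof -
  assume X: "X \<subseteq> verts G" "N ` X \<subseteq> set ns" "card X = card (source I)"
  have "models H \<phi> (N ` X) \<longleftrightarrow> models U \<phi> (N ` X)" unfolding U_def
    by (rule tj_equiv_models[OF ns(5)]) (use X in \<open>auto simp: H(3) card_image inj_bt_of_nat\<close>)
  then show ?thesis using models_gmap[OF G0(1) inj_bt_of_nat G0(2), of X] X(1) by (simp add: H_def models_G0)
qed

lemma res_correct: "res \<noteq> [] \<longleftrightarrow> (\<exists>Ss. tj_sequence KG \<phi> (idx ns ` S) (idx ns ` T) Ss)"
  "res \<noteq> [] \<Longrightarrow> shortest_tj_sequence KG \<phi> (idx ns ` S) (idx ns ` T) (map set res) \<and> (\<forall>X\<in>set res. distinct X \<and> set X \<subseteq> {..<length ns})"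
proof -
  have st: "set (positions ns (map N sn)) = idx ns ` S" "set (positions ns (map N tn)) = idx ns ` T"
    using ns(3,4) sn(2) tn(2) by (simp_all add: set_positions Int_absorb2)
  have sub: "positions ns D \<in> set (subseqs [0..<length ns])" for D
    unfolding positions_def by (rule filter_in_subseqs)
  have mod: "models KG \<phi> (set (positions ns (map N sn)))" "models KG \<phi> (set (positions ns (map N tn)))"
    unfolding st KG_def using models_gmap[OF U(1,3,2) U(4)] models_gmap[OF U(1,3,2) U(5)]
      models_U[OF G(3)] models_U[OF G(4)] ns(3,4) G(5-7) by simp_all
  have key: "tok_keys (lin \<phi>) \<subseteq> set ks" "ks = key VertexSet 0 # concat (map (\<lambda>t. [fst (snd t), snd (snd t)]) (lin \<phi>))"
    by (auto simp: ks_def set_keys_of) (simp add: keys_of_def)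
  have ci': "color_indices \<phi> \<subseteq> {..<length (colors KG)}" using ci by (simp add: KG_def U_def colors_H(2))
  have r: "res = search (configs (length ns) kes (map (positions ns) cls) (map (norm_tok ks) (lin \<phi>)))
      (positions ns (map N sn)) (positions ns (map N tn))"
    by (simp add: res_def kernelize_inp solve_def kernel_of_def kes_def)
  note K = kern.search_correct[OF kern fv key ci' sub mod(1) sub mod(2), folded r, unfolded st]
  show "res \<noteq> [] \<longleftrightarrow> (\<exists>Ss. tj_sequence KG \<phi> (idx ns ` S) (idx ns ` T) Ss)" by (rule K(1))
  show "res \<noteq> [] \<Longrightarrow> shortest_tj_sequence KG \<phi> (idx ns ` S) (idx ns ` T) (map set res) \<and> (\<forall>X\<in>set res. distinct X \<and> set X \<subseteq> {..<length ns})"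
    by (rule K(2))
qed

text \<open>The passage from \<open>H\<close> to \<open>U\<close> may replace the intermediate sets
  but keeps the length; all other passages are renamings.\<close>

lemma from_G:
  assumes "tj_sequence G \<phi> (source I) (target I) Ss"
  shows "\<exists>Rs. tj_sequence KG \<phi> (idx ns ` S) (idx ns ` T) Rs \<and> length Rs = length Ss"
proof -
  have sub: "\<forall>X\<in>set Ss. X \<subseteq> verts G0" using assms by (simp add: tj_sequence_iff)
  have "tj_sequence H \<phi> S T (map (image N) Ss)" unfolding H_def
    using tj_sequence_gmap[OF G0(1) inj_bt_of_nat G0(2) _ _ sub] G(3,4) assms by (simp add: tj_G0)
  then obtain Rs where Rs: "tj_sequence U \<phi> S T Rs" "length Rs = length Ss"
    using tj_equiv_seq[OF ns(5)] unfolding U_def by fastforce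
  then have "\<forall>X\<in>set Rs. X \<subseteq> verts U" by (simp add: tj_sequence_iff)
  from tj_sequence_gmap[OF U(1,3,2,4,5) this] Rs show ?thesis
    unfolding KG_def by (intro exI[of _ "map (image (idx ns)) Rs"]) simp
qed

lemma to_G:
  assumes "tj_sequence KG \<phi> (idx ns ` S) (idx ns ` T) Rs"
  shows "tj_sequence G \<phi> (source I) (target I) (map (\<lambda>R. {v \<in> verts G. N v \<in> set ns \<and> idx ns (N v) \<in> R}) Rs)"
proof -
  have "tj_sequence U \<phi> S T (map (\<lambda>R. {v \<in> verts U. idx ns v \<in> R}) Rs)"
    by (rule tj_sequence_gmap_ex[OF U(1,3,2,4,5) assms[unfolded KG_def]])
  moreover have "finite (verts H)" using H(1) by (simp add: cgraph_def)
  ultimately have "tj_sequence H \<phi> S T (map (\<lambda>R. {v \<in> verts U. idx ns v \<in> R}) Rs)"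
    unfolding U_def by (intro tj_equiv_back[OF ns(5)])
  then have "tj_sequence G0 \<phi> (source I) (target I)
      (map (\<lambda>R. {v \<in> verts G0. N v \<in> R}) (map (\<lambda>R. {v \<in> verts U. idx ns v \<in> R}) Rs))"
    unfolding H_def by (intro tj_sequence_gmap_ex[OF G0(1) inj_bt_of_nat G0(2)]) (use G(3,4) in simp_all)
  then show ?thesis by (simp add: tj_G0 comp_def verts_U)
qed

theorem decision: "res \<noteq> [] \<longleftrightarrow> msor2_yes I"
  unfolding res_correct(1) msor2_yes_def using from_G to_G by blast

text \<open>By \<open>from_G\<close> every sequence of the input graph has a partner of equal length
  in the kernel, so the sequence pulled back from a shortest one there is again shortest.\<close>

theorem shortest:
  assumes "res \<noteq> []"
  shows "\<exists>Ss. shortest_tj_sequence G \<phi> (source I) (target I) Ss \<and>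
    represents_sets (enc (map (map (\<lambda>i. nthd Lf i ns)) res)) Ss"
proof -
  let ?back = "\<lambda>R. {v \<in> verts G. N v \<in> set ns \<and> idx ns (N v) \<in> R}"
  have r: "shortest_tj_sequence KG \<phi> (idx ns ` S) (idx ns ` T) (map set res)"
    and dist: "\<And>X. X \<in> set res \<Longrightarrow> distinct X \<and> set X \<subseteq> {..<length ns}" using res_correct(2)[OF assms] by auto
  let ?Ss = "map ?back (map set res)"
  have seq: "tj_sequence G \<phi> (source I) (target I) ?Ss"
    by (rule to_G) (use r in \<open>simp add: shortest_tj_sequence_def\<close>)
  have "length ?Ss \<le> length Ts" if Ts: "tj_sequence G \<phi> (source I) (target I) Ts" for Ts
  proof -
    obtain Rs where "tj_sequence KG \<phi> (idx ns ` S) (idx ns ` T) Rs" "length Rs = length Ts" using from_G[OF Ts] by blast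
    then show ?thesis using r by (auto simp: shortest_tj_sequence_def)
  qed
  then have short: "shortest_tj_sequence G \<phi> (source I) (target I) ?Ss" using seq by (simp add: shortest_tj_sequence_def)
  have rep: "represents_set (enc (map (\<lambda>i. nthd Lf i ns) X)) (?back (set X))" if X: "X \<in> set res" for X
  proof -
    have d: "distinct X" "\<And>i. i \<in> set X \<Longrightarrow> i < length ns" using dist[OF X] by auto
    define f where "f i = unary (ns ! i)" for i
    have nf: "N (f i) = ns ! i" "f i \<in> verts G" if "i < length ns" for i
    proof -
      have "ns ! i \<in> N ` verts G" using ns(2) nth_mem[OF that] by (auto simp: H(3))
      then show "N (f i) = ns ! i" "f i \<in> verts G" by (auto simp: f_def unary_bt_of_nat)
    qed
    have "distinct (map f X)" unfolding distinct_map
    proof (intro conjI d(1) inj_onI)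
      fix i j assume "i \<in> set X" "j \<in> set X" "f i = f j"
      then show "i = j" using nf(1) d(2) nth_eq_iff_index_eq[OF ns(1)] by metis
    qed
    moreover have "set (map f X) = ?back (set X)"
    proof
      show "set (map f X) \<subseteq> ?back (set X)" using nf d(2) idx_nth[OF ns(1)] by auto
      show "?back (set X) \<subseteq> set (map f X)"
      proof
        fix v assume v: "v \<in> ?back (set X)"
        then have "ns ! idx ns (N v) = N v" by (simp add: idx_props(2))
        then have "f (idx ns (N v)) = v" by (simp add: f_def unary_bt_of_nat)
        then show "v \<in> set (map f X)" using v by force
      qed
    qed
    moreover have "enc (map (\<lambda>i. nthd Lf i ns) X) = bt_of_list bt_of_nat (map f X)"
      using d(2) nf(1) by (induction X) auto
    ultimately show ?thesis unfolding represents_set_def by blast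
  qed
  have "represents_sets (enc (map (map (\<lambda>i. nthd Lf i ns)) res)) ?Ss"
    unfolding represents_sets_def
  proof (intro exI conjI)
    show "list_all2 represents_set (map (\<lambda>X. enc (map (\<lambda>i. nthd Lf i ns) X)) res) ?Ss"
      using rep by (auto simp: list_all2_conv_all_nth)
    have "enc (map (map f) rs) = bt_of_list id (map (\<lambda>X. enc (map f X)) rs)" for f :: "nat \<Rightarrow> bt" and rs
      by (induction rs) auto
    then show "enc (map (map (\<lambda>i. nthd Lf i ns)) res) = bt_of_list id (map (\<lambda>X. enc (map (\<lambda>i. nthd Lf i ns) X)) res)" .
  qed
  then show ?thesis using short by blast
qed

lemma size_kernel: "sz (snd (kernelize inp)) \<le> total_bound (msor2_param I)"
proof -
  have "distinct (map (\<lambda>e. {fst e, snd e}) es)"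
  proof -
    have "map (\<lambda>e. {fst e, snd e}) es = map (image N) (map (\<lambda>e. {fst e, snd e}) esn)" by (simp add: es_def)
    moreover have "inj_on (image N) X" for X by (rule inj_onI) (simp add: inj_image_eq_iff inj_bt_of_nat)
    ultimately show ?thesis using esn(1) by (simp add: distinct_map[of "image N"] del: map_map)
  qed
  from sz_kernel_of[OF this ns(1) cls(1) ks_def] show ?thesis unfolding kernelize_inp snd_conv
    by (rule le_trans) (rule ns(6))
qed

end

lemma enc_map_bt_of_nat: "enc (map bt_of_nat xs) = bt_of_list bt_of_nat xs"
  by (induction xs) auto

lemma represents_msor2_input:
  assumes "represents_msor2 x I"
  shows "\<exists>vsn esn csn sn tn. msor2_input I vsn esn csn sn tn \<and> x = enc (msor2_input.inp I vsn esn csn sn tn)"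
proof -
  obtain g s t where inst: "msor2_instance I" and g: "represents_cgraph g (graph I)" and s: "represents_set s (source I)"
    and t: "represents_set t (target I)" and x: "x = Br g (Br (bt_of_mso2 (formula I)) (Br s t))"
    using assms unfolding represents_msor2_def by blast
  obtain v e c where v: "represents_set v (verts (graph I))" and e: "represents_edges e (edges (graph I))"
    and c: "represents_sets c (colors (graph I))" and g': "g = Br v (Br e c)" using g unfolding represents_cgraph_def by blast
  obtain vsn where vsn: "distinct vsn" "set vsn = verts (graph I)" "v = bt_of_list bt_of_nat vsn"
    using v unfolding represents_set_def by blast
  obtain sn where sn: "distinct sn" "set sn = source I" "s = bt_of_list bt_of_nat sn"
    using s unfolding represents_set_def by blast
  obtain tn where tn: "distinct tn" "set tn = target I" "t = bt_of_list bt_of_nat tn"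
    using t unfolding represents_set_def by blast
  obtain esn where esn: "distinct (map (\<lambda>(u, v). {u, v}) esn)" "set (map (\<lambda>(u, v). {u, v}) esn) = edges (graph I)"
    "e = bt_of_list (\<lambda>(u, v). Br (bt_of_nat u) (bt_of_nat v)) esn" using e unfolding represents_edges_def by blast
  have cp: "(\<lambda>(u, v). {u, v}) = (\<lambda>e. {fst e, snd e :: nat})" by (auto simp: fun_eq_iff)
  obtain xs where xs: "list_all2 represents_set xs (colors (graph I))" "c = bt_of_list id xs"
    using c unfolding represents_sets_def by blast
  have "\<exists>csn. map set csn = Cs \<and> xs = map (\<lambda>cn. enc (map bt_of_nat cn)) csn" if "list_all2 represents_set xs Cs" for xs Cs
    using that
  proof (induction rule: list_all2_induct)
    case (Cons y ys C Cs)
    obtain cn where "set cn = C" "y = bt_of_list bt_of_nat cn" using Cons(1) unfolding represents_set_def by blast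
    moreover obtain csn where "map set csn = Cs" "ys = map (\<lambda>cn. enc (map bt_of_nat cn)) csn" using Cons by blast
    ultimately show ?case by (intro exI[of _ "cn # csn"]) (simp add: enc_map_bt_of_nat)
  qed simp
  from this[OF xs(1)] obtain csn where csn: "map set csn = colors (graph I)" "xs = map (\<lambda>cn. enc (map bt_of_nat cn)) csn" by blast
  have M: "msor2_input I vsn esn csn sn tn"
  proof
    show "distinct (map (\<lambda>e. {fst e, snd e}) esn)" using esn(1) by (simp only: cp)
    show "(\<lambda>e. {fst e, snd e}) ` set esn = edges (graph I)" using esn(2) by (simp only: cp set_map)
  qed (rule inst vsn(1,2) csn(1) sn(1,2) tn(1,2))+
  have "e = enc (map (\<lambda>e. (bt_of_nat (fst e), bt_of_nat (snd e))) esn)"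
    unfolding esn(3) by (induction esn) (auto split: prod.splits)
  moreover have "c = enc (map (map bt_of_nat) csn)" unfolding xs(2) csn(2) by (induction csn) auto
  ultimately have "x = enc (msor2_input.inp I vsn esn csn sn tn)"
    unfolding msor2_input.inp_def[OF M] msor2_input.es_def[OF M] x g' vsn(3) sn(3) tn(3) by (simp add: enc_map_bt_of_nat)
  then show ?thesis using M by blast
qed

theorem theorem4p1:
  shows "fpt_decidable represents_msor2 msor2_param msor2_yes
    \<and> fpt_solvable (\<lambda>x I. represents_msor2 x I \<and> msor2_yes I) msor2_param
        (\<lambda>I y. \<exists>Ss. shortest_tj_sequence (graph I) (formula I) (source I) (target I) Ss
           \<and> represents_sets y Ss)"
proof
  have dec: "cmp False (dec :: bt \<Rightarrow> kernel)" by (intro cmp_decs)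
  show "fpt_decidable represents_msor2 msor2_param msor2_yes"
    unfolding fpt_decidable_def
  proof (rule fpt_solvable_kernel[OF cmp_kernelize cmp_solve _ dec cmp_total_bound])
    \<comment> \<open>A sequence contains at least one set, so the empty list is free to signal a
      no-instance.\<close>
    show "cmp True (\<lambda>z :: bt list \<times> nat list list. snd z \<noteq> [])" by (intro cmp_not cmp_is_Nil cmp_intros)
    fix x I assume "represents_msor2 x I"
    then obtain vsn esn csn sn tn where M: "msor2_input I vsn esn csn sn tn" and x: "x = enc (msor2_input.inp I vsn esn csn sn tn)"
      using represents_msor2_input by blast
    interpret msor2_input I vsn esn csn sn tn by (rule M)
    show "\<exists>i. x = enc i \<and> sz (snd (kernelize i)) \<le> total_bound (msor2_param I) \<and>
      enc (snd (fst (kernelize i), solve (snd (kernelize i))) \<noteq> []) = bt_of_bool (msor2_yes I)"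
      using x size_kernel decision by (intro exI[of _ inp]) (simp add: res_def[symmetric] enc_bool_def)
  qed
  show "fpt_solvable (\<lambda>x I. represents_msor2 x I \<and> msor2_yes I) msor2_param
      (\<lambda>I y. \<exists>Ss. shortest_tj_sequence (graph I) (formula I) (source I) (target I) Ss \<and> represents_sets y Ss)"
  proof (rule fpt_solvable_kernel[OF cmp_kernelize cmp_solve _ dec cmp_total_bound])
    \<comment> \<open>The solver answers with positions; the list of names that bypassed it turns
      them back into vertices of the input.\<close>
    show "cmp True (\<lambda>z :: bt list \<times> nat list list. map (map (\<lambda>i. nthd Lf i (fst z))) (snd z))" by (intro cmp_intros)
    fix x I assume xI: "represents_msor2 x I \<and> msor2_yes I"
    then obtain vsn esn csn sn tn where M: "msor2_input I vsn esn csn sn tn" and x: "x = enc (msor2_input.inp I vsn esn csn sn tn)"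
      using represents_msor2_input by blast
    interpret msor2_input I vsn esn csn sn tn by (rule M)
    have "res \<noteq> []" using decision xI by blast
    from shortest[OF this] show "\<exists>i. x = enc i \<and> sz (snd (kernelize i)) \<le> total_bound (msor2_param I) \<and>
      (\<exists>Ss. shortest_tj_sequence (graph I) (formula I) (source I) (target I) Ss \<and>
        represents_sets (enc (map (map (\<lambda>k. nthd Lf k (fst (fst (kernelize i), solve (snd (kernelize i))))))
          (snd (fst (kernelize i), solve (snd (kernelize i)))))) Ss)"
      using x size_kernel by (intro exI[of _ inp]) (simp add: res_def kernelize_inp)
  qed
qed

end
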